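(* For any $a,b,c\in\mathbb{R}$ there exists a unique $d=\psi(a,b,c)\in\mathbb{R}$ such that the planar system $$\dot{x}=y-(ax^4+bx^3+cx^2+dx),\qquad \dot{y}=-x$$ has a homoclinic loop in the Poincaré sphere. This loop is stable if and only if the singular point (the origin) of the system is unstable.
   Context: The Poincaré sphere is the usual Poincaré compactification of a planar polynomial vector field, in which the equator represents the points at infinity of $\mathbb{R}^2$. A homoclinic loop in the Poincaré sphere means a loop based at infinity: a singular point on the equator together with an orbit in the finite plane $\mathbb{R}^2$ that converges, in the compactification, to this singular point both in forward and in backward time. (For instance, when $a>0$ the base point is the topological saddle $(0,1,0)$, the end of the positive $y$-axis, and the orbit is asymptotic to the graph $y=ax^4+bx^3+cx^2+dx$.) The interior of the loop is the component of the complement in $\mathbb{R}^2$ of this orbit that contains the origin. The loop is called stable if it is attracting from its interior, i.e. solutions starting in the interior sufficiently close to the loop tend to the loop as $t\to+\infty$. The origin is the only singular point of the system in $\mathbb{R}^2$.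
   Formalization: The formal theorem assumes a ≠ 0, or b = 0 and c ≠ 0; in the excluded cases (a = 0 with b ≠ 0 or c = 0) no d gives a homoclinic loop, e.g. a = b = c = 0 is linear, with x²+y² monotone along orbits, so the claim for all a, b, c is false there. *)

theory Defs
  imports "HOL-Analysis.Analysis" "HOL-Computational_Algebra.Polynomial" "HOL-Real_Asymp.Real_Asymp"
begin

definition lienard_field :: "real \<Rightarrow> real \<Rightarrow> real \<Rightarrow> real \<Rightarrow> real \<times> real \<Rightarrow> real \<times> real" where
  "lienard_field a b c d = (\<lambda>(x, y). (y - (a * x^4 + b * x^3 + c * x^2 + d * x), - x))"

definition lienard_degree :: "real \<Rightarrow> real \<Rightarrow> real \<Rightarrow> real \<Rightarrow> nat" where
  "lienard_degree a b c d = max 1 (degree [:0, d, c, b, a:])"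

text \<open>
  The Poincare sphere is the unit sphere of \<open>\<real>\<^sup>3\<close> (the norm on the product type is Euclidean).
  The plane is sent to the open upper hemisphere by central projection of
  the affine plane \<open>z = 1\<close>, so that the equator \<open>z = 0\<close> carries the points at infinity; opposite
  points of the equator are distinct.
\<close>

definition poincare :: "real \<times> real \<Rightarrow> real \<times> real \<times> real" where
  "poincare = (\<lambda>(x, y). (1 / sqrt (1 + x^2 + y^2)) *\<^sub>R (x, y, 1))"

definition equator :: "(real \<times> real \<times> real) set" where
  "equator = {(u, v, w). u^2 + v^2 = 1 \<and> w = 0}"

text \<open>
  The compactified field of a polynomial field \<open>X\<close> of degree \<open>n\<close> is the push-forward of \<open>X\<close>
  to the hemisphere, multiplied by the factor \<open>z ^ (n - 1)\<close>, where \<open>z\<close> is the height on the sphere.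
  It is written here as a function of the point of the plane; with this factor it
  extends continuously to the equator, and the singular points at infinity are the points of the
  equator where the extension is zero.
\<close>

definition poincare_field ::
    "nat \<Rightarrow> (real \<times> real \<Rightarrow> real \<times> real) \<Rightarrow> real \<times> real \<Rightarrow> real \<times> real \<times> real" where
  "poincare_field n X q =
     (snd (snd (poincare q)) ^ (n - 1)) *\<^sub>R frechet_derivative poincare (at q) (X q)"

definition singular_at_infinity ::
    "nat \<Rightarrow> (real \<times> real \<Rightarrow> real \<times> real) \<Rightarrow> real \<times> real \<times> real \<Rightarrow> bool" where
  "singular_at_infinity n X p \<longleftrightarrow>
     p \<in> equator \<and> (poincare_field n X \<longlongrightarrow> 0) (filtercomap poincare (nhds p))"

text \<open>
  \<open>\<Gamma>\<close> is the finite part of the loop, an orbit in the plane, and \<open>p\<close> is its base point. The ends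
  of the time interval may be finite, since solutions of a polynomial system may reach infinity in
  finite time. As the solution is unbounded at both ends, the interval is automatically the maximal
  interval of existence, so \<open>\<Gamma>\<close> is a full orbit.
\<close>

definition homoclinic_loop ::
    "nat \<Rightarrow> (real \<times> real \<Rightarrow> real \<times> real) \<Rightarrow> real \<times> real \<times> real \<Rightarrow> (real \<times> real) set \<Rightarrow> bool" where
  "homoclinic_loop n X p \<Gamma> \<longleftrightarrow>
     singular_at_infinity n X p \<and>
     (\<exists>(\<alpha>::ereal) (\<omega>::ereal) \<gamma>. \<alpha> < \<omega> \<and>
        (\<forall>t\<in>einterval \<alpha> \<omega>. (\<gamma> has_vector_derivative X (\<gamma> t)) (at t)) \<and>
        \<Gamma> = \<gamma> ` einterval \<alpha> \<omega> \<and>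
        ((\<lambda>s. poincare (\<gamma> (real_of_ereal s))) \<longlongrightarrow> p) (at_right \<alpha>) \<and>
        ((\<lambda>s. poincare (\<gamma> (real_of_ereal s))) \<longlongrightarrow> p) (at_left \<omega>))"

definition loop_interior :: "(real \<times> real) set \<Rightarrow> (real \<times> real) set" where
  "loop_interior \<Gamma> = connected_component_set (- \<Gamma>) 0"

definition forward_solution ::
    "(real \<times> real \<Rightarrow> real \<times> real) \<Rightarrow> real \<times> real \<Rightarrow> (real \<Rightarrow> real \<times> real) \<Rightarrow> bool" where
  "forward_solution X q \<phi> \<longleftrightarrow>
     \<phi> 0 = q \<and> (\<forall>t\<ge>0. (\<phi> has_vector_derivative X (\<phi> t)) (at t within {0..}))"

text \<open>
  Distance to the loop, measured on the sphere; the base point belongs to the loop. Forward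
  solutions of a polynomial field are unique, so the existential quantifier over \<open>\<phi>\<close> in the
  two definitions of stability says that the solution through \<open>q\<close> exists for all \<open>t \<ge> 0\<close> and has
  the stated property.
\<close>

definition loop_dist ::
    "real \<times> real \<times> real \<Rightarrow> (real \<times> real) set \<Rightarrow> real \<times> real \<Rightarrow> real" where
  "loop_dist p \<Gamma> q = infdist (poincare q) (insert p (poincare ` \<Gamma>))"

definition loop_stable ::
    "(real \<times> real \<Rightarrow> real \<times> real) \<Rightarrow> real \<times> real \<times> real \<Rightarrow> (real \<times> real) set \<Rightarrow> bool" where
  "loop_stable X p \<Gamma> \<longleftrightarrow>
     (\<exists>\<epsilon>>0. \<forall>q\<in>loop_interior \<Gamma>. loop_dist p \<Gamma> q < \<epsilon> \<longrightarrow>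
        (\<exists>\<phi>. forward_solution X q \<phi> \<and> ((\<lambda>t. loop_dist p \<Gamma> (\<phi> t)) \<longlongrightarrow> 0) at_top))"

definition lyapunov_stable :: "(real \<times> real \<Rightarrow> real \<times> real) \<Rightarrow> real \<times> real \<Rightarrow> bool" where
  "lyapunov_stable X e \<longleftrightarrow>
     (\<forall>\<epsilon>>0. \<exists>\<delta>>0. \<forall>q. dist q e < \<delta> \<longrightarrow>
        (\<exists>\<phi>. forward_solution X q \<phi> \<and> (\<forall>t\<ge>0. dist (\<phi> t) e < \<epsilon>)))"

text \<open>
  For \<open>a = 0\<close> the system has a homoclinic loop (for some \<open>d\<close>) only if \<open>b = 0\<close> and \<open>c \<noteq> 0\<close>: by
  \<open>no_homoclinic_loop\<close> below, no \<open>d\<close> gives a loop if \<open>b \<noteq> 0\<close> or \<open>c = 0\<close>. Only these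
  degenerate parameters have to be excluded from a claim that a suitable \<open>d\<close> exists.
  The proof shows that solutions cannot reach infinity in forward time, or, after a time
  reversal, in backward time.
\<close>

lemma escape_impossible:
  fixes f f' :: "real \<Rightarrow> real" and \<alpha> \<omega> :: ereal
  assumes "\<alpha> < \<omega>"
    and der: "\<And>t. t \<in> einterval \<alpha> \<omega> \<Longrightarrow> (f has_real_derivative f' t) (at t)"
    and top: "filterlim (\<lambda>s. f (real_of_ereal s)) at_top (at_left \<omega>)"
    and le: "eventually (\<lambda>s. f' (real_of_ereal s) \<le> 0) (at_left \<omega>)"
  shows False
proof -
  obtain e where e: "e < \<omega>" "\<And>s. e < s \<Longrightarrow> s < \<omega> \<Longrightarrow> f' (real_of_ereal s) \<le> 0"
    using le eventually_at_left[OF \<open>\<alpha> < \<omega>\<close>] by auto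
  obtain r where r: "max \<alpha> e < ereal r" "ereal r < \<omega>"
    using ereal_dense2[of "max \<alpha> e" \<omega>] e(1) \<open>\<alpha> < \<omega>\<close> by auto
  have "eventually (\<lambda>s. f (real_of_ereal s) \<ge> f r + 1) (at_left \<omega>)"
    using top by (simp add: filterlim_at_top)
  then obtain e2 where e2: "e2 < \<omega>" "\<And>s. e2 < s \<Longrightarrow> s < \<omega> \<Longrightarrow> f (real_of_ereal s) \<ge> f r + 1"
    using eventually_at_left[OF \<open>\<alpha> < \<omega>\<close>] by auto
  obtain q where q: "max (ereal r) e2 < ereal q" "ereal q < \<omega>"
    using ereal_dense2[of "max (ereal r) e2" \<omega>] e2(1) r by auto
  have "f r \<ge> f q"
  proof (rule DERIV_nonpos_imp_nonincreasing[of r q f])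
    show "r \<le> q" using q by auto
    fix x assume x: "r \<le> x" "x \<le> q"
    have "ereal r \<le> ereal x" "ereal x \<le> ereal q" using x by auto
    moreover have "\<alpha> < ereal r" "e < ereal r" "ereal q < \<omega>" using r(1) q(2) by (auto simp: max_less_iff_conj)
    ultimately have "\<alpha> < ereal x" "e < ereal x" "ereal x < \<omega>"
      using less_le_trans le_less_trans by metis+
    then show "\<exists>y. (f has_real_derivative y) (at x) \<and> y \<le> 0"
      using der[of x] e(2)[of "ereal x"] by (auto simp: einterval_def)
  qed
  moreover have "f q \<ge> f r + 1" using e2(2)[of "ereal q"] q by auto
  ultimately show False by simp
qed

lemma poly_minus_exp_bounded:
  fixes b c d :: real
  assumes "b > 0"
  shows "\<exists>M. \<forall>x. b * x^3 + c * x^2 + d * x - x * exp x \<le> M"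
proof -
  let ?G = "\<lambda>x::real. b * x^3 + c * x^2 + d * x - x * exp x"
  have 1: "filterlim ?G at_bot at_top" by real_asymp
  have 2: "filterlim ?G at_bot at_bot" using assms by real_asymp
  from 1 obtain u where u: "\<And>x. x \<ge> u \<Longrightarrow> ?G x \<le> 0"
    unfolding filterlim_at_bot eventually_at_top_linorder by meson
  from 2 obtain l where l: "\<And>x. x \<le> l \<Longrightarrow> ?G x \<le> 0"
    unfolding filterlim_at_bot eventually_at_bot_linorder by meson
  have "continuous_on {l..u} ?G" by (intro continuous_intros)
  then have "bounded (?G ` {l..u})" using compact_continuous_image compact_imp_bounded by blast
  then obtain B where "\<forall>z\<in>?G ` {l..u}. norm z \<le> B" unfolding bounded_iff by blast
  then have B: "\<bar>?G x\<bar> \<le> B" if "x \<in> {l..u}" for x using that by auto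
  have "?G x \<le> max 0 B" for x
  proof (cases "x \<in> {l..u}")
    case True then show ?thesis using B[OF True] by linarith
  next
    case False then have "x \<le> l \<or> x \<ge> u" by auto
    then have "?G x \<le> 0" using u l by blast
    then show ?thesis by linarith
  qed
  then show ?thesis by blast
qed

lemma cubic_sign:
  fixes b c d :: real
  assumes "b > 0"
  shows "\<exists>K. \<forall>x. \<bar>x\<bar> \<ge> K \<longrightarrow> x * (b * x^3 + c * x^2 + d * x) \<ge> 0"
proof -
  let ?G = "\<lambda>x::real. x * (b * x^3 + c * x^2 + d * x)"
  have 1: "filterlim ?G at_top at_top" using assms by real_asymp
  have 2: "filterlim ?G at_top at_bot" using assms by real_asymp
  from 1 obtain u where u: "\<And>x. x \<ge> u \<Longrightarrow> ?G x \<ge> 0"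
    unfolding filterlim_at_top eventually_at_top_linorder by meson
  from 2 obtain l where l: "\<And>x. x \<le> l \<Longrightarrow> ?G x \<ge> 0"
    unfolding filterlim_at_top eventually_at_bot_linorder by meson
  have "?G x \<ge> 0" if "\<bar>x\<bar> \<ge> max u (-l)" for x
    using that u[of x] l[of x] by (cases "x \<ge> 0") auto
  then show ?thesis by blast
qed

lemma no_forward_escape:
  fixes b c d :: real and \<alpha> \<omega> :: ereal and \<gamma> :: "real \<Rightarrow> real \<times> real"
  assumes bc: "b > 0 \<or> (b = 0 \<and> c = 0 \<and> d \<ge> 0)" and ao: "\<alpha> < \<omega>"
    and der: "\<forall>t\<in>einterval \<alpha> \<omega>. (\<gamma> has_vector_derivative lienard_field 0 b c d (\<gamma> t)) (at t)"
    and lim: "((\<lambda>s. poincare (\<gamma> (real_of_ereal s))) \<longlongrightarrow> p) (at_left \<omega>)"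
    and p: "p \<in> equator"
  shows False
proof -
  define x y where "x = (\<lambda>t. fst (\<gamma> t))" and "y = (\<lambda>t. snd (\<gamma> t))"
  define F where "F = (\<lambda>x::real. b * x^3 + c * x^2 + d * x)"
  obtain u v where puv: "p = (u, v, 0)" "u^2 + v^2 = 1" using p by (auto simp: equator_def)
  have dx: "(x has_real_derivative (y t - F (x t))) (at t)"
    and dy: "(y has_real_derivative (- x t)) (at t)" if "t \<in> einterval \<alpha> \<omega>" for t
  proof -
    have D: "(\<gamma> has_vector_derivative lienard_field 0 b c d (\<gamma> t)) (at t)" using der that by blast
    have L: "lienard_field 0 b c d (\<gamma> t) = (y t - F (x t), - x t)"
      by (simp add: lienard_field_def x_def y_def F_def split: prod.split)
    show "(x has_real_derivative (y t - F (x t))) (at t)"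
      using bounded_linear.has_vector_derivative[OF bounded_linear_fst D]
      unfolding L has_real_derivative_iff_has_vector_derivative x_def[symmetric] by (simp add: x_def[symmetric])
    show "(y has_real_derivative (- x t)) (at t)"
      using bounded_linear.has_vector_derivative[OF bounded_linear_snd D]
      unfolding L has_real_derivative_iff_has_vector_derivative y_def[symmetric] by (simp add: y_def[symmetric])
  qed
  let ?A = "at_left \<omega>"
  define X Y where "X = (\<lambda>s. x (real_of_ereal s))" and "Y = (\<lambda>s. y (real_of_ereal s))"
  define \<Delta> where "\<Delta> = (\<lambda>s. sqrt (1 + (X s)^2 + (Y s)^2))"
  have Dpos: "\<Delta> s \<ge> 1" for s by (simp add: \<Delta>_def)
  have P: "poincare (\<gamma> (real_of_ereal s)) = (X s / \<Delta> s, Y s / \<Delta> s, 1 / \<Delta> s)" for s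
    by (simp add: poincare_def X_def Y_def x_def y_def \<Delta>_def split: prod.split)
  have lu: "((\<lambda>s. X s / \<Delta> s) \<longlongrightarrow> u) ?A" using tendsto_fst[OF lim] by (simp add: P puv)
  have lv: "((\<lambda>s. Y s / \<Delta> s) \<longlongrightarrow> v) ?A" using tendsto_fst[OF tendsto_snd[OF lim]] by (simp add: P puv)
  have lw: "((\<lambda>s. 1 / \<Delta> s) \<longlongrightarrow> 0) ?A" using tendsto_snd[OF tendsto_snd[OF lim]] by (simp add: P puv)
  have "filterlim (\<lambda>s. inverse (1 / \<Delta> s)) at_top ?A"
    by (rule filterlim_inverse_at_top[OF lw])
       (use Dpos in \<open>auto intro!: always_eventually simp: less_le_trans[OF zero_less_one]\<close>)
  then have DT: "filterlim \<Delta> at_top ?A" by simp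
  have X_eq: "X = (\<lambda>s. X s / \<Delta> s * \<Delta> s)" and Y_eq: "Y = (\<lambda>s. Y s / \<Delta> s * \<Delta> s)"
    using Dpos by (auto simp: fun_eq_iff) (metis not_one_le_zero)+
  define E where "E = (\<lambda>t. (x t)^2 + (y t)^2)"
  have dE: "(E has_real_derivative - 2 * (x t * F (x t))) (at t)" if "t \<in> einterval \<alpha> \<omega>" for t
    unfolding E_def by (rule derivative_eq_intros dx[OF that] dy[OF that] refl)+
      (simp add: algebra_simps)
  have ET: "filterlim (\<lambda>s. E (real_of_ereal s)) at_top ?A"
  proof (rule filterlim_at_top_mono)
    show "filterlim (\<lambda>s. - 1 + \<Delta> s) at_top ?A"
      by (rule filterlim_tendsto_add_at_top[OF tendsto_const DT])
    have "- 1 + \<Delta> s \<le> E (real_of_ereal s)" for s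
    proof -
      have "\<Delta> s \<le> (\<Delta> s)^2" using Dpos[of s] by (simp add: power2_eq_square)
      also have "\<dots> = 1 + E (real_of_ereal s)" by (simp add: \<Delta>_def E_def X_def Y_def)
      finally show ?thesis by simp
    qed
    then show "eventually (\<lambda>s. - 1 + \<Delta> s \<le> E (real_of_ereal s)) ?A" by simp
  qed
  have no_E: False if "eventually (\<lambda>s. X s * F (X s) \<ge> 0) ?A"
    by (rule escape_impossible[OF ao dE ET]) (use that in \<open>auto simp: X_def\<close>)
  show False
  proof (cases "b > 0")
    case False
    then have "b = 0" "c = 0" "d \<ge> 0" using bc by auto
    then have "X s * F (X s) \<ge> 0" for s
      using mult_nonneg_nonneg[of d "X s * X s"] by (simp add: F_def mult.left_commute)
    then show False by (intro no_E) simp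
  next
    case b: True
    obtain K where K: "\<And>x. \<bar>x\<bar> \<ge> K \<Longrightarrow> x * F x \<ge> 0"
      using cubic_sign[OF b, of c d] unfolding F_def by blast
    show False
    proof (cases "u = 0")
      case False
      have "filterlim (\<lambda>s. \<bar>X s / \<Delta> s\<bar> * \<Delta> s) at_top ?A"
        by (rule filterlim_tendsto_pos_mult_at_top[OF tendsto_rabs[OF lu] _ DT]) (use False in auto)
      then have "eventually (\<lambda>s. \<bar>X s / \<Delta> s\<bar> * \<Delta> s \<ge> K) ?A" by (simp add: filterlim_at_top)
      then have "eventually (\<lambda>s. X s * F (X s) \<ge> 0) ?A"
      proof (rule eventually_mono)
        fix s assume "\<bar>X s / \<Delta> s\<bar> * \<Delta> s \<ge> K"
        moreover have "\<bar>X s / \<Delta> s\<bar> * \<Delta> s = \<bar>X s\<bar>" using Dpos[of s] by (simp add: abs_divide)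
        ultimately show "X s * F (X s) \<ge> 0" using K by auto
      qed
      then show False by (rule no_E)
    next
      case True
      then have "v = 1 \<or> v = - 1" using puv(2) by (simp add: power2_eq_1_iff)
      then show False
      proof
        assume "v = 1"
        obtain M where M: "\<And>x. F x - x * exp x \<le> M" 
          using poly_minus_exp_bounded[OF b, of c d] unfolding F_def by blast
        have YT: "filterlim Y at_top ?A"
          by (subst Y_eq, rule filterlim_tendsto_pos_mult_at_top[OF lv _ DT]) (use \<open>v = 1\<close> in auto)
        define W where "W = (\<lambda>t. y t + exp (- x t))"
        have dW: "(W has_real_derivative exp (- x t) * (F (x t) - x t * exp (x t) - y t)) (at t)"
          if "t \<in> einterval \<alpha> \<omega>" for t
          unfolding W_def by (rule derivative_eq_intros dx[OF that] dy[OF that] refl)+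
            (simp add: algebra_simps exp_minus)
        show False
        proof (rule escape_impossible[OF ao dW])
          show "filterlim (\<lambda>s. W (real_of_ereal s)) at_top ?A"
            by (rule filterlim_at_top_mono[OF YT]) (auto simp: W_def Y_def)
          have "eventually (\<lambda>s. Y s \<ge> M) ?A" using YT by (simp add: filterlim_at_top)
          then show "eventually (\<lambda>s. exp (- x (real_of_ereal s)) * (F (x (real_of_ereal s)) - x (real_of_ereal s) * exp (x (real_of_ereal s)) - y (real_of_ereal s)) \<le> 0) ?A"
          proof (rule eventually_mono)
            fix s assume "Y s \<ge> M"
            then have "F (x (real_of_ereal s)) - x (real_of_ereal s) * exp (x (real_of_ereal s)) - y (real_of_ereal s) \<le> 0"
              using M[of "x (real_of_ereal s)"] by (simp add: Y_def)
            then show "exp (- x (real_of_ereal s)) * (F (x (real_of_ereal s)) - x (real_of_ereal s) * exp (x (real_of_ereal s)) - y (real_of_ereal s)) \<le> 0"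
              by (simp add: mult_le_0_iff)
          qed
        qed
      next
        assume "v = - 1"
        obtain M where M': "\<And>x. b * x^3 + (- c) * x^2 + d * x - x * exp x \<le> M"
          using poly_minus_exp_bounded[OF b, of "- c" d] by blast
        have M: "- F x + x * exp (- x) \<le> M" for x
          using M'[of "- x"] by (simp add: F_def)
        have YT: "filterlim (\<lambda>s. - Y s) at_top ?A"
          by (subst Y_eq, subst minus_mult_left, rule filterlim_tendsto_pos_mult_at_top[OF tendsto_minus[OF lv] _ DT])
             (use \<open>v = - 1\<close> in auto)
        define W where "W = (\<lambda>t. - y t + exp (x t))"
        have dW: "(W has_real_derivative exp (x t) * (- F (x t) + x t * exp (- x t) + y t)) (at t)"
          if "t \<in> einterval \<alpha> \<omega>" for t
          unfolding W_def by (rule derivative_eq_intros dx[OF that] dy[OF that] refl)+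
            (simp add: algebra_simps exp_minus)
        show False
        proof (rule escape_impossible[OF ao dW])
          show "filterlim (\<lambda>s. W (real_of_ereal s)) at_top ?A"
            by (rule filterlim_at_top_mono[OF YT]) (auto simp: W_def Y_def)
          have "eventually (\<lambda>s. - Y s \<ge> M) ?A" using YT by (simp add: filterlim_at_top)
          then show "eventually (\<lambda>s. exp (x (real_of_ereal s)) * (- F (x (real_of_ereal s)) + x (real_of_ereal s) * exp (- x (real_of_ereal s)) + y (real_of_ereal s)) \<le> 0) ?A"
          proof (rule eventually_mono)
            fix s assume "- Y s \<ge> M"
            then have "- F (x (real_of_ereal s)) + x (real_of_ereal s) * exp (- x (real_of_ereal s)) + y (real_of_ereal s) \<le> 0"
              using M[of "x (real_of_ereal s)"] by (simp add: Y_def)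
            then show "exp (x (real_of_ereal s)) * (- F (x (real_of_ereal s)) + x (real_of_ereal s) * exp (- x (real_of_ereal s)) + y (real_of_ereal s)) \<le> 0"
              by (simp add: mult_le_0_iff)
          qed
        qed
      qed
    qed
  qed
qed

theorem no_homoclinic_loop:
  assumes "b \<noteq> 0 \<or> c = 0"
  shows "\<not> homoclinic_loop n (lienard_field 0 b c d) p \<Gamma>"
proof
  assume H: "homoclinic_loop n (lienard_field 0 b c d) p \<Gamma>"
  then obtain \<alpha> \<omega> :: ereal and \<gamma> where ao: "\<alpha> < \<omega>"
    and der: "\<forall>t\<in>einterval \<alpha> \<omega>. (\<gamma> has_vector_derivative lienard_field 0 b c d (\<gamma> t)) (at t)"
    and l1: "((\<lambda>s. poincare (\<gamma> (real_of_ereal s))) \<longlongrightarrow> p) (at_right \<alpha>)"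
    and l2: "((\<lambda>s. poincare (\<gamma> (real_of_ereal s))) \<longlongrightarrow> p) (at_left \<omega>)"
    unfolding homoclinic_loop_def by blast
  have p: "p \<in> equator" using H by (auto simp: homoclinic_loop_def singular_at_infinity_def)
  show False
  proof (cases "b > 0 \<or> (b = 0 \<and> c = 0 \<and> d \<ge> 0)")
    case True
    then show False by (rule no_forward_escape[OF _ ao der l2 p])
  next
    case False
    then have rev: "- b > 0 \<or> (- b = 0 \<and> - c = 0 \<and> - d \<ge> 0)" using assms by auto
    define R :: "real \<times> real \<Rightarrow> real \<times> real" where "R = (\<lambda>(x, y). (x, - y))"
    define S :: "real \<times> real \<times> real \<Rightarrow> real \<times> real \<times> real" where "S = (\<lambda>(x, y, z). (x, - y, z))"
    have R: "bounded_linear R" unfolding R_def split_def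
      by (intro bounded_linear_Pair bounded_linear_fst bounded_linear_minus bounded_linear_snd)
    have Scont: "continuous_on UNIV S" unfolding S_def split_def by (intro continuous_intros)
    have PR: "poincare (R q) = S (poincare q)" for q
      by (simp add: poincare_def R_def S_def split: prod.split)
    have "S p \<in> equator" using p by (auto simp: S_def equator_def)
    have ao': "- \<omega> < - \<alpha>" using ao by simp
    have der': "\<forall>t\<in>einterval (- \<omega>) (- \<alpha>).
       ((\<lambda>t. R (\<gamma> (- t))) has_vector_derivative lienard_field 0 (- b) (- c) (- d) (R (\<gamma> (- t)))) (at t)"
    proof
      fix t assume "t \<in> einterval (- \<omega>) (- \<alpha>)"
      then have "- t \<in> einterval \<alpha> \<omega>"
        by (auto simp: einterval_def ereal_uminus_less_reorder ereal_less_uminus_reorder simp flip: uminus_ereal.simps)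
      then have D: "(\<gamma> has_vector_derivative lienard_field 0 b c d (\<gamma> (- t))) (at (- t))"
        using der by blast
      have "((\<gamma> \<circ> uminus) has_vector_derivative (- 1) *\<^sub>R lienard_field 0 b c d (\<gamma> (- t))) (at t)"
        by (rule vector_diff_chain_at) (auto intro!: derivative_eq_intros D)
      then have "((\<lambda>t. R (\<gamma> (- t))) has_vector_derivative R (- lienard_field 0 b c d (\<gamma> (- t)))) (at t)"
        using bounded_linear.has_vector_derivative[OF R] by (fastforce simp: o_def)
      moreover have "R (- lienard_field 0 b c d q) = lienard_field 0 (- b) (- c) (- d) (R q)" for q
        by (simp add: R_def lienard_field_def algebra_simps split: prod.split)
      ultimately show "((\<lambda>t. R (\<gamma> (- t))) has_vector_derivative lienard_field 0 (- b) (- c) (- d) (R (\<gamma> (- t)))) (at t)"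
        by simp
    qed
    have "filterlim uminus (at_right \<alpha>) (at_left (- \<alpha>))"
      unfolding filterlim_iff
    proof (intro allI impI)
      fix Q assume "eventually Q (at_right \<alpha>)"
      then obtain e where e: "e > \<alpha>" "\<And>s. \<alpha> < s \<Longrightarrow> s < e \<Longrightarrow> Q s"
        using eventually_at_right[OF ao] by auto
      have "Q (- s)" if "- e < s" "s < - \<alpha>" for s
        by (rule e(2)) (use that in \<open>simp_all add: ereal_less_uminus_reorder ereal_uminus_less_reorder\<close>)
      moreover have "- e < - \<alpha>" using e(1) by simp
      ultimately show "eventually (\<lambda>s. Q (- s)) (at_left (- \<alpha>))"
        using eventually_at_left[OF ao'] by blast
    qed
    then have "((\<lambda>s. poincare (\<gamma> (real_of_ereal (- s)))) \<longlongrightarrow> p) (at_left (- \<alpha>))"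
      using filterlim_compose[OF l1] by blast
    then have "((\<lambda>s. S (poincare (\<gamma> (- real_of_ereal s)))) \<longlongrightarrow> S p) (at_left (- \<alpha>))"
      using continuous_on_tendsto_compose[OF Scont] by simp
    then have "((\<lambda>s. poincare (R (\<gamma> (- real_of_ereal s)))) \<longlongrightarrow> S p) (at_left (- \<alpha>))"
      by (simp add: PR)
    then show False using no_forward_escape[OF rev ao' der' _ \<open>S p \<in> equator\<close>] by simp
  qed
qed

end

theory Submission
 imports Defs
begin

text \<open>
 After a reflection the system reads \<open>x' = F x - y\<close>, \<open>y' = x\<close> with \<open>F\<close> bounded below by a parabola.
 In the half plane \<open>x > 0\<close> a unique orbit from the negative \<open>y\<close>-axis separates the orbits that turn
 back to the axis from those that escape; time reversal together with \<open>x \<mapsto> - x\<close> gives the same for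
 \<open>F (- x)\<close>. A loop exists iff both separatrices start at the same point of the axis, and their starting
 points move strictly in opposite directions as \<open>d\<close> grows, which gives existence and uniqueness.
 For \<open>b \<noteq> 0\<close> the quartics \<open>F x\<close> and \<open>F (- x)\<close> are asymptotically horizontal translates of each other,
 but the \<open>b\<close>-term makes nearby orbits leave the two separatrices at different rates; this decides which
 side returns higher, hence the sign of the displacement of the return map near the loop. The sign of \<open>b\<close>
 is opposite to that of \<open>d\<close>, and the latter decides the stability of the origin. If \<open>b = 0\<close>, then
 \<open>d = 0\<close> and the reversible system has a centre.
\<close>

section \<open>Ordinary differential equations\<close>

text \<open>The delicate point is the comparison of the two sides for b nonzero, where the leading
  terms cancel. Over the height z an orbit of the half system satisfies dx/dz = (F x - z) / x. Let b
  > 0. The separatrices X1, X2 of the quartics with b and - b satisfy X2 - X1 \<rightarrow> b / (2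
  a). A small gap p = X1 - \<xi>1 between separatrix and arc grows at the rate 4 a X1^2 + 3 b X1 up
  to lower order, and q = X2 - \<xi>2 at the rate 4 a X2^2 - 3 b X2, which is 4 a X1^2 + b X1 after
  inserting X2. The first rate wins by about 2 b X1, so p becomes visible while q is still
  negligible. At that height \<xi>2 - \<xi>1 exceeds the asymptotic offset b / (2 a), and the first
  arc, translated by slightly more than that offset, is from then on a barrier for the second: the
  first arc is back at the axis at a lower height. The small constant b / (64 a) and the
  coefficients 5 / 2 and 3 / 2 of the rate estimates only distribute the margin in this
  computation.\<close>

definition solves :: "('a::euclidean_space \<Rightarrow> 'a) \<Rightarrow> real \<Rightarrow> (real \<Rightarrow> 'a) \<Rightarrow> bool" where
 "solves f T \<phi> \<longleftrightarrow> (\<forall>t\<in>{0..T}. (\<phi> has_vector_derivative f (\<phi> t)) (at t within {0..T}))"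

lemma solves_continuous: "solves f T \<phi> ==> continuous_on {0..T} \<phi>"
 unfolding solves_def continuous_on_eq_continuous_within
 using has_vector_derivative_continuous by blast

lemma solves_subinterval: "solves f T \<phi> ==> S <= T ==> solves f S \<phi>"
 unfolding solves_def by (auto intro: has_vector_derivative_within_subset[where S="{0..T}"])

lemma solves_transform:
 assumes "solves f T \<phi>" "!!t. t \<in> {0..T} ==> \<psi> t = \<phi> t"
 shows "solves f T \<psi>"
 unfolding solves_def
proof
 fix t assume t: "t \<in> {0..T}"
 then have "(\<phi> has_vector_derivative f (\<psi> t)) (at t within {0..T})"
  using assms by (auto simp: solves_def)
 then show "(\<psi> has_vector_derivative f (\<psi> t)) (at t within {0..T})"
  by (rule has_vector_derivative_transform[rotated 2]) (use assms t in auto)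
qed

section \<open>Existence, uniqueness and continuous dependence\<close>

text \<open>The unknown is g with \<phi> t = q + exp (2 K t) g t. With this exponential weight the
  Picard operator contracts by 1 / 2 on the whole interval at once, so no short pieces have to be
  glued.\<close>

lemma picard_lipschitz:
 fixes f :: "'a::euclidean_space \<Rightarrow> 'a"
 assumes L: "L-lipschitz_on UNIV f" and T: "T >= 0"
 shows "\<exists>\<phi>. \<phi> 0 = q & solves f T \<phi>"
proof -
 \<comment> \<open>L may be 0, while the weight needs a positive constant.\<close>
 define K where "K = L + 1"
 have K: "K > 0" using lipschitz_on_nonneg[OF L] by (simp add: K_def)
 have lip: "norm (f x - f y) <= K * norm (x - y)" for x y
  using lipschitz_on_normD[OF L, of x y] mult_right_mono[of L K "norm (x - y)"] by (simp add: K_def)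
 have fc: "continuous_on S f" for S
  using lipschitz_on_continuous_on[OF L] continuous_on_subset by blast
 \<comment> \<open>Clamping time to {0..T} turns functions on the interval into bounded continuous
   functions on the line, the complete space for the fixed point theorem.\<close>
 define \<tau> where "\<tau> = (%t::real. max 0 (min t T))"
 have \<tau>: "\<tau> t \<in> {0..T}" for t using T by (auto simp: \<tau>_def)
 have \<tau>c: "continuous_on S \<tau>" for S unfolding \<tau>_def by (intro continuous_intros)
 define h where "h = (%(g::real \<Rightarrow>\<^sub>C 'a) s. f (q + exp (2*K * s) *\<^sub>R g s))"
 have hc: "continuous_on S (h g)" for S g
  unfolding h_def by (intro continuous_on_compose2[OF fc[of UNIV]] continuous_intros) auto
 define A where "A = (%g t. exp (- 2*K*t) *\<^sub>R integral {0..t} (h g))"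
 have hd: "((%t. integral {0..t} (h g)) has_vector_derivative h g t) (at t within {0..T})"
  if "t \<in> {0..T}" for g t
  using integral_has_vector_derivative[OF hc that] .
 have Ac: "continuous_on {0..T} (A g)" for g
  unfolding A_def
  by (intro continuous_intros) (metis continuous_on_eq_continuous_within has_vector_derivative_continuous hd)
 have Abc: "(%t. A g (\<tau> t)) \<in> bcontfun" for g
 proof -
  have "bounded (A g ` {0..T})" using compact_continuous_image[OF Ac] compact_imp_bounded by blast
  then have "bounded (range (%t. A g (\<tau> t)))" using \<tau> by (auto intro: bounded_subset)
  moreover have "continuous_on UNIV (%t. A g (\<tau> t))"
   by (rule continuous_on_compose2[OF Ac \<tau>c]) (use \<tau> in auto)
  ultimately show ?thesis by (simp add: bcontfun_def)
 qed
 define P where "P = (%g. Bcontfun (%t. A g (\<tau> t)))"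
 have P: "apply_bcontfun (P g) t = A g (\<tau> t)" for g t
  using Abc by (simp add: P_def Bcontfun_inverse)
 have contr: "dist (P g) (P k) <= 1/2 * dist g k" for g k
 proof (rule dist_bound)
  fix t :: real
  define s where "s = \<tau> t"
  have s: "s >= 0" using \<tau>[of t] by (simp add: s_def)
  have I: "h g integrable_on {0..s}" "h k integrable_on {0..s}"
   using integrable_continuous_real hc by blast+
  define B where "B = K * dist g k"
  have E: "((%u. B * exp (2*K*u)) has_integral (B / (2*K) * exp (2*K * s) - B / (2*K) * exp (2*K*0))) {0..s}"
   by (rule fundamental_theorem_of_calculus[OF s])
     (use K in \<open>auto intro!: derivative_eq_intros simp: has_real_derivative_iff_has_vector_derivative[symmetric]\<close>)
  have "norm (integral {0..s} (%u. h g u - h k u)) <= integral {0..s} (%u. B * exp (2*K*u))"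
  proof (rule integral_norm_bound_integral)
   show "(%u. h g u - h k u) integrable_on {0..s}" using I by (rule integrable_diff)
   show "(%u. B * exp (2*K*u)) integrable_on {0..s}" using E by blast
   fix u
   have "norm (h g u - h k u) <= K * norm (exp (2*K*u) *\<^sub>R g u - exp (2*K*u) *\<^sub>R k u)"
    unfolding h_def using lip by (metis add_diff_cancel_left)
   also have "\<dots> = K * (exp (2*K*u) * dist (g u) (k u))"
    by (simp add: dist_norm flip: scaleR_diff_right)
   also have "\<dots> <= K * (exp (2*K*u) * dist g k)"
    using K dist_bounded[of g u k] by (intro mult_left_mono) auto
   finally show "norm (h g u - h k u) <= B * exp (2*K*u)" by (simp add: B_def algebra_simps)
  qed
  also have "\<dots> <= B / (2*K) * exp (2*K * s)"
   using integral_unique[OF E] K by (simp add: B_def)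
  finally have *: "norm (integral {0..s} (h g) - integral {0..s} (h k)) <= 1/2 * dist g k * exp (2*K * s)"
   using I K by (simp add: integral_diff B_def)
  have "dist (P g t) (P k t) = exp (- 2*K * s) * norm (integral {0..s} (h g) - integral {0..s} (h k))"
   unfolding P A_def s_def[symmetric] dist_norm by (simp flip: scaleR_diff_right)
  also have "\<dots> <= exp (- 2*K * s) * (1/2 * dist g k * exp (2*K * s))"
   using * by (intro mult_left_mono) auto
  also have "\<dots> = 1/2 * dist g k" by (simp add: exp_minus field_simps)
  finally show "dist (P g t) (P k t) <= 1/2 * dist g k" .
 qed
 obtain g where g: "P g = g" using banach_fix_type[of "1/2" P] contr by auto
 define \<phi> where "\<phi> = (%t. q + exp (2*K*t) *\<^sub>R apply_bcontfun g t)"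
 have \<phi>: "\<phi> t = q + integral {0..t} (h g)" if "t \<in> {0..T}" for t
 proof -
  have "apply_bcontfun g t = A g t" using P[of g t] g that by (simp add: \<tau>_def max_def min_def)
  then show ?thesis by (simp add: \<phi>_def A_def exp_minus)
 qed
 have h: "h g t = f (\<phi> t)" for t by (simp add: h_def \<phi>_def)
 have "solves f T \<phi>" unfolding solves_def
 proof
  fix t assume t: "t \<in> {0..T}"
  have "((%t. q + integral {0..t} (h g)) has_vector_derivative 0 + h g t) (at t within {0..T})"
   by (intro has_vector_derivative_add has_vector_derivative_const hd t)
  then have "((%t. q + integral {0..t} (h g)) has_vector_derivative f (\<phi> t)) (at t within {0..T})"
   by (simp add: h)
  then show "(\<phi> has_vector_derivative f (\<phi> t)) (at t within {0..T})"
   by (rule has_vector_derivative_transform[rotated 2]) (use \<phi> t in auto)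
 qed
 moreover have "\<phi> 0 = q" using \<phi>[of 0] T by simp
 ultimately show ?thesis by blast
qed

text \<open>By Cauchy-Schwarz, exp (- 2 L t) times the squared distance is nonincreasing; the square
  keeps it differentiable where the two solutions meet.\<close>

lemma solves_dist_exp:
 fixes f :: "'a::euclidean_space \<Rightarrow> 'a"
 assumes L: "L-lipschitz_on S f" and \<phi>: "solves f T \<phi>" and \<psi>: "solves f T \<psi>"
  and S: "!!t. t \<in> {0..T} ==> \<phi> t \<in> S" "!!t. t \<in> {0..T} ==> \<psi> t \<in> S"
  and t: "t \<in> {0..T}"
 shows "dist (\<phi> t) (\<psi> t) <= exp (L * t) * dist (\<phi> 0) (\<psi> 0)"
proof -
 define e where "e = (%t. \<phi> t - \<psi> t)"
 define e' where "e' = (%t. f (\<phi> t) - f (\<psi> t))"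
 define g where "g = (%t. exp (- 2 * L * t) * (e t \<bullet> e t))"
 have de: "(e has_vector_derivative e' s) (at s within {0..t})" if "s \<in> {0..t}" for s
  unfolding e_def e'_def
  using solves_subinterval[OF \<phi>, of t] solves_subinterval[OF \<psi>, of t] that t
  by (intro has_vector_derivative_diff) (auto simp: solves_def)
 have c: "continuous_on {0..t} g" unfolding g_def
  using de by (intro continuous_intros)
   (meson continuous_on_eq_continuous_within has_vector_derivative_continuous)+
 have "g t <= g 0"
 proof (rule DERIV_nonpos_imp_decreasing_open[OF _ _ c])
  show "0 <= t" using t by simp
  fix s assume s: "0 < s" "s < t"
  have "at s within {0..t} = at s" by (rule at_within_interior) (use s in auto)
  then have D: "(e has_vector_derivative e' s) (at s)" using de[of s] s by auto
  have D2: "((%s. e s \<bullet> e s) has_real_derivative 2 * (e s \<bullet> e' s)) (at s)"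
   using has_derivative_inner[OF D[unfolded has_vector_derivative_def] D[unfolded has_vector_derivative_def]]
   unfolding has_field_derivative_def by (rule has_derivative_eq_rhs) (auto simp: inner_commute algebra_simps)
  have "(g has_real_derivative exp (- 2 * L * s) * (2 * (e s \<bullet> e' s) - 2 * L * (e s \<bullet> e s))) (at s)"
   unfolding g_def by (rule derivative_eq_intros D2 refl)+ (auto simp: algebra_simps)
  moreover have "e s \<bullet> e' s <= L * (e s \<bullet> e s)"
  proof -
   have "e s \<bullet> e' s <= norm (e s) * norm (e' s)" by (rule norm_cauchy_schwarz)
   also have "norm (e' s) <= L * norm (e s)"
    unfolding e_def e'_def using lipschitz_on_normD[OF L] S s t by auto
   finally show ?thesis
    by (simp add: mult_left_mono power2_norm_eq_inner[symmetric] power2_eq_square mult.left_commute)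
  qed
  ultimately show "\<exists>y. (g has_real_derivative y) (at s) & y <= 0"
   by (intro exI conjI) (auto simp: mult_le_0_iff)
 qed
 then have "(norm (e t))\<^sup>2 <= (exp (L * t) * norm (e 0))\<^sup>2"
  using exp_add[of "L * t" "L * t"]
  by (simp add: g_def power2_norm_eq_inner[symmetric] exp_minus power_mult_distrib power2_eq_square[of "exp _"] field_simps)
 from power2_le_imp_le[OF this] show ?thesis by (simp add: dist_norm e_def)
qed

text \<open>Local Lipschitz continuity in a form that is stable under products and that composition
  with the projection onto a ball reduces to the global case.\<close>

definition lipschitz_on_balls :: "('a::real_normed_vector \<Rightarrow> 'b::real_normed_vector) \<Rightarrow> bool" where
 "lipschitz_on_balls f \<longleftrightarrow> (\<forall>R. \<exists>L. L-lipschitz_on (cball 0 R) f)"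

lemma lipschitz_on_ballsE:
 assumes "lipschitz_on_balls f"
 obtains L where "L-lipschitz_on (cball 0 R) f"
 using assms unfolding lipschitz_on_balls_def by blast

lemma solves_bounded:
 assumes "solves f T \<phi>"
 obtains R where "!!t. t \<in> {0..T} ==> norm (\<phi> t) <= R"
proof -
 have "bounded (\<phi> ` {0..T})"
  using compact_imp_bounded[OF compact_continuous_image[OF solves_continuous[OF assms] compact_Icc]] .
 then obtain R where "\<forall>x\<in>\<phi> ` {0..T}. norm x <= R" unfolding bounded_iff by blast
 then show ?thesis using that[of R] by blast
qed

lemma solves_unique:
 assumes f: "lipschitz_on_balls f" and "solves f T \<phi>" "solves f T \<psi>" "\<phi> 0 = \<psi> 0" "t \<in> {0..T}"
 shows "\<phi> t = \<psi> t"
proof -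
 obtain R1 where R1: "!!t. t \<in> {0..T} ==> norm (\<phi> t) <= R1" using solves_bounded[OF assms(2)] by blast
 obtain R2 where R2: "!!t. t \<in> {0..T} ==> norm (\<psi> t) <= R2" using solves_bounded[OF assms(3)] by blast
 obtain L where "L-lipschitz_on (cball 0 (max R1 R2)) f" using lipschitz_on_ballsE[OF f] .
 from solves_dist_exp[OF this assms(2,3) _ _ assms(5)] R1 R2 assms(4)
 show ?thesis by (auto simp: le_max_iff_disj)
qed

abbreviation ball_proj :: "real \<Rightarrow> 'a::euclidean_space \<Rightarrow> 'a" where
 "ball_proj R \<equiv> closest_point (cball 0 R)"

lemma ball_proj_id: "norm x <= R ==> ball_proj R x = x"
 by (simp add: closest_point_self)

lemma lipschitz_ball_proj:
 assumes f: "lipschitz_on_balls f" and R: "R >= 0"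
 obtains L where "L-lipschitz_on UNIV (%x. f (ball_proj R x))"
proof -
 obtain L where L: "L-lipschitz_on (cball 0 R) f" using lipschitz_on_ballsE[OF f] .
 have *: "ball_proj R x \<in> cball 0 R" for x :: 'a using R by (intro closest_point_in_set) auto
 have "L-lipschitz_on UNIV (%x. f (ball_proj R x))"
 proof (rule lipschitz_onI)
  fix x y :: 'a
  have "dist (f (ball_proj R x)) (f (ball_proj R y)) <= L * dist (ball_proj R x) (ball_proj R y)"
   using lipschitz_onD[OF L] * by blast
  also have "\<dots> <= L * dist x y"
   using lipschitz_on_nonneg[OF L] R by (intro mult_left_mono closest_point_lipschitz) auto
  finally show "dist (f (ball_proj R x)) (f (ball_proj R y)) <= L * dist x y" .
 qed (use lipschitz_on_nonneg[OF L] in auto)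
 then show ?thesis using that by blast
qed

lemma solves_ball_proj_iff:
 assumes "!!t. t \<in> {0..T} ==> norm (\<phi> t) <= R"
 shows "solves (%x. f (ball_proj R x)) T \<phi> \<longleftrightarrow> solves f T \<phi>"
 using assms by (simp add: solves_def ball_proj_id)

text \<open>An a priori bound on all partial solutions excludes blow-up: the field cut off at radius
  C + 1 has a solution on {0..T}, and up to the first time at which that radius is reached it solves
  the original equation, so its norm is at most C there.\<close>

lemma solves_exists_of_bound:
 fixes f :: "'a::euclidean_space \<Rightarrow> 'a"
 assumes f: "lipschitz_on_balls f" and T: "T >= 0"
  and C: "!!s \<phi>. 0 <= s ==> s <= T ==> \<phi> 0 = q ==> solves f s \<phi> ==> norm (\<phi> s) <= C"
 shows "\<exists>\<phi>. \<phi> 0 = q & solves f T \<phi>"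
proof -
 \<comment> \<open>The constant function on the degenerate interval is a partial solution, so the
   bound C covers the initial point as well.\<close>
 have "solves f 0 (%_. q)"
  by (auto simp: solves_def has_vector_derivative_def has_derivative_within_singleton_iff bounded_linear_scaleR_left)
 then have q: "norm q <= C" using C[of 0 "%_. q"] T by simp
 define R where "R = C + 1"
 have R: "R > C" "R >= 0" using q norm_ge_zero[of q] unfolding R_def by linarith+
 obtain L where L: "L-lipschitz_on UNIV (%x. f (ball_proj R x))" using lipschitz_ball_proj[OF f R(2)] .
 obtain \<phi> where \<phi>: "\<phi> 0 = q" "solves (%x. f (ball_proj R x)) T \<phi>" using picard_lipschitz[OF L T] by blast
 have \<phi>c: "continuous_on {0..T} \<phi>" using solves_continuous[OF \<phi>(2)] .
 have "norm (\<phi> t) <= R" if t: "t \<in> {0..T}" for t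
 proof (rule ccontr)
  assume "\<not> norm (\<phi> t) <= R"
  then have "\<exists>s. 0 <= s & s <= t & norm (\<phi> s) = R"
   using t R q \<phi>(1) by (intro IVT') (auto intro!: continuous_intros continuous_on_subset[OF \<phi>c])
  then have ne: "{s \<in> {0..t}. norm (\<phi> s) = R} \<noteq> {}" by auto
  have "continuous_on {0..t} (%s. norm (\<phi> s))"
   using t by (intro continuous_intros continuous_on_subset[OF \<phi>c]) auto
  then have "compact {s \<in> {0..t}. norm (\<phi> s) = R}"
   using continuous_closed_preimage_constant[of "{0..t}" "%s. norm (\<phi> s)" R]
   by (metis (no_types, lifting) closed_atLeastAtMost compact_Icc compact_Int_closed inf.absorb_iff2 mem_Collect_eq subsetI)
  then obtain s where s: "s \<in> {0..t}" "norm (\<phi> s) = R"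
   and smin: "!!r. r \<in> {0..t} ==> norm (\<phi> r) = R ==> s <= r"
   using compact_attains_inf[OF _ ne] by auto
  have "norm (\<phi> r) <= R" if r: "r \<in> {0..s}" for r
  proof (rule ccontr)
   assume "\<not> norm (\<phi> r) <= R"
   then have "\<exists>u. 0 <= u & u <= r & norm (\<phi> u) = R"
    using t R q \<phi>(1) r s by (intro IVT') (auto intro!: continuous_intros continuous_on_subset[OF \<phi>c])
   then obtain u where u: "0 <= u" "u <= r" "norm (\<phi> u) = R" by blast
   with smin[of u] r s have "u = r" by auto
   with u \<open>\<not> norm (\<phi> r) <= R\<close> show False by simp
  qed
  then have "solves f s \<phi>"
   using solves_ball_proj_iff[of s \<phi> R f] solves_subinterval[OF \<phi>(2), of s] s t by auto
  with C[of s \<phi>] s t \<phi>(1) R show False by auto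
 qed
 then have "solves f T \<phi>" using solves_ball_proj_iff[of T \<phi> R f] \<phi>(2) by blast
 with \<phi>(1) show ?thesis by blast
qed

lemma global_solution_of_bounds:
 fixes f :: "'a::euclidean_space \<Rightarrow> 'a"
 assumes f: "lipschitz_on_balls f"
  and C: "!!T. T >= 0 ==> \<exists>C. \<forall>s \<phi>. 0 <= s & s <= T & \<phi> 0 = q & solves f s \<phi> --> norm (\<phi> s) <= C"
 shows "\<exists>\<phi>. \<phi> 0 = q & (\<forall>T. solves f T \<phi>)"
proof -
 have "\<exists>\<phi>. \<phi> 0 = q & solves f T \<phi>" if T: "T >= 0" for T
 proof -
  obtain C where "\<forall>s \<phi>. 0 <= s & s <= T & \<phi> 0 = q & solves f s \<phi> --> norm (\<phi> s) <= C"
   using C[OF T] by blast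
  then show ?thesis by (intro solves_exists_of_bound[OF f T, of q C]) blast
 qed
 then obtain \<Phi> where \<Phi>: "!!T. T >= 0 ==> \<Phi> T 0 = q & solves f T (\<Phi> T)" by metis
 \<comment> \<open>Diagonal choice: by uniqueness the solutions for different horizons agree, so
   evaluating the one for horizon t at t gives a single global solution.\<close>
 define \<phi> where "\<phi> = (%t. \<Phi> t t)"
 have "\<phi> t = \<Phi> T t" if "t \<in> {0..T}" for t T
  unfolding \<phi>_def
 proof (rule solves_unique[OF f, where T=t and \<phi>="\<Phi> t" and \<psi>="\<Phi> T"])
  show "solves f t (\<Phi> t)" "solves f t (\<Phi> T)" "\<Phi> t 0 = \<Phi> T 0"
   using \<Phi>[of t] \<Phi>[of T] that solves_subinterval[of f T "\<Phi> T" t] by auto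
 qed (use that in auto)
 then have "solves f T \<phi>" if "T >= 0" for T
  using \<Phi>[OF that] solves_transform[of f T "\<Phi> T" \<phi>] by blast
 moreover have "solves f T \<phi>" if "T < 0" for T using that by (simp add: solves_def)
 ultimately have "solves f T \<phi>" for T by (meson not_less)
 moreover have "\<phi> 0 = q" using \<Phi>[of 0] by (simp add: \<phi>_def)
 ultimately show ?thesis by blast
qed

text \<open>The field is cut off outside a ball containing the e-neighbourhood of the given orbit,
  so the perturbed solution exists up to T; the exponential estimate keeps it within e, where the
  cut-off is invisible.\<close>

lemma solves_near:
 fixes f :: "'a::euclidean_space \<Rightarrow> 'a"
 assumes f: "lipschitz_on_balls f" and \<phi>: "solves f T \<phi>" and T: "T >= 0" and e: "e > 0"
 obtains \<delta> where "\<delta> > 0"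
  "!!q. dist q (\<phi> 0) < \<delta> ==> \<exists>\<psi>. \<psi> 0 = q & solves f T \<psi> & (\<forall>t\<in>{0..T}. dist (\<psi> t) (\<phi> t) < e)"
proof -
 obtain R0 where R0: "!!t. t \<in> {0..T} ==> norm (\<phi> t) <= R0" using solves_bounded[OF \<phi>] by blast
 define R where "R = R0 + e"
 have R: "R >= 0" using R0[of 0] T e norm_ge_zero[of "\<phi> 0"] unfolding R_def by (simp del: norm_ge_zero)
 have "solves (%x. f (ball_proj R x)) T \<phi>"
 proof (subst solves_ball_proj_iff)
  show "norm (\<phi> t) <= R" if "t \<in> {0..T}" for t using R0[OF that] e by (simp add: R_def)
 qed (rule \<phi>)
 note \<phi>R = this
 obtain L where L: "L-lipschitz_on UNIV (%x. f (ball_proj R x))" using lipschitz_ball_proj[OF f R] .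
 have L0: "L >= 0" using lipschitz_on_nonneg[OF L] .
 define \<delta> where "\<delta> = e * exp (- L * T)"
 show ?thesis
 proof (rule that[of \<delta>])
  show "\<delta> > 0" using e by (simp add: \<delta>_def)
  fix q assume q: "dist q (\<phi> 0) < \<delta>"
  obtain \<psi> where \<psi>: "\<psi> 0 = q" "solves (%x. f (ball_proj R x)) T \<psi>" using picard_lipschitz[OF L T] by blast
  have d: "dist (\<psi> t) (\<phi> t) < e" if t: "t \<in> {0..T}" for t
  proof -
   have "dist (\<psi> t) (\<phi> t) <= exp (L * t) * dist (\<psi> 0) (\<phi> 0)"
    by (rule solves_dist_exp[OF L \<psi>(2) \<phi>R _ _ t]) auto
   also have "\<dots> < exp (L * t) * \<delta>" using q \<psi>(1) by simp
   also have "\<dots> <= exp (L * T) * \<delta>" using t L0 e by (auto simp: \<delta>_def mult_left_mono)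
   also have "\<dots> = e" by (simp add: \<delta>_def exp_minus field_simps)
   finally show ?thesis .
  qed
  have "norm (\<psi> t) <= R" if "t \<in> {0..T}" for t
   using d[OF that] R0[OF that] norm_triangle_sub[of "\<psi> t" "\<phi> t"] by (simp add: R_def dist_norm)
  then have "solves f T \<psi>" using \<psi>(2) solves_ball_proj_iff by blast
  with d \<psi>(1) show "\<exists>\<psi>. \<psi> 0 = q & solves f T \<psi> & (\<forall>t\<in>{0..T}. dist (\<psi> t) (\<phi> t) < e)" by blast
 qed
qed

text \<open>The sign of \<open>g\<close> is controlled by looking at the last zero before a positive value.\<close>

lemma gronwall_nonpos:
 fixes g g' :: "real \<Rightarrow> real"
 assumes ab: "a <= b" and c: "continuous_on {a..b} g" and 0: "g a <= 0"
  and d: "!!t. a < t ==> t < b ==> (g has_real_derivative g' t) (at t)"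
  and le: "!!t. a < t ==> t < b ==> g t > 0 ==> g' t <= K * g t"
 shows "g b <= 0"
proof (rule ccontr)
 assume pos: "\<not> g b <= 0"
 define Z where "Z = {t \<in> {a..b}. g t = 0}"
 have "\<exists>t. a <= t & t <= b & g t = 0" using ab 0 pos c by (intro IVT') auto
 then have ne: "Z \<noteq> {}" by (auto simp: Z_def)
 have "closed Z" unfolding Z_def by (rule continuous_closed_preimage_constant[OF c]) simp
 then have "compact Z" unfolding Z_def using compact_Int_closed[OF compact_Icc[of a b]]
  by (metis (no_types, lifting) inf.absorb_iff2 mem_Collect_eq subsetI)
 then obtain s where s: "s \<in> Z" and smax: "!!t. t \<in> Z ==> t <= s" using compact_attains_sup[OF _ ne] by auto
 have sab: "a <= s" "s <= b" "g s = 0" using s by (auto simp: Z_def)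
 have gp: "g t > 0" if "s < t" "t <= b" for t
 proof (rule ccontr)
  assume "\<not> g t > 0"
  then have "\<exists>r. t <= r & r <= b & g r = 0"
   using that pos sab by (intro IVT') (auto intro: continuous_on_subset[OF c])
  then obtain r where "t <= r" "r <= b" "g r = 0" by blast
  then have "r \<in> Z" using that sab by (auto simp: Z_def)
  with smax \<open>t <= r\<close> that show False by fastforce
 qed
 have "g b * exp (- K * b) <= g s * exp (- K * s)"
 proof (rule DERIV_nonpos_imp_decreasing_open[of s b "%t. g t * exp (- K * t)"])
  show "continuous_on {s..b} (%t. g t * exp (- K * t))"
   using sab by (intro continuous_intros continuous_on_subset[OF c]) auto
  fix t assume t: "s < t" "t < b"
  have D: "(g has_real_derivative g' t) (at t)" using d t sab by auto
  have "((%t. g t * exp (- K * t)) has_real_derivative (g' t - K * g t) * exp (- K * t)) (at t)"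
   by (auto intro!: derivative_eq_intros D simp: algebra_simps)
  moreover have "(g' t - K * g t) * exp (- K * t) <= 0"
   using le[of t] gp[of t] t sab by (simp add: mult_le_0_iff)
  ultimately show "\<exists>y. ((%t. g t * exp (- K * t)) has_real_derivative y) (at t) & y <= 0" by blast
 qed (use sab in auto)
 then show False using pos sab by (simp add: mult_le_0_iff)
qed

text \<open>Read backwards from b, a loss of positivity is the situation of
  \<open>gronwall_nonpos\<close>.\<close>

lemma gronwall_pos:
 fixes g g' :: "real \<Rightarrow> real"
 assumes ab: "a <= b" and c: "continuous_on {a..b} g" and 0: "g a > 0"
  and d: "!!t. a < t ==> t < b ==> (g has_real_derivative g' t) (at t)"
  and le: "!!t. a < t ==> t < b ==> g' t >= - K * \<bar>g t\<bar>"
 shows "g b > 0"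
proof (rule ccontr)
 assume "\<not> g b > 0"
 then have gb: "g (a + b - a) <= 0" by simp
 have "g (a + b - b) <= 0"
 proof (rule gronwall_nonpos[where g="%t. g (a + b - t)" and K=K and g'="%t. - g' (a + b - t)", OF ab])
  show "continuous_on {a..b} (%t. g (a + b - t))"
   by (rule continuous_on_compose2[OF c]) (auto intro!: continuous_intros)
  show "((%t. g (a + b - t)) has_real_derivative - g' (a + b - t)) (at t)" if "a < t" "t < b" for t
   by (rule DERIV_cong[OF DERIV_chain2[where f=g and g="%t. a + b - t", OF d]])
     (use that in \<open>auto intro!: derivative_eq_intros\<close>)
  show "- g' (a + b - t) <= K * g (a + b - t)" if "a < t" "t < b" "g (a + b - t) > 0" for t
   using le[of "a + b - t"] that by simp
 qed (rule gb)
 then show False using 0 by simp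
qed

section \<open>Real-valued preliminaries\<close>

lemma first_zero:
 fixes g :: "real \<Rightarrow> real"
 assumes ab: "a <= b" and c: "continuous_on {a..b} g" and "g a > 0" "g b <= 0"
 obtains z where "a < z" "z <= b" "g z = 0" "!!t. a <= t ==> t < z ==> g t > 0"
proof -
 define Z where "Z = {t \<in> {a..b}. g t = 0}"
 have "\<exists>t. a <= t & t <= b & g t = 0" using assms by (intro IVT2') auto
 then have ne: "Z \<noteq> {}" by (auto simp: Z_def)
 have "closed Z" unfolding Z_def by (rule continuous_closed_preimage_constant[OF c]) simp
 then have "compact Z" unfolding Z_def using compact_Int_closed[OF compact_Icc[of a b]]
  by (metis (no_types, lifting) inf.absorb_iff2 mem_Collect_eq subsetI)
 then obtain z where z: "z \<in> Z" and zmin: "!!t. t \<in> Z ==> z <= t" using compact_attains_inf[OF _ ne] by auto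
 have "g t > 0" if "a <= t" "t < z" for t
 proof (rule ccontr)
  assume "\<not> g t > 0"
  then have "\<exists>r. a <= r & r <= t & g r = 0"
   using that z assms by (intro IVT2') (auto intro: continuous_on_subset[OF c] simp: Z_def)
  then obtain r where "a <= r" "r <= t" "g r = 0" by blast
  then have "r \<in> Z" using that z by (auto simp: Z_def)
  with zmin \<open>r <= t\<close> that show False by fastforce
 qed
 moreover have "a < z" using z assms by (auto simp: Z_def less_le)
 ultimately show ?thesis using z that by (auto simp: Z_def)
qed

lemma inverse_on_interval:
 fixes f f' :: "real \<Rightarrow> real"
 assumes ab: "a <= b" and c: "continuous_on {a..b} f"
  and d: "!!t. a < t ==> t < b ==> (f has_real_derivative f' t) (at t)"
  and pos: "!!t. a < t ==> t < b ==> f' t > 0"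
 obtains g where "continuous_on {f a..f b} g" "!!t. t \<in> {a..b} ==> g (f t) = t"
  "!!s. s \<in> {f a..f b} ==> g s \<in> {a..b}" "!!s. s \<in> {f a..f b} ==> f (g s) = s"
  "!!s. f a < s ==> s < f b ==> a < g s & g s < b & (g has_real_derivative inverse (f' (g s))) (at s)"
proof -
 have mono: "f u < f v" if "a <= u" "u < v" "v <= b" for u v
  using that d pos by (intro DERIV_pos_imp_increasing_open[OF \<open>u < v\<close>] continuous_on_subset[OF c]) force+
 have inj: "inj_on f {a..b}" by (intro linorder_inj_onI) (use mono in force)+
 have img: "f ` {a..b} = {f a..f b}"
 proof (intro set_eqI iffI)
  fix s assume "s \<in> f ` {a..b}"
  then obtain t where "t \<in> {a..b}" "s = f t" by blast
  then show "s \<in> {f a..f b}" using mono[of a t] mono[of t b] by (cases "t = a"; cases "t = b") auto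
 next
  fix s assume "s \<in> {f a..f b}"
  then show "s \<in> f ` {a..b}" using IVT'[of f a s b] ab c by auto
 qed
 define g where "g = the_inv_into {a..b} f"
 have gf: "g (f t) = t" if "t \<in> {a..b}" for t
  using the_inv_into_f_f[OF inj that] by (simp add: g_def)
 have g: "g s \<in> {a..b}" "f (g s) = s" if "s \<in> {f a..f b}" for s
  using that img the_inv_into_into[OF inj, of s "{a..b}"] f_the_inv_into_f[OF inj, of s] by (auto simp: g_def)
 have gc: "continuous_on {f a..f b} g"
  using continuous_on_inv[OF c compact_Icc, of g] gf img by auto
 have "a < g s & g s < b & (g has_real_derivative inverse (f' (g s))) (at s)" if s: "f a < s" "s < f b" for s
 proof -
  have gs: "a < g s" "g s < b" using g[of s] s by (auto simp: less_le)
  have "(g has_real_derivative inverse (f' (g s))) (at s)"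
  proof (rule DERIV_inverse_function[where f=f and a="f a" and b="f b"])
   show "(f has_real_derivative f' (g s)) (at (g s))" using d gs by blast
   show "f' (g s) \<noteq> 0" using pos gs by force
   show "isCont g s" using gc s by (simp add: continuous_on_interior interior_atLeastAtMost_real)
  qed (use s g in auto)
  with gs show ?thesis by blast
 qed
 with gc gf g show ?thesis by (intro that) blast+
qed

text \<open>Turns an orbit parametrised by time into a graph. On each compact piece the global
  inverse agrees with that of \<open>inverse_on_interval\<close>, and continuity and derivative are
  local.\<close>

lemma inverse_on_halfline:
 fixes f f' :: "real \<Rightarrow> real"
 assumes c: "continuous_on {a..} f"
  and d: "!!t. a < t ==> (f has_real_derivative f' t) (at t)"
  and pos: "!!t. a < t ==> f' t > 0"
  and unbounded: "!!R. \<exists>t\<ge>a. f t > R"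
 obtains g where "continuous_on {f a..} g" "!!t. t >= a ==> g (f t) = t"
  "!!s. s >= f a ==> g s >= a" "!!s. s >= f a ==> f (g s) = s"
  "!!s. s > f a ==> g s > a & (g has_real_derivative inverse (f' (g s))) (at s)"
proof -
 have mono: "f u < f v" if "a <= u" "u < v" for u v
  using that d pos by (intro DERIV_pos_imp_increasing_open[OF \<open>u < v\<close>] continuous_on_subset[OF c]) force+
 have inj: "inj_on f {a..}" by (intro linorder_inj_onI) (use mono in force)+
 define g where "g = the_inv_into {a..} f"
 have gf: "g (f t) = t" if "t >= a" for t
  using the_inv_into_f_f[OF inj, of t] that by (simp add: g_def)
 have local: "(\<forall>r\<in>{f a..s}. g r >= a & f (g r) = r) & (\<exists>b>s. continuous_on {f a..b} g) &
   (s > f a --> g s > a & (g has_real_derivative inverse (f' (g s))) (at s))" if s: "s >= f a" for s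
 proof -
  obtain b where b: "b >= a" "f b > s" using unbounded[of s] by blast
  have c': "continuous_on {a..b} f" by (rule continuous_on_subset[OF c]) auto
  obtain h where h: "continuous_on {f a..f b} h" "!!t. t \<in> {a..b} ==> h (f t) = t"
   "!!s. s \<in> {f a..f b} ==> h s \<in> {a..b}" "!!s. s \<in> {f a..f b} ==> f (h s) = s"
   "!!s. f a < s ==> s < f b ==> a < h s & h s < b & (h has_real_derivative inverse (f' (h s))) (at s)"
   using inverse_on_interval[OF b(1) c', of f'] d pos by blast
  have gh: "g r = h r" if "r \<in> {f a..f b}" for r
   using gf[of "h r"] h(3)[OF that] h(4)[OF that] by auto
  have "continuous_on {f a..f b} g" by (rule continuous_on_eq[OF h(1)]) (use gh in auto)
  moreover have "(g has_real_derivative inverse (f' (g s))) (at s)" if "s > f a"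
  proof -
   have "(h has_real_derivative inverse (f' (g s))) (at s)" using h(5)[of s] gh[of s] that b by simp
   then show ?thesis
    by (rule DERIV_cong_ev[THEN iffD1, rotated 3])
      (use that b gh in \<open>auto intro!: eventually_mono[OF eventually_nhds_in_open[of "{f a<..<f b}" s]]\<close>)
  qed
  ultimately show ?thesis using h(3,4,5) gh b s by auto
 qed
 have "continuous_on {f a..} g"
 proof (rule continuous_on_eq_continuous_within[THEN iffD2], rule ballI)
  fix s assume "s \<in> {f a..}"
  then obtain b where b: "b > s" "continuous_on {f a..b} g" "s >= f a" using local[of s] by auto
  then have "continuous (at s within {f a..b}) g" by (auto simp: continuous_on_eq_continuous_within)
  moreover have "at s within {f a..b} = at s within {f a..}"
   by (rule at_within_nhd[of s "{..<b}"]) (use b in auto)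
  ultimately show "continuous (at s within {f a..}) g" by simp
 qed
 moreover have "g s >= a" "f (g s) = s" if "s >= f a" for s using local[OF that] that by auto
 moreover have "g s > a & (g has_real_derivative inverse (f' (g s))) (at s)" if "s > f a" for s
  using local[of s] that by auto
 ultimately show ?thesis using gf by (intro that) blast+
qed

section \<open>The half system\<close>

definition quart :: "real \<Rightarrow> real \<Rightarrow> real \<Rightarrow> real \<Rightarrow> real \<Rightarrow> real" where
 "quart a b c d x = a * x^4 + b * x^3 + c * x^2 + d * x"

definition quart' :: "real \<Rightarrow> real \<Rightarrow> real \<Rightarrow> real \<Rightarrow> real \<Rightarrow> real" where
 "quart' a b c d x = 4 * a * x^3 + 3 * b * x^2 + 2 * c * x + d"

lemma quart_0 [simp]: "quart a b c d 0 = 0"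
 by (simp add: quart_def)

lemma quart_minus: "quart a b c d (- x) = quart a (- b) c (- d) x"
 by (simp add: quart_def)

lemma DERIV_quart: "(quart a b c d has_real_derivative quart' a b c d x) (at x within S)"
 unfolding quart_def[abs_def] quart'_def by (auto intro!: derivative_eq_intros)

lemma DERIV_quart_comp [derivative_intros]:
 "(f has_real_derivative f') (at x within S) ==>
  ((%x. quart a b c d (f x)) has_real_derivative quart' a b c d (f x) * f') (at x within S)"
 by (rule DERIV_chain2[OF DERIV_quart])

lemma continuous_on_quart [continuous_intros]:
 "continuous_on S f ==> continuous_on S (%x. quart a b c d (f x))"
 unfolding quart_def by (intro continuous_intros)

lemma continuous_on_quart' [continuous_intros]:
 "continuous_on S f ==> continuous_on S (%x. quart' a b c d (f x))"
 unfolding quart'_def by (intro continuous_intros)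

text \<open>Both halves \<open>x >= 0\<close> and \<open>x <= 0\<close> of the Lienard system are brought to this form, the right one
 by reversing time, the left one by the reflection \<open>x \<mapsto> - x\<close>.\<close>

definition hsol :: "(real \<Rightarrow> real) \<Rightarrow> real set \<Rightarrow> (real \<Rightarrow> real) \<Rightarrow> (real \<Rightarrow> real) \<Rightarrow> bool" where
 "hsol F S x y \<longleftrightarrow> (\<forall>t\<in>S. (x has_real_derivative F (x t) - y t) (at t within S) &
   (y has_real_derivative x t) (at t within S))"

lemma hsol_subset: "hsol F S x y ==> T \<subseteq> S ==> hsol F T x y"
 unfolding hsol_def by (auto intro: DERIV_subset)

lemma hsol_continuous:
 assumes "hsol F S x y"
 shows "continuous_on S x" "continuous_on S y"
 using assms unfolding hsol_def continuous_on_eq_continuous_within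
 using DERIV_continuous by blast+

lemma hsol_at:
 assumes "hsol F S x y" "t \<in> interior S"
 shows "(x has_real_derivative F (x t) - y t) (at t)" "(y has_real_derivative x t) (at t)"
 using assms(1) subsetD[OF interior_subset assms(2)] at_within_interior[OF assms(2)] by (auto simp: hsol_def)

lemma hsol_at_interval:
 assumes "hsol F {0..T} x y" "0 < t" "t < T"
 shows "(x has_real_derivative F (x t) - y t) (at t)" "(y has_real_derivative x t) (at t)"
 using hsol_at[OF assms(1), of t] assms by (auto simp: interior_atLeastAtMost_real)

lemma hsol_shift:
 assumes "hsol F {0..T} x y" "r >= 0"
 shows "hsol F {0..T - r} (%t. x (r + t)) (%t. y (r + t))"
proof -
 have sub: "(+) r ` {0..T - r} \<subseteq> {0..T}" using assms by auto
 show ?thesis unfolding hsol_def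
 proof (intro ballI conjI)
  fix t assume "t \<in> {0..T - r}"
  then have "r + t \<in> {0..T}" using assms by auto
  then have d: "(x has_real_derivative F (x (r + t)) - y (r + t)) (at (r + t) within (+) r ` {0..T - r})"
   "(y has_real_derivative x (r + t)) (at (r + t) within (+) r ` {0..T - r})"
   using assms(1) DERIV_subset[OF _ sub] unfolding hsol_def by blast+
  have r: "((+) r has_real_derivative 1) (at t within {0..T - r})" by (auto intro!: derivative_eq_intros)
  show "((%t. x (r + t)) has_real_derivative F (x (r + t)) - y (r + t)) (at t within {0..T - r})"
   using DERIV_image_chain[OF d(1) r] by (simp add: o_def)
  show "((%t. y (r + t)) has_real_derivative x (r + t)) (at t within {0..T - r})"
   using DERIV_image_chain[OF d(2) r] by (simp add: o_def)
 qed
qed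

text \<open>The coefficient \<open>d\<close> is carried along as a third coordinate, so that continuous dependence on
 initial values also gives continuous dependence on \<open>d\<close>.\<close>

definition hfield3 :: "real \<Rightarrow> real \<Rightarrow> real \<Rightarrow> real \<times> real \<times> real \<Rightarrow> real \<times> real \<times> real" where
 "hfield3 a b c = (%(x, y, d). (quart a b c d x - y, x, 0))"

lemma lipschitz_on_balls_mult:
 fixes f g :: "'a::real_normed_vector \<Rightarrow> real"
 assumes "lipschitz_on_balls f" "lipschitz_on_balls g"
 shows "lipschitz_on_balls (%x. f x * g x)"
 unfolding lipschitz_on_balls_def
proof
 fix R :: real
 obtain L M where L: "L-lipschitz_on (cball 0 R) f" and M: "M-lipschitz_on (cball 0 R) g"
  using assms unfolding lipschitz_on_balls_def by metis
 define A B where "A = \<bar>f 0\<bar> + L * \<bar>R\<bar>" and "B = \<bar>g 0\<bar> + M * \<bar>R\<bar>"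
 have L0: "L >= 0" "M >= 0" using lipschitz_on_nonneg L M by blast+
 have A: "\<bar>f x\<bar> <= A" "\<bar>g x\<bar> <= B" if "x \<in> cball 0 R" for x
 proof -
  have x: "norm x <= \<bar>R\<bar>" "0 \<in> cball 0 R" using that norm_ge_zero[of x] by (auto simp del: norm_ge_zero)
  have "\<bar>f x - f 0\<bar> <= L * norm x" "\<bar>g x - g 0\<bar> <= M * norm x"
   using lipschitz_on_normD[OF L that x(2)] lipschitz_on_normD[OF M that x(2)] by auto
  moreover have "L * norm x <= L * \<bar>R\<bar>" "M * norm x <= M * \<bar>R\<bar>" using L0 x by (auto intro: mult_left_mono)
  ultimately show "\<bar>f x\<bar> <= A" "\<bar>g x\<bar> <= B" unfolding A_def B_def by linarith+
 qed
 have AB: "A >= 0" "B >= 0" using L0 by (auto simp: A_def B_def)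
 have "(A * M + B * L)-lipschitz_on (cball 0 R) (%x. f x * g x)"
 proof (rule lipschitz_onI)
  fix x y :: 'a assume xy: "x \<in> cball 0 R" "y \<in> cball 0 R"
  have "\<bar>f x * g x - f y * g y\<bar> = \<bar>f x * (g x - g y) + g y * (f x - f y)\<bar>" by (simp add: algebra_simps)
  also have "\<dots> <= \<bar>f x\<bar> * \<bar>g x - g y\<bar> + \<bar>g y\<bar> * \<bar>f x - f y\<bar>"
   by (rule abs_triangle_ineq[THEN order_trans]) (simp add: abs_mult)
  also have "\<dots> <= A * (M * norm (x - y)) + B * (L * norm (x - y))"
   using A xy AB lipschitz_on_normD[OF L xy] lipschitz_on_normD[OF M xy] by (intro add_mono mult_mono) auto
  finally show "dist (f x * g x) (f y * g y) <= (A * M + B * L) * dist x y"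
   by (simp add: dist_norm algebra_simps)
 qed (use AB L0 in auto)
 then show "\<exists>L. L-lipschitz_on (cball 0 R) (%x. f x * g x)" by blast
qed

lemma lipschitz_on_balls_add:
 "lipschitz_on_balls f ==> lipschitz_on_balls g ==> lipschitz_on_balls (%x. f x + g x)"
 unfolding lipschitz_on_balls_def by (blast intro: lipschitz_on_add)

lemma lipschitz_on_balls_diff:
 "lipschitz_on_balls f ==> lipschitz_on_balls g ==> lipschitz_on_balls (%x. f x - g x)"
 unfolding lipschitz_on_balls_def by (blast intro: lipschitz_on_diff)

lemma lipschitz_on_balls_Pair:
 "lipschitz_on_balls f ==> lipschitz_on_balls g ==> lipschitz_on_balls (%x. (f x, g x))"
 unfolding lipschitz_on_balls_def by (blast intro: lipschitz_on_Pair)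

lemma lipschitz_on_balls_const: "lipschitz_on_balls (%x. c)"
 unfolding lipschitz_on_balls_def by (blast intro: lipschitz_on_constant)

lemma lipschitz_on_balls_linear: "bounded_linear f ==> lipschitz_on_balls f"
 unfolding lipschitz_on_balls_def by (meson bounded_linear.lipschitz_boundE)

lemma lipschitz_hfield3: "lipschitz_on_balls (hfield3 a b c)"
proof -
 have 1: "lipschitz_on_balls (%p::real \<times> real \<times> real. fst p)"
  "lipschitz_on_balls (%p::real \<times> real \<times> real. fst (snd p))"
  "lipschitz_on_balls (%p::real \<times> real \<times> real. snd (snd p))"
  by (intro lipschitz_on_balls_linear bounded_linear_fst bounded_linear_compose[OF bounded_linear_fst bounded_linear_snd]
   bounded_linear_compose[OF bounded_linear_snd bounded_linear_snd])+
 show ?thesis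
  unfolding hfield3_def split_def quart_def power4_eq_xxxx power3_eq_cube power2_eq_square
  by (intro lipschitz_on_balls_add lipschitz_on_balls_diff lipschitz_on_balls_mult lipschitz_on_balls_Pair
    lipschitz_on_balls_const 1)
qed

lemma hsol_iff_solves:
 "hsol (quart a b c d) {0..T} x y \<longleftrightarrow> solves (hfield3 a b c) T (%t. (x t, y t, d))"
proof -
 have "((%t. (x t, y t, d)) has_vector_derivative (u, v, 0)) (at t within S) \<longleftrightarrow>
   (x has_vector_derivative u) (at t within S) & (y has_vector_derivative v) (at t within S)"
  (is "?L \<longleftrightarrow> ?R") for t u v S
 proof
  assume L: ?L
  show ?R using bounded_linear.has_vector_derivative[OF bounded_linear_fst L]
    bounded_linear.has_vector_derivative[OF bounded_linear_compose[OF bounded_linear_fst bounded_linear_snd] L]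
   by simp
 next
  assume ?R then show ?L by (intro has_vector_derivative_Pair has_vector_derivative_const) auto
 qed
 then show ?thesis
  unfolding hsol_def solves_def hfield3_def has_real_derivative_iff_has_vector_derivative by simp
qed

text \<open>The third coordinate has derivative 0, so it keeps the value d.\<close>

lemma solves_imp_hsol:
 assumes s: "solves (hfield3 a b c) T \<phi>" and 0: "\<phi> 0 = (x0, y0, d)" and t: "t \<in> {0..T}"
 shows "\<phi> t = (fst (\<phi> t), fst (snd (\<phi> t)), d)"
proof -
 have "((%t. snd (snd (\<phi> t))) has_vector_derivative 0) (at t within {0..T})" if "t \<in> {0..T}" for t
  using bounded_linear.has_vector_derivative[OF bounded_linear_compose[OF bounded_linear_snd bounded_linear_snd],
    of \<phi> "hfield3 a b c (\<phi> t)" "at t within {0..T}"] s that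
  by (auto simp: solves_def hfield3_def split_def)
 from has_vector_derivative_zero_constant[OF convex_real_interval(5) this]
 obtain k where k: "!!t. t \<in> {0..T} ==> snd (snd (\<phi> t)) = k" by metis
 have "snd (snd (\<phi> t)) = snd (snd (\<phi> 0))" using k[of t] k[of 0] t by auto
 then show ?thesis using 0 by (simp add: prod_eq_iff)
qed

lemma hsol_unique:
 assumes "hsol (quart a b c d) {0..T} x y" "hsol (quart a b c d) {0..T} x' y'"
  "x 0 = x' 0" "y 0 = y' 0" "t \<in> {0..T}"
 shows "x t = x' t & y t = y' t"
 using solves_unique[OF lipschitz_hfield3 assms(1,2)[unfolded hsol_iff_solves] _ assms(5)] assms(3,4) by simp

lemma hsol_global:
 assumes C: "!!T. T >= 0 ==> \<exists>C. \<forall>s x y. 0 <= s & s <= T & x 0 = x0 & y 0 = y0 & hsol (quart a b c d) {0..s} x y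
   --> \<bar>x s\<bar> <= C & \<bar>y s\<bar> <= C"
 obtains x y where "x 0 = x0" "y 0 = y0" "hsol (quart a b c d) {0..} x y"
proof -
 have "\<exists>\<phi>. \<phi> 0 = (x0, y0, d) & (\<forall>T. solves (hfield3 a b c) T \<phi>)"
 proof (rule global_solution_of_bounds[OF lipschitz_hfield3])
  fix T :: real assume "T >= 0"
  then obtain C where C: "!!s x y. 0 <= s ==> s <= T ==> x 0 = x0 ==> y 0 = y0 ==>
    hsol (quart a b c d) {0..s} x y ==> \<bar>x s\<bar> <= C & \<bar>y s\<bar> <= C" using C by meson
  show "\<exists>C. \<forall>s \<phi>. 0 <= s & s <= T & \<phi> 0 = (x0, y0, d) & solves (hfield3 a b c) s \<phi> --> norm (\<phi> s) <= C"
  proof (intro exI[of _ "C + (C + \<bar>d\<bar>)"] allI impI, elim conjE)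
   fix s \<phi> assume s: "0 <= s" "s <= T" and \<phi>: "\<phi> 0 = (x0, y0, d)" "solves (hfield3 a b c) s \<phi>"
   have eq: "\<phi> t = (fst (\<phi> t), fst (snd (\<phi> t)), d)" if "t \<in> {0..s}" for t
    using solves_imp_hsol[OF \<phi>(2,1) that] .
   have "solves (hfield3 a b c) s (%t. (fst (\<phi> t), fst (snd (\<phi> t)), d))"
    by (rule solves_transform[OF \<phi>(2)]) (use eq in metis)
   then have "\<bar>fst (\<phi> s)\<bar> <= C & \<bar>fst (snd (\<phi> s))\<bar> <= C"
    using C[of s "%t. fst (\<phi> t)" "%t. fst (snd (\<phi> t))"] s \<phi>(1) by (auto simp: hsol_iff_solves)
   moreover have "norm (\<phi> s) <= norm (fst (\<phi> s)) + (norm (fst (snd (\<phi> s))) + norm d)"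
    by (subst eq) (use s norm_Pair_le[of "fst (\<phi> s)" "(fst (snd (\<phi> s)), d)"] norm_Pair_le[of "fst (snd (\<phi> s))" d] in auto)
   ultimately show "norm (\<phi> s) <= C + (C + \<bar>d\<bar>)" by simp
  qed
 qed
 then obtain \<phi> where \<phi>: "\<phi> 0 = (x0, y0, d)" "!!T. solves (hfield3 a b c) T \<phi>" by blast
 have eq: "\<phi> t = (fst (\<phi> t), fst (snd (\<phi> t)), d)" if "t >= 0" for t
  using solves_imp_hsol[OF \<phi>(2)[of t] \<phi>(1), of t] that by auto
 define x y where "x = (%t. fst (\<phi> t))" and "y = (%t. fst (snd (\<phi> t)))"
 have h: "hsol (quart a b c d) {0..T} x y" for T
  unfolding hsol_iff_solves x_def y_def
  by (rule solves_transform[OF \<phi>(2)]) (use eq in \<open>metis atLeastAtMost_iff\<close>)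
 have "hsol (quart a b c d) {0..} x y" unfolding hsol_def
 proof
  fix t :: real assume t: "t \<in> {0..}"
  have w: "at t within {0..t + 1} = at t within {0..}"
   by (rule at_within_nhd[of t "{..<t + 1}"]) auto
  have "t \<in> {0..t + 1}" using t by auto
  then show "(x has_real_derivative quart a b c d (x t) - y t) (at t within {0..}) &
     (y has_real_derivative x t) (at t within {0..})"
   using h[of "t + 1"] unfolding hsol_def w[symmetric] by blast
 qed
 moreover have "x 0 = x0" "y 0 = y0" using \<phi>(1) by (auto simp: x_def y_def)
 ultimately show ?thesis using that by blast
qed

lemma hsol_near:
 assumes h: "hsol (quart a b c d) {0..T} x y" and T: "T >= 0" and e: "e > 0"
 obtains \<delta> where "\<delta> > 0"
  "!!d' x0 y0. \<bar>d' - d\<bar> < \<delta> ==> \<bar>x0 - x 0\<bar> < \<delta> ==> \<bar>y0 - y 0\<bar> < \<delta> ==>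
    \<exists>x' y'. x' 0 = x0 & y' 0 = y0 & hsol (quart a b c d') {0..T} x' y' &
     (\<forall>t\<in>{0..T}. \<bar>x' t - x t\<bar> < e & \<bar>y' t - y t\<bar> < e)"
proof -
 obtain \<delta> where \<delta>: "\<delta> > 0" and near: "!!q. dist q (x 0, y 0, d) < \<delta> ==>
   \<exists>\<psi>. \<psi> 0 = q & solves (hfield3 a b c) T \<psi> & (\<forall>t\<in>{0..T}. dist (\<psi> t) (x t, y t, d) < e)"
  using solves_near[OF lipschitz_hfield3 h[unfolded hsol_iff_solves] T e] by metis
 show ?thesis
 proof (rule that[of "\<delta> / 3"])
  fix d' x0 y0 assume A: "\<bar>d' - d\<bar> < \<delta> / 3" "\<bar>x0 - x 0\<bar> < \<delta> / 3" "\<bar>y0 - y 0\<bar> < \<delta> / 3"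
  have "dist (x0, y0, d') (x 0, y 0, d) = norm (x0 - x 0, y0 - y 0, d' - d)" by (simp add: dist_norm)
  also have "\<dots> <= norm (x0 - x 0) + (norm (y0 - y 0) + norm (d' - d))"
   using norm_Pair_le[of "x0 - x 0" "(y0 - y 0, d' - d)"] norm_Pair_le[of "y0 - y 0" "d' - d"] by simp
  also have "\<dots> < \<delta>" using A by simp
  finally obtain \<psi> where \<psi>: "\<psi> 0 = (x0, y0, d')" "solves (hfield3 a b c) T \<psi>"
   "!!t. t \<in> {0..T} ==> dist (\<psi> t) (x t, y t, d) < e" using near by blast
  define x' y' where "x' = (%t. fst (\<psi> t))" and "y' = (%t. fst (snd (\<psi> t)))"
  have eq: "\<psi> t = (x' t, y' t, d')" if "t \<in> {0..T}" for t
   using solves_imp_hsol[OF \<psi>(2,1) that] by (simp add: x'_def y'_def)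
  have "hsol (quart a b c d') {0..T} x' y'" unfolding hsol_iff_solves
   by (rule solves_transform[OF \<psi>(2)]) (use eq in metis)
  moreover have "\<bar>x' t - x t\<bar> < e & \<bar>y' t - y t\<bar> < e" if t: "t \<in> {0..T}" for t
  proof -
   have d: "dist (x' t, y' t, d') (x t, y t, d) < e" using \<psi>(3)[OF t] eq[OF t] by simp
   show ?thesis using dist_fst_le[of "(x' t, y' t, d')" "(x t, y t, d)"]
    dist_fst_le[of "(y' t, d')" "(y t, d)"] dist_snd_le[of "(x' t, y' t, d')" "(x t, y t, d)"] d
    by (auto simp: dist_real_def)
  qed
  ultimately show "\<exists>x' y'. x' 0 = x0 & y' 0 = y0 & hsol (quart a b c d') {0..T} x' y' &
     (\<forall>t\<in>{0..T}. \<bar>x' t - x t\<bar> < e & \<bar>y' t - y t\<bar> < e)"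
   using \<psi>(1) by (intro exI[of _ x'] exI[of _ y']) (auto simp: x'_def y'_def)
 qed (use \<delta> in auto)
qed

section \<open>Increment estimates and linear equations\<close>

lemma mvt_interior:
 fixes f f' :: "real \<Rightarrow> real"
 assumes "a < b" "continuous_on {a..b} f"
  and "!!t. a < t ==> t < b ==> (f has_real_derivative f' t) (at t)"
 obtains \<xi> where "a < \<xi>" "\<xi> < b" "f b - f a = (b - a) * f' \<xi>"
proof -
 obtain \<xi> where "a < \<xi>" "\<xi> < b" "f b - f a = f' \<xi> * (b - a)"
  by (rule mvt[OF assms(1,2), of "%t h. f' t * h"])
    (use assms(3) in \<open>auto simp: has_field_derivative_def\<close>)
 then show ?thesis using that by (auto simp: mult.commute)
qed

lemma increment_le:
 fixes f f' :: "real \<Rightarrow> real"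
 assumes "a <= b" "continuous_on {a..b} f"
  and "!!t. a < t ==> t < b ==> (f has_real_derivative f' t) (at t)"
  and "!!t. a < t ==> t < b ==> f' t <= M"
 shows "f b <= f a + M * (b - a)"
proof (cases "a = b")
 case False
 then obtain \<xi> where "a < \<xi>" "\<xi> < b" "f b - f a = (b - a) * f' \<xi>"
  using mvt_interior[OF _ assms(2,3)] assms(1) by (metis less_eq_real_def)
 moreover have "f' \<xi> * (b - a) <= M * (b - a)" using assms(4)[of \<xi>] calculation by (intro mult_right_mono) auto
 ultimately show ?thesis using mult.commute[of "b - a" "f' \<xi>"] by linarith
qed simp

lemma increment_ge:
 fixes f f' :: "real \<Rightarrow> real"
 assumes "a <= b" "continuous_on {a..b} f"
  and "!!t. a < t ==> t < b ==> (f has_real_derivative f' t) (at t)"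
  and "!!t. a < t ==> t < b ==> f' t >= m"
 shows "f b >= f a + m * (b - a)"
proof (cases "a = b")
 case False
 then obtain \<xi> where "a < \<xi>" "\<xi> < b" "f b - f a = (b - a) * f' \<xi>"
  using mvt_interior[OF _ assms(2,3)] assms(1) by (metis less_eq_real_def)
 moreover have "m * (b - a) <= f' \<xi> * (b - a)" using assms(4)[of \<xi>] calculation by (intro mult_right_mono) auto
 ultimately show ?thesis using mult.commute[of "b - a" "f' \<xi>"] by linarith
qed simp

text \<open>Gronwall for g and for - g. It will be applied to the gap between an orbit and a
  separatrix, which solves such an equation: orbits do not cross.\<close>

lemma linear_ode_sgn:
 fixes g k :: "real \<Rightarrow> real"
 assumes ab: "a <= b" and c: "continuous_on {a..b} g"
  and d: "!!t. a < t ==> t < b ==> (g has_real_derivative k t * g t) (at t)"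
  and K: "!!t. a < t ==> t < b ==> \<bar>k t\<bar> <= K"
 shows "sgn (g b) = sgn (g a)"
proof -
 have le: "k t * g t <= K * \<bar>g t\<bar>" "- K * \<bar>g t\<bar> <= k t * g t" if "a < t" "t < b" for t
 proof -
  have "\<bar>k t * g t\<bar> <= K * \<bar>g t\<bar>" using K[OF that] by (simp add: abs_mult mult_right_mono)
  then show "k t * g t <= K * \<bar>g t\<bar>" "- K * \<bar>g t\<bar> <= k t * g t" by (auto simp: abs_le_iff)
 qed
 have c': "continuous_on {a..b} (%t. - g t)" using c by (intro continuous_intros)
 have d': "((%t. - g t) has_real_derivative - (k t * g t)) (at t)" if "a < t" "t < b" for t
  using d[OF that] by (rule DERIV_minus)
 consider "g a > 0" | "g a < 0" | "g a = 0" by linarith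
 then show ?thesis
 proof cases
  case 1
  have "g b > 0"
   by (rule gronwall_pos[OF ab c 1 d, where K=K]) (use le in auto)
  with 1 show ?thesis by simp
 next
  case 2
  have "- g b > 0"
   by (rule gronwall_pos[OF ab c' _ d', where K=K]) (use 2 le in auto)
  with 2 show ?thesis by simp
 next
  case 3
  have "g b <= 0" by (rule gronwall_nonpos[OF ab c _ d, where K=K]) (use 3 le in force)+
  moreover have "- g b <= 0" by (rule gronwall_nonpos[OF ab c' _ d', where K=K]) (use 3 le in force)+
  ultimately show ?thesis using 3 by simp
 qed
qed

text \<open>\<open>sepg F ys\<close> says that \<open>ys\<close> is the graph of the separatrix, the orbit of the half system that
 follows the curve \<open>y = F x\<close> from below up to infinity.\<close>

definition sepg :: "(real \<Rightarrow> real) \<Rightarrow> (real \<Rightarrow> real) \<Rightarrow> bool" where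
 "sepg F ys \<longleftrightarrow> continuous_on {0..} ys & (\<forall>x\<ge>0. ys x < F x) &
   (\<forall>x>0. (ys has_real_derivative x / (F x - ys x)) (at x)) & (\<exists>U. \<forall>x\<ge>0. F x - ys x <= U)"

definition sep :: "(real \<Rightarrow> real) \<Rightarrow> real \<Rightarrow> bool" where
 "sep F \<eta> \<longleftrightarrow> (\<exists>ys. sepg F ys & ys 0 = \<eta>)"

text \<open>Beyond the curve y = F x the coordinate x decreases, so the orbit is on its way back.
  Only a single time beyond the curve is recorded, which makes the condition open in \<eta> and in
  the coefficient d.\<close>

definition turn :: "(real \<Rightarrow> real) \<Rightarrow> real \<Rightarrow> bool" where
 "turn F \<eta> \<longleftrightarrow> (\<exists>T x y. T >= 0 & hsol F {0..T} x y & x 0 = 0 & y 0 = \<eta> & x T > 0 & y T > F (x T))"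

lemma hsol_leave:
 assumes h: "hsol F {0..T} x y" and 0: "x 0 = 0" "y 0 = \<eta>" "\<eta> < 0" "F 0 = 0" and t: "0 < t" "t <= T"
 obtains r where "0 < r" "r < t" "!!s. 0 < s ==> s <= r ==> x s > 0"
proof -
 have "(x has_real_derivative - \<eta>) (at 0 within {0..T})" using h 0 t unfolding hsol_def by force
 from has_real_derivative_pos_inc_right[OF this] 0
 obtain \<delta> where \<delta>: "\<delta> > 0" "!!h. h > 0 ==> h \<in> {0..T} ==> h < \<delta> ==> x h > 0" by auto
 show ?thesis by (rule that[of "min (\<delta> / 2) (t / 2)"]) (use \<delta> t in auto)
qed

text \<open>To come back to the axis x has to decrease somewhere, and by the mean value theorem this
  happens at a point beyond the curve. That point is the witness for \<open>turn\<close>.\<close>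

lemma hsol_return:
 assumes h: "hsol F {0..T} x y" and 0: "x 0 = 0" "y 0 = \<eta>" "\<eta> < 0" "F 0 = 0"
  and t: "0 < t" "t <= T" "x t <= 0"
 obtains z \<xi> where "0 < z" "z <= t" "x z = 0" "!!s. 0 < s ==> s < z ==> x s > 0"
  "0 < \<xi>" "\<xi> < z" "y \<xi> > F (x \<xi>)"
proof -
 obtain r where r: "0 < r" "r < t" "!!s. 0 < s ==> s <= r ==> x s > 0"
  using hsol_leave[OF h 0 t(1,2)] by blast
 have c: "continuous_on {r..t} x" using hsol_continuous(1)[OF h] by (rule continuous_on_subset) (use r t in auto)
 obtain z where z: "r < z" "z <= t" "x z = 0" "!!s. r <= s ==> s < z ==> x s > 0"
  using first_zero[OF _ c] r t by (metis less_eq_real_def)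
 have c: "continuous_on {r..z} x" using c by (rule continuous_on_subset) (use z in auto)
 obtain \<xi> where \<xi>: "r < \<xi>" "\<xi> < z" "x z - x r = (z - r) * (F (x \<xi>) - y \<xi>)"
  by (rule mvt_interior[OF z(1) c, of "%s. F (x s) - y s"])
    (use hsol_at_interval(1)[OF h] r z t in auto)
 have "(z - r) * (F (x \<xi>) - y \<xi>) < 0" using \<xi>(3) z(3) r(3)[of r] r(1) by simp
 then have "y \<xi> > F (x \<xi>)" using z(1) by (simp add: mult_less_0_iff)
 moreover have "x s > 0" if "0 < s" "s < z" for s using r(3)[of s] z(4)[of s] that by (cases "s <= r") auto
 ultimately show ?thesis using z r \<xi> by (intro that[of z \<xi>]) auto
qed

lemma nonturn_pos:
 assumes nt: "\<not> turn F \<eta>" and h: "hsol F {0..T} x y" and 0: "x 0 = 0" "y 0 = \<eta>" "\<eta> < 0" "F 0 = 0"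
  and t: "0 < t" "t <= T"
 shows "x t > 0" "y t <= F (x t)"
proof -
 have sub: "hsol F {0..s} x y" if "s <= T" for s using hsol_subset[OF h] that by auto
 show x: "x t > 0"
 proof (rule ccontr)
  assume "\<not> x t > 0"
  then obtain z \<xi> where "0 < z" "z <= t" "x z = 0" "!!s. 0 < s ==> s < z ==> x s > 0"
   "0 < \<xi>" "\<xi> < z" "y \<xi> > F (x \<xi>)"
   using hsol_return[OF h 0 t] by (metis not_less)
  then have "turn F \<eta>" unfolding turn_def using 0 sub[of \<xi>] t by (intro exI[of _ \<xi>] exI[of _ x] exI[of _ y]) auto
  with nt show False ..
 qed
 show "y t <= F (x t)"
 proof (rule ccontr)
  assume "\<not> y t <= F (x t)"
  then have "turn F \<eta>" unfolding turn_def using 0 sub[of t] t x by (intro exI[of _ t] exI[of _ x] exI[of _ y]) auto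
  with nt show False ..
 qed
qed

text \<open>The time in \<open>turn\<close> may lie after a return to the axis; then
  \<open>hsol_return\<close> supplies an earlier crossing, on the first excursion.\<close>

lemma turn_first:
 assumes tn: "turn F \<eta>" and 0: "\<eta> < 0" "F 0 = 0"
 obtains T x y where "T > 0" "hsol F {0..T} x y" "x 0 = 0" "y 0 = \<eta>" "y T > F (x T)"
  "!!t. 0 < t ==> t <= T ==> x t > 0"
proof -
 obtain T x y where T: "T >= 0" and h: "hsol F {0..T} x y" and x: "x 0 = 0" "y 0 = \<eta>" "x T > 0" "y T > F (x T)"
  using tn unfolding turn_def by blast
 have "T > 0" using T x by (cases "T = 0") auto
 show ?thesis
 proof (cases "\<exists>t. 0 < t & t <= T & x t <= 0")
  case True
  then obtain t where t: "0 < t" "t <= T" "x t <= 0" by blast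
  obtain z \<xi> where z: "0 < z" "z <= t" "x z = 0" "!!s. 0 < s ==> s < z ==> x s > 0"
   "0 < \<xi>" "\<xi> < z" "y \<xi> > F (x \<xi>)" using hsol_return[OF h x(1,2) 0 t] by blast
  have "hsol F {0..\<xi>} x y" using hsol_subset[OF h] z t by auto
  then show ?thesis using that[of \<xi> x y] z x by auto
 next
  case False
  then show ?thesis using that[OF \<open>T > 0\<close> h x(1,2,4)] by force
 qed
qed

text \<open>Bounds on the speed F x - y exclude blow-up in finite time; these are the a priori
  bounds that \<open>hsol_global\<close> asks for.\<close>

lemma hsol_growth:
 assumes h: "hsol F {0..s} x y" and s: "s >= 0"
  and x: "!!t. 0 < t ==> t < s ==> 0 <= x t" and M: "!!t. 0 < t ==> t < s ==> F (x t) - y t <= M"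
 shows "x s <= x 0 + M * s" "y s >= y 0" "M >= 0 ==> y s <= y 0 + (x 0 + M * s) * s"
proof -
 note c = hsol_continuous[OF h] and d = hsol_at_interval[OF h]
 show "x s <= x 0 + M * s" using increment_le[OF s c(1) d(1) M] by simp
 show "y s >= y 0" using increment_ge[OF s c(2) d(2) x] by simp
 assume M0: "M >= 0"
 have "x t <= x 0 + M * s" if t: "0 < t" "t < s" for t
 proof -
  have "x t <= x 0 + M * (t - 0)"
   by (rule increment_le[OF _ _ d(1) M]) (use t in \<open>auto intro: continuous_on_subset[OF c(1)]\<close>)
  also have "\<dots> <= x 0 + M * s" using t M0 by (simp add: mult_left_mono)
  finally show ?thesis .
 qed
 then show "y s <= y 0 + (x 0 + M * s) * s" using increment_le[OF s c(2) d(2)] by simp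
qed

section \<open>Orbits compared with a separatrix\<close>

text \<open>The graph of \<open>ys\<close> is itself an orbit, so the height above it solves a
  homogeneous linear equation. For x > 0 the coefficient is positive: orbits are pushed off the
  separatrix.\<close>

lemma gap_derivative:
 assumes s: "sepg F ys" and h: "hsol F {0..T} x y" and t: "0 < t" "t < T" "x t > 0"
 shows "((%t. y t - ys (x t)) has_real_derivative x t / (F (x t) - ys (x t)) * (y t - ys (x t))) (at t)"
proof -
 have D: "(ys has_real_derivative x t / (F (x t) - ys (x t))) (at (x t))" and u: "F (x t) - ys (x t) > 0"
  using s t unfolding sepg_def by auto
 have "((%t. y t - ys (x t)) has_real_derivative x t - x t / (F (x t) - ys (x t)) * (F (x t) - y t)) (at t)"
  by (rule DERIV_diff[OF hsol_at_interval(2)[OF h t(1,2)] DERIV_chain2[OF D hsol_at_interval(1)[OF h t(1,2)]]])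
 moreover have "x t - x t / (F (x t) - ys (x t)) * (F (x t) - y t) = x t / (F (x t) - ys (x t)) * (y t - ys (x t))"
  using u by (simp add: field_simps)
 ultimately show ?thesis by simp
qed

lemma gap_continuous:
 assumes s: "sepg F ys" and h: "hsol F S x y" and x: "!!t. t \<in> S ==> x t >= 0"
 shows "continuous_on S (%t. y t - ys (x t))"
proof -
 have "continuous_on {0..} ys" using s by (simp add: sepg_def)
 then show ?thesis
  by (intro continuous_on_diff hsol_continuous(2)[OF h] continuous_on_compose2[OF _ hsol_continuous(1)[OF h]])
    (use x in auto)
qed

lemma gap_sgn:
 assumes s: "sepg F ys" and F: "continuous_on UNIV F" and h: "hsol F {0..T} x y" and T: "T >= 0"
  and x: "!!t. t \<in> {0..T} ==> x t >= 0" "!!t. 0 < t ==> t < T ==> x t > 0"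
 shows "sgn (y T - ys (x T)) = sgn (y 0 - ys (x 0))"
proof -
 have yc: "continuous_on {0..} ys" and u: "!!x. x >= 0 ==> ys x < F x" using s by (auto simp: sepg_def)
 have "continuous_on {0..T} (%t. x t / (F (x t) - ys (x t)))"
  using x(1) u by (intro continuous_intros hsol_continuous(1)[OF h] continuous_on_compose2[OF F hsol_continuous(1)[OF h]]
   continuous_on_compose2[OF yc hsol_continuous(1)[OF h]]) force+
 then have "bounded ((%t. x t / (F (x t) - ys (x t))) ` {0..T})"
  using compact_continuous_image compact_imp_bounded by blast
 then obtain K where K: "\<forall>z\<in>(%t. x t / (F (x t) - ys (x t))) ` {0..T}. norm z <= K" unfolding bounded_iff by blast
 show ?thesis
 proof (rule linear_ode_sgn[OF T gap_continuous[OF s h x(1)] gap_derivative[OF s h]])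
  show "\<bar>x t / (F (x t) - ys (x t))\<bar> <= K" if "0 < t" "t < T" for t using K that by auto
 qed (use x in auto)
qed

lemma sepg_bound_pos:
 assumes "sepg F ys"
 obtains U where "U > 0" "!!x. x >= 0 ==> F x - ys x <= U"
proof -
 obtain U where "\<forall>x\<ge>0. F x - ys x <= U" and "ys 0 < F 0" using assms unfolding sepg_def by auto
 then show ?thesis using that[of U] by force
qed

text \<open>Without a crossing the gap y - ys x would stay in (0, U], because y <= F x. But its
  growth rate x / (F x - ys x) is at least x 1 / U after time 1, so the gap grows at least
  linearly.\<close>

lemma sep_above_turn:
 assumes s: "sepg (quart a b c d) ys" and \<eta>: "ys 0 < \<eta>" "\<eta> < 0"
 shows "turn (quart a b c d) \<eta>"
proof (rule ccontr)
 define F where "F = quart a b c d"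
 have F0: "F 0 = 0" and Fc: "continuous_on UNIV F"
  unfolding F_def by (simp, intro continuous_intros)
 assume nt: "\<not> turn (quart a b c d) \<eta>"
 note nt = nt[folded F_def] and s = s[folded F_def]
 obtain U where U: "U > 0" "!!x. x >= 0 ==> F x - ys x <= U" using sepg_bound_pos[OF s] by blast
 have key: "x t >= 0 & y t > ys (x t) & F (x t) - y t <= U"
  if h: "hsol F {0..T} x y" and 0: "x 0 = 0" "y 0 = \<eta>" and t: "0 <= t" "t <= T" for T x y t
 proof -
  have x: "x r > 0" if "0 < r" "r <= t" for r using nonturn_pos(1)[OF nt h 0 \<eta>(2) F0] that t by auto
  have "sgn (y t - ys (x t)) = sgn (y 0 - ys (x 0))"
  proof (rule gap_sgn[OF s Fc _ t(1)])
   show "x r >= 0" if "r \<in> {0..t}" for r using x[of r] 0 that by (cases "r = 0") auto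
  qed (use hsol_subset[OF h] t x in auto)
  then have "y t > ys (x t)" using \<eta> 0 by (simp add: sgn_if split: if_splits)
  moreover have "x t >= 0" using x[of t] t 0 by (cases "t = 0") auto
  ultimately show ?thesis using U(2)[of "x t"] by auto
 qed
 obtain x y where xy: "x 0 = 0" "y 0 = \<eta>" "hsol F {0..} x y"
 proof (rule hsol_global[of 0 \<eta> a b c d, folded F_def])
  fix T :: real assume T: "T >= 0"
  show "\<exists>C. \<forall>s x y. 0 <= s & s <= T & x 0 = 0 & y 0 = \<eta> & hsol F {0..s} x y --> \<bar>x s\<bar> <= C & \<bar>y s\<bar> <= C"
  proof (intro exI[of _ "U * T + (\<bar>\<eta>\<bar> + U * T * T)"] allI impI, elim conjE)
   fix s x y assume s: "0 <= s" "s <= T" and 0: "x 0 = 0" "y 0 = \<eta>" and h: "hsol F {0..s} x y"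
   have "x s >= 0" using key[OF h 0] s by auto
   moreover have "x s <= 0 + U * s" "y s >= \<eta>" "y s <= \<eta> + (0 + U * s) * s"
    using hsol_growth[OF h s(1), of U] key[OF h 0] U(1) 0 by auto
   moreover have "U * s <= U * T" "U * s * s <= U * T * T" using s U(1) by (auto intro!: mult_mono)
   moreover have "U * T >= 0" "U * T * T >= 0" using U T by auto
   ultimately show "\<bar>x s\<bar> <= U * T + (\<bar>\<eta>\<bar> + U * T * T) & \<bar>y s\<bar> <= U * T + (\<bar>\<eta>\<bar> + U * T * T)"
    using \<eta>(2) by (auto simp: abs_le_iff)
  qed
 qed (use that in blast)
 have h: "hsol F {0..T} x y" for T using hsol_subset[OF xy(3)] by auto
 have pos: "x t > 0" "y t <= F (x t)" if "t > 0" for t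
  using nonturn_pos[OF nt h[of t] xy(1,2) \<eta>(2) F0] that by auto
 define g where "g = (%t. y t - ys (x t))"
 have g: "0 < g t" "g t <= U" if "t > 0" for t
  using key[OF h[of t] xy(1,2), of t] that pos[OF that] U(2)[of "x t"] by (auto simp: g_def)
 have xm: "x t >= x 1" if "t >= 1" for t
  using increment_ge[OF that _ hsol_at_interval(1)[OF h[of "t + 1"]], of 0] pos that
    continuous_on_subset[OF hsol_continuous(1)[OF xy(3)], of "{1..t}"] by auto
 have gd: "(g has_real_derivative x t / (F (x t) - ys (x t)) * g t) (at t)" if "t > 0" for t
  unfolding g_def using gap_derivative[OF s h[of "t + 1"]] pos that by auto
 have gc: "continuous_on {1..t} g" for t
  by (rule DERIV_continuous_on[of _ _ "%t. x t / (F (x t) - ys (x t)) * g t"])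
    (use gd in \<open>auto intro: has_field_derivative_at_within\<close>)
 have k: "x t / (F (x t) - ys (x t)) >= x 1 / U" if "t > 1" for t
 proof -
  have "F (x t) - ys (x t) > 0" "x t >= x 1" using pos[of t] g[of t] xm[of t] that by (auto simp: g_def)
  moreover have "F (x t) - ys (x t) <= U" using U(2)[of "x t"] pos[of t] that by auto
  ultimately show ?thesis using pos(1)[of 1] U(1) by (intro frac_le) auto
 qed
 have gm: "g t >= g 1" if "t >= 1" for t
 proof -
  have "g t >= g 1 + 0 * (t - 1)"
  proof (rule increment_ge[OF that gc gd])
   fix r assume r: "1 < r" "r < t"
   have "0 <= x 1 / U" using pos(1)[of 1] U by simp
   then show "0 <= x r / (F (x r) - ys (x r)) * g r" using k[of r] r g(1)[of r] by (intro mult_nonneg_nonneg) linarith+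
  qed auto
  then show ?thesis by simp
 qed
 \<comment> \<open>A lower bound for the slope of the gap after time 1; waiting U / m longer lifts
   the gap above U.\<close>
 define m where "m = x 1 / U * g 1"
 have m: "m > 0" using pos(1)[of 1] U g(1)[of 1] by (auto simp: m_def)
 have "g (1 + U / m) >= g 1 + m * (1 + U / m - 1)"
 proof (rule increment_ge[OF _ gc gd])
  fix r assume r: "1 < r" "r < 1 + U / m"
  show "m <= x r / (F (x r) - ys (x r)) * g r" unfolding m_def
   using k[of r] gm[of r] r pos(1)[of 1] g(1)[of 1] U(1) divide_pos_pos[of "x 1" U]
   by (intro mult_mono) linarith+
 qed (use m U in auto)
 then show False using g(2)[of "1 + U / m"] g(1)[of 1] m U by (auto simp: add_pos_pos)
qed

lemma sep_below_nonturn: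
 assumes s: "sepg F ys" and F: "continuous_on UNIV F" "F 0 = 0" and \<eta>: "\<eta> <= ys 0"
 shows "\<not> turn F \<eta>"
proof
 assume tn: "turn F \<eta>"
 have \<eta>0: "\<eta> < 0" using s F \<eta> unfolding sepg_def by force
 obtain T x y where T: "T > 0" "hsol F {0..T} x y" "x 0 = 0" "y 0 = \<eta>" "y T > F (x T)"
  "!!t. 0 < t ==> t <= T ==> x t > 0" using turn_first[OF tn \<eta>0 F(2)] by blast
 have "x t >= 0" if "t \<in> {0..T}" for t using T(3) T(6)[of t] that by (cases "t = 0") auto
 then have "sgn (y T - ys (x T)) = sgn (y 0 - ys (x 0))" using gap_sgn[OF s F(1) T(2)] T by auto
 moreover have "ys (x T) < F (x T)" using s T(6)[of T] T(1) unfolding sepg_def by simp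
 ultimately show False using T \<eta> by (auto simp: sgn_if split: if_splits)
qed

text \<open>If v = y1 - y2 were positive at x0, the equation v' = x / (u1 u2) * (F2 - F1 + v) would
  make it grow without bound, while y1 < F1 <= F2 forces v <= u2 <= U2. Applied to equal curves this
  is the uniqueness of the separatrix.\<close>

lemma sepg_mono:
 assumes 1: "sepg F1 y1" and 2: "sepg F2 y2" and F: "!!x. x >= 0 ==> F1 x <= F2 x" and x0: "x0 >= 0"
  and Fc: "continuous_on UNIV F1" "continuous_on UNIV F2"
 shows "y1 x0 <= y2 x0"
proof (rule ccontr)
 assume "\<not> y1 x0 <= y2 x0"
 obtain U1 where U1: "U1 > 0" "!!x. x >= 0 ==> F1 x - y1 x <= U1" using sepg_bound_pos[OF 1] by blast
 obtain U2 where U2: "U2 > 0" "!!x. x >= 0 ==> F2 x - y2 x <= U2" using sepg_bound_pos[OF 2] by blast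
 define u1 u2 v where "u1 = (%x. F1 x - y1 x)" and "u2 = (%x. F2 x - y2 x)" and "v = (%x. y1 x - y2 x)"
 have y: "continuous_on {0..} y1" "continuous_on {0..} y2" using 1 2 by (auto simp: sepg_def)
 have u: "0 < u1 x" "u1 x <= U1" "0 < u2 x" "u2 x <= U2" if "x >= 0" for x
  using 1 2 that U1 U2 by (auto simp: sepg_def u1_def u2_def)
 have vc: "continuous_on {x0..z} v" for z
  unfolding v_def using y x0 by (intro continuous_intros) (auto elim: continuous_on_subset)
 define v' where "v' = (%x. x / (u1 x * u2 x) * ((F2 x - F1 x) + v x))"
 have vd: "(v has_real_derivative v' x) (at x)" if "x > 0" for x
 proof -
  have "(v has_real_derivative (x / (F1 x - y1 x) - x / (F2 x - y2 x))) (at x)"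
   unfolding v_def using 1 2 that by (intro DERIV_diff) (auto simp: sepg_def)
  moreover have "x / (F1 x - y1 x) - x / (F2 x - y2 x) = v' x"
   using u[of x] that unfolding v'_def u1_def u2_def v_def by (simp add: divide_simps) (simp add: algebra_simps)
  ultimately show ?thesis by simp
 qed
 have k0: "x / (u1 x * u2 x) >= 0" if "x >= 0" for x using u[OF that] that by auto
 have vpos: "v z > 0" if z: "z >= x0" for z
 proof -
  have sub: "{x0..z} \<subseteq> {0..}" using x0 by auto
  have "continuous_on {x0..z} u1" "continuous_on {x0..z} u2" unfolding u1_def u2_def
   by (intro continuous_on_diff continuous_on_subset[OF y(1) sub] continuous_on_subset[OF y(2) sub]
     continuous_on_subset[OF Fc(1)] continuous_on_subset[OF Fc(2)] subset_UNIV)+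
  moreover have "u1 x * u2 x \<noteq> 0" if "x \<in> {x0..z}" for x
   using u(1)[of x] u(3)[of x] that x0 by auto
  ultimately have "continuous_on {x0..z} (%x. x / (u1 x * u2 x))" by (intro continuous_intros) auto
  then have "bounded ((%x. x / (u1 x * u2 x)) ` {x0..z})"
   using compact_continuous_image compact_imp_bounded by blast
  then obtain K where K: "\<forall>w\<in>(%x. x / (u1 x * u2 x)) ` {x0..z}. norm w <= K" unfolding bounded_iff by blast
  show ?thesis
  proof (rule gronwall_pos[OF z vc _ vd, where K=K])
   show "0 < v x0" using \<open>\<not> y1 x0 <= y2 x0\<close> by (simp add: v_def)
   fix x assume x: "x0 < x" "x < z"
   have "norm (x / (u1 x * u2 x)) <= K" using K x by (intro bspec[OF K] imageI) auto
   then have "x / (u1 x * u2 x) <= K" unfolding real_norm_def by linarith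
   then have "x / (u1 x * u2 x) * \<bar>v x\<bar> <= K * \<bar>v x\<bar>" by (rule mult_right_mono) simp
   moreover have "- (x / (u1 x * u2 x) * \<bar>v x\<bar>) <= v' x" unfolding v'_def minus_mult_right
    using F[of x] k0[of x] x x0 by (intro mult_left_mono) auto
   ultimately show "- K * \<bar>v x\<bar> <= v' x" by simp
  qed (use x0 in auto)
 qed
 have vinc: "v z >= v w" if "w >= x0" "z >= w" for w z
 proof -
  have "v z >= v w + 0 * (z - w)"
  proof (rule increment_ge[OF that(2) _ vd])
   show "continuous_on {w..z} v" using that by (intro continuous_on_subset[OF vc[of z]]) auto
   fix x assume x: "w < x" "x < z"
   have "0 <= (F2 x - F1 x) + v x" using F[of x] vpos[of x] that x x0 by simp
   moreover have "0 <= x / (u1 x * u2 x)" using k0[of x] x that x0 by simp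
   ultimately show "0 <= v' x" unfolding v'_def by (rule mult_nonneg_nonneg[rotated])
  qed (use that x0 in auto)
  then show ?thesis by simp
 qed
 define m where "m = 1 / (U1 * U2) * v x0"
 have m: "m > 0" using vpos[of x0] U1 U2 by (auto simp: m_def)
 \<comment> \<open>Beyond x0 + 1 one has x >= 1, which bounds the coefficient x / (u1 u2) below by 1
   / (U1 U2).\<close>
 have "v (x0 + 1 + U2 / m) >= v (x0 + 1) + m * (x0 + 1 + U2 / m - (x0 + 1))"
 proof (rule increment_ge[OF _ _ vd])
  fix x assume x: "x0 + 1 < x" "x < x0 + 1 + U2 / m"
  have "1 / (U1 * U2) <= x / (u1 x * u2 x)"
   using u[of x] x x0 by (intro frac_le mult_mono) auto
  then show "m <= v' x" unfolding m_def v'_def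
   using vinc[of x0 x] F[of x] x x0 vpos[of x0] k0[of x] by (intro mult_mono) auto
 qed (use m U2 x0 in \<open>auto intro!: continuous_on_subset[OF vc]\<close>)
 then have "v (x0 + 1 + U2 / m) > U2" using m vpos[of "x0 + 1"] x0 by auto
 moreover have "v (x0 + 1 + U2 / m) <= u2 (x0 + 1 + U2 / m)"
  using u(1)[of "x0 + 1 + U2 / m"] F[of "x0 + 1 + U2 / m"] m U2 x0 by (auto simp: v_def u1_def u2_def)
 ultimately show False using u(4)[of "x0 + 1 + U2 / m"] m U2 x0 by (auto simp: add_nonneg_nonneg)
qed

section \<open>Existence of separatrices\<close>

text \<open>Up to a reflection these are the admissible parameters, those for which F grows at least
  quadratically in both directions.\<close>

definition lead :: "real \<Rightarrow> real \<Rightarrow> real \<Rightarrow> bool" where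
 "lead a b c \<longleftrightarrow> a > 0 \<or> (a = 0 & b = 0 & c > 0)"

lemma lead_minus: "lead a b c ==> lead a (- b) c"
 by (auto simp: lead_def)

lemma bounded_below_of_limits:
 fixes f :: "real \<Rightarrow> real"
 assumes c: "continuous_on UNIV f" and 1: "filterlim f at_top at_top" and 2: "filterlim f at_top at_bot"
 obtains m where "!!x. f x >= m"
proof -
 from 1 obtain u where u: "!!x. x >= u ==> f x >= 0"
  unfolding filterlim_at_top eventually_at_top_linorder by meson
 from 2 obtain l where l: "!!x. x <= l ==> f x >= 0"
  unfolding filterlim_at_top eventually_at_bot_linorder by meson
 have "bounded (f ` {l..u})"
  using compact_continuous_image[OF continuous_on_subset[OF c]] compact_imp_bounded by blast
 then obtain B where B: "\<forall>z\<in>f ` {l..u}. norm z <= B" unfolding bounded_iff by blast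
 have "f x >= min 0 (- B)" for x
 proof (cases "x \<in> {l..u}")
  case True then have "\<bar>f x\<bar> <= B" using B by auto
  then show ?thesis by linarith
 next
  case False then have "f x >= 0" using u[of x] l[of x] by auto
  then show ?thesis by linarith
 qed
 then show ?thesis using that by blast
qed

lemma lead_lower:
 assumes "lead a b c"
 obtains k C where "k > 0" "!!x. quart a b c d x >= k * x^2 - C"
proof (cases "a > 0")
 case True
 have "continuous_on UNIV (%x. quart a b c d x - x^2)" by (intro continuous_intros)
 moreover have "filterlim (%x. quart a b c d x - x^2) at_top at_top" "filterlim (%x. quart a b c d x - x^2) at_top at_bot"
  unfolding quart_def using True by real_asymp+
 ultimately obtain m where "!!x. quart a b c d x - x^2 >= m" using bounded_below_of_limits by blast
 then show ?thesis by (intro that[of 1 "- m"]) (auto simp: algebra_simps)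
next
 case False
 then have c: "a = 0" "b = 0" "c > 0" using assms by (auto simp: lead_def)
 have "quart a b c d x >= c / 2 * x^2 - d^2 / (2 * c)" for x
 proof -
  have "quart a b c d x - (c / 2 * x^2 - d^2 / (2 * c)) = (c * x + d)^2 / (2 * c)"
   using c by (simp add: quart_def power2_eq_square field_simps)
  moreover have "(c * x + d)^2 / (2 * c) >= 0" using c by simp
  ultimately show ?thesis by linarith
 qed
 then show ?thesis using that[of "c / 2"] c by auto
qed

text \<open>The constants are uniform in d, the worst case being - D; this uniformity makes escape
  stable under small changes of d.\<close>

lemma lead_slope:
 assumes "lead a b c"
 obtains g0 xB where "g0 > 0" "xB > 0" "!!x d. x >= xB ==> \<bar>d\<bar> <= D ==> quart' a b c d x >= g0 * x"
proof -
 define g0 where "g0 = (if a > 0 then 1 else c)"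
 have g0: "g0 > 0" using assms by (auto simp: lead_def g0_def)
 have "filterlim (%x. quart' a b c (- D) x - g0 * x) at_top at_top"
 proof (cases "a > 0")
  case True then show ?thesis unfolding quart'_def g0_def by simp real_asymp
 next
  case False
  then have c: "a = 0" "b = 0" "c > 0" using assms by (auto simp: lead_def)
  have "filterlim (%x. c * x - D) at_top at_top" using c by real_asymp
  then show ?thesis using c by (simp add: quart'_def g0_def algebra_simps)
 qed
 then have "\<forall>Z. eventually (%x. quart' a b c (- D) x - g0 * x >= Z) at_top" unfolding filterlim_at_top .
 then have "eventually (%x. quart' a b c (- D) x - g0 * x >= 0) at_top" by blast
 then obtain X where X: "!!x. x >= X ==> quart' a b c (- D) x - g0 * x >= 0"
  unfolding eventually_at_top_linorder by blast
 have "quart' a b c d x >= g0 * x" if "x >= max X 1" "\<bar>d\<bar> <= D" for x d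
  using X[of x] that by (simp add: quart'_def)
 then show ?thesis using that[of g0 "max X 1"] g0 by auto
qed

lemma gap_F_derivative:
 assumes h: "hsol (quart a b c d) {0..T} x y" and t: "0 < t" "t < T"
 shows "((%t. quart a b c d (x t) - y t) has_real_derivative
  quart' a b c d (x t) * (quart a b c d (x t) - y t) - x t) (at t)"
 by (auto intro!: derivative_eq_intros hsol_at_interval[OF h t])

lemma gap_F_continuous:
 assumes h: "hsol (quart a b c d) S x y"
 shows "continuous_on S (%t. quart a b c d (x t) - y t)"
 by (intro continuous_intros hsol_continuous[OF h])

text \<open>Once the distance to the curve exceeds \<open>2 / g0\<close>, it grows quadratically in \<open>x\<close>.\<close>

lemma trap:
 assumes h: "hsol (quart a b c d) {0..T} x y" and T: "T >= 0"
  and xB: "xB > 0" and g0: "g0 > 0" and sl: "!!x. x >= xB ==> quart' a b c d x >= g0 * x"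
  and x0: "x 0 >= xB" and u0: "quart a b c d (x 0) - y 0 >= U" and U: "U >= 2 / g0"
 shows "quart a b c d (x T) - y T >= U" "x T >= x 0"
  "quart a b c d (x T) - y T - g0 / 4 * (x T)^2 >= quart a b c d (x 0) - y 0 - g0 / 4 * (x 0)^2"
proof -
 define u where "u = (%t. quart a b c d (x t) - y t)"
 note uc = gap_F_continuous[OF h, folded u_def] and xc = hsol_continuous(1)[OF h]
 have ud: "(u has_real_derivative quart' a b c d (x t) * u t - x t) (at t)"
  and xd: "(x has_real_derivative u t) (at t)" if "0 < t" "t < T" for t
  unfolding u_def using gap_F_derivative[OF h that] hsol_at_interval(1)[OF h that] by auto
 have "U > 0" using U divide_pos_pos[of 2 g0] g0 by linarith
 then have U1: "U / 2 >= 1 / g0" "U / 2 > 0" "U > 0" using U g0 by (auto simp: field_simps)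
 have ux: "x t >= x 0" if "!!s. 0 < s ==> s < t ==> u s > 0" "0 <= t" "t <= T" for t
 proof -
  have "x t >= x 0 + 0 * (t - 0)"
   by (rule increment_ge[OF that(2) _ xd]) (use that in \<open>auto intro: continuous_on_subset[OF xc] simp: less_imp_le\<close>)
  then show ?thesis by simp
 qed
 have u': "quart' a b c d (x t) * u t - x t >= x t * (g0 * u t - 1)" if "x t >= xB" "u t > 0" for t
  using mult_right_mono[OF sl[OF that(1)], of "u t"] that by (simp add: algebra_simps)
 have ui: "u t >= U" if st: "!!s. 0 < s ==> s < t ==> u s > U / 2" and t: "0 <= t" "t <= T" for t
 proof -
  have "u t >= u 0 + 0 * (t - 0)"
  proof (rule increment_ge[OF t(1) _ ud])
   fix s assume s: "0 < s" "s < t"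
   have "x s >= xB" using ux[of s] st s t U1 x0 by (smt (verit))
   moreover have "g0 * u s >= 1" using st[OF s] U1 g0
    by (metis (no_types, opaque_lifting) less_eq_real_def mult.commute order_trans pos_divide_le_eq)
   ultimately show "0 <= quart' a b c d (x s) * u s - x s"
    using u'[of s] st[OF s] U1 xB by (smt (verit) mult_nonneg_nonneg)
  qed (use t in \<open>auto intro: continuous_on_subset[OF uc]\<close>)
  then show ?thesis using u0 by (simp add: u_def)
 qed
 \<comment> \<open>Bootstrap: while u > U / 2 one has g0 * u >= 1, so u is nondecreasing and stays
   at least U; hence the level U / 2 is never reached.\<close>
 have half: "u t > U / 2" if t: "0 <= t" "t <= T" for t
 proof (rule ccontr)
  assume "\<not> u t > U / 2"
  moreover have "continuous_on {0..t} (%s. u s - U / 2)"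
   using t by (intro continuous_intros continuous_on_subset[OF uc]) auto
  moreover have "u 0 - U / 2 > 0" using u0 U1 by (simp add: u_def)
  ultimately obtain z where z: "0 < z" "z <= t" "u z - U / 2 = 0" "!!s. 0 <= s ==> s < z ==> u s - U / 2 > 0"
   using first_zero[of 0 t "%s. u s - U / 2"] t by (metis diff_le_0_iff_le not_less)
  have "u z >= U" by (rule ui) (use z t in auto)
  then show False using z U1 by simp
 qed
 have uU: "u t >= U" if t: "0 <= t" "t <= T" for t by (rule ui) (use half t in auto)
 then show "quart a b c d (x T) - y T >= U" using T by (simp add: u_def)
 have upos: "u t > 0" if "0 <= t" "t <= T" for t using half[OF that] U1 by linarith
 have xx: "x t >= x 0" if t: "0 <= t" "t <= T" for t by (rule ux) (use upos t in auto)
 then show "x T >= x 0" using T by simp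
 \<comment> \<open>With g0 * u >= 2 the rate u' >= x (g0 u - 1) dominates g0 / 2 * x * u, the
   derivative of g0 / 4 * x^2.\<close>
 have "u T - g0 / 4 * (x T)^2 >= u 0 - g0 / 4 * (x 0)^2 + 0 * (T - 0)"
 proof (rule increment_ge[OF T, of "%t. u t - g0 / 4 * (x t)^2" "%t. quart' a b c d (x t) * u t - x t - g0 / 2 * x t * u t"])
  show "continuous_on {0..T} (%t. u t - g0 / 4 * (x t)\<^sup>2)" by (intro continuous_intros uc xc)
  fix t assume t: "0 < t" "t < T"
  show "((%t. u t - g0 / 4 * (x t)\<^sup>2) has_real_derivative quart' a b c d (x t) * u t - x t - g0 / 2 * x t * u t) (at t)"
   using DERIV_diff[OF ud[OF t] DERIV_cmult[OF DERIV_power[OF xd[OF t], of 2], of "g0 / 4"]]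
   by (simp add: field_simps)
  have *: "x t >= xB" "u t >= U" using xx[of t] uU[of t] t x0 by auto
  then have "g0 * u t >= 2" using U g0 by (metis mult.commute order_trans pos_divide_le_eq)
  then have "x t * (g0 * u t - 1) - g0 / 2 * x t * u t >= 0" using * xB
   by (simp add: algebra_simps)
  then show "0 <= quart' a b c d (x t) * u t - x t - g0 / 2 * x t * u t"
   using u'[of t] * U1 by linarith
 qed
 then show "quart a b c d (x T) - y T - g0 / 4 * (x T)^2 >= quart a b c d (x 0) - y 0 - g0 / 4 * (x 0)^2"
  by (simp add: u_def)
qed

text \<open>A nonturning orbit at bounded distance from the curve exists for all time, x increases
  to infinity along it, and eliminating time gives a separatrix. Read contrapositively: a nonturning
  orbit off the separatrix reaches, in finite time and strictly below the curve, a distance U beyond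
  xB.\<close>

lemma sep_of_bounded:
 assumes lead: "lead a b c" and nt: "\<not> turn (quart a b c d) \<eta>" and \<eta>: "\<eta> < 0" and xB: "xB >= 0" and U: "U > 0"
  and bnd: "!!T x y. T >= 0 ==> hsol (quart a b c d) {0..T} x y ==> x 0 = 0 ==> y 0 = \<eta> ==>
   (!!t. t \<in> {0..T} ==> y t < quart a b c d (x t)) ==> x T >= xB ==> quart a b c d (x T) - y T < U"
 shows "sep (quart a b c d) \<eta>"
proof -
 define F where "F = quart a b c d"
 have F0: "F 0 = 0" and Fc: "continuous_on S F" for S
  unfolding F_def by (simp, intro continuous_intros)
 note nt = nt[folded F_def] and bnd = bnd[folded F_def]
 have "bounded (F ` {0..xB})" using compact_continuous_image[OF Fc] compact_imp_bounded by blast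
 then obtain B where B: "\<forall>z\<in>F ` {0..xB}. norm z <= B" unfolding bounded_iff by blast
 define M where "M = max U (B - \<eta>)"
 have M: "M > 0" using U by (simp add: M_def)
 have key: "y t < F (x t) & F (x t) - y t <= M & x t >= 0"
  if h: "hsol F {0..T} x y" and 0: "x 0 = 0" "y 0 = \<eta>" and t: "0 <= t" "t < T" for T x y t
 proof -
  have x: "x r > 0" "y r <= F (x r)" if "0 < r" "r <= T" for r using nonturn_pos[OF nt h 0 \<eta> F0] that by auto
  have u: "y r < F (x r)" if r: "0 <= r" "r < T" for r
  proof (cases "r = 0")
   case False
   show ?thesis
   proof (rule ccontr)
    assume "\<not> y r < F (x r)"
    then have z: "F (x r) - y r = 0" using x[of r] r False by auto
    have D: "((%t. F (x t) - y t) has_real_derivative quart' a b c d (x r) * (F (x r) - y r) - x r) (at r)"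
     using gap_F_derivative[OF h[unfolded F_def]] r False by (simp add: F_def)
    \<comment> \<open>Touching the curve would be a local minimum 0 of the gap, where the derivative
      of the gap is - x < 0.\<close>
    have "quart' a b c d (x r) * (F (x r) - y r) - x r = 0"
    proof (rule DERIV_local_min[OF D])
     show "0 < min r (T - r)" using r False by auto
     show "\<forall>w. \<bar>r - w\<bar> < min r (T - r) --> F (x r) - y r <= F (x w) - y w"
      using x z by (auto simp: abs_less_iff)
    qed
    then show False using z x(1)[of r] r False by auto
   qed
  qed (use 0 \<eta> F0 in auto)
  have xt: "x r >= 0" if "0 <= r" "r <= t" for r using x[of r] t 0 that by (cases "r = 0") auto
  have "y t >= \<eta>"
   using increment_ge[of 0 t y x 0] hsol_at_interval(2)[OF h] t xt 0 hsol_continuous(2)[OF hsol_subset[OF h, of "{0..t}"]]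
   by auto
  moreover have "F (x t) - y t < U" if "x t >= xB"
   by (rule bnd[of t x y]) (use t 0 u that hsol_subset[OF h, of "{0..t}"] in auto)
  moreover have "F (x t) <= B" if "x t < xB"
   using B xt[of t] t that by (auto simp: abs_le_iff)
  ultimately have "F (x t) - y t <= M" unfolding M_def by (cases "x t >= xB") auto
  with u[OF t] xt[of t] t show ?thesis by auto
 qed
 obtain x y where xy: "x 0 = 0" "y 0 = \<eta>" "hsol F {0..} x y"
 proof (rule hsol_global[of 0 \<eta> a b c d, folded F_def])
  fix T :: real assume T: "T >= 0"
  show "\<exists>C. \<forall>s x y. 0 <= s & s <= T & x 0 = 0 & y 0 = \<eta> & hsol F {0..s} x y --> \<bar>x s\<bar> <= C & \<bar>y s\<bar> <= C"
  proof (intro exI[of _ "M * T + (\<bar>\<eta>\<bar> + M * T * T)"] allI impI, elim conjE)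
   fix s x y assume s: "0 <= s" "s <= T" and 0: "x 0 = 0" "y 0 = \<eta>" and h: "hsol F {0..s} x y"
   have "x s >= 0" using nonturn_pos(1)[OF nt h 0 \<eta> F0, of s] s 0 by (cases "s = 0") auto
   moreover have "x s <= 0 + M * s" "y s >= \<eta>" "y s <= \<eta> + (0 + M * s) * s"
    using hsol_growth[OF h s(1), of M] key[OF h 0] M 0 by auto
   moreover have "M * s <= M * T" "M * s * s <= M * T * T" using s M by (auto intro!: mult_mono)
   moreover have "M * T >= 0" "M * T * T >= 0" using M T by auto
   ultimately show "\<bar>x s\<bar> <= M * T + (\<bar>\<eta>\<bar> + M * T * T) & \<bar>y s\<bar> <= M * T + (\<bar>\<eta>\<bar> + M * T * T)"
    using \<eta> by (auto simp: abs_le_iff)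
  qed
 qed (use that in blast)
 have h: "hsol F {0..T} x y" for T using hsol_subset[OF xy(3)] by auto
 have xpos: "x t > 0" if "t > 0" for t using nonturn_pos(1)[OF nt h[of t] xy(1,2) \<eta> F0] that by auto
 have u: "y t < F (x t)" "F (x t) - y t <= M" if "t >= 0" for t
  using key[OF h[of "t + 1"] xy(1,2), of t] that by auto
 have xd: "(x has_real_derivative F (x t) - y t) (at t)" and yd: "(y has_real_derivative x t) (at t)" if "t > 0" for t
  using hsol_at_interval[OF h[of "t + 1"]] that by auto
 note xc = hsol_continuous(1)[OF xy(3)] and yc = hsol_continuous(2)[OF xy(3)]
 have xm: "x t >= x 1" if "t >= 1" for t
  using increment_ge[OF that _ xd, of 0] u that continuous_on_subset[OF xc, of "{1..t}"] by (auto simp: less_imp_le)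
 have ym: "y t >= y 1 + x 1 * (t - 1)" if "t >= 1" for t
  using increment_ge[OF that _ yd, of "x 1"] xm that continuous_on_subset[OF yc, of "{1..t}"] by auto
 have unb: "\<exists>t\<ge>0. x t > R" for R
 proof (rule ccontr)
  assume "\<not> (\<exists>t\<ge>0. x t > R)"
  then have xR: "x t <= R" if "t >= 0" for t using that by force
  have "bounded (F ` {0..R})" using compact_continuous_image[OF Fc] compact_imp_bounded by blast
  then obtain B where B: "\<forall>z\<in>F ` {0..R}. norm z <= B" unfolding bounded_iff by blast
  \<comment> \<open>By this time y, which grows with slope at least x 1, has passed the bound B of F
    on {0..R}, against y < F x.\<close>
  define t where "t = 1 + (\<bar>B\<bar> + \<bar>y 1\<bar>) / x 1"
  have t: "t >= 1" using xpos[of 1] by (simp add: t_def)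
  have "F (x t) <= B" using B xR[of t] xpos[of t] t by (auto simp: abs_le_iff)
  moreover have "y t >= y 1 + (\<bar>B\<bar> + \<bar>y 1\<bar>)" using ym[OF t] xpos[of 1] by (simp add: t_def)
  ultimately show False using u(1)[of t] t by linarith
 qed
 have upos: "0 < F (x t) - y t" if "0 < t" for t using u(1)[of t] that by simp
 obtain \<tau> where \<tau>: "continuous_on {x 0..} \<tau>" "!!t. t >= 0 ==> \<tau> (x t) = t"
   "!!s. s >= x 0 ==> \<tau> s >= 0" "!!s. s >= x 0 ==> x (\<tau> s) = s"
   "!!s. s > x 0 ==> \<tau> s > 0 & (\<tau> has_real_derivative inverse (F (x (\<tau> s)) - y (\<tau> s))) (at s)"
  using inverse_on_halfline[OF xc xd upos unb] by blast
 define ys where "ys = (%s. y (\<tau> s))"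
 have "sepg F ys" unfolding sepg_def
 proof (intro conjI allI impI exI[of _ M])
  show "continuous_on {0..} ys" unfolding ys_def
   by (rule continuous_on_compose2[OF yc]) (use \<tau> xy in auto)
  show "ys s < F s" "F s - ys s <= M" if "s >= 0" for s using u[of "\<tau> s"] \<tau>(3,4)[of s] that xy by (auto simp: ys_def)
  show "(ys has_real_derivative s / (F s - ys s)) (at s)" if "s > 0" for s
   using DERIV_chain2[of y _ \<tau>, OF yd] \<tau>(4,5)[of s] that xy by (fastforce simp: ys_def divide_inverse)
 qed
 moreover have "ys 0 = \<eta>" using \<tau>(2)[of 0] xy by (simp add: ys_def)
 ultimately show ?thesis unfolding sep_def F_def[symmetric] by blast
qed

section \<open>Openness of turning and escaping\<close>

lemma quart_near:
 assumes e: "e > 0"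
 obtains \<delta> where "\<delta> > 0" "!!x x' d'. \<bar>x\<bar> <= R ==> \<bar>x' - x\<bar> < \<delta> ==> \<bar>d' - d\<bar> < \<delta> ==>
  \<bar>quart a b c d' x' - quart a b c d x\<bar> < e"
proof -
 define S where "S = {- \<bar>R\<bar> - 1..\<bar>R\<bar> + 1} \<times> {d - 1..d + 1}"
 have "continuous_on S (%p. quart a b c (snd p) (fst p))"
  unfolding quart_def by (intro continuous_intros)
 then have "uniformly_continuous_on S (%p. quart a b c (snd p) (fst p))"
  by (rule compact_uniformly_continuous) (auto simp: S_def intro: compact_Times)
 then obtain \<delta> where \<delta>: "\<delta> > 0" "!!p q. p \<in> S ==> q \<in> S ==> dist q p < \<delta> ==>
   dist (quart a b c (snd q) (fst q)) (quart a b c (snd p) (fst p)) < e"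
  unfolding uniformly_continuous_on_def using e by metis
 show ?thesis
 proof (rule that[of "min 1 (\<delta> / 2)"])
  fix x x' d' assume A: "\<bar>x\<bar> <= R" "\<bar>x' - x\<bar> < min 1 (\<delta> / 2)" "\<bar>d' - d\<bar> < min 1 (\<delta> / 2)"
  have "dist (x', d') (x, d) <= \<bar>x' - x\<bar> + \<bar>d' - d\<bar>"
   using norm_Pair_le[of "x' - x" "d' - d"] by (simp add: dist_norm)
  then have "dist (x', d') (x, d) < \<delta>" using A by simp
  moreover have "(x, d) \<in> S" "(x', d') \<in> S" using A by (auto simp: S_def abs_le_iff abs_less_iff)
  ultimately show "\<bar>quart a b c d' x' - quart a b c d x\<bar> < e"
   using \<delta>(2)[of "(x, d)" "(x', d')"] by (simp add: dist_real_def)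
 qed (use \<delta> in auto)
qed

text \<open>Defined by exclusion, so that turning, separatrix and escape exhaust the negative axis;
  the dynamical content, a distance to the curve above the threshold of \<open>trap\<close>, is
  recovered in \<open>open_esc\<close>.\<close>

definition esc :: "(real \<Rightarrow> real) \<Rightarrow> real \<Rightarrow> bool" where
 "esc F \<eta> \<longleftrightarrow> \<eta> < 0 & \<not> turn F \<eta> & \<not> sep F \<eta>"

lemma sep_neg: "sep F \<eta> ==> F 0 = 0 ==> \<eta> < 0"
 unfolding sep_def sepg_def by force

lemma open_turn:
 assumes tn: "turn (quart a b c d) \<eta>"
 obtains \<delta> where "\<delta> > 0" "!!d' \<eta>'. \<bar>d' - d\<bar> < \<delta> ==> \<bar>\<eta>' - \<eta>\<bar> < \<delta> ==> turn (quart a b c d') \<eta>'"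
proof -
 obtain T x y where T: "T >= 0" and h: "hsol (quart a b c d) {0..T} x y" and 0: "x 0 = 0" "y 0 = \<eta>"
  and x: "x T > 0" "y T > quart a b c d (x T)" using tn unfolding turn_def by blast
 define m where "m = (y T - quart a b c d (x T)) / 2"
 have m: "m > 0" using x by (simp add: m_def)
 obtain \<delta>1 where \<delta>1: "\<delta>1 > 0" "!!x1 x' d'. \<bar>x1\<bar> <= \<bar>x T\<bar> ==> \<bar>x' - x1\<bar> < \<delta>1 ==> \<bar>d' - d\<bar> < \<delta>1 ==>
  \<bar>quart a b c d' x' - quart a b c d x1\<bar> < m" using quart_near[OF m, of "\<bar>x T\<bar>" d a b c] by blast
 define e where "e = min (min \<delta>1 m) (x T)"
 have e: "e > 0" using \<delta>1 m x by (simp add: e_def)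
 obtain \<delta>2 where \<delta>2: "\<delta>2 > 0" and near: "!!d' x0 y0. \<bar>d' - d\<bar> < \<delta>2 ==> \<bar>x0 - x 0\<bar> < \<delta>2 ==> \<bar>y0 - y 0\<bar> < \<delta>2 ==>
    \<exists>x' y'. x' 0 = x0 & y' 0 = y0 & hsol (quart a b c d') {0..T} x' y' &
     (\<forall>t\<in>{0..T}. \<bar>x' t - x t\<bar> < e & \<bar>y' t - y t\<bar> < e)" using hsol_near[OF h T e] by blast
 show ?thesis
 proof (rule that[of "min \<delta>1 \<delta>2"])
  fix d' \<eta>' assume A: "\<bar>d' - d\<bar> < min \<delta>1 \<delta>2" "\<bar>\<eta>' - \<eta>\<bar> < min \<delta>1 \<delta>2"
  obtain x' y' where xy': "x' 0 = 0" "y' 0 = \<eta>'" "hsol (quart a b c d') {0..T} x' y'"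
   "\<forall>t\<in>{0..T}. \<bar>x' t - x t\<bar> < e & \<bar>y' t - y t\<bar> < e"
   using near[of d' 0 \<eta>'] A 0 \<delta>2 by auto
  have B: "\<bar>x' T - x T\<bar> < e" "\<bar>y' T - y T\<bar> < e" using xy'(4) T by auto
  then have "\<bar>quart a b c d' (x' T) - quart a b c d (x T)\<bar> < m" using \<delta>1(2)[of "x T" "x' T" d'] A by (simp add: e_def)
  then have "y' T > quart a b c d' (x' T)" "x' T > 0"
  proof -
   have "e <= m" "e <= x T" unfolding e_def by linarith+
   moreover have "y T - quart a b c d (x T) = 2 * m" by (simp add: m_def)
   moreover assume "\<bar>quart a b c d' (x' T) - quart a b c d (x T)\<bar> < m"
   ultimately show "y' T > quart a b c d' (x' T)" "x' T > 0" using B by linarith+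
  qed
  then show "turn (quart a b c d') \<eta>'" unfolding turn_def using xy' T by blast
 qed (use \<delta>1 \<delta>2 in auto)
qed

text \<open>By \<open>sep_of_bounded\<close> an escaping orbit enters the region of
  \<open>trap\<close> after a finite time, and by continuous dependence so do its neighbours. Inside
  the trap an orbit cannot turn, and it cannot be a separatrix because its distance to the curve is
  unbounded.\<close>

lemma open_esc:
 assumes lead: "lead a b c" and es: "esc (quart a b c d) \<eta>"
 obtains \<delta> where "\<delta> > 0"
  "!!d' \<eta>'. \<bar>d' - d\<bar> < \<delta> ==> \<bar>\<eta>' - \<eta>\<bar> < \<delta> ==> esc (quart a b c d') \<eta>'"
proof -
 obtain g0 xB where g0: "g0 > 0" and xB: "xB > 0"
  and sl: "!!x d'. x >= xB ==> \<bar>d'\<bar> <= \<bar>d\<bar> + 1 ==> quart' a b c d' x >= g0 * x" using lead_slope[OF lead] by metis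
 \<comment> \<open>The threshold of \<open>trap\<close>. The orbit is followed to a distance U + 1
   beyond xB + 1, so that a perturbed orbit still has distance U beyond xB.\<close>
 define U where "U = 2 / g0"
 have U: "U > 0" using g0 by (simp add: U_def)
 have \<eta>: "\<eta> < 0" "\<not> turn (quart a b c d) \<eta>" "\<not> sep (quart a b c d) \<eta>" using es by (auto simp: esc_def)
 obtain T x y where T: "T >= 0" and h: "hsol (quart a b c d) {0..T} x y" and 0: "x 0 = 0" "y 0 = \<eta>"
  and pos: "!!t. t \<in> {0..T} ==> y t < quart a b c d (x t)" and xT: "x T >= xB + 1"
  and uT: "quart a b c d (x T) - y T >= U + 1"
  using sep_of_bounded[OF lead \<eta>(2,1), of "xB + 1" "U + 1"] \<eta>(3) xB U by (smt (verit))
 have "\<exists>t\<in>{0..T}. \<forall>s\<in>{0..T}. quart a b c d (x t) - y t <= quart a b c d (x s) - y s"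
  by (rule continuous_attains_inf[OF compact_Icc _ gap_F_continuous[OF h]]) (use T in auto)
 then obtain t0 where t0: "t0 \<in> {0..T}" "!!s. s \<in> {0..T} ==> quart a b c d (x t0) - y t0 <= quart a b c d (x s) - y s"
  by blast
 \<comment> \<open>Half the smallest gap up to time T, so that nearby orbits stay below their curve
   until then; the cap 1 / 2 keeps the sum of the errors in F and in y within the margin 1.\<close>
 define m where "m = min ((quart a b c d (x t0) - y t0) / 2) (1 / 2)"
 have m: "m > 0" using pos[OF t0(1)] by (simp add: m_def)
 have um: "quart a b c d (x s) - y s >= 2 * m" if "s \<in> {0..T}" for s 
 proof -
  have "m <= (quart a b c d (x t0) - y t0) / 2" unfolding m_def by (rule min.cobounded1)
  then have "2 * m <= quart a b c d (x t0) - y t0" by (simp only: le_divide_eq_numeral1 mult.commute)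
  then show ?thesis using t0(2)[OF that] by (rule order_trans)
 qed
 have "bounded (x ` {0..T})" using compact_continuous_image[OF hsol_continuous(1)[OF h]] compact_imp_bounded by blast
 then obtain R where R: "\<forall>z\<in>x ` {0..T}. norm z <= R" unfolding bounded_iff by blast
 obtain \<delta>1 where \<delta>1: "\<delta>1 > 0" "!!x1 x' d'. \<bar>x1\<bar> <= R ==> \<bar>x' - x1\<bar> < \<delta>1 ==> \<bar>d' - d\<bar> < \<delta>1 ==>
  \<bar>quart a b c d' x' - quart a b c d x1\<bar> < m" using quart_near[OF m, of R d a b c] by blast
 define e where "e = min (min \<delta>1 m) 1"
 have e: "e > 0" using \<delta>1 m by (simp add: e_def)
 obtain \<delta>2 where \<delta>2: "\<delta>2 > 0" and near: "!!d' x0 y0. \<bar>d' - d\<bar> < \<delta>2 ==> \<bar>x0 - x 0\<bar> < \<delta>2 ==> \<bar>y0 - y 0\<bar> < \<delta>2 ==>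
    \<exists>x' y'. x' 0 = x0 & y' 0 = y0 & hsol (quart a b c d') {0..T} x' y' &
     (\<forall>t\<in>{0..T}. \<bar>x' t - x t\<bar> < e & \<bar>y' t - y t\<bar> < e)" using hsol_near[OF h T e] by blast
 define \<delta> where "\<delta> = min (min \<delta>1 \<delta>2) (min 1 (- \<eta>))"
 have \<delta>: "\<delta> > 0" "\<delta> <= \<delta>1" "\<delta> <= \<delta>2" "\<delta> <= 1" "\<delta> <= - \<eta>" using \<delta>1 \<delta>2 \<eta> by (auto simp: \<delta>_def)
 show ?thesis
 proof (rule that[OF \<delta>(1)])
  fix d' \<eta>' assume A: "\<bar>d' - d\<bar> < \<delta>" "\<bar>\<eta>' - \<eta>\<bar> < \<delta>"
  define F where "F = quart a b c d'"
  have F0: "F 0 = 0" and Fc: "continuous_on S F" for S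
   unfolding F_def by (simp, intro continuous_intros)
  have \<eta>'0: "\<eta>' < 0" using A \<delta> by (auto simp: abs_less_iff)
  have sl': "quart' a b c d' x >= g0 * x" if "x >= xB" for x by (rule sl[OF that]) (use A \<delta> in auto)
  obtain x' y' where xy': "x' 0 = 0" "y' 0 = \<eta>'" and h': "hsol F {0..T} x' y'"
   and cl: "!!t. t \<in> {0..T} ==> \<bar>x' t - x t\<bar> < e & \<bar>y' t - y t\<bar> < e"
   using near[of d' 0 \<eta>'] A 0 \<delta> \<delta>2 unfolding F_def by auto
  have qn: "\<bar>F (x' t) - quart a b c d (x t)\<bar> < m" if "t \<in> {0..T}" for t unfolding F_def
   by (rule \<delta>1(2)) (use R that cl[OF that] A \<delta> in \<open>auto simp: e_def\<close>)
  have u': "F (x' t) - y' t > 0" if "t \<in> {0..T}" for t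
   using um[OF that] qn[OF that] cl[OF that] by (auto simp: e_def abs_less_iff)
  have uT': "F (x' T) - y' T >= U" "x' T >= xB"
  proof -
   have T': "T \<in> {0..T}" using T by simp
   have em: "e <= m" "e <= 1" unfolding e_def by linarith+
   have mh: "m <= 1 / 2" unfolding m_def by (rule min.cobounded2)
   have "\<bar>p' - p\<bar> < m ==> \<bar>r' - r\<bar> < e ==> U + 1 <= p - r ==> U <= p' - r'" for p p' r r'
    using em mh by linarith
   from this[OF qn[OF T'] conjunct2[OF cl[OF T']] uT] show "F (x' T) - y' T >= U" .
   show "x' T >= xB" using cl[OF T'] xT em by linarith
  qed
  have x'pos: "x' t > 0" if t: "0 < t" "t <= T" for t
  proof (rule ccontr)
   assume "\<not> x' t > 0"
   then obtain z \<xi> where "0 < z" "z <= t" "x' z = 0" "!!s. 0 < s ==> s < z ==> x' s > 0"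
     "0 < \<xi>" "\<xi> < z" "y' \<xi> > F (x' \<xi>)"
    using hsol_return[OF h' xy' \<eta>'0 F0 t] by (metis not_less)
   with u'[of \<xi>] t show False by auto
  qed
  have nt: "\<not> turn F \<eta>'"
  proof
   assume tn: "turn F \<eta>'"
   obtain S X Y where S: "S > 0" "hsol F {0..S} X Y" "X 0 = 0" "Y 0 = \<eta>'" "Y S > F (X S)"
    "!!t. 0 < t ==> t <= S ==> X t > 0" using turn_first[OF tn \<eta>'0 F0] by metis
   show False
   proof (cases "S <= T")
    case True
    have "X S = x' S & Y S = y' S"
     using hsol_unique[of a b c d' S X Y x' y' S, folded F_def] S xy' True hsol_subset[OF h', of "{0..S}"] by auto
    then show False using u'[of S] S True by auto
   next
    case False
    have "X T = x' T & Y T = y' T"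
     using hsol_unique[of a b c d' T X Y x' y' T, folded F_def] S xy' T False h' hsol_subset[OF S(2), of "{0..T}"] by auto
    then have "F (X (T + (S - T))) - Y (T + (S - T)) >= U"
     using trap(1)[of a b c d' "S - T" "%t. X (T + t)" "%t. Y (T + t)" xB g0 U, folded F_def]
      hsol_shift[OF S(2) T] False xB g0 sl' uT' by (auto simp: U_def)
    then show False using S U by simp
   qed
  qed
  have "\<not> sep F \<eta>'"
  proof
   assume "sep F \<eta>'"
   then obtain ys where ys: "sepg F ys" "ys 0 = \<eta>'" by (auto simp: sep_def)
   have "x' t >= 0" if "t \<in> {0..T}" for t using x'pos[of t] xy' that by (cases "t = 0") auto
   then have "sgn (y' T - ys (x' T)) = sgn (y' 0 - ys (x' 0))"
    using x'pos by (intro gap_sgn[OF ys(1) Fc h' T]) auto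
   then have eq: "y' T = ys (x' T)" using xy' ys by (simp add: sgn_if split: if_splits)
   \<comment> \<open>Along a separatrix the gap as a function of x satisfies u' = F' - x / u. Above
     the threshold it grows with slope at least g0 * x1 / 2, although a separatrix has bounded
     gap.\<close>
   define u where "u = (%x. F x - ys x)"
   define x1 where "x1 = x' T"
   have x1: "x1 >= xB" "u x1 >= U" using uT' eq by (auto simp: x1_def u_def)
   have uc: "continuous_on {x1..z} u" for z unfolding u_def
    using ys x1 xB by (intro continuous_intros Fc) (auto simp: sepg_def elim: continuous_on_subset)
   have ud: "(u has_real_derivative quart' a b c d' x - x / u x) (at x)" if "x > 0" for x
    unfolding u_def F_def using ys that by (intro DERIV_diff DERIV_quart) (auto simp: sepg_def F_def)
   have ui: "u z >= U" if st: "!!s. x1 < s ==> s < z ==> u s > U / 2" and z: "x1 <= z" for z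
   proof -
    have "u z >= u x1 + 0 * (z - x1)"
    proof (rule increment_ge[OF z uc ud])
     fix s assume s: "x1 < s" "s < z"
     have "u s > 0" using st[OF s] U by linarith
     then have "s / u s <= s / (1 / g0)" using st[OF s] g0 s x1 xB by (intro divide_left_mono) (auto simp: U_def)
     then show "0 <= quart' a b c d' s - s / u s" using sl'[of s] s x1 by (simp add: mult.commute)
    qed (use x1 xB in auto)
    then show ?thesis using x1 by simp
   qed
   have half: "u z > U / 2" if z: "x1 <= z" for z
   proof (rule ccontr)
    assume n: "\<not> u z > U / 2"
    obtain w where w: "x1 < w" "w <= z" "u w - U / 2 = 0" "!!s. x1 <= s ==> s < w ==> u s - U / 2 > 0"
     by (rule first_zero[of x1 z "%s. u s - U / 2"])
      (use z n x1 U in \<open>auto intro!: continuous_intros uc\<close>)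
    have "u w >= U" by (rule ui) (use w in auto)
    then show False using w U by simp
   qed
   have uU: "u z >= U" if "x1 <= z" for z by (rule ui[OF half that]) auto
   obtain V where V: "V > 0" "!!x. x >= 0 ==> F x - ys x <= V" using sepg_bound_pos[OF ys(1)] by blast
   \<comment> \<open>Far enough for the gap to gain its whole bound V.\<close>
   define z where "z = x1 + 2 * V / (g0 * x1)"
   have zx: "z >= x1" using V g0 x1 xB by (simp add: z_def)
   have "u z >= u x1 + g0 * x1 / 2 * (z - x1)"
   proof (rule increment_ge[OF zx uc ud])
    fix s assume s: "x1 < s" "s < z"
    have "u s > 0" using uU[of s] s U by linarith
    then have "s / u s <= s / (2 / g0)" using uU[of s] g0 s x1 xB by (intro divide_left_mono) (auto simp: U_def)
    then have "s / u s <= g0 * s / 2" by (simp add: mult.commute)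
    moreover have "g0 * x1 <= g0 * s" using s g0 by simp
    ultimately show "g0 * x1 / 2 <= quart' a b c d' s - s / u s" using sl'[of s] s x1 by linarith
   qed (use x1 xB in auto)
   moreover have "g0 * x1 / 2 * (z - x1) = V" using g0 x1 xB by (simp add: z_def)
   ultimately have "u z >= U + V" using x1 by linarith
   then show False using V(2)[of z] U zx x1 xB by (simp add: u_def)
  qed
  with nt \<eta>'0 show "esc (quart a b c d') \<eta>'" by (simp add: esc_def F_def)
 qed
qed

section \<open>Existence of a separatrix\<close>

text \<open>The parabola w = - K + k x^2 / 4 stays at least 2 / k below the curve. On it an orbit
  has slope x / (F x - y) <= k x / 2, the slope of w, so an orbit starting at - K never rises above
  the parabola.\<close>

lemma nonturn_exists:
 assumes lead: "lead a b c"
 obtains \<eta> where "\<eta> < 0" "\<not> turn (quart a b c d) \<eta>"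
proof -
 define F where "F = quart a b c d"
 obtain k C where k: "k > 0" and low: "!!x. F x >= k * x^2 - C" using lead_lower[OF lead] unfolding F_def by metis
 define K where "K = \<bar>C\<bar> + 2 / k + 1"
 have K: "K > 0" "K >= C + 2 / k" using k by (auto simp: K_def add_nonneg_pos)
 define w where "w = (%x::real. - K + k * x^2 / 4)"
 have wF: "F x - w x >= 2 / k" for x
 proof -
  have "k * x^2 >= 0" using k by simp
  then show ?thesis using low[of x] K by (simp add: w_def)
 qed
 have "\<not> turn F (- K)"
 proof
  assume "turn F (- K)"
  then obtain T x y where T: "T > 0" "hsol F {0..T} x y" "x 0 = 0" "y 0 = - K" "y T > F (x T)"
    "!!t. 0 < t ==> t <= T ==> x t > 0" using turn_first[of F "- K"] K by (auto simp: F_def)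
  note c = hsol_continuous[OF T(2)]
  have "continuous_on {0..T} (%t. k * x t / 2)" using c by (intro continuous_intros) auto
  then have "bounded ((%t. k * x t / 2) ` {0..T})"
   using compact_continuous_image compact_imp_bounded by blast
  then obtain M where M: "\<forall>z\<in>(%t. k * x t / 2) ` {0..T}. norm z <= M" unfolding bounded_iff by blast
  have "y T - w (x T) <= 0"
  proof (rule gronwall_nonpos[of 0 T "%t. y t - w (x t)" "%t. x t - (k * x t / 2) * (F (x t) - y t)" M])
   show "continuous_on {0..T} (%t. y t - w (x t))" unfolding w_def by (intro continuous_intros c) auto
   fix t assume t: "0 < t" "t < T"
   show "((%t. y t - w (x t)) has_real_derivative x t - (k * x t / 2) * (F (x t) - y t)) (at t)"
    unfolding w_def using hsol_at_interval[OF T(2) t] by (auto intro!: derivative_eq_intros)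
   assume g: "0 < y t - w (x t)"
   have x: "x t > 0" using T t by auto
   have "(k * x t / 2) * (2 / k - (y t - w (x t))) <= (k * x t / 2) * (F (x t) - y t)"
    using wF[of "x t"] x k by (intro mult_left_mono) auto
   moreover have "(k * x t / 2) * (2 / k) = x t" using k by simp
   moreover have "norm (k * x t / 2) <= M" using M t by (intro bspec[OF M] imageI) auto
   then have "(k * x t / 2) * (y t - w (x t)) <= M * (y t - w (x t))" using g by (intro mult_right_mono) auto
   ultimately show "x t - (k * x t / 2) * (F (x t) - y t) <= M * (y t - w (x t))"
    by (simp add: right_diff_distrib)
  qed (use T in \<open>auto simp: w_def\<close>)
  moreover have "2 / k > 0" using k by simp
  ultimately show False using wF[of "x T"] T(5) by linarith
 qed
 then show ?thesis using that[of "- K"] K by (simp add: F_def)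
qed

text \<open>Turning and escaping starting points form disjoint open sets, both nonempty. They cannot
  cover the connected half axis, and what is left over are separatrices.\<close>

lemma sep_exists:
 assumes lead: "lead a b c" and tn: "turn (quart a b c d) \<eta>" "\<eta> < 0"
 obtains s where "sep (quart a b c d) s"
proof (rule ccontr)
 assume "\<not> thesis"
 then have ns: "\<not> sep (quart a b c d) s" for s using that by blast
 define A B where "A = {\<eta>. \<eta> < 0 & turn (quart a b c d) \<eta>}" and "B = {\<eta>. esc (quart a b c d) \<eta>}"
 have "open A" unfolding open_dist
 proof
  fix \<zeta> assume "\<zeta> \<in> A"
  then have z: "\<zeta> < 0" "turn (quart a b c d) \<zeta>" by (auto simp: A_def)
  then obtain \<delta> where "\<delta> > 0" "!!d' \<eta>'. \<bar>d' - d\<bar> < \<delta> ==> \<bar>\<eta>' - \<zeta>\<bar> < \<delta> ==> turn (quart a b c d') \<eta>'"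
   using open_turn by blast
  then show "\<exists>e>0. \<forall>y. dist y \<zeta> < e --> y \<in> A"
   using z by (intro exI[of _ "min \<delta> (- \<zeta>)"]) (auto simp: A_def dist_real_def)
 qed
 moreover have "open B" unfolding open_dist
 proof
  fix \<zeta> assume "\<zeta> \<in> B"
  then obtain \<delta> where "\<delta> > 0" "!!d' \<eta>'. \<bar>d' - d\<bar> < \<delta> ==> \<bar>\<eta>' - \<zeta>\<bar> < \<delta> ==> esc (quart a b c d') \<eta>'"
   using open_esc[OF lead, of d \<zeta>] by (auto simp: B_def)
  then show "\<exists>e>0. \<forall>y. dist y \<zeta> < e --> y \<in> B"
   by (intro exI[of _ \<delta>]) (auto simp: B_def dist_real_def)
 qed
 moreover have "{..<0} \<subseteq> A \<union> B" using ns by (auto simp: A_def B_def esc_def)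
 moreover have "A \<inter> B \<inter> {..<0} = {}" by (auto simp: A_def B_def esc_def)
 moreover have "connected {..<0::real}" by simp
 ultimately have "A \<inter> {..<0} = {} \<or> B \<inter> {..<0} = {}" using connectedD by blast
 moreover have "\<eta> \<in> A \<inter> {..<0}" using tn by (auto simp: A_def)
 moreover obtain \<zeta> where "\<zeta> < 0" "\<not> turn (quart a b c d) \<zeta>" using nonturn_exists[OF lead] by blast
 then have "\<zeta> \<in> B \<inter> {..<0}" using ns by (auto simp: B_def esc_def)
 ultimately show False by blast
qed

text \<open>For d <= 0 the origin does not repel to first order: F' x <= K x near 0, so a nonturning
  orbit from a small \<eta> would stay small. But x would never drop below x 1 > 0, and y would grow
  past F.\<close>

lemma turn_near_0:
 assumes lead: "lead a b c" and d: "d <= 0"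
 obtains \<eta> where "\<eta> < 0" "turn (quart a b c d) \<eta>"
proof -
 define F where "F = quart a b c d"
 have F0: "F 0 = 0" and Fc: "continuous_on S F" for S
  unfolding F_def by (simp, intro continuous_intros)
 define K where "K = 4 * \<bar>a\<bar> + 3 * \<bar>b\<bar> + 2 * \<bar>c\<bar> + 1"
 have K: "K >= 1" by (simp add: K_def)
 have q: "quart' a b c d x <= K * x" if x: "0 <= x" "x <= 1" for x
 proof -
  have p: "x^3 <= x" "x^2 <= x" "x^3 >= 0" "x^2 >= 0" using x power_decreasing[of 1 3 x] power_decreasing[of 1 2 x] by auto
  have "a * x^3 <= \<bar>a\<bar> * x" "b * x^2 <= \<bar>b\<bar> * x" "c * x <= \<bar>c\<bar> * x"
   using mult_mono[of a "\<bar>a\<bar>" "x^3" x] mult_mono[of b "\<bar>b\<bar>" "x^2" x] mult_mono[of c "\<bar>c\<bar>" x x] x p by simp_all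
  then show ?thesis using d x by (simp add: quart'_def K_def algebra_simps)
 qed
 \<comment> \<open>Makes F' x * u <= x / 2 as long as u = F x - y is at most 2 |\<eta>|.\<close>
 define \<eta> where "\<eta> = - (1 / (4 * K))"
 have \<eta>: "\<eta> < 0" "\<bar>\<eta>\<bar> <= 1 / 4" "\<bar>\<eta>\<bar> * (4 * K) = 1" using K by (auto simp: \<eta>_def field_simps)
 have "turn F \<eta>"
 proof (rule ccontr)
  assume nt: "\<not> turn F \<eta>"
  have key: "x s <= 1 & y s >= \<eta> & F (x s) - y s <= 1 & x s >= 0"
   if h: "hsol F {0..s} x y" and 0: "x 0 = 0" "y 0 = \<eta>" and s: "0 <= s" for s x y
  proof -
   have pos: "x t >= 0" "F (x t) - y t >= 0" if "t \<in> {0..s}" for t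
    using nonturn_pos[OF nt h 0 \<eta>(1) F0, of t] that 0 \<eta> F0 by (cases "t = 0"; force)+
   \<comment> \<open>With u = F x - y the weight 1 / 2 leaves W' = u (2 F' u - x), which is
     nonpositive once F' u <= x / 2.\<close>
   define W where "W = (%t. (F (x t) - y t)^2 + (x t)^2 / 2)"
   have Wc: "continuous_on {0..s} W" unfolding W_def
    by (intro continuous_on_add continuous_on_power continuous_on_divide continuous_on_const
      gap_F_continuous[OF h[unfolded F_def], folded F_def] hsol_continuous(1)[OF h]) auto
   have W0: "W 0 = \<eta>^2" using 0 F0 by (simp add: W_def)
   have \<eta>2: "\<eta>^2 > 0" using \<eta> by simp
   have small: "x t <= 2 * \<bar>\<eta>\<bar>" "F (x t) - y t <= 2 * \<bar>\<eta>\<bar>" if "W t < 2 * \<eta>^2" "t \<in> {0..s}" for t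
   proof -
    have "(x t)^2 <= (2 * \<bar>\<eta>\<bar>)^2" "(F (x t) - y t)^2 <= (2 * \<bar>\<eta>\<bar>)^2"
    proof -
     have "(2 * \<bar>\<eta>\<bar>)^2 = 4 * \<eta>^2" by (simp add: power_mult_distrib)
     then show "(x t)^2 <= (2 * \<bar>\<eta>\<bar>)^2" "(F (x t) - y t)^2 <= (2 * \<bar>\<eta>\<bar>)^2"
      using that(1) zero_le_power2[of "F (x t) - y t"] zero_le_power2[of "x t"] \<eta>2
      unfolding W_def by linarith+
    qed
    then show "x t <= 2 * \<bar>\<eta>\<bar>" "F (x t) - y t <= 2 * \<bar>\<eta>\<bar>" by (auto intro: power2_le_imp_le)
   qed
   have Ws: "W t < 2 * \<eta>^2" if t: "t \<in> {0..s}" for t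
   proof (rule ccontr)
    assume n: "\<not> W t < 2 * \<eta>^2"
    have "continuous_on {0..t} (%r. 2 * \<eta>^2 - W r)" using t by (intro continuous_intros continuous_on_subset[OF Wc]) auto
    then obtain z where z: "0 < z" "z <= t" "2 * \<eta>^2 - W z = 0" "!!r. 0 <= r ==> r < z ==> 2 * \<eta>^2 - W r > 0"
     using first_zero[of 0 t "%r. 2 * \<eta>^2 - W r"] t W0 n \<eta>2 by (smt (verit) atLeastAtMost_iff)
    have "W z <= W 0 + 0 * (z - 0)"
    proof (rule increment_le[of 0 z W "%r. 2 * (F (x r) - y r) * (quart' a b c d (x r) * (F (x r) - y r) - x r) + x r * (F (x r) - y r)"])
     fix r assume r: "0 < r" "r < z"
     then have rs: "r \<in> {0..s}" "0 < r" "r < s" using z t by auto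
     have D: "((%t. F (x t) - y t) has_real_derivative quart' a b c d (x r) * (F (x r) - y r) - x r) (at r)"
      using gap_F_derivative[OF h[unfolded F_def] rs(2,3)] by (simp add: F_def)
     show "(W has_real_derivative 2 * (F (x r) - y r) * (quart' a b c d (x r) * (F (x r) - y r) - x r) + x r * (F (x r) - y r)) (at r)"
      unfolding W_def
      by (rule DERIV_cong[OF DERIV_add[OF DERIV_power[OF D, of 2]
        DERIV_cdivide[OF DERIV_power[OF hsol_at_interval(1)[OF h rs(2,3)], of 2], of 2]]])
       (simp add: field_simps)
     have b: "x r <= 2 * \<bar>\<eta>\<bar>" "F (x r) - y r <= 2 * \<bar>\<eta>\<bar>" using small[of r] z(4)[of r] r rs by auto
     define u where "u = F (x r) - y r"
     have u: "u >= 0" "u <= 2 * \<bar>\<eta>\<bar>" "x r >= 0" "x r <= 1" using pos[OF rs(1)] b \<eta> by (auto simp: u_def)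
     have "2 * u * (quart' a b c d (x r) * u - x r) + x r * u = u * (2 * (quart' a b c d (x r) * u) - x r)"
      by (simp add: algebra_simps)
     moreover have "quart' a b c d (x r) * u <= (K * x r) * (2 * \<bar>\<eta>\<bar>)"
      using q[OF u(3,4)] u K by (intro order_trans[OF mult_right_mono[OF q[OF u(3,4)] u(1)]] mult_left_mono) auto
     moreover have "(K * x r) * (2 * \<bar>\<eta>\<bar>) = x r / 2"
     proof -
      have "(K * x r) * (2 * \<bar>\<eta>\<bar>) = x r * (\<bar>\<eta>\<bar> * (4 * K)) / 2" by (simp add: algebra_simps)
      then show ?thesis using \<eta>(3) by simp
     qed
     ultimately have "2 * u * (quart' a b c d (x r) * u - x r) + x r * u <= 0"
      using u by (simp add: mult_nonneg_nonpos)
     then show "2 * (F (x r) - y r) * (quart' a b c d (x r) * (F (x r) - y r) - x r) + x r * (F (x r) - y r) <= 0"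
      by (simp add: u_def)
    qed (use z t in \<open>auto intro: continuous_on_subset[OF Wc]\<close>)
    then show False using z W0 \<eta>2 by simp
   qed
   have "y s >= y 0" using increment_ge[OF s hsol_continuous(2)[OF h] hsol_at_interval(2)[OF h], of 0] pos(1) by auto
   then show ?thesis using small[OF Ws[of s]] s \<eta> pos[of s] 0 by auto
  qed
  have "bounded (F ` {0..1})" using compact_continuous_image[OF Fc] compact_imp_bounded by blast
  then obtain B where B: "\<forall>z\<in>F ` {0..1}. norm z <= B" unfolding bounded_iff by blast
  have yB: "y s <= B"  if h: "hsol F {0..s} x y" and 0: "x 0 = 0" "y 0 = \<eta>" and s: "0 < s" for s x y
   using nonturn_pos(2)[OF nt h 0 \<eta>(1) F0, of s] key[OF h 0] s bspec[OF B, of "F (x s)"] by (auto simp: abs_le_iff)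
  obtain x y where xy: "x 0 = 0" "y 0 = \<eta>" "hsol F {0..} x y"
  proof (rule hsol_global[of 0 \<eta> a b c d, folded F_def])
   fix T :: real assume "T >= 0"
   show "\<exists>C. \<forall>s x y. 0 <= s & s <= T & x 0 = 0 & y 0 = \<eta> & hsol F {0..s} x y --> \<bar>x s\<bar> <= C & \<bar>y s\<bar> <= C"
   proof (intro exI[of _ "1 + \<bar>B\<bar>"] allI impI, elim conjE)
    fix s x y assume s: "0 <= s" and 0: "x 0 = 0" "y 0 = \<eta>" and h: "hsol F {0..s} x y"
    have "y s <= \<bar>B\<bar>" using yB[OF h 0] s 0 \<eta> by (cases "s = 0") auto
    then show "\<bar>x s\<bar> <= 1 + \<bar>B\<bar> & \<bar>y s\<bar> <= 1 + \<bar>B\<bar>" using key[OF h 0 s] \<eta> by (auto simp: abs_le_iff)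
   qed
  qed (use that in blast)
  have h: "hsol F {0..T} x y" for T using hsol_subset[OF xy(3)] by auto
  have xpos: "x t > 0" "F (x t) - y t >= 0" if "t > 0" for t
   using nonturn_pos[OF nt h[of t] xy(1,2) \<eta>(1) F0, of t] that by auto
  have xd: "(x has_real_derivative F (x t) - y t) (at t)" and yd: "(y has_real_derivative x t) (at t)" if "t > 0" for t
   using hsol_at_interval[OF h[of "t + 1"]] that by auto
  note xc = hsol_continuous(1)[OF xy(3)] and yc = hsol_continuous(2)[OF xy(3)]
  have xm: "x t >= x 1" if "t >= 1" for t
   using increment_ge[OF that _ xd, of 0] xpos that continuous_on_subset[OF xc, of "{1..t}"] by auto
  define t where "t = 1 + (\<bar>B\<bar> + \<bar>y 1\<bar> + 1) / x 1"
  have t: "t >= 1" using xpos[of 1] by (simp add: t_def)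
  have "y t >= y 1 + x 1 * (t - 1)"
   using increment_ge[OF t _ yd, of "x 1"] xm continuous_on_subset[OF yc, of "{1..t}"] by auto
  then have "y t >= y 1 + (\<bar>B\<bar> + \<bar>y 1\<bar> + 1)" using xpos[of 1] by (simp add: t_def)
  then show False using yB[OF h[of t] xy(1,2)] t by auto
 qed
 then show ?thesis using that \<eta>(1) by (simp add: F_def)
qed

section \<open>Dependence of the separatrix on the curve\<close>

lemma sep_unique:
 assumes "sep (quart a b c d) s" "sep (quart a b c d) s'"
 shows "s = s'"
proof -
 have c: "continuous_on UNIV (quart a b c d)" by (intro continuous_intros)
 obtain y1 y2 where y: "sepg (quart a b c d) y1" "y1 0 = s" "sepg (quart a b c d) y2" "y2 0 = s'"
  using assms by (auto simp: sep_def)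
 show ?thesis using sepg_mono[OF y(1,3) _ _ c c, of 0] sepg_mono[OF y(3,1) _ _ c c, of 0] y by auto
qed

lemma sep_mono:
 assumes "sep (quart a b c d) s" "sep (quart a' b' c' d') s'"
  and "!!x. x >= 0 ==> quart a b c d x <= quart a' b' c' d' x"
 shows "s <= s'"
proof -
 have c: "continuous_on UNIV (quart a b c d)" "continuous_on UNIV (quart a' b' c' d')" by (intro continuous_intros)+
 obtain y1 y2 where y: "sepg (quart a b c d) y1" "y1 0 = s" "sepg (quart a' b' c' d') y2" "y2 0 = s'"
  using assms(1,2) by (auto simp: sep_def)
 show ?thesis using sepg_mono[OF y(1,3) assms(3) _ c, of 0] y by auto
qed

text \<open>If the starting points agreed, monotonicity from one side and Gronwall from the other
  would make the graphs coincide on {0..1}; but equal graphs would have the different slopes x / (F1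
  x - y) and x / (F2 x - y).\<close>

lemma sep_strict_mono:
 assumes s: "sep (quart a b c d) s" "sep (quart a' b' c' d') s'"
  and le: "!!x. x >= 0 ==> quart a b c d x <= quart a' b' c' d' x"
  and less: "!!x. x > 0 ==> quart a b c d x < quart a' b' c' d' x"
 shows "s < s'"
proof (rule ccontr)
 assume "\<not> s < s'"
 then have eq: "s = s'" using sep_mono[OF s le] by simp
 define F1 F2 where "F1 = quart a b c d" and "F2 = quart a' b' c' d'"
 have Fc: "continuous_on S F1" "continuous_on S F2" for S
  unfolding F1_def F2_def by (intro continuous_intros)+
 obtain y1 y2 where y: "sepg F1 y1" "y1 0 = s" "sepg F2 y2" "y2 0 = s"
  using s eq by (auto simp: sep_def F1_def F2_def)
 have m: "y1 x <= y2 x" if "x >= 0" for x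
  using sepg_mono[OF y(1,3) _ that Fc] le by (simp add: F1_def F2_def)
 have yc: "continuous_on {0..} y1" "continuous_on {0..} y2" using y by (auto simp: sepg_def)
 define u1 u2 v where "u1 = (%x. F1 x - y1 x)" and "u2 = (%x. F2 x - y2 x)" and "v = (%x. y2 x - y1 x)"
 have u: "u1 x > 0" "u2 x > 0" if "x >= 0" for x using y that by (auto simp: sepg_def u1_def u2_def)
 have sub: "{0..1::real} \<subseteq> {0..}" by auto
 have c: "continuous_on {0..1} u1" "continuous_on {0..1} u2" "continuous_on {0..1} v"
  unfolding u1_def u2_def v_def by (intro continuous_on_diff Fc continuous_on_subset[OF yc(1) sub] continuous_on_subset[OF yc(2) sub])+
 have vd: "(v has_real_derivative x / u2 x - x / u1 x) (at x)" if "x > 0" for x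
  unfolding v_def u1_def u2_def using y that by (intro DERIV_diff) (auto simp: sepg_def)
 have v': "x / u2 x - x / u1 x = x / (u1 x * u2 x) * (v x - (F2 x - F1 x))" if "x > 0" for x
  using u[of x] that unfolding u1_def u2_def v_def by (simp add: divide_simps) (simp add: algebra_simps)
 have "continuous_on {0..1} (%x. x / (u1 x * u2 x))" using u c by (intro continuous_intros) force+
 then have "bounded ((%x. x / (u1 x * u2 x)) ` {0..1})"
  using compact_continuous_image compact_imp_bounded by blast
 then obtain K where K: "\<forall>w\<in>(%x. x / (u1 x * u2 x)) ` {0..1}. norm w <= K" unfolding bounded_iff by blast
 have k: "x / (u1 x * u2 x) <= K" "x / (u1 x * u2 x) > 0" if "0 < x" "x <= 1" for x
 proof -
  have "norm (x / (u1 x * u2 x)) <= K" using that by (intro bspec[OF K] imageI) auto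
  then show "x / (u1 x * u2 x) <= K" unfolding real_norm_def by linarith
  show "x / (u1 x * u2 x) > 0" using u[of x] that by simp
 qed
 have v0: "v x = 0" if x: "0 <= x" "x <= 1" for x
 proof -
  have "v x <= 0"
  proof (rule gronwall_nonpos[OF x(1) _ _ vd, where K=K])
   fix t assume t: "0 < t" "t < x" "v t > 0"
   have t1: "t <= 1" using t x by simp
   have "t / (u1 t * u2 t) * (v t - (F2 t - F1 t)) <= t / (u1 t * u2 t) * v t"
    using k(2)[OF t(1) t1] less[OF t(1)] by (intro mult_left_mono) (auto simp: F1_def F2_def)
   also have "\<dots> <= K * v t" using k(1)[OF t(1) t1] t by (intro mult_right_mono) auto
   finally show "t / u2 t - t / u1 t <= K * v t" using v'[OF t(1)] by simp
  next
   show "continuous_on {0..x} v" using x by (intro continuous_on_subset[OF c(3)]) auto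
   show "v 0 <= 0" using y by (simp add: v_def)
  qed
  with m[OF x(1)] show ?thesis by (simp add: v_def)
 qed
 have "(v has_real_derivative 0) (at (1/2))"
 proof (rule DERIV_cong_ev[THEN iffD2])
  show "((%x. 0::real) has_real_derivative 0) (at (1/2))" by simp
  show "\<forall>\<^sub>F x in nhds (1 / 2). v x = 0"
   using eventually_nhds_in_open[of "{0<..<1::real}" "1/2"] v0 by (auto elim!: eventually_mono)
 qed auto
 then have "(1/2) / u2 (1/2) - (1/2) / u1 (1/2) = 0" using vd[of "1/2"] DERIV_unique by fastforce
 then show False using v'[of "1/2"] k(2)[of "1/2"] v0[of "1/2"] less[of "1/2"] by (auto simp: F1_def F2_def)
qed

lemma esc_less_turn:
 assumes lead: "lead a b c" and "turn (quart a b c d) \<eta>'" "\<eta>' < 0" "esc (quart a b c d) \<eta>"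
 shows "\<eta> < \<eta>'"
proof (rule ccontr)
 assume n: "\<not> \<eta> < \<eta>'"
 have c: "continuous_on UNIV (quart a b c d)" by (intro continuous_intros)
 obtain s ys where s: "sepg (quart a b c d) ys" "ys 0 = s"
  using sep_exists[OF lead assms(2,3)] unfolding sep_def by metis
 have "\<not> \<eta>' <= s" using sep_below_nonturn[of "quart a b c d" ys \<eta>'] s c assms(2) by auto
 then have "turn (quart a b c d) \<eta>" using sep_above_turn[OF s(1), of \<eta>] n s(2) assms(4) by (auto simp: esc_def)
 with assms(4) show False by (auto simp: esc_def)
qed

section \<open>The coefficient d for which the separatrices meet\<close>

text \<open>The second conjunct is the half plane x <= 0 after the reflection x \<mapsto> - x,
  whence the signs of b and d.\<close>

definition loop_param :: "real \<Rightarrow> real \<Rightarrow> real \<Rightarrow> real \<Rightarrow> real \<Rightarrow> bool" where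
 "loop_param a b c d s \<longleftrightarrow> sep (quart a b c d) s & sep (quart a (- b) c (- d)) s"

text \<open>\<open>turn_near_0\<close> guarantees a separatrix only for a nonpositive linear
  coefficient, so the two starting points cannot be compared as functions of d. Instead the
  comparison is expressed by a point \<eta> at which one side turns and the other escapes, an open
  condition in d, and connectedness of {- M..0} gives a value of d at which neither comparison is
  strict.\<close>

lemma loop_param_exists_pos:
 assumes lead: "lead a b c" and b: "b >= 0"
 shows "\<exists>d s. loop_param a b c d s"
proof (rule ccontr)
 assume no: "\<nexists>d s. loop_param a b c d s"
 define R L where "R = (%d. quart a b c d)" and "L = (%d. quart a (- b) c (- d))"
 have c: "continuous_on UNIV (R d)" "continuous_on UNIV (L d)" for d
  unfolding R_def L_def by (intro continuous_intros)+
 have z: "R d 0 = 0" "L d 0 = 0" for d by (simp_all add: R_def L_def)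
 note lead' = lead_minus[OF lead]
 have no': "\<not> (sep (R d) s & sep (L d) s)" for d s using no by (auto simp: loop_param_def R_def L_def)
 have sepR: "\<exists>s. sep (R d) s" if "d <= 0" for d
  using turn_near_0[OF lead that] sep_exists[OF lead] unfolding R_def by metis
 have below: "\<eta> < 0 & esc (R d) \<eta>" if s: "sep (R d) s" "\<eta> < s" for d s \<eta>
 proof -
  obtain ys where "sepg (R d) ys" "ys 0 = s" using s(1) by (auto simp: sep_def)
  then have "\<not> turn (R d) \<eta>" using sep_below_nonturn[of "R d" ys \<eta>] c z s by auto
  moreover have "\<not> sep (R d) \<eta>" using s sep_unique[of a b c d s \<eta>] by (auto simp: R_def)
  ultimately show ?thesis using sep_neg[of "R d" s] z s by (auto simp: esc_def)
 qed
 have above: "turn (R d) \<eta>" if "sep (R d) s" "\<eta> > s" "\<eta> < 0" for d s \<eta>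
  using that sep_above_turn unfolding sep_def R_def by blast
 have aboveL: "turn (L d) \<eta>" if "sep (L d) s" "\<eta> > s" "\<eta> < 0" for d s \<eta>
  using that sep_above_turn unfolding sep_def L_def by blast
 \<comment> \<open>In \<open>U1\<close> the right separatrix starts below the left one, in
   \<open>U2\<close> above it; a missing separatrix, for which no orbit turns, behaves like the
   starting value 0.\<close>
 define U1 U2 where "U1 = {d. \<exists>\<eta><0. turn (R d) \<eta> & esc (L d) \<eta>}" and "U2 = {d. \<exists>\<eta><0. esc (R d) \<eta> & turn (L d) \<eta>}"
 have openU: "open U1" "open U2"
  unfolding open_dist
 proof safe
  fix d assume "d \<in> U1"
  then obtain \<eta> where \<eta>: "\<eta> < 0" "turn (R d) \<eta>" "esc (L d) \<eta>" by (auto simp: U1_def)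
  obtain \<delta>1 where 1: "\<delta>1 > 0" "!!d' \<eta>'. \<bar>d' - d\<bar> < \<delta>1 ==> \<bar>\<eta>' - \<eta>\<bar> < \<delta>1 ==> turn (R d') \<eta>'"
   using open_turn[OF \<eta>(2)[unfolded R_def]] unfolding R_def by metis
  obtain \<delta>2 where 2: "\<delta>2 > 0" "!!d' \<eta>'. \<bar>d' - - d\<bar> < \<delta>2 ==> \<bar>\<eta>' - \<eta>\<bar> < \<delta>2 ==> esc (quart a (- b) c d') \<eta>'"
   using open_esc[OF lead' \<eta>(3)[unfolded L_def]] by metis
  show "\<exists>e>0. \<forall>y. dist y d < e --> y \<in> U1"
  proof (intro exI[of _ "min \<delta>1 \<delta>2"] conjI allI impI)
   fix y assume "dist y d < min \<delta>1 \<delta>2"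
   then have "turn (R y) \<eta>" "esc (L y) \<eta>" unfolding L_def using 1 2 by (auto simp: dist_real_def abs_minus_commute)
   then show "y \<in> U1" using \<eta> by (auto simp: U1_def)
  qed (use 1 2 in auto)
 next
  fix d assume "d \<in> U2"
  then obtain \<eta> where \<eta>: "\<eta> < 0" "esc (R d) \<eta>" "turn (L d) \<eta>" by (auto simp: U2_def)
  obtain \<delta>1 where 1: "\<delta>1 > 0" "!!d' \<eta>'. \<bar>d' - d\<bar> < \<delta>1 ==> \<bar>\<eta>' - \<eta>\<bar> < \<delta>1 ==> esc (R d') \<eta>'"
   using open_esc[OF lead \<eta>(2)[unfolded R_def]] unfolding R_def by metis
  obtain \<delta>2 where 2: "\<delta>2 > 0" "!!d' \<eta>'. \<bar>d' - - d\<bar> < \<delta>2 ==> \<bar>\<eta>' - \<eta>\<bar> < \<delta>2 ==> turn (quart a (- b) c d') \<eta>'"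
   using open_turn[OF \<eta>(3)[unfolded L_def]] by metis
  show "\<exists>e>0. \<forall>y. dist y d < e --> y \<in> U2"
  proof (intro exI[of _ "min \<delta>1 \<delta>2"] conjI allI impI)
   fix y assume "dist y d < min \<delta>1 \<delta>2"
   then have "esc (R y) \<eta>" "turn (L y) \<eta>" unfolding L_def using 1 2 by (auto simp: dist_real_def abs_minus_commute)
   then show "y \<in> U2" using \<eta> by (auto simp: U2_def)
  qed (use 1 2 in auto)
 qed
 have cover: "d \<in> U1 \<union> U2" and cover_turn: "!!s. sep (R d) s ==> turn (L d) s ==> d \<in> U2" if d: "d <= 0" for d
 proof -
  show U2: "d \<in> U2" if s: "sep (R d) s" "turn (L d) s" for s
  proof -
   obtain \<delta> where \<delta>: "\<delta> > 0" "!!d' \<eta>'. \<bar>d' - - d\<bar> < \<delta> ==> \<bar>\<eta>' - s\<bar> < \<delta> ==> turn (quart a (- b) c d') \<eta>'"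
    using open_turn[OF s(2)[unfolded L_def]] by metis
   have "turn (L d) (s - \<delta> / 2)" unfolding L_def by (rule \<delta>(2)) (use \<delta> in auto)
   moreover have "s - \<delta> / 2 < 0 & esc (R d) (s - \<delta> / 2)" by (rule below[OF s(1)]) (use \<delta> in auto)
   ultimately show ?thesis unfolding U2_def by blast
  qed
  obtain s where s: "sep (R d) s" using sepR[OF d] by blast
  then have s0: "s < 0" using sep_neg[of "R d" s] z by auto
  show "d \<in> U1 \<union> U2"
  proof (cases "turn (L d) s")
   case True then show ?thesis using U2 s by blast
  next
   case False
   then have "esc (L d) s" using no' s s0 by (auto simp: esc_def)
   then obtain \<delta> where \<delta>: "\<delta> > 0" "!!d' \<eta>'. \<bar>d' - - d\<bar> < \<delta> ==> \<bar>\<eta>' - s\<bar> < \<delta> ==> esc (quart a (- b) c d') \<eta>'"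
    using open_esc[OF lead', of "- d" s] unfolding L_def by metis
   define \<eta> where "\<eta> = s + min (\<delta> / 2) (- s / 2)"
   have \<eta>: "s < \<eta>" "\<eta> < 0" "\<bar>\<eta> - s\<bar> < \<delta>" using \<delta> s0 by (auto simp: \<eta>_def min_def)
   have "esc (L d) \<eta>" unfolding L_def by (rule \<delta>(2)) (use \<delta> \<eta> in auto)
   then show ?thesis using above[OF s \<eta>(1,2)] \<eta> by (auto simp: U1_def)
  qed
 qed
 have disj: "U1 \<inter> U2 = {}"
 proof safe
  fix d assume "d \<in> U1" "d \<in> U2"
  then obtain \<eta> \<eta>' where "\<eta> < 0" "turn (R d) \<eta>" "esc (L d) \<eta>" "\<eta>' < 0" "esc (R d) \<eta>'" "turn (L d) \<eta>'"
   by (auto simp: U1_def U2_def)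
  then show "d \<in> {}" using esc_less_turn[OF lead, of d \<eta> \<eta>'] esc_less_turn[OF lead', of "- d" \<eta>' \<eta>]
   by (auto simp: R_def L_def)
 qed
 obtain s0 where s0: "sep (L 0) s0"
  using turn_near_0[OF lead', of "- 0"] sep_exists[OF lead', of "- 0"] unfolding L_def by (metis minus_zero order_refl)
 have "0 \<in> U2"
 proof -
  obtain s where s: "sep (R 0) s" using sepR by blast
  have "s0 <= s" by (rule sep_mono[OF s0[unfolded L_def] s[unfolded R_def]]) (use b in \<open>auto simp: quart_def\<close>)
  then have "s0 < s" using no'[of 0 s] s s0 by (auto simp: less_le)
  then have "turn (L 0) s" using aboveL[OF s0] sep_neg[of "R 0" s] s z by auto
  then show ?thesis using cover_turn s by blast
 qed
 define \<eta> where "\<eta> = s0 - 1"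
 \<comment> \<open>Large enough that the right curve at x = 1 lies below \<eta>. A separatrix
   increases and stays below its curve, so the right one starts below \<eta>, while the left curve
   has only been raised from its position for d = 0.\<close>
 define M where "M = \<bar>a + b + c\<bar> + \<bar>\<eta>\<bar> + 1"
 have s00: "s0 < 0" using sep_neg[of "L 0" s0] s0 z by auto
 have "- M \<in> U1"
 proof -
  have "- M <= 0" unfolding M_def by linarith
  then obtain s where s: "sep (R (- M)) s" using sepR by blast
  then obtain ys where ys: "sepg (R (- M)) ys" "ys 0 = s" by (auto simp: sep_def)
  have "ys 1 >= ys 0 + 0 * (1 - 0)"
   by (rule increment_ge[of 0 1 ys "%x. x / (R (- M) x - ys x)"])
    (use ys in \<open>auto simp: sepg_def less_imp_le intro: continuous_on_subset\<close>)
  moreover have "ys 1 < R (- M) 1" using ys by (auto simp: sepg_def)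
  moreover have "R (- M) 1 < \<eta>" unfolding R_def quart_def M_def by simp
  ultimately have "s < \<eta>" using ys by simp
  then have 1: "turn (R (- M)) \<eta>" using above[OF s] s00 by (simp add: \<eta>_def)
  have le: "L 0 x <= L (- M) x" if "x >= 0" for x using that by (auto simp: L_def quart_def M_def)
  have mono: "s0 <= s''" if "sep (L (- M)) s''" for s''
   using sep_mono[OF s0[unfolded L_def] that[unfolded L_def]] le by (simp add: L_def)
  have "\<not> turn (L (- M)) \<eta>"
  proof
   assume t: "turn (L (- M)) \<eta>"
   then obtain s'' where s'': "sep (L (- M)) s''"
    using sep_exists[OF lead', of "- (- M)" \<eta>] s00 unfolding L_def \<eta>_def by auto
   then obtain ys where ys: "sepg (L (- M)) ys" "ys 0 = s''" by (auto simp: sep_def)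
   have "\<eta> <= ys 0" using mono[OF s''] ys by (simp add: \<eta>_def)
   then show False using sep_below_nonturn[of "L (- M)" ys \<eta>] ys(1) c z t by auto
  qed
  moreover have "\<not> sep (L (- M)) \<eta>" using mono[of \<eta>] by (auto simp: \<eta>_def)
  ultimately have "esc (L (- M)) \<eta>" using s00 by (auto simp: esc_def \<eta>_def)
  moreover have "\<eta> < 0" using s00 by (simp add: \<eta>_def)
  ultimately show ?thesis using 1 unfolding U1_def by blast
 qed
 moreover have "connected {- M..0}" by simp
 moreover have "{- M..0} \<subseteq> U1 \<union> U2"
 proof
  fix d assume "d \<in> {- M..0}"
  then show "d \<in> U1 \<union> U2" by (intro cover) simp
 qed
 moreover have "- M <= 0" unfolding M_def by linarith
 ultimately show False
  using connectedD[of "{- M..0}" U1 U2] openU disj \<open>0 \<in> U2\<close> by (simp add: disjoint_iff) force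
qed

lemma loop_param_reflect: "loop_param a (- b) c (- d) s \<longleftrightarrow> loop_param a b c d s"
 by (auto simp: loop_param_def)

lemma loop_param_exists:
 assumes lead: "lead a b c"
 shows "\<exists>d s. loop_param a b c d s"
proof (cases "b >= 0")
 case False
 then obtain d s where "loop_param a (- b) c d s" using loop_param_exists_pos[OF lead_minus[OF lead]] by auto
 then show ?thesis using loop_param_reflect[of a b c "- d" s] by auto
qed (rule loop_param_exists_pos[OF lead])

lemma loop_param_unique:
 assumes "loop_param a b c d s" "loop_param a b c d' s'"
 shows "d = d'" "s = s'"
proof -
 have False if "loop_param a b c d s" "loop_param a b c d' s'" "d < d'" for d d' s s'
 proof -
  have "s < s'" by (rule sep_strict_mono[of a b c d s a b c d'])
   (use that in \<open>auto simp: loop_param_def quart_def mult_right_mono\<close>)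
  moreover have "s' < s" by (rule sep_strict_mono[of a "- b" c "- d'" s' a "- b" c "- d"])
   (use that in \<open>auto simp: loop_param_def quart_def mult_right_mono\<close>)
  ultimately show False by simp
 qed
 then show "d = d'" using assms by (metis linorder_neqE_linordered_idom)
 then show "s = s'" using assms sep_unique by (auto simp: loop_param_def)
qed

text \<open>For b >= 0 and d >= 0, not both 0, the right curve lies strictly above the reflected
  left one on x > 0, so by strict monotonicity the separatrices cannot start at the same point. The
  other signs follow by reflection.\<close>

lemma loop_param_sign:
 assumes "loop_param a b c d s"
 shows "b > 0 ==> d < 0" "b < 0 ==> d > 0" "b = 0 ==> d = 0"
proof -
 have *: "d < 0" if l: "loop_param a b c d s" and b: "b >= 0" "b > 0 \<or> d \<noteq> 0" for b d
 proof (rule ccontr)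
  assume d: "\<not> d < 0"
  have "s < s"
  proof (rule sep_strict_mono[of a "- b" c "- d" s a b c d])
   show "quart a (- b) c (- d) x < quart a b c d x" if "x > 0" for x
   proof -
    have "b * x^3 + d * x > 0" using that b d by (auto intro: add_pos_nonneg add_nonneg_pos)
    then show ?thesis by (simp add: quart_def)
   qed
   show "quart a (- b) c (- d) x <= quart a b c d x" if "x >= 0" for x
    using that b d by (simp add: quart_def)
  qed (use l in \<open>auto simp: loop_param_def\<close>)
  then show False by simp
 qed
 show "b > 0 ==> d < 0" using *[OF assms] by auto
 show "b < 0 ==> d > 0" using *[of "- b" "- d"] assms loop_param_reflect by auto
 show "b = 0 ==> d = 0" using *[OF assms] *[of "- b" "- d"] assms loop_param_reflect by force
qed

section \<open>The loop as a graph\<close>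

definition loopg :: "(real \<Rightarrow> real) \<Rightarrow> (real \<Rightarrow> real) \<Rightarrow> bool" where
 "loopg F yy \<longleftrightarrow> (\<forall>x. yy x < F x & (yy has_real_derivative x / (F x - yy x)) (at x)) &
   (\<exists>U. \<forall>x. F x - yy x <= U)"

lemma loopg_continuous: "loopg F yy ==> continuous_on S yy"
 unfolding loopg_def by (meson DERIV_continuous continuous_at_imp_continuous_on)

lemma loopg_reflect: "loopg F yy ==> loopg (%x. F (- x)) (%x. yy (- x))"
 unfolding loopg_def
proof (elim conjE exE, intro conjI allI)
 fix x U assume D: "\<forall>x. yy x < F x & (yy has_real_derivative x / (F x - yy x)) (at x)"
 then show "yy (- x) < F (- x)" by blast
 have D': "(yy has_real_derivative (- x) / (F (- x) - yy (- x))) (at (- x))" using D by blast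
 have "((%x. yy (- x)) has_real_derivative ((- x) / (F (- x) - yy (- x))) * (- 1)) (at x)"
  by (rule DERIV_chain2[where f=yy and g=uminus, OF D']) (auto intro!: derivative_eq_intros)
 then show "((%x. yy (- x)) has_real_derivative x / (F (- x) - yy (- x))) (at x)" by simp
qed blast

text \<open>l'Hopital for the difference quotient. It serves where two half graphs meet at x = 0,
  since \<open>sepg\<close> provides derivatives only for x > 0.\<close>

lemma DERIV_of_tendsto:
 fixes f f' :: "real \<Rightarrow> real"
 assumes c: "isCont f a" and d: "!!x. x \<noteq> a ==> (f has_real_derivative f' x) (at x)"
  and l: "(f' \<longlongrightarrow> l) (at a)"
 shows "(f has_real_derivative l) (at a)"
 unfolding has_field_derivative_iff
proof (rule lhopital[where f'=f' and g'="%_. 1"])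
 show "((%x. f x - f a) \<longlongrightarrow> 0) (at a)" using c unfolding isCont_def by (simp add: LIM_zero)
 show "((%x. x - a) \<longlongrightarrow> 0) (at a)" by (rule LIM_zero) simp
 show "\<forall>\<^sub>F x in at a. x - a \<noteq> 0" by (simp add: eventually_at_filter)
 show "\<forall>\<^sub>F x in at a. ((%x. f x - f a) has_real_derivative f' x) (at x)"
 proof -
  have "((%x. f x - f a) has_real_derivative f' x) (at x)" if "x \<noteq> a" for x
   using DERIV_diff[OF d[OF that] DERIV_const[of "f a"]] by simp
  then show ?thesis unfolding eventually_at_filter by (auto intro: always_eventually)
 qed
 show "\<forall>\<^sub>F x in at a. ((%x. x - a) has_real_derivative 1) (at x)"
  by (intro always_eventually allI) (auto intro!: derivative_eq_intros)
qed (use l in auto)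

lemma loopg_of_sepg:
 assumes R: "sepg F yR" and L: "sepg (%x. F (- x)) yL" and 0: "yR 0 = yL 0" and F: "continuous_on UNIV F"
 defines "yy \<equiv> %x. if x >= 0 then yR x else yL (- x)"
 shows "loopg F yy"
proof -
 have lt: "yy x < F x" for x using R L unfolding sepg_def yy_def by (auto dest!: spec[of _ "- x"])
 have c: "continuous_on UNIV yy"
 proof -
  have "continuous_on ({..0} \<union> {0..}) (%x. if x <= 0 then yL (- x) else yR x)"
  proof (rule continuous_on_If)
   show "continuous_on {..0} (%x. yL (- x))"
    by (rule continuous_on_compose2[of "{0..}" yL]) (use L in \<open>auto simp: sepg_def intro!: continuous_intros\<close>)
   show "continuous_on {0..} yR" using R by (simp add: sepg_def)
  qed (use 0 in auto)
  moreover have "{..0} \<union> {0..} = (UNIV :: real set)" by auto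
  moreover have "(%x. if x <= 0 then yL (- x) else yR x) = yy" using 0 by (auto simp: yy_def fun_eq_iff)
  ultimately show ?thesis by (simp only:)
 qed
 have d: "(yy has_real_derivative x / (F x - yy x)) (at x)" if x: "x \<noteq> 0" for x
 proof (cases "x > 0")
  case True
  have "(yR has_real_derivative x / (F x - yy x)) (at x)" using R True by (simp add: sepg_def yy_def)
  then show ?thesis
   by (rule DERIV_cong_ev[THEN iffD1, rotated 3])
     (use True in \<open>auto simp: yy_def intro!: eventually_mono[OF eventually_nhds_in_open[of "{0<..}" x]]\<close>)
 next
  case False
  then have "x < 0" using x by simp
  have D': "(yL has_real_derivative (- x) / (F (- (- x)) - yL (- x))) (at (- x))"
   using L \<open>x < 0\<close> unfolding sepg_def by (metis neg_0_less_iff_less)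
  have "((%x. yL (- x)) has_real_derivative ((- x) / (F (- (- x)) - yL (- x))) * (- 1)) (at x)"
   by (rule DERIV_chain2[where f=yL and g=uminus, OF D']) (auto intro!: derivative_eq_intros)
  then have "((%x. yL (- x)) has_real_derivative x / (F x - yy x)) (at x)" using \<open>x < 0\<close> by (simp add: yy_def)
  then show ?thesis
   by (rule DERIV_cong_ev[THEN iffD1, rotated 3])
     (use \<open>x < 0\<close> in \<open>auto simp: yy_def intro!: eventually_mono[OF eventually_nhds_in_open[of "{..<0}" x]]\<close>)
 qed
 have "(yy has_real_derivative 0 / (F 0 - yy 0)) (at 0)"
 proof (rule DERIV_of_tendsto)
  show "isCont yy 0" using c by (simp add: continuous_on_eq_continuous_at)
  have "isCont (%x. x / (F x - yy x)) 0"
   using c F lt[of 0] by (intro continuous_intros) (auto simp: continuous_on_eq_continuous_at)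
  then show "((%x. x / (F x - yy x)) \<longlongrightarrow> 0 / (F 0 - yy 0)) (at 0)" unfolding isCont_def .
 qed (use d in auto)
 with d have "(yy has_real_derivative x / (F x - yy x)) (at x)" for x by (cases "x = 0") auto
 moreover have "\<exists>U. \<forall>x. F x - yy x <= U"
 proof -
  obtain U1 U2 where "!!x. x >= 0 ==> F x - yR x <= U1" "!!x. x >= 0 ==> F (- x) - yL x <= U2"
   using R L unfolding sepg_def by metis
  then have "F x - yy x <= max U1 U2" for x using \<open>!!x. x >= 0 ==> F (- x) - yL x <= U2\<close>[of "- x"]
   by (auto simp: yy_def le_max_iff_disj)
  then show ?thesis by blast
 qed
 ultimately show ?thesis using lt by (auto simp: loopg_def)
qed

lemma quart_uminus_fun: "(%x. quart a b c d (- x)) = quart a (- b) c (- d)"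
 by (auto simp: quart_minus)

lemma loop_param_loopg:
 assumes "loop_param a b c d s"
 obtains yy where "loopg (quart a b c d) yy" "yy 0 = s"
proof -
 obtain yR yL where R: "sepg (quart a b c d) yR" "yR 0 = s" and L: "sepg (quart a (- b) c (- d)) yL" "yL 0 = s"
  using assms by (auto simp: loop_param_def sep_def)
 show ?thesis
  by (rule that[OF loopg_of_sepg[OF R(1) L(1)[folded quart_uminus_fun]]]) (use R L in \<open>auto intro!: continuous_intros\<close>)
qed

text \<open>The coefficient now carries the sign of x: relative to the loop, orbits move away in x >
  0 and come closer in x < 0. The balance of the two effects is the stability of the loop.\<close>

lemma loop_gap_derivative:
 assumes s: "loopg F yy" and h: "hsol F S x y" and t: "t \<in> interior S"
 shows "((%t. y t - yy (x t)) has_real_derivative x t / (F (x t) - yy (x t)) * (y t - yy (x t))) (at t)"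
proof -
 have D: "(yy has_real_derivative x t / (F (x t) - yy (x t))) (at (x t))" and u: "F (x t) - yy (x t) > 0"
  using s unfolding loopg_def by auto
 have "((%t. y t - yy (x t)) has_real_derivative x t - x t / (F (x t) - yy (x t)) * (F (x t) - y t)) (at t)"
  by (rule DERIV_diff[OF hsol_at(2)[OF h t] DERIV_chain2[OF D hsol_at(1)[OF h t]]])
 moreover have "x t - x t / (F (x t) - yy (x t)) * (F (x t) - y t) = x t / (F (x t) - yy (x t)) * (y t - yy (x t))"
  using u by (simp add: field_simps)
 ultimately show ?thesis by simp
qed

lemma loop_gap_continuous:
 assumes s: "loopg F yy" and h: "hsol F S x y"
 shows "continuous_on S (%t. y t - yy (x t))"
 by (intro continuous_on_diff hsol_continuous(2)[OF h]
   continuous_on_compose2[OF loopg_continuous[OF s, of UNIV] hsol_continuous(1)[OF h]]) auto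

lemma loop_gap_sgn:
 assumes s: "loopg F yy" and F: "continuous_on UNIV F" and h: "hsol F {r..T} x y" and T: "T >= r"
 shows "sgn (y T - yy (x T)) = sgn (y r - yy (x r))"
proof -
 have "F (x t) - yy (x t) \<noteq> 0" for t using s by (metis loopg_def diff_gt_0_iff_gt less_irrefl)
 then have "continuous_on {r..T} (%t. x t / (F (x t) - yy (x t)))"
  by (intro continuous_on_divide continuous_on_diff hsol_continuous(1)[OF h] continuous_on_compose2[OF F hsol_continuous(1)[OF h]]
   continuous_on_compose2[OF loopg_continuous[OF s, of UNIV] hsol_continuous(1)[OF h]]) auto
 then have "bounded ((%t. x t / (F (x t) - yy (x t))) ` {r..T})"
  using compact_continuous_image compact_imp_bounded by blast
 then obtain K where K: "\<forall>z\<in>(%t. x t / (F (x t) - yy (x t))) ` {r..T}. norm z <= K" unfolding bounded_iff by blast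
 show ?thesis
 proof (rule linear_ode_sgn[OF T loop_gap_continuous[OF s h] loop_gap_derivative[OF s h]])
  show "\<bar>x t / (F (x t) - yy (x t))\<bar> <= K" if "r < t" "t < T" for t using K that by auto
 qed (auto simp: interior_atLeastAtMost_real)
qed

lemma loopg_bound_pos:
 assumes "loopg F yy"
 obtains U where "U > 0" "!!x. F x - yy x <= U"
proof -
 obtain U where U: "\<forall>x. F x - yy x <= U" and "yy 0 < F 0" using assms unfolding loopg_def by auto
 then have "U > 0" using spec[OF U, of 0] by linarith
 then show ?thesis using that[of U] U by blast
qed

lemma loopg_quadratic:
 assumes lead: "lead a b c" and l: "loopg (quart a b c d) yy"
 obtains k C where "k > 0" "!!x. yy x >= k * x^2 - C" "!!x. \<bar>x\<bar> <= yy x + C"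
proof -
 obtain k C where k: "k > 0" "!!x. quart a b c d x >= k * x^2 - C" using lead_lower[OF lead] by metis
 obtain U where U: "U > 0" "!!x. quart a b c d x - yy x <= U" using loopg_bound_pos[OF l] by metis
 have 1: "yy x >= k * x^2 - (C + U)" for x using k(2)[of x] U(2)[of x] by linarith
 have 2: "\<bar>x\<bar> <= k * x^2 + 1 / (4 * k)" for x
 proof -
  have "k * x^2 + 1 / (4 * k) - \<bar>x\<bar> = (2 * k * \<bar>x\<bar> - 1)^2 / (4 * k)"
   using k(1) by (simp add: power2_eq_square field_simps)
  moreover have "(2 * k * \<bar>x\<bar> - 1)^2 / (4 * k) >= 0" using k(1) by simp
  ultimately show ?thesis by linarith
 qed
 have k4: "1 / (4 * k) > 0" using k by simp
 show ?thesis
 proof (rule that[of k "C + U + 1 / (4 * k)"])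
  show "yy x >= k * x\<^sup>2 - (C + U + 1 / (4 * k))" "\<bar>x\<bar> <= yy x + (C + U + 1 / (4 * k))" for x
   using 1[of x] 2[of x] k4 by linarith+
 qed (use k in auto)
qed

text \<open>The loop is a barrier, and above it |x| <= y + C because yy grows quadratically. So y' =
  x <= y + C, and y grows at most exponentially.\<close>

lemma loop_global:
 assumes lead: "lead a b c" and l: "loopg (quart a b c d) yy" and y0: "y0 >= yy x0"
 obtains x y where "x 0 = x0" "y 0 = y0" "hsol (quart a b c d) {0..} x y"
proof -
 define F where "F = quart a b c d"
 have Fc: "continuous_on UNIV F" unfolding F_def by (intro continuous_intros)
 note l = l[folded F_def]
 obtain k C where C: "!!x. \<bar>x\<bar> <= yy x + C" using loopg_quadratic[OF lead l[unfolded F_def]] by metis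
 show ?thesis
 proof (rule hsol_global[of x0 y0 a b c d, folded F_def])
  fix T :: real assume T: "T >= 0"
  define B where "B = \<bar>y0 + C\<bar> * exp T + \<bar>C\<bar>"
  show "\<exists>B. \<forall>s x y. 0 <= s & s <= T & x 0 = x0 & y 0 = y0 & hsol F {0..s} x y --> \<bar>x s\<bar> <= B & \<bar>y s\<bar> <= B"
  proof (intro exI[of _ B] allI impI, elim conjE)
   fix s x y assume s: "0 <= s" "s <= T" and 0: "x 0 = x0" "y 0 = y0" and h: "hsol F {0..s} x y"
   have ge: "y t >= yy (x t)" if t: "0 <= t" "t <= s" for t
   proof -
    have "sgn (y t - yy (x t)) = sgn (y 0 - yy (x 0))"
     by (rule loop_gap_sgn[OF l Fc hsol_subset[OF h]]) (use t in auto)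
    then show ?thesis using y0 0 by (auto simp: sgn_if split: if_splits)
   qed
   have xh: "\<bar>x t\<bar> <= y t + C" if "0 <= t" "t <= s" for t using C[of "x t"] ge[OF that] by linarith
   have "(y s + C) * exp (- s) <= (y 0 + C) * exp (- 0) + 0 * (s - 0)"
   proof (rule increment_le[OF s(1), of "%t. (y t + C) * exp (- t)" "%t. (x t - (y t + C)) * exp (- t)"])
    show "continuous_on {0..s} (%t. (y t + C) * exp (- t))" by (intro continuous_intros hsol_continuous(2)[OF h])
    fix t assume t: "0 < t" "t < s"
    show "((%t. (y t + C) * exp (- t)) has_real_derivative (x t - (y t + C)) * exp (- t)) (at t)"
     using hsol_at_interval(2)[OF h t] by (auto intro!: derivative_eq_intros simp: algebra_simps)
    show "(x t - (y t + C)) * exp (- t) <= 0" using xh[of t] t by (simp add: mult_le_0_iff abs_le_iff)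
   qed
   then have "y s + C <= (y0 + C) * exp s" using 0 by (simp add: exp_minus field_simps)
   also have "\<dots> <= \<bar>y0 + C\<bar> * exp T" using s by (intro mult_mono) auto
   finally have "y s + C <= \<bar>y0 + C\<bar> * exp T" .
   then show "\<bar>x s\<bar> <= B & \<bar>y s\<bar> <= B" using xh[of s] s unfolding B_def by linarith
  qed
 qed (use that in \<open>auto simp: F_def\<close>)
qed

lemma inverse_on_line:
 fixes f f' :: "real \<Rightarrow> real"
 assumes d: "!!t. (f has_real_derivative f' t) (at t)" and pos: "!!t. f' t > 0"
  and up: "!!R. \<exists>t. f t > R" and down: "!!R. \<exists>t. f t < R"
 obtains g where "!!s. f (g s) = s" "!!t. g (f t) = t" "!!s. (g has_real_derivative inverse (f' (g s))) (at s)"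
proof -
 have mono: "f u < f v" if "u < v" for u v
  by (rule DERIV_pos_imp_increasing[OF that]) (use d pos in blast)
 have inj: "inj f" by (intro linorder_inj_onI') (use mono in \<open>auto simp: less_imp_neq\<close>)
 have gf: "inv f (f t) = t" for t using inj by simp
 have c: "continuous_on S f" for S using d by (meson DERIV_continuous continuous_at_imp_continuous_on)
 have "f (inv f s) = s & (inv f has_real_derivative inverse (f' (inv f s))) (at s)" for s
 proof -
  obtain u v where uv: "f u < s" "f v > s" using up down by metis
  then have "u <= v" using mono[of v u] by (cases "u <= v") auto
  obtain h where h: "continuous_on {f u..f v} h" "!!t. t \<in> {u..v} ==> h (f t) = t"
   "!!s. s \<in> {f u..f v} ==> h s \<in> {u..v}" "!!s. s \<in> {f u..f v} ==> f (h s) = s"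
   "!!s. f u < s ==> s < f v ==> u < h s & h s < v & (h has_real_derivative inverse (f' (h s))) (at s)"
   using inverse_on_interval[OF \<open>u <= v\<close> c, of f'] d pos by blast
  have eq: "inv f r = h r" if "r \<in> {f u..f v}" for r using gf[of "h r"] h(4)[OF that] by simp
  have "(h has_real_derivative inverse (f' (inv f s))) (at s)" using h(5)[of s] uv eq[of s] by simp
  then have "(inv f has_real_derivative inverse (f' (inv f s))) (at s)"
   by (rule DERIV_cong_ev[THEN iffD1, rotated 3])
     (use uv eq in \<open>auto intro!: eventually_mono[OF eventually_nhds_in_open[of "{f u<..<f v}" s]]\<close>)
  then show ?thesis using eq[of s] h(4)[of s] uv by auto
 qed
 then show ?thesis using that gf by blast
qed

text \<open>The time along the loop is a primitive of \<open>1 / (F x - yy x)\<close>.\<close>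

lemma loop_orbit:
 assumes l: "loopg F yy" and F: "continuous_on UNIV F"
 obtains x where "hsol F UNIV x (%t. yy (x t))" "range x = UNIV"
  "filterlim x at_top at_top" "filterlim x at_bot at_bot"
proof -
 obtain U where U: "U > 0" "!!x. F x - yy x <= U" using loopg_bound_pos[OF l] by metis
 have u: "F x - yy x > 0" for x using l by (simp add: loopg_def)
 have "\<exists>T. \<forall>x::real. - \<infinity> < ereal x --> ereal x < \<infinity> --> (T has_vector_derivative 1 / (F x - yy x)) (at x)"
 proof (rule einterval_antiderivative)
  fix x
  show "isCont (%x. 1 / (F x - yy x)) x"
   using F loopg_continuous[OF l, of UNIV] u[of x]
   by (intro continuous_intros) (auto simp: continuous_on_eq_continuous_at)
 qed simp
 then obtain T where T: "!!x. (T has_real_derivative 1 / (F x - yy x)) (at x)"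
  by (auto simp: has_real_derivative_iff_has_vector_derivative)
 have k: "1 / (F x - yy x) >= 1 / U" for x using u[of x] U(2)[of x] U(1) by (intro divide_left_mono) auto
 have c: "continuous_on S T" for S using T by (meson DERIV_continuous continuous_at_imp_continuous_on)
 have inc: "T v >= T w + 1 / U * (v - w)" if "w <= v" for v w
  by (rule increment_ge[OF that c T]) (rule k)
 have up: "\<exists>t. T t > R" for R
 proof -
  have "T (U * (\<bar>R\<bar> + \<bar>T 0\<bar> + 1)) >= T 0 + 1 / U * (U * (\<bar>R\<bar> + \<bar>T 0\<bar> + 1) - 0)" by (rule inc) (use U in auto)
  also have "1 / U * (U * (\<bar>R\<bar> + \<bar>T 0\<bar> + 1) - 0) = \<bar>R\<bar> + \<bar>T 0\<bar> + 1" using U by simp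
  finally have "T (U * (\<bar>R\<bar> + \<bar>T 0\<bar> + 1)) > R" by linarith
  then show ?thesis by blast
 qed
 have down: "\<exists>t. T t < R" for R
 proof -
  have "T 0 >= T (- (U * (\<bar>R\<bar> + \<bar>T 0\<bar> + 1))) + 1 / U * (0 - - (U * (\<bar>R\<bar> + \<bar>T 0\<bar> + 1)))" by (rule inc) (use U in auto)
  also have "1 / U * (0 - - (U * (\<bar>R\<bar> + \<bar>T 0\<bar> + 1))) = \<bar>R\<bar> + \<bar>T 0\<bar> + 1" using U by simp
  finally have "T (- (U * (\<bar>R\<bar> + \<bar>T 0\<bar> + 1))) < R" by linarith
  then show ?thesis by blast
 qed
 have pos: "1 / (F x - yy x) > 0" for x using u[of x] by simp
 obtain x where x: "!!s. T (x s) = s" "!!t. x (T t) = t" "!!s. (x has_real_derivative inverse (1 / (F (x s) - yy (x s)))) (at s)"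
  using inverse_on_line[OF T pos up down] by blast
 have xd: "(x has_real_derivative F (x s) - yy (x s)) (at s)" for s using x(3)[of s] by simp
 have yd: "((%t. yy (x t)) has_real_derivative x s) (at s)" for s
 proof -
  have "(yy has_real_derivative x s / (F (x s) - yy (x s))) (at (x s))" using l by (simp add: loopg_def)
  from DERIV_chain2[OF this xd] show ?thesis using u[of "x s"] by simp
 qed
 have mono: "x r < x s" if "r < s" for r s
 proof (rule ccontr)
  assume "\<not> x r < x s"
  then have "T (x r) >= T (x s) + 1 / U * (x r - x s)" by (intro inc) auto
  moreover have "1 / U * (x r - x s) >= 0" using U \<open>\<not> x r < x s\<close> by simp
  ultimately show False using x(1)[of r] x(1)[of s] that by linarith
 qed
 show ?thesis
 proof (rule that)
  show "hsol F UNIV x (%t. yy (x t))" using xd yd by (simp add: hsol_def)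
  show "range x = UNIV" using x(2) by (metis surj_def)
  show "filterlim x at_top at_top" unfolding filterlim_at_top eventually_at_top_linorder
  proof
   fix Z show "\<exists>N. \<forall>n\<ge>N. Z <= x n"
    by (rule exI[of _ "T Z"]) (use mono x(2)[of Z] in \<open>metis less_eq_real_def\<close>)
  qed
  show "filterlim x at_bot at_bot" unfolding filterlim_at_bot eventually_at_bot_linorder
  proof
   fix Z show "\<exists>N. \<forall>n\<le>N. x n <= Z"
    by (rule exI[of _ "T Z"]) (use mono x(2)[of Z] in \<open>metis less_eq_real_def\<close>)
  qed
 qed
qed

section \<open>Homoclinic loops are graphs\<close>

definition hfield :: "real \<Rightarrow> real \<Rightarrow> real \<Rightarrow> real \<Rightarrow> real \<times> real \<Rightarrow> real \<times> real" where
 "hfield a b c d = (%(x, y). (quart a b c d x - y, x))"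

text \<open>\<open>homoclinic_loop\<close> without the requirement that the base point be singular.
  That requirement involves the degree of the field and is settled separately.\<close>

definition loop_orbit_at ::
  "(real \<times> real \<Rightarrow> real \<times> real) \<Rightarrow> real \<times> real \<times> real \<Rightarrow> (real \<times> real) set \<Rightarrow> bool" where
 "loop_orbit_at X p \<Gamma> \<longleftrightarrow> p \<in> equator &
   (\<exists>(\<alpha>::ereal) (\<omega>::ereal) \<gamma>. \<alpha> < \<omega> &
    (\<forall>t\<in>einterval \<alpha> \<omega>. (\<gamma> has_vector_derivative X (\<gamma> t)) (at t)) &
    \<Gamma> = \<gamma> ` einterval \<alpha> \<omega> &
    ((%s. poincare (\<gamma> (real_of_ereal s))) \<longlongrightarrow> p) (at_right \<alpha>) &
    ((%s. poincare (\<gamma> (real_of_ereal s))) \<longlongrightarrow> p) (at_left \<omega>))"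

lemma homoclinic_loop_iff:
 "homoclinic_loop n X p \<Gamma> \<longleftrightarrow> singular_at_infinity n X p & loop_orbit_at X p \<Gamma>"
 unfolding homoclinic_loop_def loop_orbit_at_def singular_at_infinity_def by blast

lemma poincare_Pair:
 "poincare (x, y) = (x / sqrt (1 + x^2 + y^2), y / sqrt (1 + x^2 + y^2), 1 / sqrt (1 + x^2 + y^2))"
 by (simp add: poincare_def)

text \<open>Dividing by Y inside the root shows Y / \<Delta> \<rightarrow> 1; the other two
  coordinates are Y / \<Delta> times factors that tend to 0.\<close>

lemma poincare_tendsto_top:
 assumes Y: "filterlim Y at_top G" and XY: "((%s. X s / Y s) \<longlongrightarrow> 0) G"
 shows "((%s. poincare (X s, Y s)) \<longlongrightarrow> (0, 1, 0)) G"
proof -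
 define \<Delta> where "\<Delta> = (%s. sqrt (1 + (X s)^2 + (Y s)^2))"
 have iY: "((%s. 1 / Y s) \<longlongrightarrow> 0) G"
  using tendsto_inverse_0_at_top[OF Y] by (simp add: inverse_eq_divide)
 have "((%s. 1 / sqrt ((1 / Y s)^2 + (X s / Y s)^2 + 1)) \<longlongrightarrow> 1 / sqrt (0^2 + 0^2 + 1)) G"
  by (intro tendsto_intros iY XY) auto
 moreover have "eventually (%s. 1 / sqrt ((1 / Y s)^2 + (X s / Y s)^2 + 1) = Y s / \<Delta> s) G"
 proof -
  have "eventually (%s. Y s > 0) G" using Y by (simp add: filterlim_at_top_dense)
  then show ?thesis
  proof (rule eventually_mono)
   fix s assume s: "Y s > 0"
   have "(1 / Y s)^2 + (X s / Y s)^2 + 1 = (1 + (X s)^2 + (Y s)^2) / (Y s)^2"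
    using s by (simp add: power_divide field_simps)
   then have "sqrt ((1 / Y s)^2 + (X s / Y s)^2 + 1) = \<Delta> s / Y s"
    using s by (simp add: real_sqrt_divide \<Delta>_def)
   then show "1 / sqrt ((1 / Y s)^2 + (X s / Y s)^2 + 1) = Y s / \<Delta> s" by simp
  qed
 qed
 ultimately have v: "((%s. Y s / \<Delta> s) \<longlongrightarrow> 1) G" by (simp add: tendsto_cong)
 have Y0: "eventually (%s. Y s > 0) G" using Y by (simp add: filterlim_at_top_dense)
 have a: "((%s. X s / Y s * (Y s / \<Delta> s)) \<longlongrightarrow> 0 * 1) G" "((%s. 1 / Y s * (Y s / \<Delta> s)) \<longlongrightarrow> 0 * 1) G"
  by (intro tendsto_mult XY v iY)+
 have e: "eventually (%s. X s / Y s * (Y s / \<Delta> s) = X s / \<Delta> s) G"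
  "eventually (%s. 1 / Y s * (Y s / \<Delta> s) = 1 / \<Delta> s) G"
  using Y0 by (auto elim!: eventually_mono)
 have "((%s. X s / \<Delta> s) \<longlongrightarrow> 0) G" "((%s. 1 / \<Delta> s) \<longlongrightarrow> 0) G"
  using Lim_transform_eventually[OF a(1) e(1)] Lim_transform_eventually[OF a(2) e(2)] by simp_all
 then show ?thesis unfolding poincare_Pair \<Delta>_def[symmetric] using v by (intro tendsto_Pair) (auto simp: \<Delta>_def)
qed

lemma hfield_has_vector_derivative:
 "((%t. (x t, y t)) has_vector_derivative hfield a b c d (x t, y t)) (at t within S) \<longleftrightarrow>
  (x has_real_derivative quart a b c d (x t) - y t) (at t within S) &
  (y has_real_derivative x t) (at t within S)" (is "?L \<longleftrightarrow> ?R")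
proof
 assume L: ?L
 show ?R using bounded_linear.has_vector_derivative[OF bounded_linear_fst L]
   bounded_linear.has_vector_derivative[OF bounded_linear_snd L]
  by (simp add: hfield_def has_real_derivative_iff_has_vector_derivative)
next
 assume ?R then show ?L unfolding hfield_def has_real_derivative_iff_has_vector_derivative
  by (auto intro!: has_vector_derivative_Pair)
qed

lemma loopg_poincare_limits:
 assumes lead: "lead a b c" and l: "loopg (quart a b c d) yy"
 shows "((%x. poincare (x, yy x)) \<longlongrightarrow> (0, 1, 0)) at_top" "((%x. poincare (x, yy x)) \<longlongrightarrow> (0, 1, 0)) at_bot"
proof -
 obtain k C where k: "k > 0" "!!x. yy x >= k * x^2 - C" using loopg_quadratic[OF lead l] by metis
 have t: "filterlim (%x. k * x^2 - C) at_top at_top" "filterlim (%x. k * x^2 - C) at_top at_bot"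
  using k by real_asymp+
 have q: "((%x. \<bar>x\<bar> / (k * x^2 - C)) \<longlongrightarrow> 0) at_top" "((%x. \<bar>x\<bar> / (k * x^2 - C)) \<longlongrightarrow> 0) at_bot"
  using k by real_asymp+
 have "((%x. poincare (x, yy x)) \<longlongrightarrow> (0, 1, 0)) G"
  if t: "filterlim (%x. k * x^2 - C) at_top G" and q: "((%x. \<bar>x\<bar> / (k * x^2 - C)) \<longlongrightarrow> 0) G" for G
 proof (rule poincare_tendsto_top)
  show "filterlim yy at_top G" by (rule filterlim_at_top_mono[OF t]) (use k in auto)
  have "eventually (%x. k * x^2 - C > 0) G" using t unfolding filterlim_at_top_dense by blast
  then have "eventually (%x. norm (x / yy x) <= \<bar>x\<bar> / (k * x^2 - C)) G"
  proof (rule eventually_mono)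
   fix x assume x: "k * x^2 - C > 0"
   then have "yy x > 0" using k(2)[of x] by linarith
   then show "norm (x / yy x) <= \<bar>x\<bar> / (k * x^2 - C)"
    using k(2)[of x] x by (simp add: abs_divide) (intro divide_left_mono, auto)
  qed
  then show "((%x. x / yy x) \<longlongrightarrow> 0) G" by (rule Lim_null_comparison[OF _ q])
 qed
 from this[OF t(1) q(1)] this[OF t(2) q(2)]
 show "((%x. poincare (x, yy x)) \<longlongrightarrow> (0, 1, 0)) at_top" "((%x. poincare (x, yy x)) \<longlongrightarrow> (0, 1, 0)) at_bot" .
qed

lemma loopg_loop_orbit_at:
 assumes lead: "lead a b c" and l: "loopg (quart a b c d) yy"
 shows "loop_orbit_at (hfield a b c d) (0, 1, 0) (range (%x. (x, yy x)))"
proof -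
 obtain x where x: "hsol (quart a b c d) UNIV x (%t. yy (x t))" "range x = UNIV"
  "filterlim x at_top at_top" "filterlim x at_bot at_bot"
  using loop_orbit[OF l continuous_on_quart[OF continuous_on_id]] by blast
 define \<gamma> where "\<gamma> = (%t. (x t, yy (x t)))"
 have u: "einterval (- \<infinity>) \<infinity> = UNIV" by (auto simp: einterval_def)
 show ?thesis unfolding loop_orbit_at_def
 proof (rule conjI, goal_cases)
  case 2
  show ?case
  proof (rule exI[of _ "- \<infinity>"], rule exI[of _ "\<infinity>"], rule exI[of _ \<gamma>], intro conjI)
  show "\<forall>t\<in>einterval (- \<infinity>) \<infinity>. (\<gamma> has_vector_derivative hfield a b c d (\<gamma> t)) (at t)"
   using x(1) hfield_has_vector_derivative[of x "%t. yy (x t)" a b c d _ UNIV]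
   unfolding \<gamma>_def hsol_def by simp
  have "range (%t. (x t, yy (x t))) = (%x. (x, yy x)) ` range x" by (simp add: image_image)
  then show "range (%x. (x, yy x)) = \<gamma> ` einterval (- \<infinity>) \<infinity>" unfolding u \<gamma>_def x(2) by (rule sym)
  show "((%s. poincare (\<gamma> (real_of_ereal s))) \<longlongrightarrow> (0, 1, 0)) (at_right (- \<infinity>))"
   "((%s. poincare (\<gamma> (real_of_ereal s))) \<longlongrightarrow> (0, 1, 0)) (at_left \<infinity>)"
   unfolding at_left_PInf at_right_MInf filterlim_filtermap \<gamma>_def
   using filterlim_compose[OF loopg_poincare_limits(2)[OF lead l] x(4)]
    filterlim_compose[OF loopg_poincare_limits(1)[OF lead l] x(3)] by simp_all
  qed simp
 qed (simp add: equator_def)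
qed

section \<open>Orbits that end on the equator\<close>

text \<open>The time interval of a loop is not known to be the whole line, so its ends are extended
  reals; it is open, so two-sided derivatives make sense everywhere.\<close>

definition horbit :: "(real \<Rightarrow> real) \<Rightarrow> ereal \<Rightarrow> ereal \<Rightarrow> (real \<Rightarrow> real) \<Rightarrow> (real \<Rightarrow> real) \<Rightarrow> bool" where
 "horbit F \<alpha> \<omega> x y \<longleftrightarrow> (\<forall>t\<in>einterval \<alpha> \<omega>. (x has_real_derivative F (x t) - y t) (at t) &
   (y has_real_derivative x t) (at t))"

lemma quart_linear_bound:
 obtains K where "K >= 0" "!!x. \<bar>x\<bar> <= R ==> \<bar>quart a b c d x\<bar> <= K * \<bar>x\<bar>"
proof -
 have "bounded ((%x. a * x^3 + b * x^2 + c * x + d) ` {- R..R})"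
  by (intro compact_imp_bounded compact_continuous_image continuous_intros compact_Icc)
 then obtain K where K: "\<forall>z\<in>(%x. a * x^3 + b * x^2 + c * x + d) ` {- R..R}. norm z <= K" unfolding bounded_iff by blast
 show ?thesis
 proof (rule that[of "\<bar>K\<bar>"])
  fix x :: real assume x: "\<bar>x\<bar> <= R"
  have "norm (a * x^3 + b * x^2 + c * x + d) <= K" using x by (intro bspec[OF K] imageI) auto
  then have "\<bar>a * x^3 + b * x^2 + c * x + d\<bar> * \<bar>x\<bar> <= \<bar>K\<bar> * \<bar>x\<bar>" by (intro mult_right_mono) auto
  moreover have "quart a b c d x = (a * x^3 + b * x^2 + c * x + d) * x"
   by (simp add: quart_def algebra_simps power3_eq_cube power4_eq_xxxx power2_eq_square)
  ultimately show "\<bar>quart a b c d x\<bar> <= \<bar>K\<bar> * \<bar>x\<bar>" by (simp add: abs_mult)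
 qed simp
qed

lemma poincare_tendsto_equator:
 assumes lim: "((%s. poincare (X s, Y s)) \<longlongrightarrow> (u, v, 0)) G"
 defines "\<Delta> \<equiv> %s. sqrt (1 + (X s)^2 + (Y s)^2)"
 shows "filterlim \<Delta> at_top G" "((%s. X s / \<Delta> s) \<longlongrightarrow> u) G" "((%s. Y s / \<Delta> s) \<longlongrightarrow> v) G"
proof -
 have Dpos: "\<Delta> s >= 1" for s by (simp add: \<Delta>_def)
 have P: "poincare (X s, Y s) = (X s / \<Delta> s, Y s / \<Delta> s, 1 / \<Delta> s)" for s
  by (simp add: poincare_Pair \<Delta>_def)
 show "((%s. X s / \<Delta> s) \<longlongrightarrow> u) G" using tendsto_fst[OF lim] by (simp add: P)
 show "((%s. Y s / \<Delta> s) \<longlongrightarrow> v) G" using tendsto_fst[OF tendsto_snd[OF lim]] by (simp add: P)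
 have lw: "((%s. 1 / \<Delta> s) \<longlongrightarrow> 0) G" using tendsto_snd[OF tendsto_snd[OF lim]] by (simp add: P)
 have "filterlim (%s. inverse (1 / \<Delta> s)) at_top G"
  by (rule filterlim_inverse_at_top[OF lw])
    (use Dpos in \<open>auto intro!: always_eventually simp: less_le_trans[OF zero_less_one]\<close>)
 then show "filterlim \<Delta> at_top G" by simp
qed

text \<open>At an end with u < 0 the coordinate x would tend to minus infinity although F x,
  quadratically large, exceeds y and makes x' positive. At the end of the negative y-axis F x - y is
  at least 1, and a corrected height is monotone in the wrong direction.\<close>

lemma horbit_end_point:
 assumes lead: "lead a b c" and ao: "\<alpha> < \<omega>" and h: "horbit (quart a b c d) \<alpha> \<omega> x y"
  and lim: "((%s. poincare (x (real_of_ereal s), y (real_of_ereal s))) \<longlongrightarrow> (u, v, 0)) (at_left \<omega>)"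
 shows "u >= 0" "u = 0 ==> v \<noteq> - 1"
proof -
 define F where "F = quart a b c d"
 obtain k C where k: "k > 0" "!!x. F x >= k * x^2 - C" using lead_lower[OF lead] unfolding F_def by metis
 let ?A = "at_left \<omega>"
 define X Y where "X = (%s. x (real_of_ereal s))" and "Y = (%s. y (real_of_ereal s))"
 define \<Delta> where "\<Delta> = (%s. sqrt (1 + (X s)^2 + (Y s)^2))"
 have lim': "((%s. poincare (X s, Y s)) \<longlongrightarrow> (u, v, 0)) ?A" using lim by (simp add: X_def Y_def)
 have L: "filterlim \<Delta> at_top ?A" "((%s. X s / \<Delta> s) \<longlongrightarrow> u) ?A" "((%s. Y s / \<Delta> s) \<longlongrightarrow> v) ?A"
  using poincare_tendsto_equator[OF lim'] by (simp_all add: \<Delta>_def)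
 have D: "(x has_real_derivative F (x t) - y t) (at t)" "(y has_real_derivative x t) (at t)" if "t \<in> einterval \<alpha> \<omega>" for t
  using h that by (auto simp: horbit_def F_def)
 have Dpos: "\<Delta> s >= 1" for s by (simp add: \<Delta>_def)
 have YD: "\<bar>Y s\<bar> <= \<Delta> s" for s unfolding \<Delta>_def by (rule real_le_rsqrt) simp
 show "u >= 0"
 proof (rule ccontr)
  assume u: "\<not> u >= 0"
  have "filterlim (%s. - (X s / \<Delta> s) * \<Delta> s) at_top ?A"
   by (rule filterlim_tendsto_pos_mult_at_top[OF tendsto_minus[OF L(2)] _ L(1)]) (use u in auto)
  moreover have "- (X s / \<Delta> s) * \<Delta> s = - X s" for s using Dpos[of s] by simp
  ultimately have XT: "filterlim (%s. - X s) at_top ?A" by simp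
  \<comment> \<open>From X / \<Delta> < u / 2 one gets |Y| <= \<Delta> <= K * (- X), which the
    parabola below F dominates.\<close>
  define K where "K = 2 / (- u)"
  have K: "K > 0" using u by (simp add: K_def)
  have "filterlim (%z. k * z^2 - C - K * z) at_top at_top" using k by real_asymp
  from filterlim_compose[OF this XT] have "eventually (%s. k * (X s)^2 - C - K * (- X s) >= 0) ?A"
   unfolding filterlim_at_top by auto
  moreover have "eventually (%s. X s / \<Delta> s < u / 2) ?A" using order_tendstoD(2)[OF L(2), of "u / 2"] u by simp
  ultimately have ev: "eventually (%s. - (F (X s) - Y s) <= 0) ?A"
  proof eventually_elim
   fix s assume 1: "k * (X s)^2 - C - K * (- X s) >= 0" and 2: "X s / \<Delta> s < u / 2"
   have "X s < u / 2 * \<Delta> s" using 2 Dpos[of s] by (simp add: pos_divide_less_eq)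
   then have "\<Delta> s <= K * (- X s)" using u by (simp add: K_def field_simps)
   then show "- (F (X s) - Y s) <= 0" using 1 k(2)[of "X s"] YD[of s] by linarith
  qed
  show False
   by (rule escape_impossible[OF ao, of "%t. - x t" "%t. - (F (x t) - y t)"])
     (use XT ev D in \<open>auto simp: X_def Y_def intro!: DERIV_minus\<close>, metis DERIV_minus minus_diff_eq)
 qed
 assume u: "u = 0"
 show "v \<noteq> - 1"
 proof
  assume v: "v = - 1"
  have "filterlim (%s. - (Y s / \<Delta> s) * \<Delta> s) at_top ?A"
   by (rule filterlim_tendsto_pos_mult_at_top[OF tendsto_minus[OF L(3)] _ L(1)]) (use v in auto)
  moreover have "- (Y s / \<Delta> s) * \<Delta> s = - Y s" for s using Dpos[of s] by simp
  ultimately have YT: "filterlim (%s. - Y s) at_top ?A" by simp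
  show False
  proof (rule escape_impossible[OF ao])
   \<comment> \<open>The exponential contributes - exp (- x) (F x - y), which absorbs the term - x
     because exp (- x) >= - x and F x - y >= 1.\<close>
   show "((%t. - y t + exp (- x t)) has_real_derivative - x t - exp (- x t) * (F (x t) - y t)) (at t)"
    if "t \<in> einterval \<alpha> \<omega>" for t
    using D[OF that] by (auto intro!: derivative_eq_intros simp: algebra_simps)
   show "filterlim (%s. - y (real_of_ereal s) + exp (- x (real_of_ereal s))) at_top ?A"
    by (rule filterlim_at_top_mono[OF YT]) (auto simp: Y_def)
   have "eventually (%s. - Y s >= C + 1) ?A" using YT unfolding filterlim_at_top by blast
   then show "eventually (%s. - x (real_of_ereal s) - exp (- x (real_of_ereal s)) *
     (F (x (real_of_ereal s)) - y (real_of_ereal s)) <= 0) ?A"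
   proof (rule eventually_mono)
    fix s assume s: "- Y s >= C + 1"
    have "k * (X s)^2 >= 0" using k by simp
    then have "F (X s) - Y s >= 1" using s k(2)[of "X s"] by linarith
    then have "exp (- X s) * (F (X s) - Y s) >= exp (- X s) * 1" by (intro mult_left_mono) auto
    moreover have "exp (- X s) >= - X s" using exp_ge_add_one_self[of "- X s"] by linarith
    ultimately show "- x (real_of_ereal s) - exp (- x (real_of_ereal s)) *
     (F (x (real_of_ereal s)) - y (real_of_ereal s)) <= 0" unfolding X_def Y_def by linarith
   qed
  qed
 qed
qed

lemma eventually_at_left_real:
 assumes ev: "eventually (%s. Q (real_of_ereal s)) (at_left \<omega>)" and ao: "\<alpha> < \<omega>" and t1: "t1 \<in> einterval \<alpha> \<omega>"
 obtains t0 where "t0 >= t1" "ereal t0 < \<omega>" "!!t. t >= t0 ==> ereal t < \<omega> ==> Q t"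
proof -
 obtain e where e: "e < \<omega>" "!!s. e < s ==> s < \<omega> ==> Q (real_of_ereal s)"
  using ev eventually_at_left[OF ao] by auto
 obtain r where r: "max e (ereal t1) < ereal r" "ereal r < \<omega>"
  using ereal_dense2[of "max e (ereal t1)" \<omega>] e t1 by (auto simp: einterval_def)
 show ?thesis
 proof (rule that[of r])
  fix t assume t: "t >= r" "ereal t < \<omega>"
  have "e < ereal r" using r by (simp add: max_less_iff_conj)
  also have "ereal r <= ereal t" using t by simp
  finally show "Q t" using e(2)[of "ereal t"] t by simp
 qed (use r in \<open>auto simp: max_less_iff_conj\<close>)
qed

lemma horbit_shift:
 assumes h: "horbit F \<alpha> \<omega> x y" and t: "\<alpha> < ereal r" and T: "ereal (r + T) < \<omega>"
 shows "hsol F {0..T} (%t. x (r + t)) (%t. y (r + t))"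
 unfolding hsol_def
proof (intro ballI)
 fix t assume t': "t \<in> {0..T}"
 have "ereal r <= ereal (r + t)" "ereal (r + t) <= ereal (r + T)" using t' by auto
 then have "r + t \<in> einterval \<alpha> \<omega>" unfolding einterval_def mem_Collect_eq using t T
  by (meson le_less_trans less_le_trans)
 then have "(x has_real_derivative F (x (r + t)) - y (r + t)) (at (r + t))" "(y has_real_derivative x (r + t)) (at (r + t))"
  using h by (auto simp: horbit_def)
 then show "((%t. x (r + t)) has_real_derivative F (x (r + t)) - y (r + t)) (at t within {0..T}) &
   ((%t. y (r + t)) has_real_derivative x (r + t)) (at t within {0..T})"
  by (auto simp: DERIV_at_within_shift add.commute[of r] DERIV_shift intro: has_field_derivative_at_within)
qed

text \<open>After its last visit to the axis the orbit lives in x > 0. If it turned, x would stay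
  bounded and y could not tend to infinity; if it escaped, the distance to the curve would grow
  quadratically and x would outgrow y, against x / y \<rightarrow> 0. So it lies on the
  separatrix.\<close>

lemma horbit_end:
 assumes lead: "lead a b c" and ao: "\<alpha> < \<omega>" and h: "horbit (quart a b c d) \<alpha> \<omega> x y"
  and lim: "((%s. poincare (x (real_of_ereal s), y (real_of_ereal s))) \<longlongrightarrow> (0, 1, 0)) (at_left \<omega>)"
  and t1: "t1 \<in> einterval \<alpha> \<omega>" "x t1 <= 0"
 obtains r ys where "r \<in> einterval \<alpha> \<omega>" "r >= t1" "x r = 0" "y r < 0" "!!t. r < t ==> ereal t < \<omega> ==> x t > 0"
  "sepg (quart a b c d) ys" "!!t. r <= t ==> ereal t < \<omega> ==> y t = ys (x t)"
  "!!R. \<exists>t. r <= t & ereal t < \<omega> & x t > R"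
proof -
 define F where "F = quart a b c d"
 have F0: "F 0 = 0" and Fc: "continuous_on S F" for S
  unfolding F_def by (simp, intro continuous_intros)
 have Fb: "\<exists>B. \<forall>x\<in>{0..R}. F x <= B" for R
 proof -
  have "bounded (F ` {0..R})" using compact_continuous_image[OF Fc] compact_imp_bounded by blast
  then obtain B where B: "\<forall>z\<in>F ` {0..R}. norm z <= B" unfolding bounded_iff by blast
  then have "F x <= B" if "x \<in> {0..R}" for x using that by (auto simp: abs_le_iff)
  then show ?thesis by blast
 qed
 let ?A = "at_left \<omega>"
 define X Y where "X = (%s. x (real_of_ereal s))" and "Y = (%s. y (real_of_ereal s))"
 define \<Delta> where "\<Delta> = (%s. sqrt (1 + (X s)^2 + (Y s)^2))"
 have lim': "((%s. poincare (X s, Y s)) \<longlongrightarrow> (0, 1, 0)) ?A" using lim by (simp add: X_def Y_def)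
 have L: "filterlim \<Delta> at_top ?A" "((%s. X s / \<Delta> s) \<longlongrightarrow> 0) ?A" "((%s. Y s / \<Delta> s) \<longlongrightarrow> 1) ?A"
  using poincare_tendsto_equator[OF lim'] by (simp_all add: \<Delta>_def)
 have Dpos: "\<Delta> s >= 1" for s by (simp add: \<Delta>_def)
 have D: "(x has_real_derivative F (x t) - y t) (at t)" "(y has_real_derivative x t) (at t)" if "t \<in> einterval \<alpha> \<omega>" for t
  using h that by (auto simp: horbit_def F_def)
 have "filterlim (%s. Y s / \<Delta> s * \<Delta> s) at_top ?A"
  by (rule filterlim_tendsto_pos_mult_at_top[OF L(3) _ L(1)]) simp
 moreover have "Y s / \<Delta> s * \<Delta> s = Y s" for s using Dpos[of s] by simp
 ultimately have YT: "filterlim Y at_top ?A" by simp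
 have "((%s. X s / \<Delta> s / (Y s / \<Delta> s)) \<longlongrightarrow> 0 / 1) ?A" by (intro tendsto_divide L) simp
 moreover have "(%s. X s / \<Delta> s / (Y s / \<Delta> s)) = (%s. X s / Y s)"
 proof
  show "X s / \<Delta> s / (Y s / \<Delta> s) = X s / Y s" for s using Dpos[of s] by simp
 qed
 ultimately have XY: "((%s. X s / Y s) \<longlongrightarrow> 0) ?A" by (simp only: div_0)
 have in_I: "t \<in> einterval \<alpha> \<omega>" if "t >= t1" "ereal t < \<omega>" for t
 proof -
  have "\<alpha> < ereal t1" using t1 by (simp add: einterval_def)
  also have "ereal t1 <= ereal t" using that by simp
  finally show ?thesis using that by (simp add: einterval_def)
 qed
 have c: "continuous_on {p..q} x" "continuous_on {p..q} y" if "p >= t1" "ereal q < \<omega>" for p q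
 proof -
  have "t \<in> einterval \<alpha> \<omega>" if "t \<in> {p..q}" for t
   by (rule in_I) (use that \<open>p >= t1\<close> \<open>ereal q < \<omega>\<close> in \<open>auto intro: le_less_trans[of _ "ereal q"]\<close>)
  then show "continuous_on {p..q} x" "continuous_on {p..q} y"
   using D by (meson DERIV_continuous continuous_at_imp_continuous_on)+
 qed
 have lt: "ereal p < \<omega>" if "p <= q" "ereal q < \<omega>" for p q
  using that by (meson ereal_less_eq(3) le_less_trans)
 have ev: "\<exists>t0. t0 >= p & ereal t0 < \<omega> & (\<forall>t. t >= t0 & ereal t < \<omega> --> Q t)"
  if "p >= t1" "ereal p < \<omega>" "eventually (%s. Q (real_of_ereal s)) ?A" for p Q
  using eventually_at_left_real[OF that(3) ao in_I[OF that(1,2)]] by metis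
 have evI: "eventually (%s. Q (real_of_ereal s)) ?A" if p: "p >= t1" "ereal p < \<omega>" and "!!t. t >= p ==> ereal t < \<omega> ==> Q t" for p Q
  unfolding eventually_at_left[OF ao]
 proof (intro exI[of _ "ereal p"] conjI allI impI)
  fix s assume s: "ereal p < s" "s < \<omega>"
  then have "\<bar>s\<bar> \<noteq> \<infinity>" by (cases s) auto
  then obtain z where z: "s = ereal z" by (cases s) auto
  then show "Q (real_of_ereal s)" using that(3)[of z] s by simp
 qed (use p in simp)
 obtain tY where tY: "tY >= t1" "ereal tY < \<omega>" "!!t. t >= tY ==> ereal t < \<omega> ==> y t >= 1"
  using ev[of t1 "%t. y t >= 1"] t1 YT unfolding filterlim_at_top Y_def by (auto simp: einterval_def)
 \<comment> \<open>Once y >= 1, an orbit at x <= 0 cannot enter x > 0, since F x - y <= K * x for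
   the positive x in question; then y' = x <= 0 forbids that y tends to infinity.\<close>
 have xpos: "x t2 > 0" if t2: "t2 >= tY" "ereal t2 < \<omega>" for t2
 proof (rule ccontr)
  assume n: "\<not> x t2 > 0"
  have xle: "x t <= 0" if t: "t >= t2" "ereal t < \<omega>" for t
  proof -
   have "bounded (x ` {t2..t})" using t t2 tY by (intro compact_imp_bounded compact_continuous_image[OF c(1)]) auto
   then obtain R where R: "\<forall>z\<in>x ` {t2..t}. norm z <= R" unfolding bounded_iff by blast
   obtain K where K: "!!x. \<bar>x\<bar> <= R ==> \<bar>F x\<bar> <= K * \<bar>x\<bar>" using quart_linear_bound[of R a b c d] unfolding F_def by metis
   show ?thesis
   proof (rule gronwall_nonpos[OF t(1), of x "%t. F (x t) - y t" K])
    show "continuous_on {t2..t} x" using c(1) t t2 tY by auto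
    fix s assume s: "t2 < s" "s < t"
    have sI: "s \<in> einterval \<alpha> \<omega>" "ereal s < \<omega>" using in_I[of s] lt[of s t] s t t2 tY by auto
    show "(x has_real_derivative F (x s) - y s) (at s)" using D sI by blast
    assume "0 < x s"
    moreover have "\<bar>x s\<bar> <= R" using R s by auto
    ultimately show "F (x s) - y s <= K * x s" using K[of "x s"] tY(3)[of s] s t2 sI by (auto simp: abs_le_iff)
   qed (use n in auto)
  qed
  show False
   by (rule escape_impossible[OF ao D(2) YT[unfolded Y_def]]) (use evI[of t2 "%t. x t <= 0"] xle t2 tY in auto)
 qed
 define S where "S = {t \<in> {t1..tY}. x t <= 0}"
 have "closed S" unfolding S_def by (rule continuous_on_closed_Collect_le[OF c(1)]) (use tY in auto)
 then have "compact S" unfolding S_def using compact_Int_closed[OF compact_Icc[of t1 tY]]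
  by (metis (no_types, lifting) inf.absorb_iff2 mem_Collect_eq subsetI)
 moreover have "t1 \<in> S" using t1 tY by (simp add: S_def)
 ultimately obtain r where r: "r \<in> S" "!!t. t \<in> S ==> t <= r" using compact_attains_sup[of S] by auto
 have r1: "t1 <= r" "r <= tY" "x r <= 0" "ereal r < \<omega>" using r lt tY by (auto simp: S_def)
 have rI: "r \<in> einterval \<alpha> \<omega>" using in_I r1 by blast
 have xr: "x t > 0" if t: "r < t" "ereal t < \<omega>" for t
 proof (cases "t <= tY")
  case True
  then show ?thesis using r(2)[of t] t r1 by (auto simp: S_def not_less[symmetric])
 qed (use xpos t in auto)
 have x0: "x r = 0"
 proof (rule ccontr)
  assume "x r \<noteq> 0"
  then have "x r < 0" using r1 by simp
  have "\<exists>z. r <= z & z <= tY & x z = 0"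
   using \<open>x r < 0\<close> xpos[of tY] tY r1 by (intro IVT' c(1)) auto
  then obtain z where z: "r <= z" "z <= tY" "x z = 0" by blast
  then have "r < z" using \<open>x r < 0\<close> by (cases "r = z") auto
  then show False using xr[of z] z lt tY by auto
 qed
 obtain q where q: "r < q" "ereal q < \<omega>" using ereal_dense2[OF r1(4)] by auto
 have sol: "hsol F {0..T} (%t. x (r + t)) (%t. y (r + t))" if "ereal (r + T) < \<omega>" for T
  unfolding F_def by (rule horbit_shift[OF h _ that]) (use rI in \<open>simp add: einterval_def\<close>)
 \<comment> \<open>y r > 0 would push the orbit into x < 0, and y r = 0 would be the
   equilibrium.\<close>
 have yr: "y r < 0"
 proof -
  have "\<not> y r > 0"
  proof
   assume "y r > 0"
   then have "F (x r) - y r < 0" using x0 F0 by simp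
   from DERIV_neg_dec_right[OF D(1)[OF rI] this]
   obtain e where e: "e > 0" "!!h. 0 < h ==> h < e ==> x (r + h) < x r" by auto
   define h where "h = min (e / 2) (q - r)"
   have "0 < h" "h < e" "r + h <= q" using e q by (auto simp: h_def min_def)
   then show False using e(2)[of h] xr[of "r + h"] x0 lt[of "r + h" q] q by auto
  qed
  moreover have "y r \<noteq> 0"
  proof
   assume y0: "y r = 0"
   have "hsol F {0..q - r} (%_. 0) (%_. 0)" using F0 by (auto simp: hsol_def)
   then have "x (r + (q - r)) = 0"
    using hsol_unique[of a b c d "q - r" "%t. x (r + t)" "%t. y (r + t)" "%_. 0" "%_. 0" "q - r"] sol[of "q - r"] q x0 y0
    by (auto simp: F_def)
   then show False using xr[of q] q by simp
  qed
  ultimately show ?thesis by linarith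
 qed
 \<comment> \<open>Solutions from (0, y r) are this orbit, and it lives at least as long: otherwise
   y would be unbounded on a compact time interval on which the given solution is bounded.\<close>
 have coincide: "ereal (r + T) < \<omega> & (\<forall>t\<in>{0..T}. x (r + t) = X' t & y (r + t) = Y' t)"
  if T: "T >= 0" and s: "hsol F {0..T} X' Y'" "X' 0 = 0" "Y' 0 = y r" for T X' Y'
 proof -
  have eq: "x (r + t) = X' t & y (r + t) = Y' t" if t: "t \<in> {0..T}" "ereal (r + t) < \<omega>" for t
   using hsol_unique[of a b c d t "%t. x (r + t)" "%t. y (r + t)" X' Y' t] sol[of t] hsol_subset[OF s(1), of "{0..t}"] s t x0
   by (auto simp: F_def)
  have "ereal (r + T) < \<omega>"
  proof (rule ccontr)
   assume n: "\<not> ereal (r + T) < \<omega>"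
   have "bounded (Y' ` {0..T})" using compact_continuous_image[OF hsol_continuous(2)[OF s(1)]] compact_imp_bounded by blast
   then obtain M where M: "\<forall>z\<in>Y' ` {0..T}. norm z <= M" unfolding bounded_iff by blast
   obtain t0 where t0: "t0 >= r" "ereal t0 < \<omega>" "y t0 > M"
    using ev[of r "%t. y t > M"] r1 YT unfolding filterlim_at_top_dense Y_def by blast
   have "ereal t0 < ereal (r + T)" using t0 n by (meson less_le_trans not_less)
   then have "t0 - r \<in> {0..T}" using t0 by auto
   then have "y t0 = Y' (t0 - r)" "norm (Y' (t0 - r)) <= M" using eq[of "t0 - r"] t0 M by auto
   then show False using t0 by auto
  qed
  moreover have "ereal (r + t) < \<omega>" if "t \<in> {0..T}" for t using lt[of "r + t" "r + T"] calculation that by auto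
  ultimately show ?thesis using eq by blast
 qed
 have nt: "\<not> turn F (y r)"
 proof
  assume "turn F (y r)"
  from turn_first[OF this yr F0]
  obtain T X' Y' where T: "T > 0" "hsol F {0..T} X' Y'" "X' 0 = 0" "Y' 0 = y r" "Y' T > F (X' T)" by metis
  define t2 where "t2 = r + T"
  have t2: "ereal t2 < \<omega>" "y t2 > F (x t2)" "t2 > r" using coincide[OF _ T(2-4)] T by (auto simp: t2_def)
  define u where "u = (%t. y t - F (x t))"
  have ud: "(u has_real_derivative x t - quart' a b c d (x t) * (F (x t) - y t)) (at t)" if "t \<in> einterval \<alpha> \<omega>" for t
   unfolding u_def F_def using D[OF that] by (auto intro!: derivative_eq_intros simp: F_def)
  have uc: "continuous_on {p..q} u" if "p >= t1" "ereal q < \<omega>" for p q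
   unfolding u_def by (intro continuous_intros c that continuous_on_compose2[OF Fc[of UNIV]]) auto
  \<comment> \<open>Beyond the curve the orbit stays beyond it, because at a contact the derivative
    of y - F x is x > 0.\<close>
  have upos: "u t > 0" if t: "t >= t2" "ereal t < \<omega>" for t
  proof (rule ccontr)
   assume "\<not> u t > 0"
   then obtain z where z: "t2 < z" "z <= t" "u z = 0" "!!s. t2 <= s ==> s < z ==> u s > 0"
    using first_zero[OF t(1) uc[of t2 t]] t t2 r1 by (auto simp: u_def not_less)
   have zI: "z \<in> einterval \<alpha> \<omega>" using in_I[of z] lt[of z t] z t t2 r1 by auto
   have "x z > 0" using xr[of z] lt[of z t] z t t2 by auto
   then have "x z - quart' a b c d (x z) * (F (x z) - y z) > 0" using z(3) by (simp add: u_def)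
   from DERIV_pos_inc_left[OF ud[OF zI] this]
   obtain e where e: "e > 0" "!!h. 0 < h ==> h < e ==> u (z - h) < u z" by auto
   define h where "h = min (e / 2) (z - t2)"
   have "0 < h" "h < e" "t2 <= z - h" using e z by (auto simp: h_def min_def)
   then show False using e(2)[of h] z(3) z(4)[of "z - h"] by auto
  qed
  have xle: "x t <= x t2" if t: "t >= t2" "ereal t < \<omega>" for t
  proof -
   have "x t <= x t2 + 0 * (t - t2)"
   proof (rule increment_le[OF t(1), of x "%t. F (x t) - y t"])
    show "continuous_on {t2..t} x" using c(1) t t2 r1 by auto
    fix s assume s: "t2 < s" "s < t"
    show "(x has_real_derivative F (x s) - y s) (at s)" using D in_I[of s] lt[of s t] s t t2 r1 by auto
    show "F (x s) - y s <= 0" using upos[of s] lt[of s t] s t by (auto simp: u_def)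
   qed
   then show ?thesis by simp
  qed
  define x1 where "x1 = x t2"
  have x1: "x1 > 0" using xr t2 by (simp add: x1_def)
  obtain B where B: "\<forall>x\<in>{0..x1}. F x <= B" using Fb by blast
  show False
  \<comment> \<open>This combination is at least y, yet eventually nonincreasing: x <= x1, and F x -
    y <= - 1 once y exceeds the bound of F on {0..x1} by 1.\<close>
  proof (rule escape_impossible[OF ao, of "%t. y t + x1 * x t" "%t. x t + x1 * (F (x t) - y t)"])
   show "((%t. y t + x1 * x t) has_real_derivative x t + x1 * (F (x t) - y t)) (at t)" if "t \<in> einterval \<alpha> \<omega>" for t
    using D[OF that] by (auto intro!: derivative_eq_intros)
   show "filterlim (%s. y (real_of_ereal s) + x1 * x (real_of_ereal s)) at_top ?A"
    by (rule filterlim_at_top_mono[OF YT]) (use evI[of t2 "%t. y t <= y t + x1 * x t"] xr t2 x1 r1 in \<open>auto simp: Y_def less_imp_le\<close>)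
   obtain t3 where t3: "t3 >= t2" "ereal t3 < \<omega>" "!!t. t >= t3 ==> ereal t < \<omega> ==> y t >= 1 + B"
    using ev[of t2 "%t. y t >= 1 + B"] t2 r1 YT unfolding filterlim_at_top Y_def by auto
   have "x t + x1 * (F (x t) - y t) <= 0" if t: "t >= t3" "ereal t < \<omega>" for t
   proof -
    have "F (x t) <= B" using B xr[of t] xle[of t] t t3 t2 by (auto simp: x1_def)
    then have "F (x t) - y t <= - 1" using t3(3)[OF t] by linarith
    then have "x1 * (F (x t) - y t) <= x1 * (- 1)" using x1 by (intro mult_left_mono) auto
    then show ?thesis using xle[of t] t t3 by (auto simp: x1_def)
   qed
   then show "\<forall>\<^sub>F s in ?A. x (real_of_ereal s) + x1 * (F (x (real_of_ereal s)) - y (real_of_ereal s)) <= 0"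
    using evI[of t3 "%t. x t + x1 * (F (x t) - y t) <= 0"] t3 t2 r1 by auto
  qed
 qed
 have "sep F (y r)"
 proof (rule ccontr)
  assume ns: "\<not> sep F (y r)"
  obtain g0 xB where g0: "g0 > 0" and xB: "xB > 0"
   and sl: "!!x d'. x >= xB ==> \<bar>d'\<bar> <= \<bar>d\<bar> ==> quart' a b c d' x >= g0 * x" using lead_slope[OF lead] by metis
  define U where "U = 2 / g0"
  have U: "U > 0" using g0 by (simp add: U_def)
  have "\<exists>T X' Y'. T >= 0 & hsol F {0..T} X' Y' & X' 0 = 0 & Y' 0 = y r & X' T >= xB & \<not> F (X' T) - Y' T < U"
   using sep_of_bounded[OF lead nt[unfolded F_def] yr, of xB U] ns xB U unfolding F_def by (meson less_imp_le)
  then obtain T X' Y' where T: "T >= 0" "hsol F {0..T} X' Y'" "X' 0 = 0" "Y' 0 = y r" "X' T >= xB" "F (X' T) - Y' T >= U"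
   by (auto simp: not_less)
  define t2 where "t2 = r + T"
  have t2: "ereal t2 < \<omega>" "x t2 >= xB" "F (x t2) - y t2 >= U" "t2 >= r"
   using coincide[OF T(1-4)] T by (auto simp: t2_def)
  define C1 where "C1 = F (x t2) - y t2 - g0 / 4 * (x t2)^2"
  have tr: "F (x t) - y t >= U" "x t >= x t2" "F (x t) - y t - g0 / 4 * (x t)^2 >= C1" if t: "t >= t2" "ereal t < \<omega>" for t
  proof -
   have "hsol F {0..t - t2} (%s. x (t2 + s)) (%s. y (t2 + s))"
    unfolding F_def by (rule horbit_shift[OF h]) (use in_I[of t2] t t2 r1 in \<open>auto simp: einterval_def\<close>)
   from trap[OF this[unfolded F_def] _ xB g0 sl, of U] t t2
   show "F (x t) - y t >= U" "x t >= x t2" "F (x t) - y t - g0 / 4 * (x t)^2 >= C1"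
    by (auto simp: U_def F_def C1_def)
  qed
  have "filterlim (%z. g0 / 4 * z^2 + C1 - z) at_top at_top" using g0 by real_asymp
  then obtain X0 where X0: "!!z. z >= X0 ==> g0 / 4 * z^2 + C1 - z >= 0"
   unfolding filterlim_at_top eventually_at_top_linorder by meson
  obtain B where B: "\<forall>x\<in>{0..X0}. F x <= B" using Fb by blast
  obtain t3 where t3: "t3 >= t2" "ereal t3 < \<omega>" "!!t. t >= t3 ==> ereal t < \<omega> ==> y t >= B"
   using ev[of t2 "%t. y t >= B"] t2 r1 YT unfolding filterlim_at_top Y_def by auto
  show False
  \<comment> \<open>y - x tends to infinity because x / y \<rightarrow> 0, but \<open>trap\<close>
    gives F x - y >= g0 / 4 * x^2 + C1, which is at least x for large x.\<close>
  proof (rule escape_impossible[OF ao, of "%t. y t - x t" "%t. x t - (F (x t) - y t)"])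
   show "((%t. y t - x t) has_real_derivative x t - (F (x t) - y t)) (at t)" if "t \<in> einterval \<alpha> \<omega>" for t
    using D[OF that] by (intro DERIV_diff)
   have "filterlim (%s. (1 - X s / Y s) * Y s) at_top ?A"
    by (rule filterlim_tendsto_pos_mult_at_top[OF tendsto_diff[OF tendsto_const XY] _ YT]) simp
   moreover have "eventually (%s. (1 - X s / Y s) * Y s = Y s - X s) ?A"
   proof -
    have "eventually (%s. Y s > 0) ?A" using YT unfolding filterlim_at_top_dense by blast
    then show ?thesis by (rule eventually_mono) (simp add: field_simps)
   qed
   ultimately show "filterlim (%s. y (real_of_ereal s) - x (real_of_ereal s)) at_top ?A"
    unfolding X_def Y_def by (rule filterlim_cong[OF refl refl, THEN iffD1, rotated])
   have "x t - (F (x t) - y t) <= 0" if t: "t >= t3" "ereal t < \<omega>" for t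
   proof -
    have t': "t >= t2" using t t3 by simp
    have "x t >= X0"
    proof (rule ccontr)
     assume "\<not> x t >= X0"
     then have "F (x t) <= B" using B tr(2)[OF t' t(2)] t2 xB by auto
     then show False using tr(1)[OF t' t(2)] t3(3)[OF t] U by linarith
    qed
    then show ?thesis using X0[of "x t"] tr(3)[OF t' t(2)] by linarith
   qed
   then show "\<forall>\<^sub>F s in ?A. x (real_of_ereal s) - (F (x (real_of_ereal s)) - y (real_of_ereal s)) <= 0"
    using evI[of t3 "%t. x t - (F (x t) - y t) <= 0"] t3 t2 r1 by auto
  qed
 qed
 then obtain ys where ys: "sepg F ys" "ys 0 = y r" by (auto simp: sep_def)
 have graph: "y t = ys (x t)" if t: "r <= t" "ereal t < \<omega>" for t
 proof -
  have "sgn (y (r + (t - r)) - ys (x (r + (t - r)))) = sgn (y (r + 0) - ys (x (r + 0)))"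
  proof (rule gap_sgn[OF ys(1) Fc sol])
   show "x (r + s) >= 0" if "s \<in> {0..t - r}" for s
    using xr[of "r + s"] x0 lt[of "r + s" t] t that by (cases "s = 0") auto
   show "x (r + s) > 0" if "0 < s" "s < t - r" for s
    using xr[of "r + s"] lt[of "r + s" t] t that by auto
  qed (use t in auto)
  then show ?thesis using ys x0 by (simp add: sgn_if split: if_splits)
 qed
 have "\<exists>t. r <= t & ereal t < \<omega> & x t > R" for R
 proof (rule ccontr)
  assume n: "\<not> (\<exists>t. r <= t & ereal t < \<omega> & x t > R)"
  obtain B where B: "\<forall>x\<in>{0..R}. F x <= B" using Fb by blast
  obtain t where t: "t >= r" "ereal t < \<omega>" "y t > B"
   using ev[of r "%t. y t > B"] r1 YT unfolding filterlim_at_top_dense Y_def by blast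
  have "x t >= 0" using xr[of t] x0 t by (cases "t = r") auto
  moreover have "x t <= R" using n t by force
  ultimately have "F (x t) <= B" "ys (x t) < F (x t)" using B ys by (auto simp: sepg_def)
  then show False using graph[of t] t by simp
 qed
 then show ?thesis using that[OF rI r1(1) x0 yr xr ys(1)[unfolded F_def] graph] by blast
qed

text \<open>Time reversal changes the sign of the field and x \<mapsto> - x restores its form, with
  F (- x); so a backward end becomes a forward end.\<close>

lemma horbit_reverse:
 assumes "horbit F \<alpha> \<omega> x y"
 shows "horbit (%x. F (- x)) (- \<omega>) (- \<alpha>) (%t. - x (- t)) (%t. y (- t))"
 unfolding horbit_def
proof
 fix t assume "t \<in> einterval (- \<omega>) (- \<alpha>)"
 then have "- t \<in> einterval \<alpha> \<omega>"
  by (auto simp: einterval_def ereal_uminus_less_reorder ereal_less_uminus_reorder simp flip: uminus_ereal.simps)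
 then have D: "(x has_real_derivative F (x (- t)) - y (- t)) (at (- t))" "(y has_real_derivative x (- t)) (at (- t))"
  using assms by (auto simp: horbit_def)
 have u: "(uminus has_real_derivative - 1) (at t)" by (auto intro!: derivative_eq_intros)
 show "((%t. - x (- t)) has_real_derivative F (- (- x (- t))) - y (- t)) (at t) &
    ((%t. y (- t)) has_real_derivative - x (- t)) (at t)"
  using DERIV_minus[OF DERIV_chain2[where f=x and g=uminus, OF D(1) u]] DERIV_chain2[where f=y and g=uminus, OF D(2) u] by simp
qed

lemma filterlim_uminus_at_left_ereal:
 fixes \<alpha> \<omega> :: ereal
 assumes ao: "\<alpha> < \<omega>"
 shows "filterlim uminus (at_right \<alpha>) (at_left (- \<alpha>))"
 unfolding filterlim_iff
proof (intro allI impI)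
 have ao': "- \<omega> < - \<alpha>" using ao by simp
 fix Q assume "eventually Q (at_right \<alpha>)"
 then obtain e where e: "e > \<alpha>" "!!s. \<alpha> < s ==> s < e ==> Q s"
  using eventually_at_right[OF ao] by auto
 have "Q (- s)" if "- e < s" "s < - \<alpha>" for s
  by (rule e(2)) (use that in \<open>simp_all add: ereal_less_uminus_reorder ereal_uminus_less_reorder\<close>)
 moreover have "- e < - \<alpha>" using e(1) by simp
 ultimately show "eventually (%s. Q (- s)) (at_left (- \<alpha>))"
  using eventually_at_left[OF ao'] by blast
qed

lemma poincare_reflect_tendsto:
 assumes ao: "\<alpha> < \<omega>"
  and lim: "((%s. poincare (x (real_of_ereal s), y (real_of_ereal s))) \<longlongrightarrow> (u, v, w)) (at_right \<alpha>)"
 shows "((%s. poincare (- x (- real_of_ereal s), y (- real_of_ereal s))) \<longlongrightarrow> (- u, v, w)) (at_left (- \<alpha>))"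
proof -
 define S :: "real \<times> real \<times> real \<Rightarrow> real \<times> real \<times> real" where "S = (%(x, y, z). (- x, y, z))"
 have Scont: "continuous_on UNIV S" unfolding S_def split_def by (intro continuous_intros)
 have PS: "poincare (- p, q) = S (poincare (p, q))" for p q by (simp add: poincare_Pair S_def)
 have "((%s. poincare (x (real_of_ereal (- s)), y (real_of_ereal (- s)))) \<longlongrightarrow> (u, v, w)) (at_left (- \<alpha>))"
  using filterlim_compose[OF lim filterlim_uminus_at_left_ereal[OF ao]] .
 then have "((%s. S (poincare (x (- real_of_ereal s), y (- real_of_ereal s)))) \<longlongrightarrow> S (u, v, w)) (at_left (- \<alpha>))"
  using continuous_on_tendsto_compose[OF Scont] by simp
 then show ?thesis unfolding PS by (simp add: S_def)
qed

lemma horbit_positive_point: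
 assumes ao: "\<alpha> < \<omega>" and h: "horbit F \<alpha> \<omega> x y"
  and lim: "((%s. poincare (x (real_of_ereal s), y (real_of_ereal s))) \<longlongrightarrow> (0, 1, 0)) (at_left \<omega>)"
 obtains t where "t \<in> einterval \<alpha> \<omega>" "x t > 0"
proof (rule ccontr)
 assume n: "\<not> thesis"
 let ?A = "at_left \<omega>"
 define X Y where "X = (%s. x (real_of_ereal s))" and "Y = (%s. y (real_of_ereal s))"
 define \<Delta> where "\<Delta> = (%s. sqrt (1 + (X s)^2 + (Y s)^2))"
 have lim': "((%s. poincare (X s, Y s)) \<longlongrightarrow> (0, 1, 0)) ?A" using lim by (simp add: X_def Y_def)
 have L: "filterlim \<Delta> at_top ?A" "((%s. X s / \<Delta> s) \<longlongrightarrow> 0) ?A" "((%s. Y s / \<Delta> s) \<longlongrightarrow> 1) ?A"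
  using poincare_tendsto_equator[OF lim'] by (simp_all add: \<Delta>_def)
 have Dpos: "\<Delta> s >= 1" for s by (simp add: \<Delta>_def)
 have "filterlim (%s. Y s / \<Delta> s * \<Delta> s) at_top ?A"
  by (rule filterlim_tendsto_pos_mult_at_top[OF L(3) _ L(1)]) simp
 moreover have "Y s / \<Delta> s * \<Delta> s = Y s" for s using Dpos[of s] by simp
 ultimately have YT: "filterlim (%s. y (real_of_ereal s)) at_top ?A" by (simp add: Y_def)
 show False
 proof (rule escape_impossible[OF ao _ YT])
  show "(y has_real_derivative x t) (at t)" if "t \<in> einterval \<alpha> \<omega>" for t using h that by (simp add: horbit_def)
  show "\<forall>\<^sub>F s in ?A. x (real_of_ereal s) <= 0"
   unfolding eventually_at_left[OF ao]
  proof (intro exI[of _ \<alpha>] conjI allI impI ao)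
   fix s assume s: "\<alpha> < s" "s < \<omega>"
   then have "\<bar>s\<bar> \<noteq> \<infinity>" by (cases s) auto
   then obtain z where z: "s = ereal z" by (cases s) auto
   then have "z \<in> einterval \<alpha> \<omega>" using s by (simp add: einterval_def)
   then show "x (real_of_ereal s) <= 0" using n that z by force
  qed
 qed
qed

text \<open>A return to the axis contains a crossing of the curve, while an orbit starting at or
  below the separatrix never turns.\<close>

lemma horbit_no_return:
 assumes h: "horbit F \<alpha> \<omega> x y" and F: "continuous_on UNIV F" "F 0 = 0" and q: "q \<in> einterval \<alpha> \<omega>"
  and r: "r \<in> einterval \<alpha> \<omega>" "q < r" and 0: "x q = 0" "x r = 0" "y q < 0"
  and s: "sepg F ys" "y q <= ys 0"
 shows False
proof -
 have hs: "hsol F {0..r - q} (%t. x (q + t)) (%t. y (q + t))"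
  by (rule horbit_shift[OF h]) (use q r in \<open>auto simp: einterval_def\<close>)
 obtain z \<xi> where z: "0 < z" "z <= r - q" "x (q + z) = 0" "!!s. 0 < s ==> s < z ==> x (q + s) > 0"
  "0 < \<xi>" "\<xi> < z" "y (q + \<xi>) > F (x (q + \<xi>))"
  using hsol_return[OF hs, of "y q" "r - q"] 0 r F by auto
 have "turn F (y q)" unfolding turn_def
  using z 0 hsol_subset[OF hs, of "{0..\<xi>}"]
  by (intro exI[of _ \<xi>] exI[of _ "%t. x (q + t)"] exI[of _ "%t. y (q + t)"]) auto
 then show False using sep_below_nonturn[OF s(1) F s(2)] by blast
qed

text \<open>\<open>horbit_end_point\<close> at both ends gives u >= 0 and - u >= 0, so the base
  point is the end of the positive y-axis. After its last axis time r the orbit is on the right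
  separatrix, before its first axis time q on the left one; what remains is q = r.\<close>

theorem loop_orbit_at_graph:
 assumes lead: "lead a b c" and l: "loop_orbit_at (hfield a b c d) p \<Gamma>"
 obtains yy where "p = (0, 1, 0)" "loopg (quart a b c d) yy" "loop_param a b c d (yy 0)" "\<Gamma> = range (%x. (x, yy x))"
proof -
 define F where "F = quart a b c d"
 have F0: "F 0 = 0" and Fc: "continuous_on S F" for S
  unfolding F_def by (simp, intro continuous_intros)
 have Fm: "(%x. F (- x)) = quart a (- b) c (- d)" by (simp add: F_def quart_uminus_fun)
 obtain \<alpha> \<omega> :: ereal and \<gamma> where ao: "\<alpha> < \<omega>"
  and der: "\<forall>t\<in>einterval \<alpha> \<omega>. (\<gamma> has_vector_derivative hfield a b c d (\<gamma> t)) (at t)"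
  and G: "\<Gamma> = \<gamma> ` einterval \<alpha> \<omega>"
  and l1: "((%s. poincare (\<gamma> (real_of_ereal s))) \<longlongrightarrow> p) (at_right \<alpha>)"
  and l2: "((%s. poincare (\<gamma> (real_of_ereal s))) \<longlongrightarrow> p) (at_left \<omega>)" and p: "p \<in> equator"
  using l unfolding loop_orbit_at_def by blast
 define x y where "x = (%t. fst (\<gamma> t))" and "y = (%t. snd (\<gamma> t))"
 have \<gamma>: "\<gamma> t = (x t, y t)" for t by (simp add: x_def y_def)
 have \<gamma>': "\<gamma> = (%t. (x t, y t))" using \<gamma> by blast
 have h: "horbit F \<alpha> \<omega> x y"
  using der unfolding \<gamma>' hfield_has_vector_derivative horbit_def F_def by simp
 obtain u v where uv: "p = (u, v, 0)" "u^2 + v^2 = 1" using p by (auto simp: equator_def)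
 define x' y' where "x' = (%t. - x (- t))" and "y' = (%t. y (- t))"
 have ao': "- \<omega> < - \<alpha>" using ao by simp
 have h': "horbit (quart a (- b) c (- d)) (- \<omega>) (- \<alpha>) x' y'"
  using horbit_reverse[OF h] unfolding Fm x'_def y'_def .
 have lim: "((%s. poincare (x (real_of_ereal s), y (real_of_ereal s))) \<longlongrightarrow> (u, v, 0)) (at_left \<omega>)"
  using l2 by (simp add: \<gamma> uv)
 have lim': "((%s. poincare (x' (real_of_ereal s), y' (real_of_ereal s))) \<longlongrightarrow> (- u, v, 0)) (at_left (- \<alpha>))"
  using poincare_reflect_tendsto[OF ao, of x y u v 0] l1 by (simp add: \<gamma> uv x'_def y'_def)
 have "u >= 0" "- u >= 0" using horbit_end_point(1)[OF lead ao h[unfolded F_def] lim]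
   horbit_end_point(1)[OF lead_minus[OF lead] ao' h' lim'] by auto
 then have u0: "u = 0" by simp
 then have "v \<noteq> - 1" using horbit_end_point(2)[OF lead ao h[unfolded F_def] lim] by simp
 then have v1: "v = 1" using uv u0 by (simp add: power2_eq_1_iff)
 have pp: "p = (0, 1, 0)" using uv u0 v1 by simp
 note lim = lim[unfolded u0 v1] and lim' = lim'[unfolded u0 v1 minus_zero]
 have I': "- t \<in> einterval (- \<omega>) (- \<alpha>) \<longleftrightarrow> t \<in> einterval \<alpha> \<omega>" for t
  by (auto simp: einterval_def simp flip: uminus_ereal.simps)
 obtain t1 where t1: "t1 \<in> einterval \<alpha> \<omega>" "x t1 > 0" using horbit_positive_point[OF ao h lim] by blast
 obtain t2 where t2: "t2 \<in> einterval (- \<omega>) (- \<alpha>)" "x' t2 > 0" using horbit_positive_point[OF ao' h' lim'] by blast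
 have t2': "- t2 \<in> einterval \<alpha> \<omega>" "x (- t2) <= 0" using t2 I'[of "- t2"] by (auto simp: x'_def)
 have t1': "- t1 \<in> einterval (- \<omega>) (- \<alpha>)" "x' (- t1) <= 0" using t1 I'[of t1] by (auto simp: x'_def)
 obtain r ysR where r: "r \<in> einterval \<alpha> \<omega>" "x r = 0" "y r < 0" "!!t. r < t ==> ereal t < \<omega> ==> x t > 0"
  and R: "sepg F ysR" "!!t. r <= t ==> ereal t < \<omega> ==> y t = ysR (x t)"
  "!!R. \<exists>t. r <= t & ereal t < \<omega> & x t > R"
  using horbit_end[OF lead ao h[unfolded F_def] lim t2'] unfolding F_def by metis
 obtain r' ysL where r': "r' \<in> einterval (- \<omega>) (- \<alpha>)" "x' r' = 0" "y' r' < 0"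
   "!!t. r' < t ==> ereal t < - \<alpha> ==> x' t > 0"
  and L: "sepg (%x. F (- x)) ysL" "!!t. r' <= t ==> ereal t < - \<alpha> ==> y' t = ysL (x' t)"
  "!!R. \<exists>t. r' <= t & ereal t < - \<alpha> & x' t > R"
  using horbit_end[OF lead_minus[OF lead] ao' h' lim' t1'] unfolding Fm by metis
 define q where "q = - r'"
 have q: "q \<in> einterval \<alpha> \<omega>" "x q = 0" "y q < 0" using r' I'[of q] by (auto simp: q_def x'_def y'_def)
 have neg: "ereal (- t) < - \<alpha> \<longleftrightarrow> \<alpha> < ereal t" for t by (simp flip: uminus_ereal.simps)
 have xneg: "x t < 0" if "t < q" "\<alpha> < ereal t" for t
  using r'(4)[of "- t"] that neg[of t] by (auto simp: q_def x'_def)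
 have graphL: "y t = ysL (- x t)" if "t <= q" "\<alpha> < ereal t" for t
  using L(2)[of "- t"] that neg[of t] by (auto simp: q_def x'_def y'_def)
 have F'c: "continuous_on UNIV (%x. F (- x))" "F (- 0) = 0" unfolding Fm by (intro continuous_intros, simp add: F_def)
 have "q <= r"
 proof (rule ccontr)
  assume "\<not> q <= r"
  define t where "t = (q + r) / 2"
  have t: "r < t" "t < q" using \<open>\<not> q <= r\<close> by (auto simp: t_def)
  have "\<alpha> < ereal r" "ereal q < \<omega>" using q r by (auto simp: einterval_def)
  then have "\<alpha> < ereal t" "ereal t < \<omega>" using t by (meson ereal_less_eq(3) less_imp_le less_le_trans le_less_trans)+
  then show False using r(4)[of t] xneg[of t] t by auto
 qed
 \<comment> \<open>The lower of the two axis points starts, in its own time direction, at or below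
   the relevant separatrix, and yet the orbit comes back to the axis at the other point.\<close>
 moreover have "\<not> q < r"
 proof
  assume qr: "q < r"
  have yr: "y r = ysR 0" using R(2)[of r] r by (simp add: einterval_def)
  have yq: "y q = ysL 0" using graphL[of q] q by (simp add: einterval_def)
  show False
  proof (cases "y q <= y r")
   case True
   then show False using horbit_no_return[OF h Fc F0 q(1) r(1) qr q(2) r(2) q(3) R(1)] yr by simp
  next
   case False
   show False
   proof (rule horbit_no_return[OF h'[folded Fm] F'c])
    show "- r \<in> einterval (- \<omega>) (- \<alpha>)" "- q \<in> einterval (- \<omega>) (- \<alpha>)" using I' q r by auto
    show "- r < - q" "x' (- r) = 0" "x' (- q) = 0" "y' (- r) < 0" using qr q r by (auto simp: x'_def y'_def)
    show "sepg (%x. F (- x)) ysL" "y' (- r) <= ysL 0" using L False yq by (auto simp: y'_def)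
   qed
  qed
 qed
 ultimately have qr: "q = r" by simp
 have y0: "ysR 0 = ysL 0" "ysR 0 = y r"
  using R(2)[of r] graphL[of r] r qr by (auto simp: einterval_def)
 define yy where "yy = (%x. if x >= 0 then ysR x else ysL (- x))"
 have lg: "loopg F yy" unfolding yy_def by (rule loopg_of_sepg[OF R(1) L(1) y0(1) Fc])
 have "loop_param a b c d (yy 0)" unfolding loop_param_def sep_def Fm[symmetric] F_def[symmetric]
  using R(1) L(1) y0 by (auto simp: yy_def)
 moreover have "\<Gamma> = range (%x. (x, yy x))"
 proof (intro equalityI subsetI)
  fix w assume "w \<in> \<Gamma>"
  then obtain t where t: "t \<in> einterval \<alpha> \<omega>" "w = (x t, y t)" using G \<gamma> by auto
  then have t': "\<alpha> < ereal t" "ereal t < \<omega>" by (auto simp: einterval_def)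
  have "y t = yy (x t)"
  proof (cases "t >= r")
   case True
   then have "x t >= 0" using r(4)[of t] r(2) t' by (cases "t = r") auto
   then show ?thesis using R(2)[OF True t'(2)] by (simp add: yy_def)
  next
   case False
   then show ?thesis using xneg[of t] graphL[of t] t' qr by (simp add: yy_def)
  qed
  then show "w \<in> range (%x. (x, yy x))" using t by auto
 next
  fix w assume "w \<in> range (%x. (x, yy x))"
  then obtain z where w: "w = (z, yy z)" by blast
  have xc: "continuous_on {s..t} x" if "s \<in> einterval \<alpha> \<omega>" "t \<in> einterval \<alpha> \<omega>" for s t
  proof -
   have "\<tau> \<in> einterval \<alpha> \<omega>" if "\<tau> \<in> {s..t}" for \<tau>
    using that \<open>s \<in> _\<close> \<open>t \<in> _\<close> unfolding einterval_def mem_Collect_eq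
    by (meson atLeastAtMost_iff ereal_less_eq(3) le_less_trans less_le_trans)
   then show ?thesis using h unfolding horbit_def by (meson DERIV_continuous continuous_at_imp_continuous_on)
  qed
  have "\<exists>t\<in>einterval \<alpha> \<omega>. x t = z & y t = yy z"
  proof (cases "z >= 0")
   case True
   obtain t where t: "r <= t" "ereal t < \<omega>" "x t > z" using R(3) by blast
   have tI: "t \<in> einterval \<alpha> \<omega>" using t r by (auto simp: einterval_def intro: less_le_trans)
   obtain s where s: "r <= s" "s <= t" "x s = z"
    using IVT'[of x r z t] xc[OF r(1) tI] True t r by auto
   have "ereal s < \<omega>" using s t by (meson ereal_less_eq(3) le_less_trans)
   moreover have "\<alpha> < ereal s" using s r by (auto simp: einterval_def intro: less_le_trans)
   ultimately show ?thesis using R(2)[of s] s True by (intro bexI[of _ s]) (auto simp: yy_def einterval_def)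
  next
   case False
   obtain t where t: "r' <= t" "ereal t < - \<alpha>" "x' t > - z" using L(3) by blast
   then have t': "- t <= q" "\<alpha> < ereal (- t)" "x (- t) < z" using neg[of "- t"] by (auto simp: q_def x'_def)
   have "ereal (- t) <= ereal q" "ereal q < \<omega>" using t' q by (auto simp: einterval_def)
   then have tI: "- t \<in> einterval \<alpha> \<omega>" using t' unfolding einterval_def mem_Collect_eq by (blast intro: le_less_trans)
   obtain s where s: "- t <= s" "s <= q" "x s = z"
    using IVT'[of x "- t" z q] xc[OF tI q(1)] False t' q by auto
   have "\<alpha> < ereal s" using s t' by (meson ereal_less_eq(3) less_le_trans)
   moreover have "ereal s <= ereal q" "ereal q < \<omega>" using s q by (auto simp: einterval_def)
   then have "ereal s < \<omega>" by (rule le_less_trans)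
   ultimately show ?thesis using graphL[of s] s False by (intro bexI[of _ s]) (auto simp: yy_def einterval_def)
  qed
  then show "w \<in> \<Gamma>" using G w \<gamma> by (metis imageI)
 qed
 ultimately show ?thesis using that pp lg unfolding F_def by blast
qed

section \<open>Arcs near the loop\<close>

lemma hsol_halfline:
 assumes "hsol F {0..} x y"
 shows "hsol F {0..T} x y" "continuous_on {0..T} x" "continuous_on {0..T} y"
  "t > 0 ==> (x has_real_derivative F (x t) - y t) (at t)" "t > 0 ==> (y has_real_derivative x t) (at t)"
proof -
 show h: "hsol F {0..T} x y" for T using hsol_subset[OF assms] by auto
 then show "continuous_on {0..T} x" "continuous_on {0..T} y" using hsol_continuous by blast+
 show "t > 0 ==> (x has_real_derivative F (x t) - y t) (at t)" "t > 0 ==> (y has_real_derivative x t) (at t)"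
  using hsol_at_interval[OF h[of "t + 1"], of t] by auto
qed

lemma hsol_halfline_shift:
 assumes "hsol F {0..} x y" "r >= 0"
 shows "hsol F {0..} (%t. x (r + t)) (%t. y (r + t))"
proof -
 have h: "hsol F {0..T - r} (%t. x (r + t)) (%t. y (r + t))" for T
  using hsol_shift[OF hsol_halfline(1)[OF assms(1)] assms(2)] .
 show ?thesis unfolding hsol_def
 proof
  fix t :: real assume t: "t \<in> {0..}"
  have w: "at t within {0..t + 1 + r - r} = at t within {0..}"
   by (rule at_within_nhd[of t "{..<t + 1}"]) auto
  have "t \<in> {0..t + 1 + r - r}" using t by auto
  then show "((%t. x (r + t)) has_real_derivative F (x (r + t)) - y (r + t)) (at t within {0..}) &
    ((%t. y (r + t)) has_real_derivative x (r + t)) (at t within {0..})"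
   using h[of "t + 1 + r"] unfolding hsol_def w[symmetric] by blast
 qed
qed

lemma loop_gap_pos:
 assumes l: "loopg F yy" and F: "continuous_on UNIV F" and h: "hsol F {0..} x y" and 0: "y 0 > yy (x 0)" and t: "t >= 0"
 shows "y t > yy (x t)"
 using loop_gap_sgn[OF l F hsol_halfline(1)[OF h] t] 0 by (simp add: sgn_if split: if_splits)

lemma loop_gap_deriv_halfline:
 assumes l: "loopg F yy" and h: "hsol F {0..} x y" and t: "t > 0"
 shows "((%t. y t - yy (x t)) has_real_derivative x t / (F (x t) - yy (x t)) * (y t - yy (x t))) (at t)"
 using loop_gap_derivative[OF l hsol_halfline(1)[OF h, of "t + 1"], of t] t by (simp add: interior_atLeastAtMost_real)

lemma hsol_mono:
 assumes h: "hsol F {0..} x y" and x: "!!t. a < t ==> t < b ==> x t >= 0" and ab: "0 <= a" "a <= b"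
 shows "y a <= y b"
proof -
 have "y b >= y a + 0 * (b - a)"
  by (rule increment_ge[OF ab(2) _ hsol_halfline(5)[OF h]])
    (use ab x in \<open>auto intro: continuous_on_subset[OF hsol_halfline(3)[OF h, of b]]\<close>)
 then show ?thesis by simp
qed

text \<open>If x stayed positive, y would increase and the gap to the loop would grow exponentially
  in y. As long as x is bounded away from 0 this drives the gap above U, where x decreases at unit
  speed; and for small x the curve is far below y, so x reaches 0.\<close>

lemma loop_return:
 assumes l: "loopg (quart a b c d) yy" and h: "hsol (quart a b c d) {0..} x y"
  and 0: "x 0 > 0" "y 0 > 0" "y 0 > yy (x 0)"
 obtains T where "T > 0" "x T = 0" "!!t. 0 <= t ==> t < T ==> x t > 0"
proof -
 define F where "F = quart a b c d"
 have Fc: "continuous_on UNIV F" unfolding F_def by (intro continuous_intros)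
 note l = l[folded F_def] and h = h[folded F_def]
 obtain U where U: "U > 0" "!!x. F x - yy x <= U" using loopg_bound_pos[OF l] by metis
 have u: "F x - yy x > 0" for x using l by (simp add: loopg_def)
 note xd = hsol_halfline(4)[OF h] and yd = hsol_halfline(5)[OF h]
 have xc: "continuous_on {p..q} x" "continuous_on {p..q} y" if "p >= 0" for p q
  using that hsol_halfline(2,3)[OF h, of q] by (auto elim: continuous_on_subset)
 have "\<exists>t\<ge>0. x t <= 0"
 proof (rule ccontr)
  assume "\<not> (\<exists>t\<ge>0. x t <= 0)"
  then have pos: "x t > 0" if "t >= 0" for t using that by force
  have ym: "y s <= y t" if st: "0 <= s" "s <= t" for s t
  proof (rule hsol_mono[OF h _ st])
   show "x r >= 0" if "s < r" "r < t" for r using pos[of r] that st by simp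
  qed
  define g where "g = (%t. y t - yy (x t))"
  have g: "g t > 0" if "t >= 0" for t using loop_gap_pos[OF l Fc h 0(3) that] by (simp add: g_def)
  have gd: "(g has_real_derivative x t / (F (x t) - yy (x t)) * g t) (at t)" if "t > 0" for t
   unfolding g_def by (rule loop_gap_deriv_halfline[OF l h that])
  have gc: "continuous_on {p..q} g" if "p >= 0" for p q unfolding g_def
   using that loop_gap_continuous[OF l hsol_halfline(1)[OF h, of q]] by (auto elim: continuous_on_subset)
  have gm: "g s <= g t" if "0 <= s" "s <= t" for s t
  proof -
   have "g t >= g s + 0 * (t - s)"
   proof (rule increment_ge[OF that(2) gc[OF that(1)] gd])
    fix r assume r: "s < r" "r < t"
    have "0 < x r / (F (x r) - yy (x r)) * g r" using pos[of r] u[of "x r"] g[of r] that r by simp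
    then show "0 <= x r / (F (x r) - yy (x r)) * g r" by simp
   qed (use that in auto)
   then show ?thesis by simp
  qed
  \<comment> \<open>Along the orbit dg / dy = g / (F x - yy x) >= g / U.\<close>
  have ge: "g t >= g 0 * exp ((y t - y 0) / U)" if t: "t >= 0" for t
  proof -
   have "g t * exp (- y t / U) >= g 0 * exp (- y 0 / U) + 0 * (t - 0)"
   proof (rule increment_ge[OF t, of "%t. g t * exp (- y t / U)"
      "%t. (x t / (F (x t) - yy (x t)) * g t - x t / U * g t) * exp (- y t / U)"])
    show "continuous_on {0..t} (%t. g t * exp (- y t / U))" using U by (intro continuous_intros gc xc) auto
    fix r assume r: "0 < r" "r < t"
    note D = gd[OF r(1)] yd[OF r(1)]
    show "((%t. g t * exp (- y t / U)) has_real_derivative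
      (x r / (F (x r) - yy (x r)) * g r - x r / U * g r) * exp (- y r / U)) (at r)"
     using D U by (auto intro!: derivative_eq_intros simp: algebra_simps)
    have "x r / U <= x r / (F (x r) - yy (x r))"
     using U(2)[of "x r"] u[of "x r"] U(1) pos[of r] r by (intro divide_left_mono) auto
    then have "x r / U * g r <= x r / (F (x r) - yy (x r)) * g r" using g[of r] r by (intro mult_right_mono) auto
    then show "0 <= (x r / (F (x r) - yy (x r)) * g r - x r / U * g r) * exp (- y r / U)" by simp
   qed
   then have "g 0 * exp (- y 0 / U) * exp (y t / U) <= g t * exp (- y t / U) * exp (y t / U)" by simp
   then show ?thesis by (simp add: mult.assoc exp_add[symmetric] diff_divide_distrib)
  qed
  obtain K where K: "K >= 0" "!!x. \<bar>x\<bar> <= 1 ==> \<bar>F x\<bar> <= K * \<bar>x\<bar>"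
   using quart_linear_bound[of 1 a b c d] unfolding F_def by metis
  \<comment> \<open>On {0..\<xi>} the curve stays below y 0 / 2, so there x decreases with speed at
    least y 0 / 2.\<close>
  define \<xi> where "\<xi> = min 1 (y 0 / (2 * (K + 1)))"
  have \<xi>: "\<xi> > 0" "\<xi> <= 1" using 0 K by (auto simp: \<xi>_def)
  have F\<xi>: "F z <= y 0 / 2" if z: "0 <= z" "z <= \<xi>" for z
  proof -
   have "F z <= K * z" using K(2)[of z] z \<xi> by (auto simp: abs_le_iff)
   also have "\<dots> <= (K + 1) * \<xi>" using z K by (intro mult_mono) auto
   also have "\<dots> <= (K + 1) * (y 0 / (2 * (K + 1)))" using K by (intro mult_left_mono) (auto simp: \<xi>_def)
   also have "\<dots> = y 0 / 2" using K by (simp add: field_simps)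
   finally show ?thesis .
  qed
  have "\<exists>t1\<ge>0. x t1 < \<xi>"
  proof (rule ccontr)
   assume "\<not> (\<exists>t1\<ge>0. x t1 < \<xi>)"
   then have x\<xi>: "x t >= \<xi>" if "t >= 0" for t using that by force
   \<comment> \<open>With x >= \<xi> this makes (y t - y 0) / U at least (U + 1) / g 0; exp z >= z
     then lifts the gap to U + 1, and x' <= - 1 from there on.\<close>
   define t where "t = U * ((U + 1) / g 0) / \<xi>"
   have t: "t >= 0" using U g[of 0] \<xi> by (simp add: t_def)
   have "y t >= y 0 + \<xi> * (t - 0)" by (rule increment_ge[OF t xc(2) yd]) (use x\<xi> in auto)
   then have "(y t - y 0) / U >= (U + 1) / g 0" using U \<xi> by (simp add: t_def pos_le_divide_eq mult.commute)
   then have "exp ((y t - y 0) / U) >= (U + 1) / g 0" using exp_ge_add_one_self[of "(y t - y 0) / U"] by linarith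
   then have "g 0 * exp ((y t - y 0) / U) >= U + 1" using g[of 0] by (simp add: pos_divide_le_eq mult.commute)
   then have gt: "g t >= U + 1" using ge[OF t] by linarith
   have "x (t + (x t + 1)) <= x t + (- 1) * (t + (x t + 1) - t)"
   proof (rule increment_le[OF _ xc(1)[OF t] xd])
    fix r assume r: "t < r" "r < t + (x t + 1)"
    show "F (x r) - y r <= - 1" using gm[of t r] gt U(2)[of "x r"] r t by (auto simp: g_def)
   qed (use pos[OF t] t in auto)
   then show False using pos[of "t + (x t + 1)"] pos[OF t] t by auto
  qed
  then obtain t1 where t1: "t1 >= 0" "x t1 < \<xi>" by blast
  have xl: "x t < \<xi>" if t: "t >= t1" for t
  proof (rule ccontr)
   assume n: "\<not> x t < \<xi>"
   obtain z where z: "t1 < z" "z <= t" "\<xi> - x z = 0" "!!s. t1 <= s ==> s < z ==> \<xi> - x s > 0"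
    by (rule first_zero[of t1 t "%s. \<xi> - x s"]) (use t t1 n in \<open>auto intro!: continuous_intros xc\<close>)
   have "x z <= x t1 + 0 * (z - t1)"
   proof (rule increment_le[OF _ xc(1)[OF t1(1)] xd])
    fix r assume r: "t1 < r" "r < z"
    have "F (x r) <= y 0 / 2" by (rule F\<xi>) (use pos[of r] z(4)[of r] r t1 in auto)
    then show "F (x r) - y r <= 0" using ym[of 0 r] r t1 0 by auto
   qed (use z t1 in auto)
   then show False using z t1 by simp
  qed
  define t where "t = t1 + 2 * \<xi> / y 0 + 1"
  have t: "t >= t1" using \<xi> 0 by (simp add: t_def)
  have "x t <= x t1 + (- (y 0 / 2)) * (t - t1)"
  proof (rule increment_le[OF t xc(1)[OF t1(1)] xd])
   fix r assume r: "t1 < r" "r < t"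
   have "F (x r) <= y 0 / 2" by (rule F\<xi>) (use pos[of r] xl[of r] r t1 in auto)
   then show "F (x r) - y r <= - (y 0 / 2)" using ym[of 0 r] r t1 by auto
  qed (use t1 in auto)
  also have "(- (y 0 / 2)) * (t - t1) = - \<xi> - y 0 / 2" using 0 by (simp add: t_def field_simps)
  finally show False using t1 pos[of t] t 0 by auto
 qed
 then obtain t where t: "t >= 0" "x t <= 0" by blast
 show ?thesis by (rule first_zero[OF t(1) xc(1)]) (use 0 t that in auto)
qed

text \<open>On a bounded piece of the loop x moves right at a speed bounded below as long as the gap
  is small, so the passage takes bounded time and the gap grows at most by a fixed factor. This
  linear control of the gap is what the later quantitative comparison uses.\<close>

lemma loop_follow:
 assumes lead: "lead a b c" and l: "loopg (quart a b c d) yy" and e: "e > 0"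
 obtains \<delta> Cg where "\<delta> > 0" "Cg >= 1" "!!x y. hsol (quart a b c d) {0..} x y ==> 0 <= x 0 ==> x 0 <= Xb ==>
  yy (x 0) < y 0 ==> y 0 < yy (x 0) + \<delta> ==>
  \<exists>r>0. y r >= y3 & (\<forall>t. 0 < t & t <= r --> x t > 0) &
   (\<forall>t. 0 <= t & t <= r --> y t - yy (x t) < e & y 0 - yy (x 0) <= y t - yy (x t) &
     y t - yy (x t) <= Cg * (y 0 - yy (x 0)))"
proof -
 define F where "F = quart a b c d"
 have Fc: "continuous_on S F" for S unfolding F_def by (intro continuous_intros)
 note l = l[folded F_def]
 have u: "F x - yy x > 0" for x using l by (simp add: loopg_def)
 obtain k C where k: "k > 0" "!!x. yy x >= k * x^2 - C" using loopg_quadratic[OF lead l[unfolded F_def]] by metis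
 have "filterlim (%x. k * x^2 - C) at_top at_top" using k by real_asymp
 then obtain X0 where X0: "!!x. x >= X0 ==> k * x^2 - C >= y3"
  unfolding filterlim_at_top eventually_at_top_linorder by meson
 define X3 where "X3 = max X0 (max Xb 0 + 1)"
 have X3: "X3 > 0" "Xb < X3" "yy X3 >= y3" using X0[of X3] k(2)[of X3] by (auto simp: X3_def)
 \<comment> \<open>The interval extends to - 1 because the Gronwall argument for x >= 0 needs x' >=
   0 also at slightly negative x.\<close>
 have "\<exists>z\<in>{-1..X3}. \<forall>w\<in>{-1..X3}. F z - yy z <= F w - yy w"
  by (rule continuous_attains_inf) (use X3 in \<open>auto intro!: continuous_on_diff Fc loopg_continuous[OF l]\<close>)
 then obtain z0 where z0: "!!w. w \<in> {-1..X3} ==> F z0 - yy z0 <= F w - yy w" by blast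
 define m where "m = F z0 - yy z0"
 have m: "m > 0" "!!w. - 1 <= w ==> w <= X3 ==> m <= F w - yy w" using u[of z0] z0 by (auto simp: m_def)
 \<comment> \<open>With the gap below m / 2 one has x' >= m / 2, so X3 is passed within time
   \<Theta>; K bounds the growth rate of the gap there, whence the factor exp (K *
   \<Theta>).\<close>
 define K \<Theta> where "K = X3 / m" and "\<Theta> = 2 * X3 / m"
 have K: "K > 0" "\<Theta> > 0" using X3 m by (auto simp: K_def \<Theta>_def)
 define e' where "e' = min e (m / 2)"
 have e': "e' > 0" "e' <= e" "e' <= m / 2" using e m by (auto simp: e'_def)
 define Cg where "Cg = exp (K * \<Theta>)"
 have Cg: "Cg >= 1" using K by (simp add: Cg_def)
 show ?thesis
 proof (rule that[of "e' / Cg" Cg])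
  fix x y
  assume h: "hsol (quart a b c d) {0..} x y" and 0: "0 <= x 0" "x 0 <= Xb" "yy (x 0) < y 0" "y 0 < yy (x 0) + e' / Cg"
  note h = h[folded F_def]
  define g where "g = (%t. y t - yy (x t))"
  have g: "g t > 0" if "t >= 0" for t using loop_gap_pos[OF l Fc h 0(3) that] by (simp add: g_def)
  have gd: "(g has_real_derivative x t / (F (x t) - yy (x t)) * g t) (at t)" if "t > 0" for t
   unfolding g_def by (rule loop_gap_deriv_halfline[OF l h that])
  have gc: "continuous_on {p..q} g" if "p >= 0" for p q unfolding g_def
   using that loop_gap_continuous[OF l hsol_halfline(1)[OF h, of q]] by (auto elim: continuous_on_subset)
  note xd = hsol_halfline(4)[OF h]
  have xc: "continuous_on {p..q} x" if "p >= 0" for p q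
   using that hsol_halfline(2)[OF h, of q] by (auto elim: continuous_on_subset)
  have eC: "e' / Cg <= e'" using Cg e' by (simp add: divide_le_eq)
  have g0: "g 0 < e' / Cg" using 0 by (simp add: g_def)
  \<comment> \<open>Positive while the orbit is left of X3 with gap below e'; its first zero r turns
    out to be the passage through X3.\<close>
  define w where "w = (%t. min (X3 - x t) (e' - g t))"
  have w0: "w 0 > 0" using 0 X3 g0 eC by (auto simp: w_def)
  have wc: "continuous_on {0..q} w" for q unfolding w_def by (intro continuous_intros xc gc) auto
  have xge: "x t >= 0" if t: "0 <= t" "!!s. 0 <= s ==> s < t ==> w s > 0" for t
  proof -
   have "- x t <= 0"
   proof (rule gronwall_nonpos[OF t(1), of "%t. - x t" "%t. - (F (x t) - y t)" e'])
    show "continuous_on {0..t} (%t. - x t)" by (intro continuous_intros xc) auto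
    fix s assume s: "0 < s" "s < t"
    show "((%t. - x t) has_real_derivative - (F (x s) - y s)) (at s)" using DERIV_minus[OF xd[OF s(1)]] .
    assume "0 < - x s"
    have ws: "x s < X3" "g s < e'" using t(2)[of s] s by (auto simp: w_def)
    show "- (F (x s) - y s) <= e' * - x s"
    proof (cases "x s >= - 1")
     case True
     then have "m <= F (x s) - yy (x s)" using m(2)[of "x s"] ws by simp
     then have "- (F (x s) - y s) <= 0" using ws(2) e' m(1) unfolding g_def by linarith
     also have "0 <= e' * - x s" using e'(1) \<open>0 < - x s\<close> by (intro mult_nonneg_nonneg) auto
     finally show ?thesis .
    next
     case False
     have "- (F (x s) - y s) <= e'" using u[of "x s"] ws by (auto simp: g_def)
     also have "e' * 1 <= e' * - x s" using False e'(1) by (intro mult_left_mono) auto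
     then have "e' <= e' * - x s" by simp
     finally show ?thesis .
    qed
   qed (use 0 in simp)
   then show ?thesis by simp
  qed
  have xinc: "x t >= x 0 + m / 2 * (t - 0)" if t: "0 <= t" "!!s. 0 <= s ==> s < t ==> w s > 0" for t
  proof (rule increment_ge[OF t(1) xc xd])
   fix s assume s: "0 < s" "s < t"
   have "x s >= 0" "x s < X3" "g s < e'" using xge[of s] t(2)[of s] t(2) s by (auto simp: w_def)
   then show "m / 2 <= F (x s) - y s" using m(2)[of "x s"] e' by (auto simp: g_def)
  qed auto
  have "\<not> w \<Theta> > 0 \<or> (\<exists>s. 0 <= s & s < \<Theta> & \<not> w s > 0)"
  proof (rule ccontr)
   assume "\<not> (\<not> w \<Theta> > 0 \<or> (\<exists>s. 0 <= s & s < \<Theta> & \<not> w s > 0))"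
   then have "x \<Theta> >= x 0 + m / 2 * (\<Theta> - 0)" "w \<Theta> > 0" using xinc[of \<Theta>] K by auto
   moreover have "m / 2 * (\<Theta> - 0) = X3" using m by (simp add: \<Theta>_def)
   ultimately show False using 0 by (auto simp: w_def)
  qed
  then obtain q where q: "0 <= q" "q <= \<Theta>" "w q <= 0" using K by (auto simp: not_less intro: less_imp_le)
  obtain r where r: "0 < r" "r <= q" "w r = 0" "!!s. 0 <= s ==> s < r ==> w s > 0"
   using first_zero[OF q(1) wc w0 q(3)] by blast
  have xr: "x t >= 0" "x t >= x 0 + m / 2 * t" "x t <= X3" if "0 <= t" "t <= r" for t
   using xge[of t] xinc[of t] r that by (auto simp: w_def less_imp_le) (metis (no_types, lifting) diff_ge_0_iff_ge min.boundedE order_refl less_eq_real_def)+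
  have gg: "g 0 <= g t" "g t <= Cg * g 0" if t: "0 <= t" "t <= r" for t
  proof -
   have kk: "0 <= x s / (F (x s) - yy (x s))" "x s / (F (x s) - yy (x s)) <= K" if s: "0 < s" "s < t" for s
   proof -
    have *: "x s >= 0" "x s <= X3" "F (x s) - yy (x s) >= m" using xr[of s] m(2)[of "x s"] s t by auto
    show "0 <= x s / (F (x s) - yy (x s))" using *(1) u[of "x s"] by (intro divide_nonneg_pos) auto
    show "x s / (F (x s) - yy (x s)) <= K" unfolding K_def by (rule frac_le) (use * m X3 in auto)
   qed
   have "g t >= g 0 + 0 * (t - 0)"
   proof (rule increment_ge[OF t(1) gc gd])
    fix s assume s: "0 < s" "s < t"
    show "0 <= x s / (F (x s) - yy (x s)) * g s"
     using kk(1)[OF s] g[of s] s by (intro mult_nonneg_nonneg) auto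
   qed auto
   then show "g 0 <= g t" by simp
   have "g t * exp (- K * t) <= g 0 * exp (- K * 0) + 0 * (t - 0)"
   proof (rule increment_le[OF t(1), of "%t. g t * exp (- K * t)"
      "%t. (x t / (F (x t) - yy (x t)) * g t - K * g t) * exp (- K * t)"])
    show "continuous_on {0..t} (%t. g t * exp (- K * t))" by (intro continuous_intros gc) auto
    fix s assume s: "0 < s" "s < t"
    note D = gd[OF s(1)]
    show "((%t. g t * exp (- K * t)) has_real_derivative
      (x s / (F (x s) - yy (x s)) * g s - K * g s) * exp (- K * s)) (at s)"
     using D by (auto intro!: derivative_eq_intros simp: algebra_simps)
    show "(x s / (F (x s) - yy (x s)) * g s - K * g s) * exp (- K * s) <= 0"
     using mult_right_mono[OF kk(2)[OF s], of "g s"] g[of s] s by (simp add: mult_le_0_iff)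
   qed
   then have "g t <= g 0 * exp (K * t)" by (simp add: exp_minus field_simps)
   also have "\<dots> <= g 0 * Cg" unfolding Cg_def using g[of 0] t r q K by (intro mult_left_mono) auto
   finally show "g t <= Cg * g 0" by (simp add: mult.commute)
  qed
  have "Cg * g 0 < e'" using g0 Cg by (simp add: pos_less_divide_eq mult.commute)
  then have ge: "g t < e'" if "0 <= t" "t <= r" for t using gg(2)[OF that] by linarith
  have "x r = X3" using r(3) ge[of r] r(1) by (auto simp: w_def min_def split: if_splits)
  then have "y r >= y3" using g[of r] r X3 by (simp add: g_def)
  moreover have "x t > 0" if "0 < t" "t <= r" for t
  proof -
   have "m / 2 * t > 0" using m that by simp
   then show ?thesis using xr(2)[of t] that 0 by linarith
  qed
  ultimately show "\<exists>r>0. y r >= y3 & (\<forall>t. 0 < t & t <= r --> x t > 0) &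
   (\<forall>t. 0 <= t & t <= r --> y t - yy (x t) < e & y 0 - yy (x 0) <= y t - yy (x t) &
     y t - yy (x t) <= Cg * (y 0 - yy (x 0)))"
   using r(1) gg ge e' by (intro exI[of _ r]) (fastforce simp: g_def)
 qed (use e' Cg in auto)
qed

text \<open>The half return map as a relation: an excursion through x > 0 from (0, \<eta>) to (0,
  Y). The solution is given on the whole half line so that it can be followed past T.\<close>

definition arc :: "(real \<Rightarrow> real) \<Rightarrow> real \<Rightarrow> real \<Rightarrow> bool" where
 "arc F \<eta> Y \<longleftrightarrow> (\<exists>T x y. T > 0 & hsol F {0..} x y & x 0 = 0 & y 0 = \<eta> & x T = 0 & y T = Y &
   (\<forall>t. 0 < t & t < T --> x t > 0))"

text \<open>Orbits starting just above the loop follow it to any prescribed height before they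
  return, so Y tends to infinity as \<eta> decreases to yy 0.\<close>

lemma arc_exists:
 assumes lead: "lead a b c" and l: "loopg (quart a b c d) yy"
 obtains \<eta>1 where "\<eta>1 > yy 0" "!!\<eta>. yy 0 < \<eta> ==> \<eta> < \<eta>1 ==>
  (\<exists>Y. arc (quart a b c d) \<eta> Y) & (\<forall>Y. arc (quart a b c d) \<eta> Y --> Y >= y3)"
proof -
 define F where "F = quart a b c d"
 have Fc: "continuous_on S F" for S unfolding F_def by (intro continuous_intros)
 define y4 where "y4 = max y3 1"
 obtain \<delta> Cg where \<delta>: "\<delta> > 0" and fol: "!!x y. hsol F {0..} x y ==> 0 <= x 0 ==> x 0 <= 0 ==>
  yy (x 0) < y 0 ==> y 0 < yy (x 0) + \<delta> ==> \<exists>r>0. y r >= y4 & (\<forall>t. 0 < t & t <= r --> x t > 0)"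
  using loop_follow[OF lead l, of 1 0 y4] unfolding F_def by (metis zero_less_one)
 show ?thesis
 proof (rule that[of "yy 0 + \<delta>"])
  fix \<eta> assume \<eta>: "yy 0 < \<eta>" "\<eta> < yy 0 + \<delta>"
  obtain x y where xy: "x 0 = 0" "y 0 = \<eta>" "hsol F {0..} x y"
   using loop_global[OF lead l, of 0 \<eta>] \<eta> unfolding F_def by auto
  obtain r where r: "r > 0" "y r >= y4" "!!t. 0 < t ==> t <= r ==> x t > 0"
   using fol[OF xy(3)] xy \<eta> by auto
  have gr: "y r > yy (x r)" using loop_gap_pos[OF l[folded F_def] Fc xy(3), of r] xy \<eta> r by simp
  have hs: "hsol F {0..} (%t. x (r + t)) (%t. y (r + t))" by (rule hsol_halfline_shift[OF xy(3)]) (use r in simp)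
  obtain T where T: "T > 0" "x (r + T) = 0" "!!t. 0 <= t ==> t < T ==> x (r + t) > 0"
   using loop_return[OF l hs[unfolded F_def]] r gr by (auto simp: y4_def)
  have pos: "x t > 0" if "0 < t" "t < r + T" for t
   using r(3)[of t] T(3)[of "t - r"] that by (cases "t <= r") auto
  have "arc F \<eta> (y (r + T))" unfolding arc_def
   using xy T r pos by (intro exI[of _ "r + T"] exI[of _ x] exI[of _ y]) auto
  moreover have "Y >= y3" if A: "arc F \<eta> Y" for Y
  proof -
   obtain T' x' y' where T': "T' > 0" "hsol F {0..} x' y'" "x' 0 = 0" "y' 0 = \<eta>" "x' T' = 0" "y' T' = Y"
    "!!t. 0 < t ==> t < T' ==> x' t > 0" using A unfolding arc_def by metis
   have eq: "x' t = x t & y' t = y t" if "t >= 0" for t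
    using hsol_unique[of a b c d t x' y' x y t] hsol_halfline(1)[OF T'(2), of t] hsol_halfline(1)[OF xy(3), of t] T' xy that
    by (simp add: F_def)
   have "r < T'" using r(3)[of T'] T' eq[of T'] by (cases "T' <= r") auto
   then have "y' r <= y' T'"
    by (intro hsol_mono[OF T'(2)]) (use T'(7) r in \<open>auto simp: less_imp_le\<close>)
   then show "Y >= y3" using r eq[of r] T' by (auto simp: y4_def)
  qed
  ultimately show "(\<exists>Y. arc (quart a b c d) \<eta> Y) & (\<forall>Y. arc (quart a b c d) \<eta> Y --> Y >= y3)"
   unfolding F_def by blast
 qed (use \<delta> in auto)
qed

lemma arc_unique:
 assumes "arc (quart a b c d) \<eta> Y" "arc (quart a b c d) \<eta> Y'"
 shows "Y = Y'"
proof -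
 obtain T x y where T: "T > 0" "hsol (quart a b c d) {0..} x y" "x 0 = 0" "y 0 = \<eta>" "x T = 0" "y T = Y"
  "!!t. 0 < t ==> t < T ==> x t > 0" using assms(1) unfolding arc_def by metis
 obtain T' x' y' where T': "T' > 0" "hsol (quart a b c d) {0..} x' y'" "x' 0 = 0" "y' 0 = \<eta>" "x' T' = 0" "y' T' = Y'"
  "!!t. 0 < t ==> t < T' ==> x' t > 0" using assms(2) unfolding arc_def by metis
 have eq: "x' t = x t & y' t = y t" if "t >= 0" for t
  using hsol_unique[of a b c d t x' y' x y t] hsol_halfline(1)[OF T'(2), of t] hsol_halfline(1)[OF T(2), of t] T' T that
  by simp
 have "T = T'" using T(5,7) T'(5,7) eq T(1) T'(1) by (metis less_irrefl linorder_neqE_linordered_idom less_imp_le)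
 then show ?thesis using eq T T' by auto
qed

text \<open>Both ends of the arc are transversal to the axis: x' = - \<eta> > 0 at the start and x'
  = - Y < 0 at the end. So the return time, and with it Y, depends continuously on \<eta>.\<close>

lemma arc_continuous:
 assumes lead: "lead a b c" and l: "loopg (quart a b c d) yy" and A: "arc (quart a b c d) \<eta> Y"
  and \<eta>: "\<eta> < 0" "Y > 0" and e: "e > 0"
 obtains \<delta> where "\<delta> > 0" "!!\<eta>'. \<bar>\<eta>' - \<eta>\<bar> < \<delta> ==> yy 0 < \<eta>' ==> \<exists>Y'. arc (quart a b c d) \<eta>' Y' & \<bar>Y' - Y\<bar> < e"
proof -
 define F where "F = quart a b c d"
 have F0: "F 0 = 0" by (simp add: F_def)
 obtain T x y where T: "T > 0" "hsol F {0..} x y" "x 0 = 0" "y 0 = \<eta>" "x T = 0" "y T = Y"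
  "!!t. 0 < t ==> t < T ==> x t > 0" using A unfolding arc_def F_def by metis
 have xc: "continuous_on {p..q} x" "continuous_on {p..q} y" if "p >= 0" for p q
  using that hsol_halfline(2,3)[OF T(2), of q] by (auto elim: continuous_on_subset)
 have "isCont y T" using DERIV_isCont[OF hsol_halfline(5)[OF T(2,1)]] .
 then obtain \<sigma>1 where \<sigma>1: "\<sigma>1 > 0" "!!t. \<bar>t - T\<bar> < \<sigma>1 ==> \<bar>y t - Y\<bar> < e / 2"
  unfolding continuous_at_eps_delta using e T(6) by (metis dist_real_def half_gt_zero)
 have "F (x T) - y T < 0" using T \<eta> F0 by simp
 from DERIV_neg_dec_right[OF hsol_halfline(4)[OF T(2,1)] this]
 obtain \<sigma>2 where \<sigma>2: "\<sigma>2 > 0" "!!h. 0 < h ==> h < \<sigma>2 ==> x (T + h) < 0" using T(5) by auto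
 have "continuous (at 0 within {0..T}) y" using xc(2)[of 0 T] T(1) by (auto simp: continuous_on_eq_continuous_within)
 then obtain \<sigma>3 where \<sigma>3: "\<sigma>3 > 0" "!!t. 0 <= t ==> t <= T ==> t < \<sigma>3 ==> \<bar>y t - \<eta>\<bar> < - \<eta> / 2"
  unfolding continuous_within_eps_delta using \<eta> T(4) by (auto simp: dist_real_def dest!: spec[of _ "- \<eta> / 2"])
 \<comment> \<open>The first zero of a nearby orbit is excluded before \<sigma> by the sign of y and
   from {\<sigma>..T - \<sigma>} by the minimum x z; it occurs by T + \<sigma>, where x is no longer
   positive.\<close>
 define \<sigma> where "\<sigma> = min (min \<sigma>1 \<sigma>2) (min \<sigma>3 T) / 3"
 have \<sigma>: "\<sigma> > 0" "\<sigma> < \<sigma>1" "\<sigma> < \<sigma>2" "\<sigma> < \<sigma>3" "2 * \<sigma> < T" using \<sigma>1 \<sigma>2 \<sigma>3 T(1) by (auto simp: \<sigma>_def)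
 have "\<exists>z\<in>{\<sigma>..T - \<sigma>}. \<forall>w\<in>{\<sigma>..T - \<sigma>}. x z <= x w"
  by (rule continuous_attains_inf) (use \<sigma> in \<open>auto intro!: xc\<close>)
 then obtain z where z: "z \<in> {\<sigma>..T - \<sigma>}" "!!w. w \<in> {\<sigma>..T - \<sigma>} ==> x z <= x w" by blast
 define e' where "e' = min (min (x z) (- x (T + \<sigma>))) (min (- \<eta> / 2) (e / 2))"
 have xz: "x z > 0" using T(7)[of z] z \<sigma> by auto
 have e': "e' > 0" using xz \<sigma>2(2)[OF \<sigma>(1,3)] \<eta> e by (simp add: e'_def)
 have e'le: "e' <= x z" "e' <= - x (T + \<sigma>)" "e' <= - \<eta> / 2" "e' <= e / 2" unfolding e'_def by linarith+
 have T\<sigma>: "T + \<sigma> >= 0" using T \<sigma> by simp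
 obtain \<delta> where \<delta>: "\<delta> > 0" and near: "!!d' x0 y0. \<bar>d' - d\<bar> < \<delta> ==> \<bar>x0 - x 0\<bar> < \<delta> ==> \<bar>y0 - y 0\<bar> < \<delta> ==>
    \<exists>x' y'. x' 0 = x0 & y' 0 = y0 & hsol (quart a b c d') {0..T + \<sigma>} x' y' &
     (\<forall>t\<in>{0..T + \<sigma>}. \<bar>x' t - x t\<bar> < e' & \<bar>y' t - y t\<bar> < e')"
  using hsol_near[OF hsol_halfline(1)[OF T(2)[unfolded F_def], of "T + \<sigma>"] T\<sigma> e'] by blast
 show ?thesis
 proof (rule that[of "min \<delta> (- \<eta>)"])
  fix \<eta>' assume \<eta>': "\<bar>\<eta>' - \<eta>\<bar> < min \<delta> (- \<eta>)" "yy 0 < \<eta>'"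
  obtain x1 y1 where 1: "x1 0 = 0" "y1 0 = \<eta>'" "hsol F {0..T + \<sigma>} x1 y1"
   "!!t. t \<in> {0..T + \<sigma>} ==> \<bar>x1 t - x t\<bar> < e' & \<bar>y1 t - y t\<bar> < e'"
   using near[of d 0 \<eta>'] \<eta>' \<delta> T by (auto simp: F_def)
  obtain x' y' where 2: "x' 0 = 0" "y' 0 = \<eta>'" "hsol F {0..} x' y'"
   using loop_global[OF lead l, of 0 \<eta>'] \<eta>' unfolding F_def by auto
  have eq: "x' t = x1 t & y' t = y1 t" if "t \<in> {0..T + \<sigma>}" for t
   using hsol_unique[of a b c d t x' y' x1 y1 t] hsol_halfline(1)[OF 2(3), of t] hsol_subset[OF 1(3), of "{0..t}"] 1 2 that
   by (auto simp: F_def)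
  have cl: "\<bar>x' t - x t\<bar> < e'" "\<bar>y' t - y t\<bar> < e'" if "t \<in> {0..T + \<sigma>}" for t using 1(4)[OF that] eq[OF that] by auto
  have \<eta>'0: "\<eta>' < 0" using \<eta>' by (auto simp: abs_less_iff)
  have neg: "x' (T + \<sigma>) <= 0" using cl(1)[of "T + \<sigma>"] e'le T\<sigma> by (auto simp: abs_less_iff)
  obtain z1 \<xi> where z1: "0 < z1" "z1 <= T + \<sigma>" "x' z1 = 0" "!!s. 0 < s ==> s < z1 ==> x' s > 0"
   "0 < \<xi>" "\<xi> < z1" "y' \<xi> > F (x' \<xi>)"
   using hsol_return[OF hsol_halfline(1)[OF 2(3), of "T + \<sigma>"] 2(1,2) \<eta>'0 F0 _ _ neg] T \<sigma> by auto
  have n1: "\<not> (\<sigma> <= z1 & z1 <= T - \<sigma>)"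
  proof
   assume A: "\<sigma> <= z1 & z1 <= T - \<sigma>"
   have "x' z1 > x z1 - e'" using cl(1)[of z1] z1 by (auto simp: abs_less_iff)
   then show False using z(2)[of z1] A z1 e'le by auto
  qed
  have n2: "\<not> z1 < \<sigma>"
  proof
   assume A: "z1 < \<sigma>"
   have "y' z1 < 0" using cl(2)[of z1] \<sigma>3(2)[of z1] z1 A \<sigma> e'le by (auto simp: abs_less_iff)
   then have "F (x' z1) - y' z1 > 0" using z1 F0 by simp
   from DERIV_pos_inc_left[OF hsol_halfline(4)[OF 2(3) z1(1)] this]
   obtain q where q: "q > 0" "!!h. 0 < h ==> h < q ==> x' (z1 - h) < x' z1" by auto
   define h where "h = min q z1 / 2"
   have "0 < h" "h < q" "h < z1" using q z1 by (auto simp: h_def)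
   then show False using q(2)[of h] z1(3) z1(4)[of "z1 - h"] by auto
  qed
  have z1T: "\<bar>z1 - T\<bar> < \<sigma>1" using n1 n2 z1 \<sigma> by (auto simp: abs_less_iff)
  have "z1 \<in> {0..T + \<sigma>}" using z1 by simp
  from cl(2)[OF this] have "\<bar>y' z1 - Y\<bar> < e" using \<sigma>1(2)[OF z1T] e'le(4) by linarith
  moreover have "arc F \<eta>' (y' z1)" unfolding arc_def using z1 2 by blast
  ultimately show "\<exists>Y'. arc (quart a b c d) \<eta>' Y' & \<bar>Y' - Y\<bar> < e" unfolding F_def by blast
 qed (use \<delta> \<eta> in auto)
qed

section \<open>Comparison of the two sides\<close>

text \<open>Lets an inequality between values of the curve be turned into one between abscissae,
  although F need not be monotone near 0.\<close>

lemma eventually_dominates: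
 assumes lead: "lead a b c"
 shows "eventually (%w. \<forall>z. 0 <= z & z <= w --> quart a b c d z <= quart a b c d w) at_top"
proof -
 define F where "F = quart a b c d"
 have Fc: "continuous_on S F" for S unfolding F_def by (intro continuous_intros)
 obtain g0 xB where g0: "g0 > 0" and xB: "xB > 0"
  and sl: "!!x d'. x >= xB ==> \<bar>d'\<bar> <= \<bar>d\<bar> ==> quart' a b c d' x >= g0 * x" using lead_slope[OF lead] by metis
 have inc: "F z <= F w" if "xB <= z" "z <= w" for z w
 proof -
  have "F w >= F z + 0 * (w - z)" unfolding F_def
  proof (rule increment_ge[OF that(2) _ DERIV_quart])
   fix t assume "z < t" "t < w"
   then have "g0 * t <= quart' a b c d t" "g0 * t >= 0" using sl[of t d] that xB g0 by auto
   then show "0 <= quart' a b c d t" by linarith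
  qed (intro continuous_intros)
  then show ?thesis by simp
 qed
 have "bounded (F ` {0..xB})" using compact_continuous_image[OF Fc] compact_imp_bounded by blast
 then obtain B where B: "\<forall>z\<in>F ` {0..xB}. norm z <= B" unfolding bounded_iff by blast
 obtain k C where k: "k > 0" "!!x. F x >= k * x^2 - C" using lead_lower[OF lead] unfolding F_def by metis
 have "filterlim (%x. k * x^2 - C) at_top at_top" using k by real_asymp
 then have "eventually (%x. k * x^2 - C >= B) at_top" unfolding filterlim_at_top by blast
 with eventually_ge_at_top[of xB] show ?thesis
 proof eventually_elim
  case (elim w)
  have "F z <= F w" if z: "0 <= z" "z <= w" for z
  proof (cases "z >= xB")
   case False
   then have "F z <= B" using B z by (auto simp: abs_le_iff)
   then show ?thesis using elim k(2)[of w] by linarith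
  qed (use inc z in auto)
  then show ?case by (auto simp: F_def)
 qed
qed

section \<open>Asymptotic offset of the curves and growth rates of the gaps\<close>

text \<open>The cubic coefficient vanishes at l = b / (2 a), the asymptotic horizontal offset of the
  two curves; on either side of this value its sign decides which curve is higher.\<close>

lemma quart_shift_expand:
 "quart a (- b) c (- d) (X + l) - quart a b c d X =
  (4 * a * l - 2 * b) * X^3 + (6 * a * l^2 - 3 * b * l) * X^2
  + (4 * a * l^3 - 3 * b * l^2 + 2 * c * l - 2 * d) * X + (a * l^4 - b * l^3 + c * l^2 - d * l)"
 by (simp add: quart_def power4_eq_xxxx power3_eq_cube power2_eq_square algebra_simps)

lemma quart_shift_ge:
 assumes "4 * a * l - 2 * b > 0"
 shows "eventually (%X. quart a (- b) c (- d) (X + l) - quart a b c d X > U) at_top"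
proof -
 define k where "k = 4 * a * l - 2 * b"
 have "filterlim (%X. k * X^3 + k2 * X^2 + k1 * X + k0) at_top at_top" for k2 k1 k0
  using assms unfolding k_def[symmetric] by real_asymp
 then show ?thesis unfolding quart_shift_expand k_def[symmetric] filterlim_at_top_dense by blast
qed

lemma quart_shift_le:
 assumes "4 * a * l - 2 * b < 0"
 shows "eventually (%X. quart a (- b) c (- d) (X + l) - quart a b c d X < U) at_top"
proof -
 define k where "k = 4 * a * l - 2 * b"
 have "filterlim (%X. k * X^3 + k2 * X^2 + k1 * X + k0) at_bot at_top" for k2 k1 k0
  using assms unfolding k_def[symmetric] by real_asymp
 then show ?thesis unfolding quart_shift_expand k_def[symmetric] filterlim_at_bot_dense by blast
qed

lemma quart_drop:
 assumes "a > 0" "h > 0"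
 shows "eventually (%X. quart a b c d X - quart a b c d (X - h) > U) at_top"
proof -
 have eq: "quart a b c d X - quart a b c d (X - h) = (4 * (a * h)) * X^3 + (3 * b * h - 6 * a * h^2) * X^2
   + (4 * a * h^3 - 3 * b * h^2 + 2 * c * h) * X + (b * h^3 - a * h^4 - c * h^2 + d * h)" for X
  by (simp add: quart_def power4_eq_xxxx power3_eq_cube power2_eq_square algebra_simps)
 define k where "k = 4 * (a * h)"
 have "k > 0" using assms by (simp add: k_def)
 then have "filterlim (%X. k * X^3 + k2 * X^2 + k1 * X + k0) at_top at_top" for k2 k1 k0
  by real_asymp
 then show ?thesis unfolding eq k_def[symmetric] filterlim_at_top_dense by blast
qed

text \<open>Over the height y a branch has slope (F x - y) / x. The left side is the derivative of
  the gap p between two branches, so the factor of p is the growth rate of the gap.\<close>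

lemma slope_diff:
 fixes X p u :: real
 assumes "X > 0" "p < X"
 shows "(quart a b c d X - y) / X - (quart a b c d (X - p) - y) / (X - p) =
  p * (a * (3 * X^2 - 3 * X * p + p^2) + b * (2 * X - p) + c + y / (X * (X - p)))"
proof -
 have "(quart a b c d X - y) / X = a * X^3 + b * X^2 + c * X + d - y / X"
  "(quart a b c d (X - p) - y) / (X - p) = a * (X - p)^3 + b * (X - p)^2 + c * (X - p) + d - y / (X - p)"
  using assms by (simp_all add: quart_def diff_divide_distrib add_divide_distrib power4_eq_xxxx power3_eq_cube power2_eq_square)
 moreover have "y / (X - p) - y / X = p * (y / (X * (X - p)))"
  using assms by (simp add: field_simps)
 ultimately show ?thesis
  by (simp add: power3_eq_cube power2_eq_square algebra_simps)
qed

text \<open>As y is F X up to the bounded u, the rate is 4 a X^2 + 3 b X in its two leading orders;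
  the estimate gives away b / 2 * X to be uniform in p and u.\<close>

lemma rate_lower:
 assumes ab: "a > 0" "b > 0" and U: "U >= 0"
 defines "\<epsilon> \<equiv> b / (64 * a)"
 shows "eventually (%X. \<forall>p u. 0 < p & p <= 2 * \<epsilon> & 0 <= u & u <= U -->
  a * (3 * X^2 - 3 * X * p + p^2) + b * (2 * X - p) + c + (quart a b c d X - u) / (X * (X - p))
   >= 4 * a * X^2 + 5 / 2 * b * X) at_top"
proof -
 have \<epsilon>: "\<epsilon> > 0" "a * \<epsilon> = b / 64" using ab by (auto simp: \<epsilon>_def)
 define K where "K = 2 * b * \<epsilon> - 2 * c + \<bar>d\<bar> + U"
 \<comment> \<open>Bookkeeping for the coefficient of X: of 3 b, the term 3 a X p costs 6 a
   \<epsilon> = 3 / 32 * b and the constants K cost 13 / 32 * b, which leaves 5 / 2 * b.\<close>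
 have "filterlim (%X. 13 / 32 * b * X) at_top at_top" using ab by real_asymp
 then have 1: "eventually (%X. 13 / 32 * b * X >= K) at_top" unfolding filterlim_at_top by blast
 have "filterlim (%X. quart a b c d X) at_top at_top" unfolding quart_def using ab by real_asymp
 then have 2: "eventually (%X. quart a b c d X >= U) at_top" unfolding filterlim_at_top by blast
 show ?thesis
  using 1 2 eventually_ge_at_top[of 1] eventually_gt_at_top[of "2 * \<epsilon>"]
 proof eventually_elim
  case (elim X)
  show ?case
  proof (intro allI impI, elim conjE)
   fix p u assume p: "0 < p" "p <= 2 * \<epsilon>" and u: "0 <= u" "u <= U"
   have "(quart a b c d X - U) / (X * X) <= (quart a b c d X - u) / (X * (X - p))"
    using elim p u \<epsilon> by (intro frac_le mult_left_mono) auto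
   moreover have "(quart a b c d X - U) / (X * X) = a * X^2 + b * X + c + d / X - U / X^2"
    using elim by (simp add: quart_def field_simps power4_eq_xxxx power3_eq_cube power2_eq_square)
   moreover have "d / X >= - \<bar>d\<bar>"
   proof -
    have "\<bar>d / X\<bar> <= \<bar>d\<bar>" using elim by (simp add: abs_divide divide_le_eq mult_le_cancel_left1)
    then show ?thesis by linarith
   qed
   moreover have "U / X^2 <= U" using elim U by (simp add: divide_le_eq mult_le_cancel_left1)
   moreover have "3 * (a * X * p) <= 3 * (a * X * (2 * \<epsilon>))" using ab elim p by (intro mult_left_mono) auto
   moreover have "3 * (a * X * (2 * \<epsilon>)) = 6 * (a * \<epsilon>) * X" by simp
   moreover have "a * p^2 >= 0" using ab by simp
   moreover have "b * p <= b * (2 * \<epsilon>)" using ab p by (intro mult_left_mono) auto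
   moreover have "a * (3 * X^2 - 3 * X * p + p^2) + b * (2 * X - p) = 3 * (a * X^2) - 3 * (a * X * p) + a * p^2 + 2 * (b * X) - b * p"
    by (simp add: algebra_simps)
   ultimately show "a * (3 * X^2 - 3 * X * p + p^2) + b * (2 * X - p) + c + (quart a b c d X - u) / (X * (X - p))
    >= 4 * a * X^2 + 5 / 2 * b * X"
    using elim(1) unfolding K_def \<epsilon>(2) by linarith
  qed
 qed
qed

text \<open>The counterpart for - b, with leading terms 4 a X^2 - 3 b X. Of the four units of a
  \<epsilon>, three bound the quotient and the fourth absorbs the constants.\<close>

lemma rate_upper:
 fixes a b c d :: real
 assumes ab: "a > 0" "b > 0"
 defines "\<epsilon> \<equiv> b / (64 * a)"
 shows "eventually (%X. \<forall>q u::real. 0 < q & q <= 2 * \<epsilon> & 0 <= u -->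
  a * (3 * X^2 - 3 * X * q + q^2) + (- b) * (2 * X - q) + c + (quart a (- b) c (- d) X - u) / (X * (X - q))
   <= 4 * a * X^2 + (4 * a * \<epsilon> - 3 * b) * X) at_top"
proof -
 have \<epsilon>: "\<epsilon> > 0" using ab by (simp add: \<epsilon>_def)
 define k where "k = a * \<epsilon>"
 have k: "k > 0" using ab \<epsilon> by (simp add: k_def)
 define K where "K = 4 * a * \<epsilon>^2 + 2 * \<epsilon> * b + c"
 have "filterlim (%X. k * X) at_top at_top" using k by real_asymp
 then have 1: "eventually (%X. k * X >= K) at_top" unfolding filterlim_at_top by blast
 have "filterlim (%X. k * X^3 - k2 * X^2 + d * X) at_top at_top" for k2 using k by real_asymp
 then have 2: "eventually (%X. k * X^3 - (c + 2 * \<epsilon> * (3 * k - b)) * X^2 + d * X >= 0) at_top"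
  unfolding filterlim_at_top by blast
 have "filterlim (%X. quart a (- b) c (- d) X) at_top at_top" unfolding quart_def using ab by real_asymp
 then have 3: "eventually (%X. quart a (- b) c (- d) X >= 0) at_top" unfolding filterlim_at_top by blast
 show ?thesis
  using 1 2 3 eventually_ge_at_top[of 1] eventually_gt_at_top[of "2 * \<epsilon>"]
 proof eventually_elim
  case (elim X)
  have D: "X * (X - 2 * \<epsilon>) > 0" using elim by simp
  have "X * (X - 2 * \<epsilon>) * (a * X^2 + (3 * k - b) * X) - quart a (- b) c (- d) X =
    k * X^3 - (c + 2 * \<epsilon> * (3 * k - b)) * X^2 + d * X"
   unfolding quart_def k_def by (simp add: power4_eq_xxxx power3_eq_cube power2_eq_square algebra_simps)
  then have "quart a (- b) c (- d) X <= (a * X^2 + (3 * k - b) * X) * (X * (X - 2 * \<epsilon>))"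
   using elim(2) by (simp add: mult.commute)
  then have bound: "quart a (- b) c (- d) X / (X * (X - 2 * \<epsilon>)) <= a * X^2 + (3 * k - b) * X"
   using D by (simp add: pos_divide_le_eq)
  show ?case
  proof (intro allI impI, elim conjE)
   fix q u :: real assume q: "0 < q" "q <= 2 * \<epsilon>" and u: "0 <= u"
   have "(quart a (- b) c (- d) X - u) / (X * (X - q)) <= quart a (- b) c (- d) X / (X * (X - 2 * \<epsilon>))"
   proof -
    have "(quart a (- b) c (- d) X - u) / (X * (X - q)) <= quart a (- b) c (- d) X / (X * (X - q))"
     using elim q u by (intro divide_right_mono) auto
    also have "\<dots> <= quart a (- b) c (- d) X / (X * (X - 2 * \<epsilon>))"
     using elim q D by (intro divide_left_mono mult_left_mono mult_pos_pos) auto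
    finally show ?thesis .
   qed
   moreover have "a * (X * q) >= 0" using ab elim q by simp
   moreover have "a * q^2 <= a * (4 * \<epsilon>^2)"
   proof -
    have "q^2 <= (2 * \<epsilon>)^2" using q by (intro power_mono) auto
    then show ?thesis using ab by (intro mult_left_mono) (auto simp: power_mult_distrib)
   qed
   moreover have "b * q <= b * (2 * \<epsilon>)" using ab q by (intro mult_left_mono) auto
   moreover have "a * (3 * X^2 - 3 * X * q + q^2) + (- b) * (2 * X - q) = 3 * (a * X^2) - 3 * (a * (X * q)) + a * q^2 - 2 * (b * X) + b * q"
    by (simp add: algebra_simps)
   moreover have "(3 * k - b) * X = 3 * (k * X) - b * X" "(4 * a * \<epsilon> - 3 * b) * X = 4 * (k * X) - 3 * (b * X)"
    by (simp_all add: k_def algebra_simps)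
   moreover have "a * (4 * \<epsilon>^2) = 4 * a * \<epsilon>^2" "b * (2 * \<epsilon>) = 2 * \<epsilon> * b" "4 * a * X^2 = 4 * (a * X^2)" by simp_all
   ultimately show "a * (3 * X^2 - 3 * X * q + q^2) + (- b) * (2 * X - q) + c + (quart a (- b) c (- d) X - u) / (X * (X - q))
    <= 4 * a * X^2 + (4 * a * \<epsilon> - 3 * b) * X"
    using bound elim(1) unfolding K_def by linarith
  qed
 qed
qed

text \<open>For this l one has 8 a l + 4 a \<epsilon> - 3 b = 9 / 8 * b, the coefficient left after
  rewriting the rate in X1; a further 3 / 8 * b absorbs the constants. Against the 5 / 2 * b of
  \<open>rate_lower\<close> a margin of b * X1 remains.\<close>

lemma rate_shift:
 fixes a b :: real
 assumes ab: "a > 0" "b > 0"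
 defines "\<epsilon> \<equiv> b / (64 * a)"
 defines "l \<equiv> b / (2 * a) + \<epsilon> / 2"
 shows "eventually (%X1. \<forall>X2. X1 <= X2 & X2 <= X1 + l -->
  4 * a * X2^2 + (4 * a * \<epsilon> - 3 * b) * X2 <= 4 * a * X1^2 + 3 / 2 * b * X1) at_top"
proof -
 have a\<epsilon>: "a * \<epsilon> = b / 64" "a * l = b / 2 + b / 128" using ab by (auto simp: \<epsilon>_def l_def field_simps)
 define K where "K = 4 * a * l^2 + (4 * a * \<epsilon> - 3 * b) * l"
 have "filterlim (%X. 3 / 8 * b * X) at_top at_top" using ab by real_asymp
 then have 1: "eventually (%X. 3 / 8 * b * X >= K) at_top" unfolding filterlim_at_top by blast
 have "filterlim (%X. 8 * a * X - 3 * b) at_top at_top" using ab by real_asymp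
 then have 2: "eventually (%X. 8 * a * X - 3 * b >= 0) at_top" unfolding filterlim_at_top by blast
 show ?thesis using 1 2
 proof eventually_elim
  case (elim X1)
  show ?case
  proof (intro allI impI, elim conjE)
   fix X2 assume X2: "X1 <= X2" "X2 <= X1 + l"
   define f where "f = (%X. 4 * a * X^2 + (4 * a * \<epsilon> - 3 * b) * X)"
   have "f (X1 + l) - f X2 = (X1 + l - X2) * (4 * a * (X1 + l + X2) + (4 * a * \<epsilon> - 3 * b))"
    by (simp add: f_def power2_eq_square algebra_simps)
   moreover have "4 * a * (X1 + l + X2) + (4 * a * \<epsilon> - 3 * b) >= 0"
   proof -
    have "4 * (a * X1) <= 4 * (a * X2)" using ab X2 by (intro mult_left_mono) auto
    moreover have "8 * a * X1 = 8 * (a * X1)" by simp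
    moreover have "4 * a * (X1 + l + X2) + (4 * a * \<epsilon> - 3 * b) = 4 * (a * X1) + 4 * (a * X2) + 4 * (a * l) + 4 * (a * \<epsilon>) - 3 * b"
     by (simp add: algebra_simps)
    ultimately show ?thesis using elim(2) a\<epsilon> ab by linarith
   qed
   ultimately have "f X2 <= f (X1 + l)" using X2 by (smt (verit) mult_nonneg_nonneg)
   also have "f (X1 + l) = 4 * a * X1^2 + (8 * (a * l) + 4 * (a * \<epsilon>) - 3 * b) * X1 + K"
    by (simp add: f_def K_def power2_eq_square algebra_simps)
   also have "\<dots> = 4 * a * X1^2 + 9 / 8 * b * X1 + K" unfolding a\<epsilon> by (simp add: algebra_simps)
   also have "\<dots> <= 4 * a * X1^2 + 3 / 2 * b * X1" using elim(1) by (simp add: algebra_simps)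
   finally show "4 * a * X2^2 + (4 * a * \<epsilon> - 3 * b) * X2 <= 4 * a * X1^2 + 3 / 2 * b * X1" by (simp add: f_def)
  qed
 qed
qed

section \<open>Arcs as graphs over the height\<close>

text \<open>The arc rewritten as x = \<xi> z over the height z. Since y' = x > 0 on an arc, the
  height is an independent variable common to the arcs of both sides, which have no common
  time.\<close>

definition arc_graph ::
  "(real \<Rightarrow> real) \<Rightarrow> (real \<Rightarrow> real) \<Rightarrow> real \<Rightarrow> real \<Rightarrow> (real \<Rightarrow> real) \<Rightarrow> real \<Rightarrow> (real \<Rightarrow> real) \<Rightarrow> (real \<Rightarrow> real) \<Rightarrow> bool" where
 "arc_graph F yy \<eta> Y \<xi> T x y \<longleftrightarrow> T > 0 & hsol F {0..} x y & x 0 = 0 & y 0 = \<eta> & x T = 0 &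
  (\<forall>t. 0 < t & t < T --> x t > 0) & (\<forall>t. 0 < t & t < T --> y t < Y) &
  continuous_on {\<eta>..Y} \<xi> & \<xi> Y = 0 & (\<forall>t. 0 <= t & t <= T --> \<xi> (y t) = x t) &
  (\<forall>z. \<eta> < z & z < Y --> \<xi> z > 0 & (\<xi> has_real_derivative (F (\<xi> z) - z) / \<xi> z) (at z) & z > yy (\<xi> z))"

lemma arc_graphD:
 assumes "arc_graph F yy \<eta> Y \<xi> T x y"
 shows "T > 0" "hsol F {0..} x y" "x 0 = 0" "y 0 = \<eta>" "x T = 0"
  "!!t. 0 < t ==> t < T ==> x t > 0" "!!t. 0 < t ==> t < T ==> y t < Y"
  "continuous_on {\<eta>..Y} \<xi>" "\<xi> Y = 0" "!!t. 0 <= t ==> t <= T ==> \<xi> (y t) = x t"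
  "!!z. \<eta> < z ==> z < Y ==> \<xi> z > 0 & (\<xi> has_real_derivative (F (\<xi> z) - z) / \<xi> z) (at z) & z > yy (\<xi> z)"
 using assms unfolding arc_graph_def by simp_all

lemma arc_curve:
 assumes A: "arc F \<eta> Y" and l: "loopg F yy" and Fc: "continuous_on UNIV F" and \<eta>: "yy 0 < \<eta>"
 obtains \<xi> T x y where "arc_graph F yy \<eta> Y \<xi> T x y"
proof -
 obtain T x y where T: "T > 0" "hsol F {0..} x y" "x 0 = 0" "y 0 = \<eta>" "x T = 0" "y T = Y"
  "!!t. 0 < t ==> t < T ==> x t > 0" using A unfolding arc_def by metis
 note xd = hsol_halfline(4)[OF T(2)] and yd = hsol_halfline(5)[OF T(2)]
 have T0: "0 <= T" using T by simp
 obtain \<tau> where \<tau>: "continuous_on {y 0..y T} \<tau>" "!!t. t \<in> {0..T} ==> \<tau> (y t) = t"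
  "!!s. s \<in> {y 0..y T} ==> \<tau> s \<in> {0..T}" "!!s. s \<in> {y 0..y T} ==> y (\<tau> s) = s"
  "!!s. y 0 < s ==> s < y T ==> 0 < \<tau> s & \<tau> s < T & (\<tau> has_real_derivative inverse (x (\<tau> s))) (at s)"
  using inverse_on_interval[OF T0 hsol_halfline(3)[OF T(2)], of x] yd T(7) by blast
 have yT: "y t < y T" if t: "0 <= t" "t < T" for t
 proof (rule DERIV_pos_imp_increasing_open[OF t(2)])
  fix r assume "t < r" "r < T"
  then show "\<exists>D. (y has_real_derivative D) (at r) & D > 0" using yd[of r] T(7)[of r] t by auto
 qed (use t in \<open>auto intro: continuous_on_subset[OF hsol_halfline(3)[OF T(2), of T]]\<close>)
 define \<xi> where "\<xi> = (%z. x (\<tau> z))"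
 have "continuous_on {\<eta>..Y} \<xi>" unfolding \<xi>_def
  by (rule continuous_on_compose2[OF hsol_halfline(2)[OF T(2), of T]]) (use \<tau> T in auto)
 moreover have "\<xi> Y = 0" using \<tau>(2)[of T] T by (simp add: \<xi>_def)
 moreover have "\<xi> (y t) = x t" if "0 <= t" "t <= T" for t using \<tau>(2)[of t] that by (simp add: \<xi>_def)
 moreover have "\<xi> z > 0 & (\<xi> has_real_derivative (F (\<xi> z) - z) / \<xi> z) (at z) & z > yy (\<xi> z)" if z: "\<eta> < z" "z < Y" for z
 proof -
  have t: "0 < \<tau> z" "\<tau> z < T" "(\<tau> has_real_derivative inverse (x (\<tau> z))) (at z)" "y (\<tau> z) = z"
   using \<tau>(4,5)[of z] z T by auto
  have "(\<xi> has_real_derivative (F (x (\<tau> z)) - y (\<tau> z)) * inverse (x (\<tau> z))) (at z)"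
   unfolding \<xi>_def by (rule DERIV_chain2[OF xd[OF t(1)] t(3)])
  moreover have "y (\<tau> z) > yy (x (\<tau> z))"
   by (rule loop_gap_pos[OF l Fc T(2)]) (use T t \<eta> in auto)
  ultimately show ?thesis using T(7)[OF t(1,2)] t(4) by (simp add: \<xi>_def divide_inverse)
 qed
 ultimately show ?thesis using T(1-5,7) yT T(6) by (intro that[of \<xi> T x y]) (simp add: arc_graph_def)
qed

lemma sep_curve:
 assumes lead: "lead a b c" and l: "loopg (quart a b c d) yy"
 obtains X where "continuous_on {yy 0..} X" "!!x. x >= 0 ==> X (yy x) = x" "!!z. z >= yy 0 ==> X z >= 0"
  "!!z. z >= yy 0 ==> yy (X z) = z"
  "!!z. z > yy 0 ==> X z > 0 & (X has_real_derivative (quart a b c d (X z) - z) / X z) (at z)"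
proof -
 define F where "F = quart a b c d"
 note l = l[folded F_def]
 obtain k C where k: "k > 0" "!!x. yy x >= k * x^2 - C" using loopg_quadratic[OF lead l[unfolded F_def]] by metis
 have d: "(yy has_real_derivative x / (F x - yy x)) (at x)" and u: "F x - yy x > 0" for x
  using l by (auto simp: loopg_def)
 have "filterlim (%x. k * x^2 - C) at_top at_top" using k by real_asymp
 then have unb: "\<exists>t\<ge>0. yy t > R" for R
 proof -
  assume "filterlim (%x. k * x^2 - C) at_top at_top"
  then obtain N where "!!x. x >= N ==> k * x^2 - C > R" unfolding filterlim_at_top_dense eventually_at_top_linorder by meson
  then have "yy (max N 0) > R" using k(2)[of "max N 0"] by (smt (verit))
  then show ?thesis by (intro exI[of _ "max N 0"]) auto
 qed
 have pos: "x / (F x - yy x) > 0" if "0 < x" for x using u[of x] that by simp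
 obtain X where X: "continuous_on {yy 0..} X" "!!t. t >= 0 ==> X (yy t) = t" "!!s. s >= yy 0 ==> X s >= 0"
  "!!s. s >= yy 0 ==> yy (X s) = s"
  "!!s. s > yy 0 ==> X s > 0 & (X has_real_derivative inverse (X s / (F (X s) - yy (X s)))) (at s)"
  using inverse_on_halfline[OF loopg_continuous[OF l], of 0 "%x. x / (F x - yy x)"] d pos unb by blast
 have "X z > 0 & (X has_real_derivative (F (X z) - z) / X z) (at z)" if "z > yy 0" for z
  using X(5)[OF that] X(4)[of z] that by simp
 then show ?thesis using that X unfolding F_def by blast
qed

lemma loopg_strict_mono:
 assumes l: "loopg F yy" and pq: "0 <= p" "p < q"
 shows "yy p < yy q"
proof (rule DERIV_pos_imp_increasing_open[OF pq(2) _ loopg_continuous[OF l]])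
 fix t assume t: "p < t" "t < q"
 have "F t - yy t > 0" "(yy has_real_derivative t / (F t - yy t)) (at t)" using l by (auto simp: loopg_def)
 moreover have "t / (F t - yy t) > 0" using calculation(1) t pq by simp
 ultimately show "\<exists>D. (yy has_real_derivative D) (at t) & D > 0" by blast
qed

text \<open>At heights in a fixed range the horizontal gap to the separatrix is comparable to the
  initial displacement \<eta> - s. As the bounds are linear, the quotient of the gaps of two systems
  is bounded independently of \<eta>.\<close>

definition gap_bounds :: "(real \<Rightarrow> real) \<Rightarrow> real \<Rightarrow> (real \<Rightarrow> real) \<Rightarrow> real \<Rightarrow> real \<Rightarrow> real \<Rightarrow> real \<Rightarrow> real \<Rightarrow> bool" where
 "gap_bounds F s X ya yb \<delta> cl ch \<longleftrightarrow> (\<forall>\<eta> T x y z. s < \<eta> --> \<eta> < s + \<delta> --> T > 0 -->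
  hsol F {0..} x y --> x 0 = 0 --> y 0 = \<eta> --> x T = 0 --> (\<forall>t. 0 < t --> t < T --> x t > 0) -->
  ya <= z --> z <= yb --> (\<exists>t. 0 < t & t < T & y t = z &
   cl * (\<eta> - s) <= X z - x t & X z - x t <= ch * (\<eta> - s)))"

lemma gap_boundsD:
 assumes "gap_bounds F s X ya yb \<delta> cl ch" "s < \<eta>" "\<eta> < s + \<delta>" "T > 0" "hsol F {0..} x y" "x 0 = 0" "y 0 = \<eta>" "x T = 0"
  "!!t. 0 < t ==> t < T ==> x t > 0" "ya <= z" "z <= yb"
 shows "\<exists>t. 0 < t & t < T & y t = z & cl * (\<eta> - s) <= X z - x t & X z - x t <= ch * (\<eta> - s)"
 using assms unfolding gap_bounds_def by blast

text \<open>\<open>loop_follow\<close> keeps the vertical gap between \<eta> - yy 0 and a multiple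
  of it. The mean value theorem for yy converts it into a horizontal gap, since the slope of yy is
  bounded above and below on the piece concerned.\<close>

lemma arc_gap_bounds:
 assumes lead: "lead a b c" and l: "loopg (quart a b c d) yy" and yab: "yy 0 + 1 < ya" "ya <= yb"
  and X: "continuous_on {yy 0..} X" "!!x. x >= 0 ==> X (yy x) = x" "!!z. z >= yy 0 ==> X z >= 0"
  "!!z. z >= yy 0 ==> yy (X z) = z"
 obtains \<delta> cl ch where "\<delta> > 0" "cl > 0" "ch > 0" "gap_bounds (quart a b c d) (yy 0) X ya yb \<delta> cl ch"
proof -
 define F where "F = quart a b c d"
 have Fc: "continuous_on S F" for S unfolding F_def by (intro continuous_intros)
 note l = l[folded F_def]
 have u: "F x - yy x > 0" and yd: "(yy has_real_derivative x / (F x - yy x)) (at x)" for x using l by (auto simp: loopg_def)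
 obtain U where U: "U > 0" "!!x. F x - yy x <= U" using loopg_bound_pos[OF l] by metis
 note mono = loopg_strict_mono[OF l]
 obtain \<delta> Cg where \<delta>: "\<delta> > 0" "Cg >= 1" and fol: "!!x y. hsol F {0..} x y ==> 0 <= x 0 ==> x 0 <= 0 ==>
  yy (x 0) < y 0 ==> y 0 < yy (x 0) + \<delta> ==>
  \<exists>r>0. y r >= yb + 1 & (\<forall>t. 0 < t & t <= r --> x t > 0) &
   (\<forall>t. 0 <= t & t <= r --> y t - yy (x t) < 1 & y 0 - yy (x 0) <= y t - yy (x t) &
     y t - yy (x t) <= Cg * (y 0 - yy (x 0)))"
  using loop_follow[OF lead l[unfolded F_def], of 1 0 "yb + 1"] unfolding F_def by (metis zero_less_one)
 \<comment> \<open>The vertical gap stays below 1, so at heights between ya and yb all abscissae lie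
   between those of the loop at ya - 1 and at yb.\<close>
 define xl xh where "xl = X (ya - 1)" and "xh = X yb"
 have yyxl: "yy xl = ya - 1" "yy xh = yb" using X(4) yab by (auto simp: xl_def xh_def)
 have xl0: "xl >= 0" "xh >= 0" using X(3) yab by (auto simp: xl_def xh_def)
 have xl: "xl > 0" using xl0 yyxl yab by (cases "xl = 0") auto
 have xh: "xh > 0" using xl0 yyxl yab by (cases "xh = 0") auto
 have "\<exists>z\<in>{0..xh}. \<forall>w\<in>{0..xh}. F z - yy z <= F w - yy w"
  by (rule continuous_attains_inf) (use xh in \<open>auto intro!: continuous_on_diff Fc loopg_continuous[OF l]\<close>)
 then obtain z0 where z0: "!!w. w \<in> {0..xh} ==> F z0 - yy z0 <= F w - yy w" by blast
 define m where "m = F z0 - yy z0"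
 have m: "m > 0" "!!w. 0 <= w ==> w <= xh ==> m <= F w - yy w" using u[of z0] z0 by (auto simp: m_def)
 show ?thesis
 proof (rule that[of "min \<delta> 1" "m / xh" "Cg * (U / xl)"])
  show "gap_bounds (quart a b c d) (yy 0) X ya yb (min \<delta> 1) (m / xh) (Cg * (U / xl))"
   unfolding gap_bounds_def
  proof (intro allI impI)
  fix \<eta> T x y z
  assume \<eta>: "yy 0 < \<eta>" "\<eta> < yy 0 + min \<delta> 1" and T: "T > 0" and h: "hsol (quart a b c d) {0..} x y"
   and 0: "x 0 = 0" "y 0 = \<eta>" and xT: "x T = 0" and xpos: "\<forall>t. 0 < t --> t < T --> x t > 0" and z: "ya <= z" "z <= yb"
  note h = h[folded F_def]
  have st: "0 <= x 0" "x 0 <= 0" "yy (x 0) < y 0" "y 0 < yy (x 0) + \<delta>" using \<eta> by (simp_all add: 0)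
  obtain r where r: "r > 0" "y r >= yb + 1" "!!t. 0 < t ==> t <= r ==> x t > 0"
   and v: "!!t. 0 <= t ==> t <= r ==> y t - yy (x t) < 1 & \<eta> - yy 0 <= y t - yy (x t) &
     y t - yy (x t) <= Cg * (\<eta> - yy 0)"
   using fol[OF h st] unfolding 0 by blast
  have "r < T" using r(3)[of T] T xT by (cases "T <= r") auto
  have "\<exists>t. 0 <= t & t <= r & y t = z"
   by (rule IVT'[OF _ _ _ hsol_halfline(3)[OF h]]) (use 0 \<eta> yab z r in auto)
  then obtain t where t: "0 <= t" "t <= r" "y t = z" by blast
  have "t \<noteq> 0" using t 0 \<eta> yab z by auto
  then have xt: "x t > 0" using r(3)[of t] t by simp
  define w where "w = z - yy (x t)"
  have w: "w < 1" "\<eta> - yy 0 <= w" "w <= Cg * (\<eta> - yy 0)" using v[of t] t by (auto simp: w_def)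
  have Xz: "yy (X z) = z" "X z >= 0" using X(3,4)[of z] yab z by auto
  have "x t < X z"
  proof (rule ccontr)
   assume "\<not> x t < X z"
   then have "yy (X z) <= yy (x t)" using mono[of "X z" "x t"] Xz by (cases "X z = x t") auto
   then show False using Xz w \<eta> by (simp add: w_def)
  qed
  have lx: "xl < x t"
  proof (rule ccontr)
   assume "\<not> xl < x t"
   then have "yy (x t) <= yy xl" using mono[of "x t" xl] xt by (cases "x t = xl") auto
   then show False using yyxl w z by (simp add: w_def)
  qed
  have hx: "X z <= xh"
  proof (rule ccontr)
   assume "\<not> X z <= xh"
   then show False using mono[of xh "X z"] xh yyxl Xz z by simp
  qed
  obtain q where q: "x t < q" "q < X z" "yy (X z) - yy (x t) = (X z - x t) * (q / (F q - yy q))"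
   using mvt_interior[OF \<open>x t < X z\<close> loopg_continuous[OF l] yd] by blast
  have weq: "w = (X z - x t) * (q / (F q - yy q))" using q Xz by (simp add: w_def)
  have fl: "xl / U <= q / (F q - yy q)" using q lx U(2)[of q] u[of q] xl by (intro frac_le) auto
  have fh: "q / (F q - yy q) <= xh / m" using q hx m(2)[of q] m(1) xt by (intro frac_le) auto
  have pos: "X z - x t > 0" using \<open>x t < X z\<close> by simp
  have "w <= (X z - x t) * (xh / m)" unfolding weq using fh pos by (intro mult_left_mono) auto
  then have 1: "m / xh * w <= X z - x t" using m xh by (simp add: field_simps)
  have "(X z - x t) * (xl / U) <= w" unfolding weq using fl pos by (intro mult_left_mono) auto
  then have 2: "X z - x t <= U / xl * w" using U xl by (simp add: field_simps)
  have "m / xh * (\<eta> - yy 0) <= m / xh * w" using w m xh by (intro mult_left_mono) auto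
  moreover have "U / xl * w <= U / xl * (Cg * (\<eta> - yy 0))" using w U xl by (intro mult_left_mono) auto
  ultimately show "\<exists>t. 0 < t & t < T & y t = z & m / xh * (\<eta> - yy 0) <= X z - x t &
    X z - x t <= Cg * (U / xl) * (\<eta> - yy 0)"
   using t \<open>t \<noteq> 0\<close> \<open>r < T\<close> 1 2 by (intro exI[of _ t]) (auto simp: mult_ac)
  qed
 qed (use \<delta> m xh U xl in auto)
qed

lemma DERIV_first_zero_nonpos:
 fixes f :: "real \<Rightarrow> real"
 assumes D: "(f has_real_derivative l) (at z)" and z: "a < z" "f z = 0" "!!s. a <= s ==> s < z ==> f s > 0"
 shows "l <= 0"
proof (rule ccontr)
 assume "\<not> l <= 0"
 then obtain e where e: "e > 0" "!!h. h > 0 ==> h < e ==> f (z - h) < f z"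
  using DERIV_pos_inc_left[OF D] by auto
 define h where "h = min (e / 2) ((z - a) / 2)"
 have "h > 0" "h < e" "a <= z - h" using e z by (auto simp: h_def min_def field_simps)
 then show False using e(2)[of h] z(2) z(3)[of "z - h"] by auto
qed

text \<open>The growth rates differ by at least 1, so q / p decays exponentially in the height. By
  the height yb it is below 1 / 4; hence the gap that first reaches 2 * e is p, and q is at most e /
  2 there.\<close>

lemma growth_comparison:
 fixes p q :: "real \<Rightarrow> real"
 assumes y: "ya < yb" "yb < m" and pc: "continuous_on {ya..m} p" and qc: "continuous_on {ya..m} q"
  and pos: "!!t. ya < t ==> t < m ==> p t > 0"
  and pd: "!!t. ya < t ==> t < m ==> (p has_real_derivative p' t) (at t)"
  and qd: "!!t. ya < t ==> t < m ==> (q has_real_derivative q' t) (at t)"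
  and rate: "!!t. ya < t ==> t < m ==> p t <= 2 * e ==> q t <= 2 * e ==>
   p t * A t <= p' t & q' t <= q t * B t & B t <= A t - 1 & B t <= K"
  and init: "q ya <= \<kappa> * p ya" "\<kappa> > 0" and near: "!!t. ya <= t ==> t <= yb ==> p t < 2 * e & q t < 2 * e"
  and \<kappa>: "\<kappa> * exp (ya - yb) <= 1 / 4" and fin: "p m > 2 * e \<or> q m > 2 * e" and e: "e > 0"
 obtains ye where "yb < ye" "ye < m" "p ye = 2 * e" "q ye <= e / 2"
proof -
 define w where "w = (%t. 2 * e - max (p t) (q t))"
 have wc: "continuous_on {yb..m} w" unfolding w_def
  using y by (intro continuous_intros continuous_on_subset[OF pc] continuous_on_subset[OF qc]) auto
 obtain ye where ye: "yb < ye" "ye <= m" "w ye = 0" "!!s. yb <= s ==> s < ye ==> w s > 0"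
  using first_zero[OF _ wc] near[of yb] fin y unfolding w_def by (smt (verit))
 have "ye < m" using ye fin by (cases "ye = m") (auto simp: w_def)
 have small: "p t <= 2 * e & q t <= 2 * e" if "ya < t" "t < ye" for t
  using near[of t] ye(4)[of t] that by (cases "t <= yb") (auto simp: w_def)
 \<comment> \<open>Expresses the decay of q / p without a division, so that a Gronwall argument
   applies.\<close>
 define h where "h = (%t. q t - \<kappa> * exp (ya - t) * p t)"
 have "h ye <= 0"
 proof (rule gronwall_nonpos[where g = h and a = ya and K = K
    and g' = "%t. q' t - (\<kappa> * exp (ya - t) * p' t - \<kappa> * exp (ya - t) * p t)"])
  show "ya <= ye" using y ye by simp
  show "continuous_on {ya..ye} h" unfolding h_def
   using ye y by (intro continuous_intros continuous_on_subset[OF pc] continuous_on_subset[OF qc]) auto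
  show "h ya <= 0" using init by (simp add: h_def)
  fix t assume t: "ya < t" "t < ye"
  then have tm: "t < m" using ye by simp
  note D = pd[OF t(1) tm] qd[OF t(1) tm]
  show "(h has_real_derivative q' t - (\<kappa> * exp (ya - t) * p' t - \<kappa> * exp (ya - t) * p t)) (at t)"
   unfolding h_def using D by (auto intro!: derivative_eq_intros simp: algebra_simps)
  assume h0: "h t > 0"
  have r: "p t * A t <= p' t" "q' t <= q t * B t" "B t <= A t - 1" "B t <= K"
   using rate[OF t(1) tm] small[OF t] by auto
  have "p t * B t <= p t * (A t - 1)" using r pos[OF t(1) tm] by (intro mult_left_mono) auto
  then have "p t * B t <= p' t - p t" using r(1) by (simp add: algebra_simps)
  then have "\<kappa> * exp (ya - t) * (p t * B t) <= \<kappa> * exp (ya - t) * (p' t - p t)"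
   using init by (intro mult_left_mono) auto
  then have "q' t - (\<kappa> * exp (ya - t) * p' t - \<kappa> * exp (ya - t) * p t) <= B t * h t"
   using r(2) by (simp add: h_def algebra_simps)
  also have "\<dots> <= K * h t" using r(4) h0 by (intro mult_right_mono) auto
  finally show "q' t - (\<kappa> * exp (ya - t) * p' t - \<kappa> * exp (ya - t) * p t) <= K * h t" .
 qed
 then have h: "q ye <= \<kappa> * exp (ya - ye) * p ye" by (simp add: h_def)
 have pye: "p ye > 0" using pos[of ye] ye y \<open>ye < m\<close> by simp
 have "\<kappa> * exp (ya - ye) <= \<kappa> * exp (ya - yb)" using ye init by (intro mult_left_mono) auto
 then have "\<kappa> * exp (ya - ye) * p ye <= 1 / 4 * p ye" using \<kappa> pye by (intro mult_right_mono) auto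
 then have "q ye <= p ye / 4" using h by linarith
 moreover have "max (p ye) (q ye) = 2 * e" using ye(3) by (simp add: w_def)
 ultimately have "p ye = 2 * e" "q ye <= e / 2" using pye e by (auto simp: max_def split: if_splits)
 then show ?thesis using that ye(1) \<open>ye < m\<close> by blast
qed

text \<open>The translate of the first branch by l cannot be caught from the right by the second
  one. So when the second branch would reach the axis, the first would already have done so, at a
  lower height.\<close>

lemma shift_barrier:
 fixes F G \<xi>1 \<xi>2 :: "real \<Rightarrow> real"
 assumes ye: "ye < Y1" "ye < Y2" and c1: "continuous_on {ye..Y1} \<xi>1" and c2: "continuous_on {ye..Y2} \<xi>2"
  and e1: "\<xi>1 Y1 = 0" and e2: "\<xi>2 Y2 = 0"
  and o1: "!!z. ye < z ==> z < Y1 ==> \<xi>1 z > 0 & (\<xi>1 has_real_derivative (F (\<xi>1 z) - z) / \<xi>1 z) (at z)"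
  and o2: "!!z. ye < z ==> z < Y2 ==> \<xi>2 z > 0 & (\<xi>2 has_real_derivative (G (\<xi>2 z) - z) / \<xi>2 z) (at z)"
  and Fd: "!!x. (F has_real_derivative F' x) (at x)" and st: "\<xi>2 ye - \<xi>1 ye > l" "F (\<xi>1 ye) < ye" "l > 0"
  and far: "!!x. x >= xb ==> F x <= G (x + l)"
  and cl: "!!x. 0 <= x ==> x <= xb ==> (x + l) * F x - x * G (x + l) <= M" and M: "M < l * ye"
 shows "Y1 < Y2"
proof (rule ccontr)
 assume "\<not> Y1 < Y2"
 then have Y: "Y2 <= Y1" by simp
 have Fc: "continuous_on S F" for S
  by (rule continuous_at_imp_continuous_on) (use Fd DERIV_isCont in blast)
 \<comment> \<open>The first branch has passed its curve and stays past it: at a contact \<xi>1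
   would have derivative 0, so z - F (\<xi>1 z) would have derivative 1.\<close>
 have N: "F (\<xi>1 z) < z" if z: "ye <= z" "z < Y1" for z
 proof (rule ccontr)
  assume n: "\<not> F (\<xi>1 z) < z"
  obtain w where w: "ye < w" "w <= z" "w - F (\<xi>1 w) = 0" "!!s. ye <= s ==> s < w ==> s - F (\<xi>1 s) > 0"
  proof (rule first_zero[OF z(1)])
   show "continuous_on {ye..z} (%s. s - F (\<xi>1 s))"
    using z by (intro continuous_intros continuous_on_compose2[OF Fc[of UNIV]] continuous_on_subset[OF c1]) auto
  qed (use n st in auto)
  have o: "\<xi>1 w > 0" "(\<xi>1 has_real_derivative (F (\<xi>1 w) - w) / \<xi>1 w) (at w)" using o1[of w] w z by auto
  have "((%s. s - F (\<xi>1 s)) has_real_derivative 1 - F' (\<xi>1 w) * ((F (\<xi>1 w) - w) / \<xi>1 w)) (at w)"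
   by (rule DERIV_diff[OF DERIV_ident DERIV_chain2[OF Fd o(2)]])
  from DERIV_first_zero_nonpos[OF this w(1,3,4)] show False using w(3) by simp
 qed
 define D where "D = (%z. \<xi>2 z - \<xi>1 z - l)"
 have "\<xi>1 Y2 >= 0" using o1[of Y2] e1 Y ye by (cases "Y2 = Y1") auto
 then have DY: "D Y2 < 0" using e2 st by (simp add: D_def)
 have Dc: "continuous_on {ye..Y2} D" unfolding D_def
  using Y by (intro continuous_intros c2 continuous_on_subset[OF c1]) auto
 have "D ye > 0" using st by (simp add: D_def)
 then obtain z where z: "ye < z" "z <= Y2" "D z = 0" "!!s. ye <= s ==> s < z ==> D s > 0"
  using first_zero[OF less_imp_le[OF ye(2)] Dc] DY by (metis less_imp_le)
 have zY: "z < Y2" using z DY by (cases "z = Y2") auto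
 define x where "x = \<xi>1 z"
 have x: "x > 0" "(\<xi>1 has_real_derivative (F x - z) / x) (at z)" using o1[of z] z zY Y by (auto simp: x_def)
 have x2: "\<xi>2 z = x + l" using z by (simp add: D_def x_def)
 have "(\<xi>2 has_real_derivative (G (x + l) - z) / (x + l)) (at z)" using o2[of z] z zY by (simp add: x2)
 then have "(D has_real_derivative (G (x + l) - z) / (x + l) - (F x - z) / x) (at z)"
  unfolding D_def using x(2) by (auto intro!: derivative_eq_intros)
 from DERIV_first_zero_nonpos[OF this z(1,3,4)] have "(G (x + l) - z) / (x + l) <= (F x - z) / x" by simp
 then have le: "(G (x + l) - z) * x <= (F x - z) * (x + l)" using x(1) st by (simp add: field_simps)
 have Fz: "F x < z" using N[of z] z zY Y by (simp add: x_def)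
 show False
 \<comment> \<open>At a first contact \<xi>2 = \<xi>1 + l. Far out, F x <= G (x + l) and the smaller
   denominator make the first branch fall more steeply; on the bounded range the term l * z, with z
   > ye, outweighs M.\<close>
 proof (cases "x >= xb")
  case True
  have "(F x - z) * x <= (G (x + l) - z) * x" using far[OF True] x by (intro mult_right_mono) auto
  moreover have "(F x - z) * (x + l) < (F x - z) * x" using Fz st by (intro mult_strict_left_mono_neg) auto
  ultimately show False using le by linarith
 next
  case False
  have "l * ye < l * z" using z st by simp
  moreover have "(x + l) * F x - x * G (x + l) <= M" using cl[of x] False x by simp
  ultimately show False using le M by (simp add: algebra_simps)
 qed
qed

text \<open>The cubic term decides: with b > 0 the gap of the first arc grows faster, so this arc
  leaves its separatrix earlier and returns at a lower height, although the two arcs start at the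
  same point.\<close>

lemma arc_compare:
 assumes ab: "a > 0" "b > 0" and l: "loopg (quart a b c d) yy"
 obtains e where "e > 0" "!!\<eta> Y1 Y2. yy 0 < \<eta> ==> \<eta> < yy 0 + e ==> arc (quart a b c d) \<eta> Y1 ==>
  arc (quart a (- b) c (- d)) \<eta> Y2 ==> Y1 < Y2"
proof -
 define F1 F2 where "F1 = quart a b c d" and "F2 = quart a (- b) c (- d)"
 define yr where "yr = (%x. yy (- x))"
 have lead: "lead a b c" "lead a (- b) c" using ab by (auto simp: lead_def)
 have l1: "loopg F1 yy" using l by (simp add: F1_def)
 have l2: "loopg F2 yr" using loopg_reflect[OF l] by (simp add: quart_uminus_fun F2_def yr_def)
 have yr0: "yr 0 = yy 0" by (simp add: yr_def)
 have F1c: "continuous_on S F1" and F2c: "continuous_on S F2" for S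
  unfolding F1_def F2_def by (intro continuous_intros)+
 obtain Ua where Ua: "Ua > 0" "!!x. F1 x - yy x <= Ua" using loopg_bound_pos[OF l1] by metis
 obtain Ub where Ub: "Ub > 0" "!!x. F2 x - yr x <= Ub" using loopg_bound_pos[OF l2] by metis
 define U where "U = max Ua Ub"
 have U: "U > 0" "F1 x - yy x <= U" "F2 x - yr x <= U" for x
  using Ua(1) Ub(2)[of x] Ua(2)[of x] unfolding U_def by linarith+
 have u1: "F1 x - yy x > 0" and u2: "F2 x - yr x > 0" for x using l1 l2 by (auto simp: loopg_def)
 define \<epsilon> where "\<epsilon> = b / (64 * a)"
 have \<epsilon>: "\<epsilon> > 0" using ab by (simp add: \<epsilon>_def)
 \<comment> \<open>Slightly more, and \<open>\<mu>\<close> slightly less, than the offset b / (2 a)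
   of the separatrices. When p = 2 \<epsilon> and q <= \<epsilon> / 2, the arcs are more than \<mu>
   + 3 / 2 * \<epsilon> apart, which exceeds \<open>sh\<close>.\<close>
 define sh where "sh = b / (2 * a) + \<epsilon> / 2"
 define \<mu> where "\<mu> = b / (2 * a) - \<epsilon> / 2"
 have b32: "b / (2 * a) = 32 * \<epsilon>" and a\<epsilon>: "a * \<epsilon> = b / 64" using ab by (simp_all add: \<epsilon>_def)
 have "4 * a * sh - 2 * b = 130 * (a * \<epsilon>) - 2 * b" "4 * a * \<mu> - 2 * b = 126 * (a * \<epsilon>) - 2 * b"
  unfolding sh_def \<mu>_def b32 by (simp_all add: algebra_simps)
 then have sm: "sh > 0" "\<mu> > 0" "4 * a * sh - 2 * b > 0" "4 * a * \<mu> - 2 * b < 0" "\<mu> + 3 / 2 * \<epsilon> > sh"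
  using ab \<epsilon> unfolding a\<epsilon> by (auto simp: sh_def \<mu>_def b32)
 obtain w0 where w0: "!!w z. w >= w0 ==> 0 <= z ==> z <= w ==> F2 z <= F2 w"
  using eventually_dominates[OF lead(2)] unfolding eventually_at_top_linorder F2_def by meson
 have \<epsilon>2: "2 * \<epsilon> > 0" using \<epsilon> by simp
 obtain N1 where E1: "!!X. N1 <= X ==> F2 (X + sh) - F1 X > U"
  using quart_shift_ge[OF sm(3)] unfolding eventually_at_top_linorder F1_def F2_def by blast
 obtain N2 where E2: "!!X. N2 <= X ==> F2 (X + \<mu>) - F1 X < - U"
  using quart_shift_le[OF sm(4)] unfolding eventually_at_top_linorder F1_def F2_def by blast
 obtain N3 where E3: "!!X. N3 <= X ==> F1 X - F1 (X - 2 * \<epsilon>) > U"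
  using quart_drop[OF ab(1) \<epsilon>2] unfolding eventually_at_top_linorder F1_def by blast
 obtain N4 where R1: "!!X p u. N4 <= X ==> 0 < p ==> p <= 2 * \<epsilon> ==> 0 <= u ==> u <= U ==>
    a * (3 * X^2 - 3 * X * p + p^2) + b * (2 * X - p) + c + (F1 X - u) / (X * (X - p)) >= 4 * a * X^2 + 5 / 2 * b * X"
  using rate_lower[OF ab less_imp_le[OF U(1)], where c = c and d = d, folded F1_def, folded \<epsilon>_def]
  unfolding eventually_at_top_linorder by meson
 obtain N5 where R2: "!!X p u. N5 <= X ==> 0 < p ==> p <= 2 * \<epsilon> ==> 0 <= u ==>
    a * (3 * X^2 - 3 * X * p + p^2) + (- b) * (2 * X - p) + c + (F2 X - u) / (X * (X - p)) <= 4 * a * X^2 + (4 * a * \<epsilon> - 3 * b) * X"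
  using rate_upper[OF ab, where c = c and d = d, folded F2_def, folded \<epsilon>_def]
  unfolding eventually_at_top_linorder by meson
 obtain N6 where R3: "!!X1 X2. N6 <= X1 ==> X1 <= X2 ==> X2 <= X1 + sh ==>
    4 * a * X2^2 + (4 * a * \<epsilon> - 3 * b) * X2 <= 4 * a * X1^2 + 3 / 2 * b * X1"
  using rate_shift[OF ab, folded \<epsilon>_def, folded sh_def] unfolding eventually_at_top_linorder by meson
 \<comment> \<open>Beyond this abscissa all asymptotic statements hold together. The entry 1 / b
   makes the margin b * X1 of the two rates at least 1.\<close>
 define Xs where "Xs = Max {w0, 1, 1 / b, 2 * \<epsilon> + 1, N1, N2, N3, N4, N5, N6}"
 have XN: "N1 <= Xs" "N2 <= Xs" "N3 <= Xs" "N4 <= Xs" "N5 <= Xs" "N6 <= Xs" unfolding Xs_def by (rule Max_ge; simp)+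
 have "w0 <= Xs" "1 <= Xs" "1 / b <= Xs" "2 * \<epsilon> + 1 <= Xs" unfolding Xs_def by (rule Max_ge; simp)+
 then have Xs: "Xs >= w0" "Xs >= 1" "Xs >= 1 / b" "Xs > 2 * \<epsilon>" by linarith+
 obtain X1 where X1: "continuous_on {yy 0..} X1" "!!x. x >= 0 ==> X1 (yy x) = x" "!!z. z >= yy 0 ==> X1 z >= 0"
  "!!z. z >= yy 0 ==> yy (X1 z) = z"
  "!!z. z > yy 0 ==> X1 z > 0 & (X1 has_real_derivative (F1 (X1 z) - z) / X1 z) (at z)"
  using sep_curve[OF lead(1) l] unfolding F1_def by metis
 obtain X2 where X2: "continuous_on {yr 0..} X2" "!!x. x >= 0 ==> X2 (yr x) = x" "!!z. z >= yr 0 ==> X2 z >= 0"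
  "!!z. z >= yr 0 ==> yr (X2 z) = z"
  "!!z. z > yr 0 ==> X2 z > 0 & (X2 has_real_derivative (F2 (X2 z) - z) / X2 z) (at z)"
  using sep_curve[OF lead(2) l2[unfolded F2_def]] unfolding F2_def by metis
 have X1Xs: "X1 z >= Xs" if "z >= yy Xs" "z >= yy 0" for z
  using loopg_strict_mono[OF l1 X1(3)[OF that(2)], of Xs] X1(4)[OF that(2)] that by linarith
 have gapX: "X1 z + \<mu> < X2 z & X2 z < X1 z + sh" if z: "z >= yy Xs" "z >= yy 0" for z
 proof -
  define X where "X = X1 z"
  have X: "X >= Xs" "yy X = z" using X1Xs[OF z] X1(4)[OF z(2)] by (auto simp: X_def)
  have X2z: "X2 z >= 0" "yr (X2 z) = z" using X2(3,4)[of z] z(2) yr0 by auto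
  have "X2 z < X + sh"
  proof (rule ccontr)
   assume "\<not> X2 z < X + sh"
   then have "F2 (X + sh) <= F2 (X2 z)" using X Xs sm by (intro w0) auto
   then show False using E1[OF order_trans[OF XN(1) X(1)]] U(3)[of "X2 z"] u1[of X] X X2z by linarith
  qed
  moreover have "X + \<mu> < X2 z"
  proof (rule ccontr)
   assume "\<not> X + \<mu> < X2 z"
   then have "F2 (X2 z) <= F2 (X + \<mu>)" using X Xs sm X2z by (intro w0) auto
   then show False using E2[OF order_trans[OF XN(2) X(1)]] u2[of "X2 z"] U(2)[of X] X X2z by linarith
  qed
  ultimately show ?thesis by (simp add: X_def)
 qed
 have "bounded ((%x. (x + sh) * F1 x - x * F2 (x + sh)) ` {0..Xs})"
  by (intro compact_imp_bounded compact_continuous_image continuous_intros F1c continuous_on_compose2[OF F2c[of UNIV]]) auto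
 then obtain M where M0: "\<forall>z\<in>(%x. (x + sh) * F1 x - x * F2 (x + sh)) ` {0..Xs}. norm z <= M"
  unfolding bounded_iff by blast
 have M: "\<bar>(x + sh) * F1 x - x * F2 (x + sh)\<bar> <= M" if "0 <= x" "x <= Xs" for x
  using bspec[OF M0, OF imageI[of x]] that by simp
 \<comment> \<open>High enough for the separatrices to be beyond Xs, and for M < sh * ya, which
   \<open>shift_barrier\<close> requires where x is bounded.\<close>
 define ya where "ya = max (yy Xs) (max (yy 0 + 2) ((M + 1) / sh))"
 have "(M + 1) / sh <= ya" by (simp add: ya_def)
 then have "M + 1 <= ya * sh" using sm(1) by (simp add: pos_divide_le_eq)
 then have ya: "ya >= yy Xs" "yy 0 + 1 < ya" "M < sh * ya" by (auto simp: ya_def mult.commute)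
 have ya2: "yr 0 + 1 < ya" using ya yr0 by simp
 obtain \<delta>1 cl1 ch1 where g1: "\<delta>1 > 0" "cl1 > 0" "ch1 > 0" "gap_bounds F1 (yy 0) X1 ya ya \<delta>1 cl1 ch1"
  using arc_gap_bounds[OF lead(1) l ya(2) order_refl X1(1) X1(2) X1(3) X1(4)] unfolding F1_def by metis
 obtain \<delta>2 cl2 ch2 where g2: "\<delta>2 > 0" "cl2 > 0" "ch2 > 0" "gap_bounds F2 (yr 0) X2 ya ya \<delta>2 cl2 ch2"
  using arc_gap_bounds[OF lead(2) l2[unfolded F2_def] ya2 order_refl X2(1) X2(2) X2(3) X2(4)] unfolding F2_def by metis
 \<comment> \<open>Bounds q / p at the single height ya. It has to be fixed before yb, which is
   chosen from it; the bounds on the whole of {ya..yb}, whose constants depend on yb, are taken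
   afterwards.\<close>
 define \<kappa> where "\<kappa> = ch2 / cl1"
 have \<kappa>: "\<kappa> > 0" using g1 g2 by (simp add: \<kappa>_def)
 \<comment> \<open>exp (4 \<kappa>) >= 4 \<kappa> brings the decayed quotient below 1 / 4.\<close>
 define yb where "yb = ya + 4 * \<kappa>"
 have yb: "ya < yb" "ya <= yb" using \<kappa> by (auto simp: yb_def)
 have "\<kappa> * exp (ya - yb) <= 1 / 4"
 proof -
  have "4 * \<kappa> <= exp (4 * \<kappa>)" using exp_ge_add_one_self[of "4 * \<kappa>"] by linarith
  then show ?thesis by (simp add: yb_def exp_minus field_simps)
 qed
 note \<kappa>exp = this
 obtain \<delta>3 cl3 ch3 where g3: "\<delta>3 > 0" "cl3 > 0" "ch3 > 0" "gap_bounds F1 (yy 0) X1 ya yb \<delta>3 cl3 ch3"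
  using arc_gap_bounds[OF lead(1) l ya(2) yb(2) X1(1) X1(2) X1(3) X1(4)] unfolding F1_def by metis
 obtain \<delta>4 cl4 ch4 where g4: "\<delta>4 > 0" "cl4 > 0" "ch4 > 0" "gap_bounds F2 (yr 0) X2 ya yb \<delta>4 cl4 ch4"
  using arc_gap_bounds[OF lead(2) l2[unfolded F2_def] ya2 yb(2) X2(1) X2(2) X2(3) X2(4)] unfolding F2_def by metis
 \<comment> \<open>For such \<eta> both gaps are at most \<epsilon> on {ya..yb}, and neither arc
   ends below yb.\<close>
 define e where "e = Min {\<delta>1, \<delta>2, \<delta>3, \<delta>4, \<epsilon> / ch3, \<epsilon> / ch4, 1}"
 have e0: "e > 0" unfolding e_def using g1 g2 g3 g4 \<epsilon> by (intro Min_gr_iff[THEN iffD2]) simp_all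
 have "e <= \<delta>1" "e <= \<delta>2" "e <= \<delta>3" "e <= \<delta>4" "e <= \<epsilon> / ch3" "e <= \<epsilon> / ch4" "e <= 1"
  unfolding e_def by (rule Min_le; simp)+
 note e = e0 this
 show ?thesis
 proof (rule that[OF e(1)])
  fix \<eta> Y1 Y2
  assume \<eta>: "yy 0 < \<eta>" "\<eta> < yy 0 + e" and A1: "arc (quart a b c d) \<eta> Y1" and A2: "arc (quart a (- b) c (- d)) \<eta> Y2"
  have \<eta>r: "yr 0 < \<eta>" "\<eta> < yr 0 + e" using \<eta> yr0 by auto
  obtain \<xi>1 T1 x1 y1 where gr1: "arc_graph F1 yy \<eta> Y1 \<xi>1 T1 x1 y1"
   using arc_curve[OF A1[folded F1_def] l1 F1c \<eta>(1)] by blast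
  note B1 = arc_graphD(1-7)[OF gr1] and C1 = arc_graphD(8-11)[OF gr1]
  obtain \<xi>2 T2 x2 y2 where gr2: "arc_graph F2 yr \<eta> Y2 \<xi>2 T2 x2 y2"
   using arc_curve[OF A2[folded F2_def] l2 F2c \<eta>r(1)] by blast
  note B2 = arc_graphD(1-7)[OF gr2] and C2 = arc_graphD(8-11)[OF gr2]
  define p q where "p = (%z. X1 z - \<xi>1 z)" and "q = (%z. X2 z - \<xi>2 z)"
  have \<eta>e: "\<eta> < yy 0 + \<delta>1" "\<eta> < yr 0 + \<delta>2" "\<eta> < yy 0 + \<delta>3" "\<eta> < yr 0 + \<delta>4" using \<eta> e yr0 by linarith+
  have pa: "cl1 * (\<eta> - yy 0) <= p ya"
  proof -
   obtain t where "0 < t" "t < T1" "y1 t = ya" "cl1 * (\<eta> - yy 0) <= X1 ya - x1 t"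
    using gap_boundsD[OF g1(4) \<eta>(1) \<eta>e(1) B1(1-5) B1(6) order_refl order_refl] by blast
   then show ?thesis using C1(3)[of t] by (simp add: p_def)
  qed
  have qa: "q ya <= ch2 * (\<eta> - yr 0)"
  proof -
   obtain t where "0 < t" "t < T2" "y2 t = ya" "X2 ya - x2 t <= ch2 * (\<eta> - yr 0)"
    using gap_boundsD[OF g2(4) \<eta>r(1) \<eta>e(2) B2(1-5) B2(6) order_refl order_refl] by blast
   then show ?thesis using C2(3)[of t] by (simp add: q_def)
  qed
  have pb: "z < Y1 & p z < 2 * \<epsilon>" if z: "ya <= z" "z <= yb" for z
  proof -
   obtain t where t: "0 < t" "t < T1" "y1 t = z" "X1 z - x1 t <= ch3 * (\<eta> - yy 0)"
    using gap_boundsD[OF g3(4) \<eta>(1) \<eta>e(3) B1(1-5) B1(6) z] by blast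
   have "ch3 * (\<eta> - yy 0) <= ch3 * (\<epsilon> / ch3)" using \<eta> e g3 by (intro mult_left_mono) auto
   then show ?thesis using t C1(3)[of t] B1(7)[of t] g3 \<epsilon> by (auto simp: p_def)
  qed
  have qb: "z < Y2 & q z < 2 * \<epsilon>" if z: "ya <= z" "z <= yb" for z
  proof -
   obtain t where t: "0 < t" "t < T2" "y2 t = z" "X2 z - x2 t <= ch4 * (\<eta> - yr 0)"
    using gap_boundsD[OF g4(4) \<eta>r(1) \<eta>e(4) B2(1-5) B2(6) z] by blast
   have "ch4 * (\<eta> - yr 0) <= ch4 * (\<epsilon> / ch4)" using \<eta>r e g4 by (intro mult_left_mono) auto
   then show ?thesis using t C2(3)[of t] B2(7)[of t] g4 \<epsilon> by (auto simp: q_def)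
  qed
  \<comment> \<open>Where an arc ends its \<xi> vanishes, so its gap equals X1 or X2 and exceeds 2
    \<epsilon>; the level 2 \<epsilon> is therefore passed before m.\<close>
  define m where "m = min Y1 Y2"
  have m: "yb < m" "m <= Y1" "m <= Y2" using pb[of yb] qb[of yb] yb by (auto simp: m_def)
  have \<eta>ya: "\<eta> < ya" using \<eta> e ya by simp
  have ys: "z >= yy Xs & z >= yy 0 & z >= yr 0" if "z >= ya" for z using that ya yr0 by auto
  have o1: "\<xi>1 z > 0 & p z > 0 & X1 z > 0 & (p has_real_derivative (F1 (X1 z) - z) / X1 z - (F1 (\<xi>1 z) - z) / \<xi>1 z) (at z)"
   if z: "ya < z" "z < Y1" for z
  proof -
   have A: "\<xi>1 z > 0" "(\<xi>1 has_real_derivative (F1 (\<xi>1 z) - z) / \<xi>1 z) (at z)" "z > yy (\<xi>1 z)"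
    using C1(4)[of z] z \<eta>ya by auto
   have B: "X1 z > 0" "(X1 has_real_derivative (F1 (X1 z) - z) / X1 z) (at z)" "yy (X1 z) = z"
    using X1(4,5)[of z] z ya by auto
   have "\<xi>1 z < X1 z"
   proof (rule ccontr)
    assume "\<not> \<xi>1 z < X1 z"
    then have "yy (X1 z) <= yy (\<xi>1 z)" using loopg_strict_mono[OF l1, of "X1 z" "\<xi>1 z"] B by (cases "X1 z = \<xi>1 z") auto
    then show False using A B by simp
   qed
   then show ?thesis unfolding p_def using A B by (auto intro!: DERIV_diff)
  qed
  have o2: "\<xi>2 z > 0 & q z > 0 & X2 z > 0 & (q has_real_derivative (F2 (X2 z) - z) / X2 z - (F2 (\<xi>2 z) - z) / \<xi>2 z) (at z)"
   if z: "ya < z" "z < Y2" for z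
  proof -
   have A: "\<xi>2 z > 0" "(\<xi>2 has_real_derivative (F2 (\<xi>2 z) - z) / \<xi>2 z) (at z)" "z > yr (\<xi>2 z)"
    using C2(4)[of z] z \<eta>ya by auto
   have B: "X2 z > 0" "(X2 has_real_derivative (F2 (X2 z) - z) / X2 z) (at z)" "yr (X2 z) = z"
    using X2(4,5)[of z] z ya2 by auto
   have "\<xi>2 z < X2 z"
   proof (rule ccontr)
    assume "\<not> \<xi>2 z < X2 z"
    then have "yr (X2 z) <= yr (\<xi>2 z)" using loopg_strict_mono[OF l2, of "X2 z" "\<xi>2 z"] B by (cases "X2 z = \<xi>2 z") auto
    then show False using A B by simp
   qed
   then show ?thesis unfolding q_def using A B by (auto intro!: DERIV_diff)
  qed
  have pc: "continuous_on {ya..Y1} p" unfolding p_def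
   using \<eta>ya ya by (intro continuous_intros continuous_on_subset[OF X1(1)] continuous_on_subset[OF C1(1)]) auto
  have qc: "continuous_on {ya..Y2} q" unfolding q_def
   using \<eta>ya ya2 by (intro continuous_intros continuous_on_subset[OF X2(1)] continuous_on_subset[OF C2(1)]) auto
  define B where "B = (%z. 4 * a * (X1 z)^2 + 3 / 2 * b * X1 z)"
  have "bounded (B ` {ya..m})" unfolding B_def using ya
   by (intro compact_imp_bounded compact_continuous_image continuous_intros continuous_on_subset[OF X1(1)]) auto
  then obtain K where K0: "\<forall>z\<in>B ` {ya..m}. norm z <= K" unfolding bounded_iff by blast
  have K: "\<bar>B z\<bar> <= K" if "ya <= z" "z <= m" for z using bspec[OF K0, OF imageI[of z]] that by simp
  obtain ye where ye: "yb < ye" "ye < m" "p ye = 2 * \<epsilon>" "q ye <= \<epsilon> / 2"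
  proof (rule growth_comparison[where p = p and q = q and ya = ya and yb = yb and m = m and e = \<epsilon> and \<kappa> = \<kappa> and B = B and K = K
     and p' = "%z. (F1 (X1 z) - z) / X1 z - (F1 (\<xi>1 z) - z) / \<xi>1 z"
     and q' = "%z. (F2 (X2 z) - z) / X2 z - (F2 (\<xi>2 z) - z) / \<xi>2 z"
     and A = "%z. 4 * a * (X1 z)^2 + 5 / 2 * b * X1 z"])
   show "ya < yb" "yb < m" "\<kappa> > 0" "\<epsilon> > 0" "\<kappa> * exp (ya - yb) <= 1 / 4" using yb m \<kappa> \<epsilon> \<kappa>exp by auto
   show "continuous_on {ya..m} p" "continuous_on {ya..m} q"
    using m by (auto intro: continuous_on_subset[OF pc] continuous_on_subset[OF qc])
   show "p z < 2 * \<epsilon> & q z < 2 * \<epsilon>" if "ya <= z" "z <= yb" for z using pb[OF that] qb[OF that] by simp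
   have "ch2 * (\<eta> - yr 0) = \<kappa> * (cl1 * (\<eta> - yy 0))" using g1 yr0 by (simp add: \<kappa>_def)
   also have "\<dots> <= \<kappa> * p ya" using pa \<kappa> by (intro mult_left_mono) auto
   finally show "q ya <= \<kappa> * p ya" using qa by simp
   show "p m > 2 * \<epsilon> \<or> q m > 2 * \<epsilon>"
   proof -
    have "X1 m >= Xs" "X1 m + \<mu> < X2 m" using X1Xs[of m] gapX[of m] ys[of m] m yb by auto
    then have "X1 m > 2 * \<epsilon>" "X2 m > 2 * \<epsilon>" using Xs sm by auto
    moreover have "m = Y1 \<or> m = Y2" by (auto simp: m_def min_def)
    ultimately show ?thesis using C1(2) C2(2) by (auto simp: p_def q_def)
   qed
   fix z assume z: "ya < z" "z < m"
   then have zY: "z < Y1" "z < Y2" using m by auto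
   note O1 = o1[OF z(1) zY(1)] and O2 = o2[OF z(1) zY(2)]
   show "p z > 0" "(p has_real_derivative (F1 (X1 z) - z) / X1 z - (F1 (\<xi>1 z) - z) / \<xi>1 z) (at z)"
    "(q has_real_derivative (F2 (X2 z) - z) / X2 z - (F2 (\<xi>2 z) - z) / \<xi>2 z) (at z)" using O1 O2 by auto
   assume pq: "p z <= 2 * \<epsilon>" "q z <= 2 * \<epsilon>"
   have z': "z >= yy Xs" "z >= yy 0" "z >= yr 0" using ys[of z] z by auto
   have XX: "X1 z >= Xs" "X2 z >= Xs" "X1 z <= X2 z" "X2 z <= X1 z + sh"
    using X1Xs[OF z'(1,2)] gapX[OF z'(1,2)] sm by auto
   have yX: "yy (X1 z) = z" "yr (X2 z) = z" using X1(4) X2(4) z' by auto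
   have "p z * (4 * a * (X1 z)^2 + 5 / 2 * b * X1 z) <= (F1 (X1 z) - z) / X1 z - (F1 (\<xi>1 z) - z) / \<xi>1 z"
   proof -
    have "(F1 (X1 z) - z) / X1 z - (F1 (X1 z - p z) - z) / (X1 z - p z) =
     p z * (a * (3 * (X1 z)^2 - 3 * X1 z * p z + (p z)^2) + b * (2 * X1 z - p z) + c + z / (X1 z * (X1 z - p z)))"
     unfolding F1_def by (rule slope_diff) (use O1 in \<open>auto simp: p_def\<close>)
    moreover have "a * (3 * (X1 z)^2 - 3 * X1 z * p z + (p z)^2) + b * (2 * X1 z - p z) + c + (F1 (X1 z) - (F1 (X1 z) - z)) / (X1 z * (X1 z - p z))
      >= 4 * a * (X1 z)^2 + 5 / 2 * b * X1 z"
     using R1[OF order_trans[OF XN(4) XX(1)], of "p z" "F1 (X1 z) - z"] O1 pq u1[of "X1 z"] U(2)[of "X1 z"] yX by simp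
    moreover have "X1 z - p z = \<xi>1 z" by (simp add: p_def)
    ultimately show ?thesis using O1 by simp
   qed
   moreover have "(F2 (X2 z) - z) / X2 z - (F2 (\<xi>2 z) - z) / \<xi>2 z <= q z * B z"
   proof -
    have "(F2 (X2 z) - z) / X2 z - (F2 (X2 z - q z) - z) / (X2 z - q z) =
     q z * (a * (3 * (X2 z)^2 - 3 * X2 z * q z + (q z)^2) + (- b) * (2 * X2 z - q z) + c + z / (X2 z * (X2 z - q z)))"
     unfolding F2_def by (rule slope_diff) (use O2 in \<open>auto simp: q_def\<close>)
    moreover have "a * (3 * (X2 z)^2 - 3 * X2 z * q z + (q z)^2) + (- b) * (2 * X2 z - q z) + c + (F2 (X2 z) - (F2 (X2 z) - z)) / (X2 z * (X2 z - q z))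
      <= 4 * a * (X2 z)^2 + (4 * a * \<epsilon> - 3 * b) * X2 z"
     using R2[OF order_trans[OF XN(5) XX(2)], of "q z" "F2 (X2 z) - z"] O2 pq u2[of "X2 z"] yX by simp
    moreover have "4 * a * (X2 z)^2 + (4 * a * \<epsilon> - 3 * b) * X2 z <= B z"
     unfolding B_def using R3[OF order_trans[OF XN(6) XX(1)] XX(3,4)] .
    moreover have "X2 z - q z = \<xi>2 z" by (simp add: q_def)
    ultimately show ?thesis using O2 by simp
   qed
   moreover have "b * X1 z >= 1"
   proof -
    have "1 / b <= X1 z" using Xs XX by simp
    then show ?thesis using ab by (simp add: pos_divide_le_eq mult.commute)
   qed
   moreover have "B z <= K" using K[of z] z by (simp add: abs_le_iff)
   ultimately show "p z * (4 * a * (X1 z)^2 + 5 / 2 * b * X1 z) <= (F1 (X1 z) - z) / X1 z - (F1 (\<xi>1 z) - z) / \<xi>1 z &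
    (F2 (X2 z) - z) / X2 z - (F2 (\<xi>2 z) - z) / \<xi>2 z <= q z * B z & B z <= 4 * a * (X1 z)^2 + 5 / 2 * b * X1 z - 1 & B z <= K"
    by (simp add: B_def)
  qed
  have ye': "ye >= ya" "ya < ye" using ye yb by auto
  have Xe: "X1 ye >= Xs" "X1 ye + \<mu> < X2 ye" "yy (X1 ye) = ye"
   using X1Xs[of ye] gapX[of ye] ys[OF ye'(1)] X1(4) by auto
  show "Y1 < Y2"
  proof (rule shift_barrier[where ye = ye and xb = Xs and F = F1 and G = F2 and l = sh and M = M and F' = "quart' a b c d"])
   show "ye < Y1" "ye < Y2" using ye m by auto
   show "continuous_on {ye..Y1} \<xi>1" "continuous_on {ye..Y2} \<xi>2"
    using ye' \<eta>ya by (auto intro: continuous_on_subset[OF C1(1)] continuous_on_subset[OF C2(1)])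
   show "\<xi>1 Y1 = 0" "\<xi>2 Y2 = 0" using C1 C2 by auto
   show "\<xi>1 z > 0 & (\<xi>1 has_real_derivative (F1 (\<xi>1 z) - z) / \<xi>1 z) (at z)" if "ye < z" "z < Y1" for z
    using C1(4)[of z] that ye' \<eta>ya by auto
   show "\<xi>2 z > 0 & (\<xi>2 has_real_derivative (F2 (\<xi>2 z) - z) / \<xi>2 z) (at z)" if "ye < z" "z < Y2" for z
    using C2(4)[of z] that ye' \<eta>ya by auto
   show "(F1 has_real_derivative quart' a b c d x) (at x)" for x unfolding F1_def by (rule DERIV_quart)
   show "\<xi>2 ye - \<xi>1 ye > sh" using ye(3,4) Xe(2) sm(5) by (simp add: p_def q_def)
   have "\<xi>1 ye = X1 ye - 2 * \<epsilon>" using ye(3) by (simp add: p_def)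
   then show "F1 (\<xi>1 ye) < ye" using E3[OF order_trans[OF XN(3) Xe(1)]] U(2)[of "X1 ye"] Xe(3) by simp
   show "F1 x <= F2 (x + sh)" if "x >= Xs" for x using E1[of x] XN(1) that U(1) by simp
   show "(x + sh) * F1 x - x * F2 (x + sh) <= M" if "0 <= x" "x <= Xs" for x using M[OF that] by (simp add: abs_le_iff)
   have "sh * ya < sh * ye" using ye' sm by simp
   then show "M < sh * ye" using ya by simp
  qed (rule sm(1))
 qed
qed

section \<open>Distance to the loop on the sphere\<close>

text \<open>Radial projection is Lipschitz outside the unit ball. As \<open>poincare\<close>
  normalises (x, y, 1), vertical distances in the plane control distances on the sphere.\<close>

lemma norm_sgn_diff_le:
 fixes u v :: "'a::real_inner"
 assumes "norm u >= 1" "norm v >= 1"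
 shows "norm (sgn u - sgn v) <= 2 * norm (u - v)"
proof -
 have v: "norm v > 0" and u: "norm u > 0" using assms by linarith+
 have "sgn u - sgn v = (u - v) /\<^sub>R norm u + (1 / norm u - 1 / norm v) *\<^sub>R v"
  by (simp add: sgn_div_norm algebra_simps inverse_eq_divide)
 then have "norm (sgn u - sgn v) <= norm ((u - v) /\<^sub>R norm u) + norm ((1 / norm u - 1 / norm v) *\<^sub>R v)"
  by (metis norm_triangle_ineq)
 also have "norm ((u - v) /\<^sub>R norm u) = norm (u - v) / norm u" by (simp add: divide_inverse mult.commute)
 also have "norm ((1 / norm u - 1 / norm v) *\<^sub>R v) = \<bar>norm v - norm u\<bar> / norm u"
 proof -
  have "1 / norm u - 1 / norm v = (norm v - norm u) / (norm u * norm v)" using u v by (simp add: field_simps)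
  then show ?thesis using u v by (simp add: abs_mult)
 qed
 also have "\<bar>norm v - norm u\<bar> <= norm (u - v)" by (metis norm_minus_commute norm_triangle_ineq3)
 also have "norm (u - v) / norm u + norm (u - v) / norm u <= norm (u - v) + norm (u - v)"
  using assms(1) by (intro add_mono) (simp_all add: divide_le_eq mult_le_cancel_left1 u)
 finally show ?thesis using u by (simp add: divide_right_mono)
qed

lemma poincare_sgn: "poincare (x, y) = sgn (x, y, 1)"
 by (simp add: poincare_def sgn_div_norm norm_Pair add_ac divide_inverse)

lemma dist_poincare_le: "dist (poincare (x, y)) (poincare (x, y')) <= 2 * \<bar>y - y'\<bar>"
proof -
 have n: "norm (x, y, 1::real) >= 1" for y :: real by (simp add: norm_Pair)
 have "norm ((x, y, 1::real) - (x, y', 1)) = \<bar>y - y'\<bar>" by (simp add: norm_Pair)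
 then show ?thesis unfolding poincare_sgn dist_norm using norm_sgn_diff_le[OF n n, of y y'] by simp
qed

lemma continuous_on_poincare: "continuous_on S poincare"
proof -
 have "1 + (fst q)^2 + (snd q)^2 > 0" for q :: "real \<times> real" by (simp add: add_pos_nonneg)
 then have "sqrt (1 + (fst q)^2 + (snd q)^2) \<noteq> 0" for q :: "real \<times> real" by (metis less_irrefl real_sqrt_eq_0_iff)
 then show ?thesis unfolding poincare_def split_def by (intro continuous_intros) auto
qed

text \<open>High up, a point above the loop has k x^2 <= y + C, hence small x / y, and its image is
  near the base point; any other point is compared with the point of the loop vertically below
  it.\<close>

lemma loop_dist_small:
 assumes lead: "lead a b c" and l: "loopg (quart a b c d) yy" and e: "e > 0"
 obtains y3 \<delta> where "\<delta> > 0" "!!x y. yy x < y ==> y >= y3 \<or> y - yy x < \<delta> ==>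
  loop_dist (0, 1, 0) (range (%x. (x, yy x))) (x, y) < e"
proof -
 define \<Gamma> where "\<Gamma> = range (%x. (x, yy x))"
 obtain k C where k: "k > 0" "!!x. yy x >= k * x^2 - C" using loopg_quadratic[OF lead l] by metis
 have "\<exists>y3. \<forall>x y. yy x < y --> y >= y3 --> dist (poincare (x, y)) (0, 1, 0) < e"
 proof (rule ccontr)
  assume "\<nexists>y3. \<forall>x y. yy x < y --> y >= y3 --> dist (poincare (x, y)) (0, 1, 0) < e"
  then have "\<forall>n. \<exists>q. yy (fst q) < snd q & snd q >= real n & \<not> dist (poincare q) (0, 1, 0) < e" by fastforce
  then obtain q where q: "!!n. yy (fst (q n)) < snd (q n)" "!!n. snd (q n) >= real n"
   "!!n. \<not> dist (poincare (q n)) (0, 1, 0) < e" by metis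
  define X Y where "X = (%n. fst (q n))" and "Y = (%n. snd (q n))"
  have Y: "filterlim Y at_top sequentially"
   by (rule filterlim_at_top_mono[OF filterlim_real_sequentially]) (use q in \<open>auto simp: Y_def\<close>)
  have "((%y. (y + C) / (k * y^2)) \<longlongrightarrow> 0) at_top" using k by real_asymp
  from filterlim_compose[OF this Y] have "(%n. (Y n + C) / (k * (Y n)^2)) \<longlonglongrightarrow> 0" .
  then have "(%n. (X n / Y n)^2) \<longlonglongrightarrow> 0"
  proof (rule Lim_null_comparison[rotated])
   have "norm ((X n / Y n)^2) <= (Y n + C) / (k * (Y n)^2)" if "n > 0" for n
   proof -
    have y: "Y n > 0" using q(2)[of n] that unfolding Y_def by (metis less_le_trans of_nat_0_less_iff)
    have "k * (X n)^2 <= Y n + C" using q(1)[of n] k(2)[of "X n"] by (simp add: X_def Y_def)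
    then have "k * (X n)^2 / (k * (Y n)^2) <= (Y n + C) / (k * (Y n)^2)" using k y by (intro divide_right_mono) auto
    then show ?thesis using k by (simp add: power_divide)
   qed
   then show "eventually (%n. norm ((X n / Y n)^2) <= (Y n + C) / (k * (Y n)^2)) sequentially"
    using eventually_gt_at_top[of 0] by (rule eventually_mono[rotated])
  qed
  then have "(%n. X n / Y n) \<longlonglongrightarrow> 0" by (simp add: power_tendsto_0_iff)
  from poincare_tendsto_top[OF Y this] have "(%n. poincare (q n)) \<longlonglongrightarrow> (0, 1, 0)" by (simp add: X_def Y_def)
  from tendstoD[OF this e] show False using q(3) by simp
 qed
 then obtain y3 where y3: "!!x y. yy x < y ==> y >= y3 ==> dist (poincare (x, y)) (0, 1, 0) < e" by blast
 have le: "loop_dist (0, 1, 0) \<Gamma> q <= dist (poincare q) z" if "z \<in> insert (0, 1, 0) (poincare ` \<Gamma>)" for z q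
  unfolding loop_dist_def by (rule infdist_le[OF that])
 show ?thesis
 proof (rule that[of "e / 2" y3])
  fix x y assume xy: "yy x < y" "y >= y3 \<or> y - yy x < e / 2"
  show "loop_dist (0, 1, 0) (range (%x. (x, yy x))) (x, y) < e"
  proof (cases "y >= y3")
   case True
   then show ?thesis using le[of "(0, 1, 0)" "(x, y)"] y3[OF xy(1)] by (simp add: \<Gamma>_def)
  next
   case False
   then have "dist (poincare (x, y)) (poincare (x, yy x)) < e"
    using dist_poincare_le[of x y "yy x"] xy by (simp add: abs_if)
   moreover have "poincare (x, yy x) \<in> insert (0, 1, 0) (poincare ` \<Gamma>)" by (auto simp: \<Gamma>_def)
   ultimately show ?thesis using le[of _ "(x, y)"] unfolding \<Gamma>_def by (meson le_less_trans)
  qed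
 qed (use e in auto)
qed

text \<open>The plane coordinates are recovered from the sphere as u / w and v / w, and w > 0 keeps
  the limit off the equator. So a limit of points of the loop that lies in the plane lies on the
  graph.\<close>

lemma loop_dist_pos:
 assumes l: "loopg F yy" and xy: "yy x < y"
 shows "loop_dist (0, 1, 0) (range (%x. (x, yy x))) (x, y) > 0"
proof -
 define A where "A = insert (0, 1, 0) (poincare ` range (%x. (x, yy x)))"
 have yc: "isCont yy z" for z using loopg_continuous[OF l, of UNIV] by (simp add: continuous_on_eq_continuous_at)
 define \<Delta> where "\<Delta> = (%x y::real. sqrt (1 + x^2 + y^2))"
 have \<Delta>: "\<Delta> x y > 0" for x y by (simp add: \<Delta>_def add_pos_nonneg)
 have P: "poincare (x, y) = (x / \<Delta> x y, y / \<Delta> x y, 1 / \<Delta> x y)" for x y by (simp add: poincare_Pair \<Delta>_def)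
 have "poincare (x, y) \<notin> closure A"
 proof
  assume "poincare (x, y) \<in> closure A"
  then obtain z where z: "!!n. z n \<in> A" "z \<longlonglongrightarrow> poincare (x, y)" unfolding closure_sequential by metis
  define u v w where "u = (%n. fst (z n))" and "v = (%n. fst (snd (z n)))" and "w = (%n. snd (snd (z n)))"
  have lim: "u \<longlonglongrightarrow> x / \<Delta> x y" "v \<longlonglongrightarrow> y / \<Delta> x y" "w \<longlonglongrightarrow> 1 / \<Delta> x y"
   using tendsto_fst[OF z(2)] tendsto_fst[OF tendsto_snd[OF z(2)]] tendsto_snd[OF tendsto_snd[OF z(2)]]
   by (simp_all add: P u_def v_def w_def)
  have w0: "1 / \<Delta> x y > 0" using \<Delta>[of x y] by simp
  have q: "(%n. u n / w n) \<longlonglongrightarrow> x / \<Delta> x y / (1 / \<Delta> x y)" "(%n. v n / w n) \<longlonglongrightarrow> y / \<Delta> x y / (1 / \<Delta> x y)"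
   by (intro tendsto_divide lim; use w0 in simp)+
  have q': "(%n. u n / w n) \<longlonglongrightarrow> x" "(%n. v n / w n) \<longlonglongrightarrow> y" using q \<Delta>[of x y] by simp_all
  have "(%n. v n / w n - yy (u n / w n)) \<longlonglongrightarrow> y - yy x"
   by (intro tendsto_diff q' isCont_tendsto_compose[OF yc q'(1)])
  moreover have "eventually (%n. v n / w n - yy (u n / w n) = 0) sequentially"
   using order_tendstoD(1)[OF lim(3) w0]
  proof (rule eventually_mono)
   fix n assume wn: "w n > 0"
   then have "z n \<noteq> (0, 1, 0)" by (auto simp: w_def)
   then obtain t where "z n = poincare (t, yy t)" using z(1)[of n] by (auto simp: A_def)
   then show "v n / w n - yy (u n / w n) = 0" using \<Delta>[of t "yy t"] by (simp add: P u_def v_def w_def)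
  qed
  then have "(%n. v n / w n - yy (u n / w n)) \<longlonglongrightarrow> 0" by (rule tendsto_eventually)
  ultimately show False using LIMSEQ_unique xy by force
 qed
 then have "infdist (poincare (x, y)) A \<noteq> 0" using in_closure_iff_infdist_zero[of A] by (auto simp: A_def)
 then show ?thesis unfolding loop_dist_def A_def[symmetric] using infdist_nonneg[of "poincare (x, y)" A] by linarith
qed

text \<open>Points above the loop with y <= y3 and gap at least \<delta> form a compact set, on
  which the distance has a positive minimum.\<close>

lemma loop_dist_near:
 assumes lead: "lead a b c" and l: "loopg (quart a b c d) yy" and \<delta>: "\<delta> > 0"
 obtains e where "e > 0" "!!x y. yy x < y ==> loop_dist (0, 1, 0) (range (%x. (x, yy x))) (x, y) < e ==>
  y > y3 \<or> y - yy x < \<delta>"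
proof -
 define D where "D = loop_dist (0, 1, 0) (range (%x. (x, yy x)))"
 obtain C where C: "!!x. \<bar>x\<bar> <= yy x + C" using loopg_quadratic[OF lead l] by metis
 define B where "B = \<bar>y3\<bar> + \<bar>C\<bar>"
 define K where "K = ({-B..B} \<times> {-B..B}) \<inter> {q. snd q <= y3 & yy (fst q) + \<delta> <= snd q}"
 have "closed {q::real \<times> real. snd q <= y3 & yy (fst q) + \<delta> <= snd q}"
  by (intro closed_Collect_conj closed_Collect_le continuous_intros
    continuous_on_compose2[OF loopg_continuous[OF l, of UNIV]]) auto
 then have K: "compact K" unfolding K_def by (intro compact_Int_closed compact_Times compact_Icc)
 have Dc: "continuous_on K D" unfolding D_def loop_dist_def
  by (intro continuous_on_infdist continuous_on_poincare)
 have "\<exists>e>0. \<forall>q\<in>K. e <= D q"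
 proof (cases "K = {}")
  case False
  then obtain q where q: "q \<in> K" "!!q'. q' \<in> K ==> D q <= D q'" using continuous_attains_inf[OF K False Dc] by blast
  have "D (fst q, snd q) > 0" unfolding D_def by (rule loop_dist_pos[OF l]) (use q(1) \<delta> in \<open>auto simp: K_def\<close>)
  then show ?thesis using q by (intro exI[of _ "D q"]) auto
 qed (auto intro: exI[of _ 1])
 then obtain e where e: "e > 0" "!!q. q \<in> K ==> e <= D q" by blast
 show ?thesis
 proof (rule that[OF e(1)], rule ccontr)
  fix x y assume xy: "yy x < y" "loop_dist (0, 1, 0) (range (%x. (x, yy x))) (x, y) < e" "\<not> (y > y3 \<or> y - yy x < \<delta>)"
  then have "y <= y3" "yy x + \<delta> <= y" by auto
  moreover have "\<bar>x\<bar> <= B" "\<bar>y\<bar> <= B" using C[of x] xy(1) \<open>y <= y3\<close> by (auto simp: B_def)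
  ultimately have "(x, y) \<in> K" by (auto simp: K_def abs_le_iff)
  then show False using e(2) xy(2) unfolding D_def by fastforce
 qed
qed

text \<open>The component is connected, avoids the graph and contains 0, which lies above the graph
  because yy 0 < F 0 = 0.\<close>

lemma loop_interior_above:
 assumes l: "loopg F yy" and F0: "F 0 = 0" and q: "q \<in> loop_interior (range (%x. (x, yy x)))"
 shows "yy (fst q) < snd q"
proof -
 define S where "S = loop_interior (range (%x. (x, yy x)))"
 define A B where "A = {q. yy (fst q) < snd q}" and "B = {q. snd q < yy (fst q)}"
 have op: "open A" "open B" unfolding A_def B_def
  by (intro open_Collect_less continuous_intros continuous_on_compose2[OF loopg_continuous[OF l, of UNIV]]; simp)+
 have sub: "S \<subseteq> - range (%x. (x, yy x))" unfolding S_def loop_interior_def by (rule connected_component_subset)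
 have "z \<in> A \<union> B" if "z \<in> S" for z
 proof -
  have "snd z \<noteq> yy (fst z)"
  proof
   assume "snd z = yy (fst z)"
   then have "z = (fst z, yy (fst z))" by (simp add: prod_eq_iff)
   then show False using sub that by blast
  qed
  then show ?thesis by (auto simp: A_def B_def)
 qed
 then have cov: "S \<subseteq> A \<union> B" by blast
 have AB: "A \<inter> B \<inter> S = {}" by (auto simp: A_def B_def)
 have "connected S" unfolding S_def loop_interior_def by (rule connected_connected_component)
 from connectedD[OF this op AB cov] have "A \<inter> S = {} \<or> B \<inter> S = {}" .
 moreover have s: "yy 0 < 0" using l F0 unfolding loopg_def by metis
 then have "0 \<in> A" by (simp add: A_def)
 moreover have "0 \<in> S"
 proof -
  have "0 \<in> - range (%x. (x, yy x))" using s by (auto simp: zero_prod_def)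
  then show ?thesis by (simp add: S_def loop_interior_def connected_component_refl_eq)
 qed
 ultimately have "B \<inter> S = {}" by blast
 then show ?thesis using cov q unfolding S_def A_def by blast
qed

lemma loop_interior_axis:
 assumes "yy 0 < \<eta>" "\<eta> <= 0"
 shows "(0, \<eta>) \<in> loop_interior (range (%x. (x, yy x)))"
 unfolding loop_interior_def connected_component_def mem_Collect_eq
proof (intro exI conjI)
 show "connected ({0::real} \<times> {\<eta>..0})" by (intro connected_Times) auto
qed (use assms in \<open>auto simp: zero_prod_def\<close>)

lemma forward_solution_hsol:
 "forward_solution (hfield a b c d) q \<phi> \<longleftrightarrow>
   \<phi> 0 = q & hsol (quart a b c d) {0..} (%t. fst (\<phi> t)) (%t. snd (\<phi> t))"
 unfolding forward_solution_def hsol_def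
 using hfield_has_vector_derivative[of "%t. fst (\<phi> t)" "%t. snd (\<phi> t)"] by (simp add: Ball_def)

lemma hsol_halfline_unique:
 assumes "hsol (quart a b c d) {0..} x y" "hsol (quart a b c d) {0..} x' y'" "x 0 = x' 0" "y 0 = y' 0" "t >= 0"
 shows "x t = x' t" "y t = y' t"
 using hsol_unique[OF hsol_halfline(1)[OF assms(1), of t] hsol_halfline(1)[OF assms(2), of t] assms(3,4), of t] assms(5)
 by auto

lemma hsol_reverse:
 assumes "hsol F {0..T} x y"
 shows "hsol (%x. F (- x)) {0..T} (%t. - x (T - t)) (%t. y (T - t))"
 unfolding hsol_def
proof (intro ballI conjI)
 fix t assume t: "t \<in> {0..T}"
 have im: "(-) T ` {0..T} = {0..T}" by simp
 have d: "(x has_real_derivative F (x (T - t)) - y (T - t)) (at (T - t) within (-) T ` {0..T})"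
  "(y has_real_derivative x (T - t)) (at (T - t) within (-) T ` {0..T})"
  using assms t unfolding hsol_def im by auto
 have r: "((-) T has_real_derivative - 1) (at t within {0..T})" by (auto intro!: derivative_eq_intros)
 show "((%t. - x (T - t)) has_real_derivative F (- (- x (T - t))) - y (T - t)) (at t within {0..T})"
  using DERIV_minus[OF DERIV_image_chain[OF d(1) r]] by (simp add: o_def)
 show "((%t. y (T - t)) has_real_derivative - x (T - t)) (at t within {0..T})"
  using DERIV_image_chain[OF d(2) r] by (simp add: o_def)
qed

text \<open>Reflected and read backwards, an arc of the left system is the passage of an orbit of
  the right system from (0, Y) through x < 0 to (0, \<eta>).\<close>

lemma arc_reverse:
 assumes A: "arc (quart a (- b) c (- d)) \<eta> Y"
  and h: "hsol (quart a b c d) {0..} x y" "x 0 = 0" "y 0 = Y"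
 obtains T xl yl where "T > 0" "hsol (quart a (- b) c (- d)) {0..} xl yl" "xl 0 = 0" "yl 0 = \<eta>"
  "!!t. 0 <= t ==> t <= T ==> x t = - xl (T - t) & y t = yl (T - t)" "x T = 0" "y T = \<eta>"
  "!!t. 0 < t ==> t < T ==> xl t > 0"
proof -
 obtain T xl yl where T: "T > 0" "hsol (quart a (- b) c (- d)) {0..} xl yl" "xl 0 = 0" "yl 0 = \<eta>" "xl T = 0" "yl T = Y"
  "!!t. 0 < t ==> t < T ==> xl t > 0" using A unfolding arc_def by metis
 have F: "(%x. quart a (- b) c (- d) (- x)) = quart a b c d" using quart_uminus_fun[of a "- b" c "- d"] by simp
 have "hsol (quart a b c d) {0..T} (%t. - xl (T - t)) (%t. yl (T - t))"
  using hsol_reverse[OF hsol_halfline(1)[OF T(2), of T]] unfolding F .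
 then have eq: "x t = - xl (T - t) & y t = yl (T - t)" if "0 <= t" "t <= T" for t
  using hsol_unique[OF hsol_halfline(1)[OF h(1), of T], of "%t. - xl (T - t)" "%t. yl (T - t)" t] that h T by auto
 have "x T = 0" "y T = \<eta>" using eq[of T] T by auto
 then show ?thesis using that[OF T(1-4) eq] T(7) by blast
qed

text \<open>Read backwards, both arcs are the unique orbit of the reflected system from (0, Y), up
  to its first return to the axis.\<close>

lemma arc_inj:
 assumes A: "arc (quart a b c d) \<eta> Y" "arc (quart a b c d) \<eta>' Y" and l: "loopg (quart a (- b) c (- d)) yy"
  and lead: "lead a b c" and Y: "Y >= yy 0"
 shows "\<eta> = \<eta>'"
proof -
 obtain x y where xy: "x 0 = 0" "y 0 = Y" "hsol (quart a (- b) c (- d)) {0..} x y"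
  using loop_global[OF lead_minus[OF lead] l Y] by metis
 have A': "arc (quart a (- (- b)) c (- (- d))) \<eta> Y" "arc (quart a (- (- b)) c (- (- d))) \<eta>' Y" using A by simp_all
 obtain T xl yl where T: "T > 0" "!!t. 0 <= t ==> t <= T ==> x t = - xl (T - t) & y t = yl (T - t)" "x T = 0" "y T = \<eta>"
  "!!t. 0 < t ==> t < T ==> xl t > 0" using arc_reverse[OF A'(1) xy(3,1,2)] by metis
 obtain T' xl' yl' where T': "T' > 0" "!!t. 0 <= t ==> t <= T' ==> x t = - xl' (T' - t) & y t = yl' (T' - t)" "x T' = 0" "y T' = \<eta>'"
  "!!t. 0 < t ==> t < T' ==> xl' t > 0" using arc_reverse[OF A'(2) xy(3,1,2)] by metis
 have "\<not> T < T'"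
 proof
  assume "T < T'"
  then have "x T < 0" using T'(2)[of T] T'(5)[of "T' - T"] T(1) by simp
  then show False using T(3) by simp
 qed
 moreover have "\<not> T' < T"
 proof
  assume "T' < T"
  then have "x T' < 0" using T(2)[of T'] T(5)[of "T - T'"] T'(1) by simp
  then show False using T'(3) by simp
 qed
 ultimately show ?thesis using T(4) T'(4) by simp
qed

section \<open>The return map near the loop\<close>

text \<open>The half return map is continuous, injective by reversal, and tends to infinity at yy 0;
  so it is strictly decreasing and takes all larger values. The bound 1 from below keeps the upper
  end of the arcs transversal.\<close>

lemma arc_map:
 assumes lead: "lead a b c" and l: "loopg (quart a b c d) yy"
 obtains \<eta>1 Yf where "yy 0 < \<eta>1" "\<eta>1 <= 0" "continuous_on {yy 0<..<\<eta>1} Yf"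
  "!!\<eta>. yy 0 < \<eta> ==> \<eta> < \<eta>1 ==> arc (quart a b c d) \<eta> (Yf \<eta>)"
  "!!\<eta>. yy 0 < \<eta> ==> \<eta> < \<eta>1 ==> Yf \<eta> >= 1"
  "!!\<eta> \<eta>'. yy 0 < \<eta> ==> \<eta> < \<eta>' ==> \<eta>' < \<eta>1 ==> Yf \<eta>' < Yf \<eta>"
  "!!\<eta> Y. yy 0 < \<eta> ==> \<eta> < \<eta>1 ==> Yf \<eta> <= Y ==> \<exists>\<eta>'. yy 0 < \<eta>' & \<eta>' <= \<eta> & Yf \<eta>' = Y"
proof -
 define F where "F = quart a b c d"
 have F0: "F 0 = 0" by (simp add: F_def)
 have s: "yy 0 < 0" using l unfolding loopg_def by (metis quart_0)
 obtain \<eta>0 where \<eta>0: "\<eta>0 > yy 0" and ex: "!!\<eta>. yy 0 < \<eta> ==> \<eta> < \<eta>0 ==>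
  (\<exists>Y. arc F \<eta> Y) & (\<forall>Y. arc F \<eta> Y --> Y >= 1)" using arc_exists[OF lead l, of 1] unfolding F_def by metis
 define \<eta>1 where "\<eta>1 = min \<eta>0 0"
 have \<eta>1: "yy 0 < \<eta>1" "\<eta>1 <= 0" "\<eta>1 <= \<eta>0" using \<eta>0 s by (auto simp: \<eta>1_def)
 define Yf where "Yf = (%\<eta>. SOME Y. arc F \<eta> Y)"
 have Yf: "arc F \<eta> (Yf \<eta>)" if "yy 0 < \<eta>" "\<eta> < \<eta>1" for \<eta>
  unfolding Yf_def by (rule someI_ex) (use ex[of \<eta>] that \<eta>1 in auto)
 have Y1: "Yf \<eta> >= 1" if "yy 0 < \<eta>" "\<eta> < \<eta>1" for \<eta> using ex[of \<eta>] Yf[OF that] that \<eta>1 by auto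
 have uni: "Y = Yf \<eta>" if "arc F \<eta> Y" "yy 0 < \<eta>" "\<eta> < \<eta>1" for \<eta> Y
  using arc_unique[OF that(1)[unfolded F_def] Yf[OF that(2,3), unfolded F_def]] .
 have c: "continuous_on {yy 0<..<\<eta>1} Yf"
  unfolding continuous_on_iff
 proof (intro ballI allI impI)
  fix \<eta> e :: real assume \<eta>: "\<eta> \<in> {yy 0<..<\<eta>1}" and e: "e > 0"
  have A: "arc (quart a b c d) \<eta> (Yf \<eta>)" "\<eta> < 0" "Yf \<eta> > 0" using Yf[of \<eta>] Y1[of \<eta>] \<eta> \<eta>1 unfolding F_def by auto
  obtain \<delta> where \<delta>: "\<delta> > 0" "!!\<eta>'. \<bar>\<eta>' - \<eta>\<bar> < \<delta> ==> yy 0 < \<eta>' ==> \<exists>Y'. arc F \<eta>' Y' & \<bar>Y' - Yf \<eta>\<bar> < e"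
   using arc_continuous[OF lead l A e] unfolding F_def by metis
  show "\<exists>\<delta>>0. \<forall>\<eta>'\<in>{yy 0<..<\<eta>1}. dist \<eta>' \<eta> < \<delta> --> dist (Yf \<eta>') (Yf \<eta>) < e"
  proof (intro exI[of _ \<delta>] conjI ballI impI \<delta>(1))
   fix \<eta>' assume \<eta>': "\<eta>' \<in> {yy 0<..<\<eta>1}" "dist \<eta>' \<eta> < \<delta>"
   then obtain Y' where Y': "arc F \<eta>' Y'" "\<bar>Y' - Yf \<eta>\<bar> < e" using \<delta>(2)[of \<eta>'] by (auto simp: dist_real_def)
   then have "Y' = Yf \<eta>'" using uni[of \<eta>' Y'] \<eta>' by simp
   then show "dist (Yf \<eta>') (Yf \<eta>) < e" using Y' by (simp add: dist_real_def)
  qed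
 qed
 have surj: "\<exists>\<eta>'. yy 0 < \<eta>' & \<eta>' <= \<eta> & Yf \<eta>' = Y" if \<eta>: "yy 0 < \<eta>" "\<eta> < \<eta>1" and Y: "Yf \<eta> <= Y" for \<eta> Y
 proof -
  obtain \<eta>2 where \<eta>2: "\<eta>2 > yy 0" and big: "!!\<eta>. yy 0 < \<eta> ==> \<eta> < \<eta>2 ==> (\<forall>Y'. arc F \<eta> Y' --> Y' >= Y)"
   using arc_exists[OF lead l, of Y] unfolding F_def by metis
  obtain h where h: "yy 0 < h" "h < min \<eta>2 \<eta>" using dense[of "yy 0" "min \<eta>2 \<eta>"] \<eta>2 \<eta> by auto
  have "Yf h >= Y" using big[of h] Yf[of h] h \<eta> by simp
  moreover have "continuous_on {h..\<eta>} Yf" by (rule continuous_on_subset[OF c]) (use h \<eta> in auto)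
  ultimately obtain \<eta>' where "h <= \<eta>'" "\<eta>' <= \<eta>" "Yf \<eta>' = Y" using IVT2'[of Yf \<eta> Y h] Y h by auto
  then show ?thesis using h by (intro exI[of _ \<eta>']) auto
 qed
 have lr: "loopg (quart a (- b) c (- d)) (%x. yy (- x))" using loopg_reflect[OF l] by (simp add: quart_uminus_fun)
 have inj: "\<eta> = \<eta>'" if "yy 0 < \<eta>" "\<eta> < \<eta>1" "yy 0 < \<eta>'" "\<eta>' < \<eta>1" "Yf \<eta> = Yf \<eta>'" for \<eta> \<eta>'
 proof -
  have A: "arc (quart a b c d) \<eta> (Yf \<eta>)" "arc (quart a b c d) \<eta>' (Yf \<eta>)"
   using Yf[OF that(1,2)] Yf[OF that(3,4)] that(5) by (simp_all add: F_def)
  show ?thesis by (rule arc_inj[OF A lr lead]) (use Y1[OF that(1,2)] s in simp)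
 qed
 have "Yf \<eta>' < Yf \<eta>" if \<eta>: "yy 0 < \<eta>" "\<eta> < \<eta>'" "\<eta>' < \<eta>1" for \<eta> \<eta>'
 proof (rule ccontr)
  assume "\<not> Yf \<eta>' < Yf \<eta>"
  then obtain h where h: "yy 0 < h" "h <= \<eta>" "Yf h = Yf \<eta>'" using surj[of \<eta> "Yf \<eta>'"] \<eta> by auto
  then have "h = \<eta>'" using inj[of h \<eta>'] \<eta> by auto
  then show False using h \<eta> by simp
 qed
 then show ?thesis using that[OF \<eta>1(1,2) c Yf[unfolded F_def] Y1 _ surj] by blast
qed

text \<open>High points return by \<open>loop_return\<close>; lower points near the loop are first
  carried up along it by \<open>loop_follow\<close>.\<close>

lemma right_reach:
 assumes lead: "lead a b c" and l: "loopg (quart a b c d) yy"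
 obtains \<delta> yb where "\<delta> > 0" "!!x y. hsol (quart a b c d) {0..} x y ==> 0 <= x 0 ==> yy (x 0) < y 0 ==>
  y 0 > yb \<or> y 0 - yy (x 0) < \<delta> ==> \<exists>T\<ge>0. x T = 0 & y T >= y3 & (\<forall>t. 0 < t & t < T --> x t > 0)"
proof -
 define F where "F = quart a b c d"
 have Fc: "continuous_on UNIV F" unfolding F_def by (intro continuous_intros)
 define y4 where "y4 = max y3 1"
 obtain C where C: "!!x. \<bar>x\<bar> <= yy x + C" using loopg_quadratic[OF lead l] by metis
 obtain \<delta> Cg where \<delta>: "\<delta> > 0" and fol: "!!x y. hsol F {0..} x y ==> 0 <= x 0 ==> x 0 <= y4 + C ==>
  yy (x 0) < y 0 ==> y 0 < yy (x 0) + \<delta> ==> \<exists>r>0. y r >= y4 & (\<forall>t. 0 < t & t <= r --> x t > 0)"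
  using loop_follow[OF lead l, of 1 "y4 + C" y4] unfolding F_def by (metis zero_less_one)
 have high: "\<exists>T\<ge>0. x T = 0 & y T >= y3 & (\<forall>t. 0 < t & t < T --> x t > 0)"
  if h: "hsol F {0..} x y" and 0: "0 <= x 0" "yy (x 0) < y 0" "y 0 >= y4" for x y
 proof (cases "x 0 = 0")
  case True
  then show ?thesis using 0 by (intro exI[of _ 0]) (auto simp: y4_def)
 next
  case False
  then have x0: "x 0 > 0" "y 0 > 0" using 0 by (auto simp: y4_def)
  obtain T where T: "T > 0" "x T = 0" "!!t. 0 <= t ==> t < T ==> x t > 0"
   using loop_return[OF l h[unfolded F_def] x0 0(2)] by metis
  have "y 0 <= y T"
  proof (rule hsol_mono[OF h])
   show "0 <= x t" if "0 < t" "t < T" for t using T(3)[of t] that by simp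
  qed (use T in auto)
  then show ?thesis using T 0 by (intro exI[of _ T]) (auto simp: y4_def)
 qed
 show ?thesis
 proof (rule that[OF \<delta>])
  fix x y assume h: "hsol (quart a b c d) {0..} x y" and 0: "0 <= x 0" "yy (x 0) < y 0"
   and n: "y 0 > y4 \<or> y 0 - yy (x 0) < \<delta>"
  note h = h[folded F_def]
  show "\<exists>T\<ge>0. x T = 0 & y T >= y3 & (\<forall>t. 0 < t & t < T --> x t > 0)"
  proof (cases "y 0 >= y4")
   case True
   then show ?thesis using high[OF h 0] by simp
  next
   case False
   have "x 0 <= y4 + C" "y 0 < yy (x 0) + \<delta>" using C[of "x 0"] 0 False n by auto
   then obtain r where r: "r > 0" "y r >= y4" "!!t. 0 < t ==> t <= r ==> x t > 0" using fol[OF h 0(1) _ 0(2)] by blast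
   have hr: "hsol F {0..} (%t. x (r + t)) (%t. y (r + t))" by (rule hsol_halfline_shift[OF h]) (use r in simp)
   have gr: "yy (x r) < y r" by (rule loop_gap_pos[OF l[folded F_def] Fc h 0(2)]) (use r in simp)
   obtain T where T: "T >= 0" "x (r + T) = 0" "y (r + T) >= y3" "!!t. 0 < t ==> t < T ==> x (r + t) > 0"
    using high[OF hr] r(2) r(3)[of r] r(1) gr by auto
   have "x t > 0" if "0 < t" "t < r + T" for t
    using r(3)[of t] T(4)[of "t - r"] that by (cases "t <= r") auto
   then show ?thesis using T r by (intro exI[of _ "r + T"]) auto
  qed
 qed
qed

text \<open>A sufficiently high point of the positive y-axis is the end of a left arc that starts
  close to the loop, and the forward orbit descends along this arc. It remains to bring every orbit
  near the loop into this position.\<close>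

lemma reach_axis:
 assumes lead: "lead a b c" and l: "loopg (quart a b c d) yy" and e: "e > 0"
 obtains \<delta> yb where "\<delta> > 0" "!!x y. hsol (quart a b c d) {0..} x y ==> yy (x 0) < y 0 ==>
  y 0 > yb \<or> y 0 - yy (x 0) < \<delta> ==> \<exists>T\<ge>0. x T = 0 & yy 0 < y T & y T < yy 0 + e"
proof -
 define F G where "F = quart a b c d" and "G = quart a (- b) c (- d)"
 define yr where "yr = (%x. yy (- x))"
 have lr: "loopg G yr" using loopg_reflect[OF l] by (simp add: quart_uminus_fun G_def yr_def)
 have leadr: "lead a (- b) c" using lead_minus[OF lead] .
 have FG: "(%x. G (- x)) = F" using quart_uminus_fun[of a "- b" c "- d"] by (simp add: F_def G_def)
 obtain \<eta>1 Yf where Yf: "yr 0 < \<eta>1" "!!\<eta>. yr 0 < \<eta> ==> \<eta> < \<eta>1 ==> arc G \<eta> (Yf \<eta>)"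
  "!!\<eta>. yr 0 < \<eta> ==> \<eta> < \<eta>1 ==> Yf \<eta> >= 1"
  "!!\<eta> Y. yr 0 < \<eta> ==> \<eta> < \<eta>1 ==> Yf \<eta> <= Y ==> \<exists>\<eta>'. yr 0 < \<eta>' & \<eta>' <= \<eta> & Yf \<eta>' = Y"
  using arc_map[OF leadr lr[unfolded G_def]] unfolding G_def by metis
 have yr0: "yr 0 = yy 0" by (simp add: yr_def)
 obtain \<eta>0 where \<eta>0: "yy 0 < \<eta>0" "\<eta>0 < min \<eta>1 (yy 0 + e)" using dense[of "yy 0" "min \<eta>1 (yy 0 + e)"] Yf(1) e yr0 by auto
 have backw: "\<exists>\<eta>. yy 0 < \<eta> & \<eta> < yy 0 + e & arc G \<eta> Y" if Y: "Y >= Yf \<eta>0" for Y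
 proof -
  obtain \<eta> where "yr 0 < \<eta>" "\<eta> <= \<eta>0" "Yf \<eta> = Y" using Yf(4)[of \<eta>0 Y] \<eta>0 yr0 Y by auto
  then show ?thesis using Yf(2)[of \<eta>] \<eta>0 yr0 by (intro exI[of _ \<eta>]) auto
 qed
 obtain \<delta>R yR where R: "\<delta>R > 0" "!!x y. hsol F {0..} x y ==> 0 <= x 0 ==> yy (x 0) < y 0 ==>
  y 0 > yR \<or> y 0 - yy (x 0) < \<delta>R ==> \<exists>T\<ge>0. x T = 0 & y T >= Yf \<eta>0 & (\<forall>t. 0 < t & t < T --> x t > 0)"
  using right_reach[OF lead l] unfolding F_def by metis
 obtain \<delta>L yL where L: "\<delta>L > 0" "!!x y. hsol G {0..} x y ==> 0 <= x 0 ==> yr (x 0) < y 0 ==>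
  y 0 > yL \<or> y 0 - yr (x 0) < \<delta>L ==> \<exists>T\<ge>0. x T = 0 & y T >= Yf \<eta>0 & (\<forall>t. 0 < t & t < T --> x t > 0)"
  using right_reach[OF leadr lr[unfolded G_def]] unfolding G_def by metis
 show ?thesis
 proof (rule that[of "min \<delta>R \<delta>L" "max yR yL"])
  show "0 < min \<delta>R \<delta>L" using R L by simp
  fix x y assume h: "hsol (quart a b c d) {0..} x y" and 0: "yy (x 0) < y 0" and n: "y 0 > max yR yL \<or> y 0 - yy (x 0) < min \<delta>R \<delta>L"
  show "\<exists>T\<ge>0. x T = 0 & yy 0 < y T & y T < yy 0 + e"
  proof (cases "x 0 >= 0")
   case True
   obtain T where T: "T >= 0" "x T = 0" "y T >= Yf \<eta>0" using R(2)[OF h[folded F_def] True 0] n by auto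
   obtain \<eta> where \<eta>: "yy 0 < \<eta>" "\<eta> < yy 0 + e" "arc G \<eta> (y T)" using backw[OF T(3)] by blast
   have hT: "hsol (quart a b c d) {0..} (%t. x (T + t)) (%t. y (T + t))" by (rule hsol_halfline_shift[OF h T(1)])
   obtain T' where "T' > 0" "x (T + T') = 0" "y (T + T') = \<eta>"
    using arc_reverse[OF \<eta>(3)[unfolded G_def] hT] T(2) by (metis add.right_neutral)
   then show ?thesis using \<eta> T by (intro exI[of _ "T + T'"]) auto
  next
   case False
   \<comment> \<open>For x 0 < 0 the reflected backward orbit is followed up to the axis. The
     forward orbit from there descends along a left arc, and by uniqueness it passes through the
     given point on its way.\<close>
   have "y 0 >= yr (- x 0)" using 0 by (simp add: yr_def)
   then obtain xl yl where hl: "xl 0 = - x 0" "yl 0 = y 0" "hsol G {0..} xl yl"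
    using loop_global[OF leadr lr[unfolded G_def]] unfolding G_def by metis
   obtain T1 where T1: "T1 >= 0" "xl T1 = 0" "yl T1 >= Yf \<eta>0" "!!t. 0 < t ==> t < T1 ==> xl t > 0"
    using L(2)[OF hl(3)] hl(1,2) 0 n False by (auto simp: yr_def)
   obtain \<eta> where \<eta>: "yy 0 < \<eta>" "\<eta> < yy 0 + e" "arc G \<eta> (yl T1)" using backw[OF T1(3)] by blast
   have "1 <= Yf \<eta>0" using Yf(3)[of \<eta>0] \<eta>0 yr0 by simp
   moreover have "yy 0 < 0" using l unfolding loopg_def by (metis quart_0)
   ultimately have "yl T1 >= yy 0" using T1(3) by linarith
   then obtain xh yh where hh: "xh 0 = 0" "yh 0 = yl T1" "hsol (quart a b c d) {0..} xh yh" using loop_global[OF lead l] by metis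
   obtain T where T: "T > 0" "xh T = 0" "yh T = \<eta>" using arc_reverse[OF \<eta>(3)[unfolded G_def] hh(3,1,2)] by metis
   have "hsol (quart a b c d) {0..T1} (%t. - xl (T1 - t)) (%t. yl (T1 - t))"
    using hsol_reverse[OF hsol_halfline(1)[OF hl(3), of T1]] unfolding FG F_def .
   then have eq: "xh t = - xl (T1 - t) & yh t = yl (T1 - t)" if "0 <= t" "t <= T1" for t
    using hsol_unique[OF hsol_halfline(1)[OF hh(3), of T1], of "%t. - xl (T1 - t)" "%t. yl (T1 - t)" t] that hh T1 by auto
   have "T1 <= T"
   proof (rule ccontr)
    assume "\<not> T1 <= T"
    then have "xh T < 0" using eq[of T] T1(4)[of "T1 - T"] T(1) by simp
    then show False using T by simp
   qed
   have q: "xh T1 = x 0" "yh T1 = y 0" using eq[of T1] T1(1) hl by auto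
   have hs: "hsol (quart a b c d) {0..} (%t. xh (T1 + t)) (%t. yh (T1 + t))" by (rule hsol_halfline_shift[OF hh(3) T1(1)])
   have "x (T - T1) = xh (T1 + (T - T1))" "y (T - T1) = yh (T1 + (T - T1))"
    by (rule hsol_halfline_unique[OF h hs]; use q \<open>T1 <= T\<close> in simp)+
   then show ?thesis using T \<eta> \<open>T1 <= T\<close> by (intro exI[of _ "T - T1"]) auto
  qed
 qed
qed

text \<open>One full turn between crossings of the negative y-axis. The return map is encoded by the
  common upper end Y of a right and a left arc; the time with y >= 1 will keep crossing times from
  accumulating, and the last clause controls the whole turn.\<close>

lemma revolve:
 assumes lead: "lead a b c" and l: "loopg (quart a b c d) yy" and e: "e > 0"
 obtains \<delta> where "\<delta> > 0" "!!x y t. hsol (quart a b c d) {0..} x y ==> t >= 0 ==> x t = 0 ==> yy 0 < y t ==> y t < yy 0 + \<delta> ==>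
  \<exists>t'>t. x t' = 0 & yy 0 < y t' & y t' < yy 0 + e &
   (\<exists>Y. arc (quart a b c d) (y t) Y & arc (quart a (- b) c (- d)) (y t') Y) & (\<exists>u. t <= u & u <= t' & y u >= 1) &
   (\<forall>r. t <= r & r <= t' --> y r >= y3 \<or> y r - yy (x r) < e)"
proof -
 define F G where "F = quart a b c d" and "G = quart a (- b) c (- d)"
 define yr where "yr = (%x. yy (- x))"
 have lr: "loopg G yr" using loopg_reflect[OF l] by (simp add: quart_uminus_fun G_def yr_def)
 have leadr: "lead a (- b) c" using lead_minus[OF lead] .
 have yr0: "yr 0 = yy 0" by (simp add: yr_def)
 obtain \<eta>1 Yf where Yf: "yr 0 < \<eta>1" "!!\<eta>. yr 0 < \<eta> ==> \<eta> < \<eta>1 ==> arc G \<eta> (Yf \<eta>)"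
  "!!\<eta> Y. yr 0 < \<eta> ==> \<eta> < \<eta>1 ==> Yf \<eta> <= Y ==> \<exists>\<eta>'. yr 0 < \<eta>' & \<eta>' <= \<eta> & Yf \<eta>' = Y"
  using arc_map[OF leadr lr[unfolded G_def]] unfolding G_def by metis
 obtain \<delta>L where L: "\<delta>L > 0" "!!x y. hsol G {0..} x y ==> 0 <= x 0 ==> x 0 <= 0 ==>
  yr (x 0) < y 0 ==> y 0 < yr (x 0) + \<delta>L ==> \<exists>r>0. y r >= y3 & (\<forall>t. 0 <= t & t <= r --> y t - yr (x t) < e)"
  using loop_follow[OF leadr lr[unfolded G_def] e, of 0 y3] unfolding G_def by metis
 obtain \<delta>R where R: "\<delta>R > 0" "!!x y. hsol F {0..} x y ==> 0 <= x 0 ==> x 0 <= 0 ==>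
  yy (x 0) < y 0 ==> y 0 < yy (x 0) + \<delta>R ==> \<exists>r>0. y r >= y3 & (\<forall>t. 0 <= t & t <= r --> y t - yy (x t) < e)"
  using loop_follow[OF lead l e, of 0 y3] unfolding F_def by metis
 define B where "B = min \<eta>1 (yy 0 + min e \<delta>L)"
 obtain \<eta>0 where \<eta>0: "yy 0 < \<eta>0" "\<eta>0 < B" using dense[of "yy 0" B] Yf(1) e L(1) yr0 by (auto simp: B_def)
 have B3: "\<eta>0 < \<eta>1" "\<eta>0 < yy 0 + e" "\<eta>0 < yy 0 + \<delta>L"
  using \<eta>0(2) min.cobounded1[of e \<delta>L] min.cobounded2[of e \<delta>L] unfolding B_def by linarith+
 obtain \<eta>2 where \<eta>2: "\<eta>2 > yy 0" and ex: "!!\<eta>. yy 0 < \<eta> ==> \<eta> < \<eta>2 ==>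
  (\<exists>Y. arc F \<eta> Y) & (\<forall>Y. arc F \<eta> Y --> Y >= max 1 (Yf \<eta>0))" using arc_exists[OF lead l] unfolding F_def by metis
 show ?thesis
 proof (rule that[of "min \<delta>R (\<eta>2 - yy 0)"])
  show "min \<delta>R (\<eta>2 - yy 0) > 0" using R \<eta>2 by simp
  fix x y and t :: real
  assume h: "hsol (quart a b c d) {0..} x y" and t: "t >= 0" "x t = 0" "yy 0 < y t" "y t < yy 0 + min \<delta>R (\<eta>2 - yy 0)"
  have hs: "hsol F {0..} (%r. x (t + r)) (%r. y (t + r))" unfolding F_def by (rule hsol_halfline_shift[OF h t(1)])
  have t4: "y t < yy 0 + \<delta>R" "y t < \<eta>2" using t(4) min.cobounded1[of \<delta>R "\<eta>2 - yy 0"] min.cobounded2[of \<delta>R "\<eta>2 - yy 0"]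
   by linarith+
  obtain Y where Y: "arc F (y t) Y" "Y >= 1" "Y >= Yf \<eta>0" using ex[OF t(3) t4(2)] by auto
  obtain T x1 y1 where T: "T > 0" "hsol F {0..} x1 y1" "x1 0 = 0" "y1 0 = y t" "x1 T = 0" "y1 T = Y"
   "!!r. 0 < r ==> r < T ==> x1 r > 0" using Y(1) unfolding arc_def by metis
  have eq: "x1 r = x (t + r)" "y1 r = y (t + r)" if "r >= 0" for r
   by (rule hsol_halfline_unique[OF T(2)[unfolded F_def] hs[unfolded F_def]]; use T t that in simp)+
  have st: "0 <= x1 0" "x1 0 <= 0" "yy (x1 0) < y1 0" "y1 0 < yy (x1 0) + \<delta>R" using t(3) t4 by (simp_all add: T(3,4))
  obtain r1 where r1: "r1 > 0" "y1 r1 >= y3" "!!r. 0 <= r ==> r <= r1 ==> y1 r - yy (x1 r) < e"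
   using R(2)[OF T(2) st] by blast
  have c1: "y1 r >= y3 \<or> y1 r - yy (x1 r) < e" if r: "0 <= r" "r <= T" for r
  proof (cases "r <= r1")
   case False
   have "y1 r1 <= y1 r"
   proof (rule hsol_mono[OF T(2)])
    show "0 <= x1 w" if "r1 < w" "w < r" for w using T(7)[of w] that r r1 by simp
   qed (use False r1 in auto)
   then show ?thesis using r1 by simp
  qed (use r1 r in auto)
  obtain \<eta>' where \<eta>': "yr 0 < \<eta>'" "\<eta>' <= \<eta>0" "Yf \<eta>' = Y" using Yf(3)[of \<eta>0 Y] \<eta>0 B3 Y yr0 by auto
  have A': "arc G \<eta>' Y" using Yf(2)[of \<eta>'] \<eta>' B3 by auto
  have tT: "t + T >= 0" using t T by simp
  have hs2: "hsol (quart a b c d) {0..} (%r. x (t + T + r)) (%r. y (t + T + r))" by (rule hsol_halfline_shift[OF h tT])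
  have x2: "x (t + T) = 0" "y (t + T) = Y" using eq[of T] T by auto
  obtain S xl yl where S: "S > 0" "hsol G {0..} xl yl" "xl 0 = 0" "yl 0 = \<eta>'"
   "!!r. 0 <= r ==> r <= S ==> x (t + T + r) = - xl (S - r) & y (t + T + r) = yl (S - r)" "x (t + T + S) = 0" "y (t + T + S) = \<eta>'"
   "!!r. 0 < r ==> r < S ==> xl r > 0"
   using arc_reverse[OF A'[unfolded G_def] hs2] x2 unfolding G_def by (metis add.right_neutral)
  have st2: "0 <= xl 0" "xl 0 <= 0" "yr (xl 0) < yl 0" "yl 0 < yr (xl 0) + \<delta>L"
   using \<eta>' B3 yr0 by (simp_all add: S(3,4))
  obtain r2 where r2: "r2 > 0" "yl r2 >= y3" "!!r. 0 <= r ==> r <= r2 ==> yl r - yr (xl r) < e"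
   using L(2)[OF S(2) st2] by blast
  have c2: "yl r >= y3 \<or> yl r - yr (xl r) < e" if r: "0 <= r" "r <= S" for r
  proof (cases "r <= r2")
   case False
   have "yl r2 <= yl r"
   proof (rule hsol_mono[OF S(2)])
    show "0 <= xl w" if "r2 < w" "w < r" for w using S(8)[of w] that r r2 by simp
   qed (use False r2 in auto)
   then show ?thesis using r2 by simp
  qed (use r2 r in auto)
  have close: "y r >= y3 \<or> y r - yy (x r) < e" if r: "t <= r" "r <= t + T + S" for r
  proof (cases "r <= t + T")
   case True
   then show ?thesis using c1[of "r - t"] eq[of "r - t"] r by simp
  next
   case False
   then have "x r = - xl (S - (r - (t + T)))" "y r = yl (S - (r - (t + T)))" using S(5)[of "r - (t + T)"] r by auto
   then show ?thesis using c2[of "S - (r - (t + T))"] False r by (simp add: yr_def)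
  qed
  show "\<exists>t'>t. x t' = 0 & yy 0 < y t' & y t' < yy 0 + e &
   (\<exists>Y. arc (quart a b c d) (y t) Y & arc (quart a (- b) c (- d)) (y t') Y) & (\<exists>u. t <= u & u <= t' & y u >= 1) &
   (\<forall>r. t <= r & r <= t' --> y r >= y3 \<or> y r - yy (x r) < e)"
  proof (rule exI[of _ "t + T + S"], intro conjI)
   show "yy 0 < y (t + T + S)" "y (t + T + S) < yy 0 + e" using \<eta>' B3 yr0 S by auto
   show "\<exists>Y. arc (quart a b c d) (y t) Y & arc (quart a (- b) c (- d)) (y (t + T + S)) Y"
    using Y A' S(7) unfolding F_def G_def by blast
   show "\<exists>u. t <= u & u <= t + T + S & y u >= 1" using x2 Y T S by (intro exI[of _ "t + T"]) auto
   show "\<forall>r. t <= r & r <= t + T + S --> y r >= y3 \<or> y r - yy (x r) < e" using close by blast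
  qed (use S T in auto)
 qed
qed

text \<open>If the times accumulated at L, continuity would give y L <= 0 along \<tau> and y L >= 1
  along the times in between.\<close>

lemma oscillation_times_unbounded:
 fixes y :: "real \<Rightarrow> real" and \<tau> :: "nat \<Rightarrow> real"
 assumes y: "continuous_on {0..} y" and 0: "0 <= \<tau> 0" and \<tau>: "!!n. \<tau> n < \<tau> (Suc n)" "!!n. y (\<tau> n) <= 0"
  and u: "!!n. \<exists>u. \<tau> n <= u & u <= \<tau> (Suc n) & y u >= 1"
 shows "\<exists>n. t < \<tau> n"
proof (rule ccontr)
 assume "\<nexists>n. t < \<tau> n"
 then have b: "\<tau> n <= t" for n by (simp add: not_less)
 have inc: "incseq \<tau>" using \<tau>(1) by (intro incseq_SucI) (simp add: less_imp_le)
 obtain L where L: "\<tau> \<longlonglongrightarrow> L" "!!n. \<tau> n <= L" using incseq_convergent[OF inc] b by blast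
 have L0: "0 <= L" "!!n. 0 <= \<tau> n" using 0 L(2)[of 0] incseqD[OF inc, of 0] order_trans by auto
 obtain w where w: "!!n. \<tau> n <= w n" "!!n. w n <= \<tau> (Suc n)" "!!n. y (w n) >= 1" using u by metis
 have wL: "w \<longlonglongrightarrow> L"
  by (rule tendsto_sandwich[OF _ _ L(1) LIMSEQ_Suc[OF L(1)]]) (use w in auto)
 have "(%n. y (\<tau> n)) \<longlonglongrightarrow> y L" by (rule continuous_on_tendsto_compose[OF y L(1)]) (use L0 in auto)
 then have "y L <= 0" by (rule LIMSEQ_le_const2) (use \<tau> in auto)
 moreover have w0: "0 <= w n" for n using w(1)[of n] L0(2)[of n] by linarith
 have "(%n. y (w n)) \<longlonglongrightarrow> y L" by (rule continuous_on_tendsto_compose[OF y wL]) (use L0 w0 in auto)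
 then have "y L >= 1" by (rule LIMSEQ_le_const) (use w in auto)
 ultimately show False by simp
qed

section \<open>Stability of the loop\<close>

text \<open>One turn takes \<eta> to \<eta>' with YR \<eta> = YL \<eta>'. From YL \<eta> < YR \<eta>
  and the monotonicity of YL follows \<eta>' < \<eta>: each turn brings the crossing closer to the
  loop.\<close>

lemma loop_attracting:
 assumes lead: "lead a b c" and l: "loopg (quart a b c d) yy" and e0: "e0 > 0"
  and cmp: "!!\<eta> Yr Yl. yy 0 < \<eta> ==> \<eta> < yy 0 + e0 ==> arc (quart a b c d) \<eta> Yr ==>
   arc (quart a (- b) c (- d)) \<eta> Yl ==> Yl < Yr"
 shows "loop_stable (hfield a b c d) (0, 1, 0) (range (%x. (x, yy x)))"
proof -
 define F G where "F = quart a b c d" and "G = quart a (- b) c (- d)"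
 define s where "s = yy 0"
 define D where "D = loop_dist (0, 1, 0) (range (%x. (x, yy x)))"
 have lr: "loopg G (%x. yy (- x))" using loopg_reflect[OF l] by (simp add: quart_uminus_fun G_def)
 obtain \<eta>R YR where R: "s < \<eta>R" "\<eta>R <= 0" "continuous_on {s<..<\<eta>R} YR"
  "!!\<eta>. s < \<eta> ==> \<eta> < \<eta>R ==> arc F \<eta> (YR \<eta>)"
  using arc_map[OF lead l] unfolding F_def s_def by metis
 obtain \<eta>L YL where L: "s < \<eta>L" "continuous_on {s<..<\<eta>L} YL"
  "!!\<eta>. s < \<eta> ==> \<eta> < \<eta>L ==> arc G \<eta> (YL \<eta>)"
  "!!\<eta> \<eta>'. s < \<eta> ==> \<eta> < \<eta>' ==> \<eta>' < \<eta>L ==> YL \<eta>' < YL \<eta>"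
  using arc_map[OF lead_minus[OF lead] lr[unfolded G_def]] unfolding G_def s_def minus_zero by metis
 define e1 where "e1 = min e0 (min (\<eta>L - s) (\<eta>R - s))"
 have e1: "e1 > 0" "e1 <= e0" "s + e1 <= \<eta>L" "s + e1 <= \<eta>R" using e0 R L by (auto simp: e1_def)
 have uR: "Y = YR \<eta>" if "arc F \<eta> Y" "s < \<eta>" "\<eta> < s + e1" for \<eta> Y
  using arc_unique[OF that(1)[unfolded F_def] R(4)[unfolded F_def]] that e1 by simp
 have uL: "Y = YL \<eta>" if "arc G \<eta> Y" "s < \<eta>" "\<eta> < s + e1" for \<eta> Y
  using arc_unique[OF that(1)[unfolded G_def] L(3)[unfolded G_def]] that e1 by simp
 have less: "YL \<eta> < YR \<eta>" if "s < \<eta>" "\<eta> < s + e1" for \<eta>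
  using cmp[of \<eta> "YR \<eta>" "YL \<eta>"] R(4)[of \<eta>] L(3)[of \<eta>] that e1 unfolding F_def G_def s_def by auto
 have dec: "\<eta>' < \<eta>" if "s < \<eta>" "\<eta> < s + e1" "s < \<eta>'" "\<eta>' < s + e1" "arc F \<eta> Y" "arc G \<eta>' Y" for \<eta> \<eta>' Y
 proof (rule ccontr)
  assume "\<not> \<eta>' < \<eta>"
  then have "YL \<eta>' <= YL \<eta>" using L(4)[of \<eta> \<eta>'] that e1 by (cases "\<eta> = \<eta>'") auto
  then show False using less[OF that(1,2)] uR[OF that(5,1,2)] uL[OF that(6,3,4)] by simp
 qed
 have step: "\<exists>\<delta>>0. \<delta> <= e1 & (\<forall>x y t. hsol F {0..} x y --> t >= 0 --> x t = 0 --> s < y t --> y t < s + \<delta> -->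
  (\<exists>t'>t. x t' = 0 & s < y t' & y t' < y t & YR (y t) = YL (y t') & (\<exists>u. t <= u & u <= t' & y u >= 1) &
   (\<forall>r. t <= r & r <= t' --> y r >= y3 \<or> y r - yy (x r) < e)))" if e: "e > 0" for e y3
 proof -
  have "min e e1 > 0" using e e1 by simp
  then obtain \<delta> where \<delta>: "\<delta> > 0" and rv: "!!x y t. hsol F {0..} x y ==> t >= 0 ==> x t = 0 ==> s < y t ==> y t < s + \<delta> ==>
   \<exists>t'>t. x t' = 0 & s < y t' & y t' < s + min e e1 &
   (\<exists>Y. arc F (y t) Y & arc G (y t') Y) & (\<exists>u. t <= u & u <= t' & y u >= 1) &
   (\<forall>r. t <= r & r <= t' --> y r >= y3 \<or> y r - yy (x r) < min e e1)"
   by (rule revolve[OF lead l, of "min e e1" y3, folded F_def G_def, folded s_def]) blast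
  show ?thesis
  proof (rule exI[of _ "min \<delta> e1"], intro conjI allI impI)
   show "min \<delta> e1 > 0" "min \<delta> e1 <= e1" using \<delta> e1 by auto
   fix x y t assume h: "hsol F {0..} x y" and t: "0 <= t" "x t = 0" "s < y t" "y t < s + min \<delta> e1"
   have t4: "y t < s + \<delta>" "y t < s + e1" using t(4) min.cobounded1[of \<delta> e1] min.cobounded2[of \<delta> e1] by linarith+
   obtain t' Y where t': "t' > t" "x t' = 0" "s < y t'" "y t' < s + min e e1" "arc F (y t) Y" "arc G (y t') Y"
    "\<exists>u. t <= u & u <= t' & y u >= 1" "\<forall>r. t <= r & r <= t' --> y r >= y3 \<or> y r - yy (x r) < min e e1"
    using rv[OF h t(1-3) t4(1)] by blast
   have t'4: "y t' < s + e1" using t'(4) min.cobounded2[of e e1] by linarith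
   have "y t' < y t" by (rule dec[OF t(3) t4(2) t'(3) t'4 t'(5,6)])
   moreover have "YR (y t) = YL (y t')" using uR[OF t'(5) t(3) t4(2)] uL[OF t'(6) t'(3) t'4] by simp
   moreover have "\<forall>r. t <= r & r <= t' --> y r >= y3 \<or> y r - yy (x r) < e" using t'(8) by auto
   ultimately show "\<exists>t'>t. x t' = 0 & s < y t' & y t' < y t & YR (y t) = YL (y t') & (\<exists>u. t <= u & u <= t' & y u >= 1) &
    (\<forall>r. t <= r & r <= t' --> y r >= y3 \<or> y r - yy (x r) < e)"
    using t'(1,2,3,7) by (intro exI[of _ t']) simp
  qed
 qed
 \<comment> \<open>Since crossings only move down, closeness of one crossing bounds all later turns.
   Combined with the arbitrarily close crossings found afterwards, this gives convergence for all
   times and not only at crossings.\<close>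
 have stay: "\<exists>\<delta>>0. \<forall>x y. hsol F {0..} x y --> x 0 = 0 --> s < y 0 --> y 0 < s + \<delta> -->
  (\<forall>t\<ge>0. y t >= y3 \<or> y t - yy (x t) < e)" if e: "e > 0" for e y3
 proof -
  obtain \<delta> where \<delta>: "\<delta> > 0" "\<delta> <= e1" and st: "!!x y t. hsol F {0..} x y ==> t >= 0 ==> x t = 0 ==> s < y t ==> y t < s + \<delta> ==>
   \<exists>t'>t. x t' = 0 & s < y t' & y t' < y t & YR (y t) = YL (y t') & (\<exists>u. t <= u & u <= t' & y u >= 1) &
   (\<forall>r. t <= r & r <= t' --> y r >= y3 \<or> y r - yy (x r) < e)" using step[OF e, of y3] by blast
  show ?thesis
  proof (intro exI[of _ \<delta>] conjI allI impI)
   fix x y and t :: real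
   assume h: "hsol F {0..} x y" and 0: "x 0 = 0" "s < y 0" "y 0 < s + \<delta>" and t: "t >= 0"
   have "\<exists>\<tau>. \<forall>n. ((n = 0 --> \<tau> n = 0) & \<tau> n >= 0 & x (\<tau> n) = 0 & s < y (\<tau> n) & y (\<tau> n) < s + \<delta>) &
    (\<tau> n < \<tau> (Suc n) & (\<exists>u. \<tau> n <= u & u <= \<tau> (Suc n) & y u >= 1) &
     (\<forall>r. \<tau> n <= r & r <= \<tau> (Suc n) --> y r >= y3 \<or> y r - yy (x r) < e))"
   proof (rule dependent_nat_choice)
    show "\<exists>w. (0 = (0::nat) --> w = 0) & w >= 0 & x w = 0 & s < y w & y w < s + \<delta>" using 0 by (intro exI[of _ 0]) auto
    fix w and n :: nat assume w: "(n = 0 --> w = 0) & w >= 0 & x w = 0 & s < y w & y w < s + \<delta>"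
    then obtain t' where t': "t' > w" "x t' = 0" "s < y t'" "y t' < y w" "\<exists>u. w <= u & u <= t' & y u >= 1"
     "\<forall>r. w <= r & r <= t' --> y r >= y3 \<or> y r - yy (x r) < e" using st[OF h, of w] by blast
    show "\<exists>w'. ((Suc n = 0 --> w' = 0) & w' >= 0 & x w' = 0 & s < y w' & y w' < s + \<delta>) &
     (w < w' & (\<exists>u. w <= u & u <= w' & y u >= 1) & (\<forall>r. w <= r & r <= w' --> y r >= y3 \<or> y r - yy (x r) < e))"
    proof (rule exI[of _ t'], intro conjI)
     show "0 <= t'" "y t' < s + \<delta>" using t' w by auto
    qed (use t' in auto)
   qed
   then obtain \<tau> where \<tau>: "\<tau> 0 = 0" "!!n. y (\<tau> n) < s + \<delta>" "!!n. \<tau> n < \<tau> (Suc n)"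
    "!!n. \<exists>u. \<tau> n <= u & u <= \<tau> (Suc n) & y u >= 1"
    "!!n r. \<tau> n <= r ==> r <= \<tau> (Suc n) ==> y r >= y3 \<or> y r - yy (x r) < e" by blast
   have neg: "y (\<tau> n) <= 0" for n using \<tau>(2)[of n] \<delta>(2) e1(4) R(2) by linarith
   have "\<exists>n. t < \<tau> n" by (rule oscillation_times_unbounded[of y \<tau>, OF hsol_continuous(2)[OF h] _ \<tau>(3) neg \<tau>(4)]) (simp add: \<tau>(1))
   then have "t < \<tau> (LEAST n. t < \<tau> n)" by (rule LeastI_ex)
   then obtain n where n: "t < \<tau> n" "!!m. m < n ==> \<not> t < \<tau> m" using not_less_Least by blast
   then obtain m where m: "n = Suc m" using t \<tau>(1) by (cases n) auto
   show "y t >= y3 \<or> y t - yy (x t) < e" using \<tau>(5)[of m t] n(1) n(2)[of m] m by auto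
  qed (rule \<delta>(1))
 qed
 obtain \<delta>0 where \<delta>0: "\<delta>0 > 0" "\<delta>0 <= e1" and st0: "!!x y t. hsol F {0..} x y ==> t >= 0 ==> x t = 0 ==> s < y t ==> y t < s + \<delta>0 ==>
   \<exists>t'>t. x t' = 0 & s < y t' & y t' < y t & YR (y t) = YL (y t') & (\<exists>u. t <= u & u <= t' & y u >= 1) &
   (\<forall>r. t <= r & r <= t' --> y r >= 0 \<or> y r - yy (x r) < 1)"
  using step[OF zero_less_one, of 0] by blast
 have approach: "\<exists>t\<ge>0. x t = 0 & s < y t & y t < s + \<delta>"
  if h: "hsol F {0..} x y" and 0: "x 0 = 0" "s < y 0" "y 0 < s + \<delta>0" and \<delta>: "\<delta> > 0" for x y \<delta>
 proof -
  have "\<exists>\<tau>. \<forall>n. (\<tau> n >= 0 & x (\<tau> n) = 0 & s < y (\<tau> n) & y (\<tau> n) < s + \<delta>0) &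
    (y (\<tau> (Suc n)) < y (\<tau> n) & YR (y (\<tau> n)) = YL (y (\<tau> (Suc n))))"
  proof (rule dependent_nat_choice)
   show "\<exists>w. w >= 0 & x w = 0 & s < y w & y w < s + \<delta>0" using 0 by (intro exI[of _ 0]) auto
   fix w and n :: nat assume w: "w >= 0 & x w = 0 & s < y w & y w < s + \<delta>0"
   then obtain t' where t': "t' > w" "x t' = 0" "s < y t'" "y t' < y w" "YR (y w) = YL (y t')" using st0[OF h, of w] by blast
   show "\<exists>w'. (w' >= 0 & x w' = 0 & s < y w' & y w' < s + \<delta>0) & (y w' < y w & YR (y w) = YL (y w'))"
   proof (rule exI[of _ t'], intro conjI)
    show "0 <= t'" "y t' < s + \<delta>0" using t' w by auto
   qed (use t' in auto)
  qed
  then obtain \<tau> where \<tau>: "!!n. \<tau> n >= 0" "!!n. x (\<tau> n) = 0" "!!n. s < y (\<tau> n)" "!!n. y (\<tau> n) < s + \<delta>0"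
   "!!n. y (\<tau> (Suc n)) < y (\<tau> n)" "!!n. YR (y (\<tau> n)) = YL (y (\<tau> (Suc n)))" by blast
  define h where "h = (%n. y (\<tau> n))"
  have dec: "decseq h" unfolding h_def by (intro decseq_SucI less_imp_le \<tau>)
  obtain L where L': "h \<longlonglongrightarrow> L" "!!n. L <= h n" using decseq_convergent[OF dec, of s] \<tau>(3) by (auto simp: h_def less_imp_le)
  have "s <= L" by (rule LIMSEQ_le_const[OF L'(1)]) (use \<tau>(3) in \<open>auto simp: h_def less_imp_le\<close>)
  \<comment> \<open>At a limit above s, passing to the limit in YR (h n) = YL (h (Suc n)) would give
    YR L = YL L.\<close>
  moreover have "\<not> s < L"
  proof
   assume sL: "s < L"
   have Le: "L < s + e1" using L'(2)[of 0] \<tau>(4)[of 0] \<delta>0(2) by (simp add: h_def)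
   have hb: "s < h n & h n < s + e1" for n using \<tau>(3,4)[of n] \<delta>0(2) by (simp add: h_def)
   have "(%n. YR (h n)) \<longlonglongrightarrow> YR L"
   proof (rule continuous_on_tendsto_compose[OF R(3) L'(1)])
    show "\<forall>\<^sub>F n in sequentially. h n \<in> {s<..<\<eta>R}"
    proof (intro always_eventually allI)
     fix n show "h n \<in> {s<..<\<eta>R}" using hb[of n] e1(4) by simp
    qed
   qed (use sL Le e1 in auto)
   moreover have "(%n. YL (h (Suc n))) \<longlonglongrightarrow> YL L"
   proof (rule continuous_on_tendsto_compose[OF L(2) LIMSEQ_Suc[OF L'(1)]])
    show "\<forall>\<^sub>F n in sequentially. h (Suc n) \<in> {s<..<\<eta>L}"
    proof (intro always_eventually allI)
     fix n show "h (Suc n) \<in> {s<..<\<eta>L}" using hb[of "Suc n"] e1(3) by simp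
    qed
   qed (use sL Le e1 in auto)
   moreover have "(%n. YR (h n)) = (%n. YL (h (Suc n)))" using \<tau>(6) by (simp add: h_def)
   ultimately have "YR L = YL L" using LIMSEQ_unique by metis
   then show False using less[OF sL Le] by simp
  qed
  ultimately have "h \<longlonglongrightarrow> s" using L'(1) by simp
  then have "eventually (%n. h n < s + \<delta>) sequentially" by (rule order_tendstoD) (use \<delta> in simp)
  then obtain n where "h n < s + \<delta>" by (meson eventually_happens sequentially_bot)
  then show ?thesis using \<tau>(1-3)[of n] by (intro exI[of _ "\<tau> n"]) (auto simp: h_def)
 qed
 obtain \<delta>a ya where A: "\<delta>a > 0" "!!x y. hsol F {0..} x y ==> yy (x 0) < y 0 ==>
  y 0 > ya \<or> y 0 - yy (x 0) < \<delta>a ==> \<exists>T\<ge>0. x T = 0 & s < y T & y T < s + \<delta>0"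
  using reach_axis[OF lead l \<delta>0(1)] unfolding F_def s_def by metis
 obtain \<epsilon> where \<epsilon>: "\<epsilon> > 0" "!!x y. yy x < y ==> D (x, y) < \<epsilon> ==> y > ya \<or> y - yy x < \<delta>a"
  by (rule loop_dist_near[OF lead l A(1), of ya, folded D_def]) blast
 have Fc: "continuous_on UNIV F" unfolding F_def by (intro continuous_intros)
 show ?thesis
  unfolding loop_stable_def D_def[symmetric]
 proof (intro exI[of _ \<epsilon>] conjI ballI impI \<epsilon>(1))
  fix q assume q: "q \<in> loop_interior (range (%x. (x, yy x)))" and Dq: "D q < \<epsilon>"
  have W: "yy (fst q) < snd q" by (rule loop_interior_above[OF l quart_0 q])
  then obtain x y where xy: "x 0 = fst q" "y 0 = snd q" "hsol F {0..} x y"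
   using loop_global[OF lead l, of "fst q" "snd q"] unfolding F_def by (metis less_imp_le)
  have W0: "yy (x 0) < y 0" using W xy by simp
  have gap: "yy (x t) < y t" if "t >= 0" for t by (rule loop_gap_pos[OF l[folded F_def] Fc xy(3) W0 that])
  obtain T where T: "T >= 0" "x T = 0" "s < y T" "y T < s + \<delta>0" using A(2)[OF xy(3) W0] \<epsilon>(2)[OF W] Dq xy by auto
  have "((%t. D (x t, y t)) \<longlongrightarrow> 0) at_top"
  proof (rule tendstoI)
   fix e :: real assume e: "e > 0"
   obtain y3 \<delta> where \<delta>: "\<delta> > 0" "!!x y. yy x < y ==> y >= y3 \<or> y - yy x < \<delta> ==> D (x, y) < e"
    by (rule loop_dist_small[OF lead l e, folded D_def]) blast
   obtain \<delta>' where \<delta>': "\<delta>' > 0" "!!x y t. hsol F {0..} x y ==> x 0 = 0 ==> s < y 0 ==> y 0 < s + \<delta>' ==> t >= 0 ==>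
    y t >= y3 \<or> y t - yy (x t) < \<delta>" using stay[OF \<delta>(1), of y3] by blast
   have hT: "hsol F {0..} (%t. x (T + t)) (%t. y (T + t))" by (rule hsol_halfline_shift[OF xy(3) T(1)])
   obtain r where r: "r >= 0" "x (T + r) = 0" "s < y (T + r)" "y (T + r) < s + \<delta>'"
    using approach[OF hT _ _ _ \<delta>'(1)] T by auto
   have Tr: "T + r >= 0" using T r by simp
   have hTr: "hsol F {0..} (%t. x (T + r + t)) (%t. y (T + r + t))" by (rule hsol_halfline_shift[OF xy(3) Tr])
   have close: "y t >= y3 \<or> y t - yy (x t) < \<delta>" if "t >= T + r" for t
    using \<delta>'(2)[OF hTr, of "t - (T + r)"] r that by simp
   show "eventually (%t. dist (D (x t, y t)) 0 < e) at_top"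
    using eventually_ge_at_top[of "T + r"]
   proof (rule eventually_mono)
    fix t assume t: "T + r <= t"
    have "D (x t, y t) < e" by (rule \<delta>(2)[OF gap close[OF t]]) (use t Tr in simp)
    moreover have "D (x t, y t) >= 0" by (simp add: D_def loop_dist_def infdist_nonneg)
    ultimately show "dist (D (x t, y t)) 0 < e" by simp
   qed
  qed
  moreover have "forward_solution (hfield a b c d) q (%t. (x t, y t))"
   unfolding forward_solution_hsol using xy by (simp add: F_def)
  ultimately show "\<exists>\<phi>. forward_solution (hfield a b c d) q \<phi> & ((%t. D (\<phi> t)) \<longlongrightarrow> 0) at_top" by blast
 qed
qed

text \<open>If no turn brings the crossing closer, the crossings of an orbit tending to the loop
  keep their initial distance at arbitrarily late times. Equality is allowed, which covers the
  reversible case.\<close>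

lemma loop_not_attracting:
 assumes lead: "lead a b c" and l: "loopg (quart a b c d) yy" and e0: "e0 > 0"
  and cmp: "!!\<eta> Yr Yl. yy 0 < \<eta> ==> \<eta> < yy 0 + e0 ==> arc (quart a b c d) \<eta> Yr ==>
   arc (quart a (- b) c (- d)) \<eta> Yl ==> Yr <= Yl"
 shows "\<not> loop_stable (hfield a b c d) (0, 1, 0) (range (%x. (x, yy x)))"
proof
 define F G where "F = quart a b c d" and "G = quart a (- b) c (- d)"
 define s where "s = yy 0"
 define D where "D = loop_dist (0, 1, 0) (range (%x. (x, yy x)))"
 assume "loop_stable (hfield a b c d) (0, 1, 0) (range (%x. (x, yy x)))"
 then obtain \<epsilon> where \<epsilon>: "\<epsilon> > 0" "!!q. q \<in> loop_interior (range (%x. (x, yy x))) ==> D q < \<epsilon> ==>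
  \<exists>\<phi>. forward_solution (hfield a b c d) q \<phi> & ((%t. D (\<phi> t)) \<longlongrightarrow> 0) at_top"
  unfolding loop_stable_def D_def[symmetric] by blast
 have s0: "s < 0" using l unfolding loopg_def s_def by (metis quart_0)
 have lr: "loopg G (%x. yy (- x))" using loopg_reflect[OF l] by (simp add: quart_uminus_fun G_def)
 obtain \<eta>L YL where L: "s < \<eta>L" "!!\<eta>. s < \<eta> ==> \<eta> < \<eta>L ==> arc G \<eta> (YL \<eta>)"
  "!!\<eta> \<eta>'. s < \<eta> ==> \<eta> < \<eta>' ==> \<eta>' < \<eta>L ==> YL \<eta>' < YL \<eta>"
  using arc_map[OF lead_minus[OF lead] lr[unfolded G_def]] unfolding G_def s_def minus_zero by metis
 define e1 where "e1 = min e0 (min (\<eta>L - s) (- s))"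
 have e1: "e1 > 0" "e1 <= e0" "s + e1 <= \<eta>L" "s + e1 <= 0" using e0 s0 L by (auto simp: e1_def)
 have uL: "Y = YL \<eta>" if "arc G \<eta> Y" "s < \<eta>" "\<eta> < s + e1" for \<eta> Y
  using arc_unique[OF that(1)[unfolded G_def] L(2)[unfolded G_def]] that e1 by simp
 have inc: "\<eta> <= \<eta>'" if "s < \<eta>" "\<eta> < s + e1" "s < \<eta>'" "\<eta>' < s + e1" "arc F \<eta> Y" "arc G \<eta>' Y" for \<eta> \<eta>' Y
 proof (rule ccontr)
  assume "\<not> \<eta> <= \<eta>'"
  then have "YL \<eta> < YL \<eta>'" using L(3)[of \<eta>' \<eta>] that e1 by auto
  moreover have "Y <= YL \<eta>" using cmp[of \<eta> Y "YL \<eta>"] L(2)[of \<eta>] that e1 unfolding F_def G_def s_def by auto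
  ultimately show False using uL[OF that(6,3,4)] by simp
 qed
 obtain \<delta>r where \<delta>r: "\<delta>r > 0" and rv: "!!x y t. hsol F {0..} x y ==> t >= 0 ==> x t = 0 ==> s < y t ==> y t < s + \<delta>r ==>
   \<exists>t'>t. x t' = 0 & s < y t' & y t' < s + e1 &
   (\<exists>Y. arc F (y t) Y & arc G (y t') Y) & (\<exists>u. t <= u & u <= t' & y u >= 1) &
   (\<forall>r. t <= r & r <= t' --> y r >= 0 \<or> y r - yy (x r) < e1)"
  by (rule revolve[OF lead l e1(1), of 0, folded F_def G_def, folded s_def]) blast
 define \<delta> where "\<delta> = min \<delta>r e1"
 have \<delta>: "\<delta> > 0" "\<delta> <= \<delta>r" "\<delta> <= e1" using \<delta>r e1 by (auto simp: \<delta>_def)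
 obtain \<epsilon>1 where \<epsilon>1: "\<epsilon>1 > 0" "!!x y. yy x < y ==> D (x, y) < \<epsilon>1 ==> y > 0 \<or> y - yy x < \<delta>"
  by (rule loop_dist_near[OF lead l \<delta>(1), of 0, folded D_def]) blast
 obtain \<delta>a ya where A: "\<delta>a > 0" "!!x y. hsol F {0..} x y ==> yy (x 0) < y 0 ==>
  y 0 > ya \<or> y 0 - yy (x 0) < \<delta>a ==> \<exists>T\<ge>0. x T = 0 & s < y T & y T < s + \<delta>"
  using reach_axis[OF lead l \<delta>(1)] unfolding F_def s_def by metis
 obtain \<epsilon>2 where \<epsilon>2: "\<epsilon>2 > 0" "!!x y. yy x < y ==> D (x, y) < \<epsilon>2 ==> y > ya \<or> y - yy x < \<delta>a"
  by (rule loop_dist_near[OF lead l A(1), of ya, folded D_def]) blast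
 obtain ys \<delta>s where \<delta>s: "\<delta>s > 0" "!!x y. yy x < y ==> y >= ys \<or> y - yy x < \<delta>s ==> D (x, y) < \<epsilon>"
  by (rule loop_dist_small[OF lead l \<epsilon>(1), folded D_def]) blast
 \<comment> \<open>Close enough to the loop for the assumed attraction, and capped at 0 so that the
   vertical segment to the origin shows the point to be interior.\<close>
 define \<eta> where "\<eta> = s + min (\<delta>s / 2) (- s)"
 have \<eta>: "s < \<eta>" "\<eta> < s + \<delta>s" "\<eta> <= 0" using \<delta>s(1) s0 by (auto simp: \<eta>_def)
 have "(0, \<eta>) \<in> loop_interior (range (%x. (x, yy x)))" "D (0, \<eta>) < \<epsilon>"
  using loop_interior_axis[of yy \<eta>] \<delta>s(2)[of 0 \<eta>] \<eta> by (auto simp: s_def)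
 then obtain \<phi> where \<phi>: "forward_solution (hfield a b c d) (0, \<eta>) \<phi>" "((%t. D (\<phi> t)) \<longlongrightarrow> 0) at_top" using \<epsilon>(2) by blast
 define x y where "x = (%t. fst (\<phi> t))" and "y = (%t. snd (\<phi> t))"
 have h: "hsol F {0..} x y" and 0: "x 0 = 0" "y 0 = \<eta>"
  using \<phi>(1) unfolding forward_solution_hsol by (auto simp: x_def y_def F_def)
 have Fc: "continuous_on UNIV F" unfolding F_def by (intro continuous_intros)
 have W0: "yy (x 0) < y 0" using 0 \<eta> by (simp add: s_def)
 have gap: "yy (x t) < y t" if "t >= 0" for t by (rule loop_gap_pos[OF l[folded F_def] Fc h W0 that])
 have lim: "\<exists>t0. \<forall>t\<ge>t0. D (x t, y t) < e" if "e > 0" for e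
 proof -
  have "eventually (%t. D (\<phi> t) < e) at_top" using order_tendstoD(2)[OF \<phi>(2) that] .
  then show ?thesis unfolding eventually_at_top_linorder x_def y_def by simp
 qed
 obtain t1 where t1: "!!t. t >= t1 ==> D (x t, y t) < \<epsilon>1" using lim[OF \<epsilon>1(1)] by blast
 obtain t2 where t2: "!!t. t >= t2 ==> D (x t, y t) < \<epsilon>2" using lim[OF \<epsilon>2(1)] by blast
 define t0 where "t0 = max 0 (max t1 t2)"
 have t0: "t0 >= 0" "t0 >= t1" "t0 >= t2" by (auto simp: t0_def)
 have hs: "hsol F {0..} (%t. x (t0 + t)) (%t. y (t0 + t))" by (rule hsol_halfline_shift[OF h t0(1)])
 obtain T where T: "T >= 0" "x (t0 + T) = 0" "s < y (t0 + T)" "y (t0 + T) < s + \<delta>"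
  using A(2)[OF hs] \<epsilon>2(2)[OF gap[OF t0(1)] t2[OF t0(3)]] gap[OF t0(1)] by auto
 define h0 where "h0 = y (t0 + T)"
 \<comment> \<open>The crossings never move down, and they stay below s + \<delta>, where
   \<open>revolve\<close> applies again, because the orbit is assumed to approach the loop.\<close>
 have "\<exists>\<tau>. \<forall>n. (\<tau> n >= t0 + T & x (\<tau> n) = 0 & h0 <= y (\<tau> n) & y (\<tau> n) < s + \<delta>) &
    (\<tau> n < \<tau> (Suc n) & (\<exists>u. \<tau> n <= u & u <= \<tau> (Suc n) & y u >= 1))"
 proof (rule dependent_nat_choice)
  show "\<exists>w. w >= t0 + T & x w = 0 & h0 <= y w & y w < s + \<delta>" using T by (intro exI[of _ "t0 + T"]) (auto simp: h0_def)
  fix w and n :: nat assume w: "w >= t0 + T & x w = 0 & h0 <= y w & y w < s + \<delta>"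
  then have w': "w >= 0" "x w = 0" "s < y w" "y w < s + \<delta>r" "y w < s + e1" using T t0 \<delta> by (auto simp: h0_def)
  obtain t' Y where t': "t' > w" "x t' = 0" "s < y t'" "y t' < s + e1" "arc F (y w) Y" "arc G (y t') Y"
   "\<exists>u. w <= u & u <= t' & y u >= 1" using rv[OF h w'(1-4)] by blast
  have "y w <= y t'" by (rule inc[OF w'(3,5) t'(3-6)])
  moreover have "y t' < s + \<delta>"
  proof -
   have "t' >= t1" "t' >= 0" using t'(1) w t0 T by auto
   then have "y t' > 0 \<or> y t' - yy (x t') < \<delta>" using \<epsilon>1(2)[OF gap t1] by blast
   then show ?thesis using t'(2,4) e1(4) by (auto simp: s_def)
  qed
  ultimately show "\<exists>w'. (w' >= t0 + T & x w' = 0 & h0 <= y w' & y w' < s + \<delta>) &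
    (w < w' & (\<exists>u. w <= u & u <= w' & y u >= 1))"
   using t'(1,2,7) w by (intro exI[of _ t']) auto
 qed
 then obtain \<tau> where \<tau>: "!!n. \<tau> n >= t0 + T" "!!n. x (\<tau> n) = 0" "!!n. h0 <= y (\<tau> n)" "!!n. y (\<tau> n) < s + \<delta>"
  "!!n. \<tau> n < \<tau> (Suc n)" "!!n. \<exists>u. \<tau> n <= u & u <= \<tau> (Suc n) & y u >= 1" by blast
 have \<tau>0: "\<tau> n >= 0" "y (\<tau> n) <= 0" for n using \<tau>(1)[of n] \<tau>(4)[of n] T t0 \<delta> e1 by linarith+
 have h0s: "h0 - s > 0" using T by (simp add: h0_def)
 obtain \<epsilon>3 where \<epsilon>3: "\<epsilon>3 > 0" "!!x y. yy x < y ==> D (x, y) < \<epsilon>3 ==> y > 0 \<or> y - yy x < h0 - s"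
  by (rule loop_dist_near[OF lead l h0s, of 0, folded D_def]) blast
 obtain t3 where t3: "!!t. t >= t3 ==> D (x t, y t) < \<epsilon>3" using lim[OF \<epsilon>3(1)] by blast
 obtain n where "t3 < \<tau> n"
  using oscillation_times_unbounded[of y \<tau>, OF hsol_continuous(2)[OF h] \<tau>0(1) \<tau>(5) \<tau>0(2) \<tau>(6)] by blast
 then have "y (\<tau> n) > 0 \<or> y (\<tau> n) - yy (x (\<tau> n)) < h0 - s"
  using \<epsilon>3(2)[OF gap[OF \<tau>0(1)] t3] by simp
 then show False using \<tau>0(2)[of n] \<tau>(2,3)[of n] by (auto simp: s_def)
qed

text \<open>For b < 0 the comparison is applied to the reflected system, which exchanges the two
  arcs; for b = 0 the two half maps coincide.\<close>

lemma loop_stable_iff: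
 assumes lead: "lead a b c" and l: "loopg (quart a b c d) yy" and sgn: "b = 0 ==> d = 0"
 shows "loop_stable (hfield a b c d) (0, 1, 0) (range (%x. (x, yy x))) \<longleftrightarrow> b < 0"
proof (cases "b < 0")
 case True
 then have ab: "a > 0" "- b > 0" using lead by (auto simp: lead_def)
 have lr: "loopg (quart a (- b) c (- d)) (%x. yy (- x))" using loopg_reflect[OF l] by (simp add: quart_uminus_fun)
 obtain e where e: "e > 0" "!!\<eta> Y1 Y2. yy 0 < \<eta> ==> \<eta> < yy 0 + e ==> arc (quart a (- b) c (- d)) \<eta> Y1 ==>
  arc (quart a b c d) \<eta> Y2 ==> Y1 < Y2"
  using arc_compare[OF ab lr] unfolding minus_minus minus_zero by metis
 show ?thesis using loop_attracting[OF lead l e(1)] e(2) True by blast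
next
 case False
 have "\<not> loop_stable (hfield a b c d) (0, 1, 0) (range (%x. (x, yy x)))"
 proof (cases "b = 0")
  case True
  then have "d = 0" using sgn by simp
  show ?thesis
  proof (rule loop_not_attracting[OF lead l zero_less_one])
   fix \<eta> Yr Yl assume "arc (quart a b c d) \<eta> Yr" "arc (quart a (- b) c (- d)) \<eta> Yl"
   then show "Yr <= Yl" using arc_unique[of a b c d \<eta> Yr Yl] True \<open>d = 0\<close> by simp
  qed
 next
  case b: False
  then have ab: "a > 0" "b > 0" using lead False by (auto simp: lead_def)
  obtain e where e: "e > 0" "!!\<eta> Y1 Y2. yy 0 < \<eta> ==> \<eta> < yy 0 + e ==> arc (quart a b c d) \<eta> Y1 ==>
   arc (quart a (- b) c (- d)) \<eta> Y2 ==> Y1 < Y2" using arc_compare[OF ab l] by metis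
  show ?thesis by (rule loop_not_attracting[OF lead l e(1)]) (use e(2) in \<open>blast intro: less_imp_le\<close>)
 qed
 then show ?thesis using False by blast
qed

section \<open>Stability of the origin\<close>

lemma dist_zero_less_iff:
 fixes q :: "real \<times> real"
 assumes "r > 0"
 shows "dist q 0 < r \<longleftrightarrow> (fst q)^2 + (snd q)^2 < r^2"
 using real_sqrt_less_iff[of "(fst q)^2 + (snd q)^2" "r^2"] assms by (simp add: norm_prod_def)

lemma loop_global_near_origin:
 assumes lead: "lead a b c" and l: "loopg (quart a b c d) yy"
 obtains r where "r > 0" "!!x0 y0. x0^2 + y0^2 < r^2 ==> \<exists>x y. x 0 = x0 & y 0 = y0 & hsol (quart a b c d) {0..} x y"
proof -
 have "open {q. yy (fst q) < snd q}"
  by (intro open_Collect_less continuous_intros continuous_on_compose2[OF loopg_continuous[OF l, of UNIV]]) auto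
 moreover have "0 \<in> {q. yy (fst q) < snd q}" using l unfolding loopg_def by (simp, metis quart_0)
 ultimately obtain r where r: "r > 0" "!!q. dist q 0 < r ==> yy (fst q) < snd q" unfolding open_dist by blast
 show ?thesis
 proof (rule that[OF r(1)])
  fix x0 y0 :: real assume "x0^2 + y0^2 < r^2"
  then have "y0 >= yy x0" using r(2)[of "(x0, y0)"] dist_zero_less_iff[OF r(1), of "(x0, y0)"] by simp
  then show "\<exists>x y. x 0 = x0 & y 0 = y0 & hsol (quart a b c d) {0..} x y" using loop_global[OF lead l] by metis
 qed
qed

lemma lyapunov_stable_hfieldI:
 assumes "!!e. e > 0 ==> \<exists>r>0. \<forall>x0 y0. x0^2 + y0^2 < r^2 --> (\<exists>x y. x 0 = x0 & y 0 = y0 &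
  hsol (quart a b c d) {0..} x y & (\<forall>t\<ge>0. (x t)^2 + (y t)^2 < e^2))"
 shows "lyapunov_stable (hfield a b c d) 0"
 unfolding lyapunov_stable_def
proof (intro allI impI)
 fix e :: real assume e: "e > 0"
 obtain r where r: "r > 0" "!!x0 y0. x0^2 + y0^2 < r^2 ==> \<exists>x y. x 0 = x0 & y 0 = y0 &
  hsol (quart a b c d) {0..} x y & (\<forall>t\<ge>0. (x t)^2 + (y t)^2 < e^2)" using assms[OF e] by blast
 show "\<exists>\<delta>>0. \<forall>q. dist q 0 < \<delta> --> (\<exists>\<phi>. forward_solution (hfield a b c d) q \<phi> & (\<forall>t\<ge>0. dist (\<phi> t) 0 < e))"
 proof (rule exI[of _ r], intro conjI allI impI r(1))
  fix q :: "real \<times> real" assume "dist q 0 < r"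
  then obtain x y where xy: "x 0 = fst q" "y 0 = snd q" "hsol (quart a b c d) {0..} x y" "!!t. t >= 0 ==> (x t)^2 + (y t)^2 < e^2"
   using r(2)[of "fst q" "snd q"] unfolding dist_zero_less_iff[OF r(1)] by blast
  show "\<exists>\<phi>. forward_solution (hfield a b c d) q \<phi> & (\<forall>t\<ge>0. dist (\<phi> t) 0 < e)"
   unfolding forward_solution_hsol dist_zero_less_iff[OF e]
   by (rule exI[of _ "%t. (x t, y t)"]) (use xy in simp)
 qed
qed

lemma quart_factor:
 "quart a b c d x = x * (d + x * (c + b * x + a * x^2))"
 by (simp add: quart_def power4_eq_xxxx power3_eq_cube power2_eq_square algebra_simps)

lemma quart_slope_near_0:
 assumes "m > 0"
 obtains r where "r > 0" "r <= 1" "!!x. \<bar>x\<bar> < r ==> \<exists>g. quart a b c d x = x * g & \<bar>g - d\<bar> <= m"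
proof -
 define K where "K = \<bar>c\<bar> + \<bar>b\<bar> + \<bar>a\<bar> + 1"
 define r where "r = min 1 (m / K)"
 have K: "K > 0" by (simp add: K_def)
 show ?thesis
 proof (rule that[of r])
  show "r > 0" "r <= 1" using assms K by (auto simp: r_def)
  fix x :: real assume x: "\<bar>x\<bar> < r"
  then have x1: "\<bar>x\<bar> <= 1" "\<bar>x\<bar> <= m / K" by (auto simp: r_def)
  have "\<bar>b * x\<bar> <= \<bar>b\<bar>" "\<bar>a * x^2\<bar> <= \<bar>a\<bar>"
   using x1 power_le_one[of "\<bar>x\<bar>" 2] by (auto simp: abs_mult mult_le_cancel_left1 mult_left_le)
  then have "\<bar>c + b * x + a * x^2\<bar> <= K" unfolding K_def by linarith
  then have "\<bar>x\<bar> * \<bar>c + b * x + a * x^2\<bar> <= m / K * K" using x1 K by (intro mult_mono) auto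
  then have "\<bar>(d + x * (c + b * x + a * x^2)) - d\<bar> <= m" using K by (simp add: abs_mult)
  then show "\<exists>g. quart a b c d x = x * g & \<bar>g - d\<bar> <= m" using quart_factor by blast
 qed
qed

text \<open>The derivative of x^2 + y^2 is 2 x F x = 2 g x^2 with g <= 0 near 0, so small circles
  are not left.\<close>

lemma origin_stable:
 assumes lead: "lead a b c" and l: "loopg (quart a b c d) yy" and d: "d < 0"
 shows "lyapunov_stable (hfield a b c d) 0"
proof (rule lyapunov_stable_hfieldI)
 fix e :: real assume e: "e > 0"
 obtain r0 where r0: "r0 > 0" "!!x0 y0. x0^2 + y0^2 < r0^2 ==> \<exists>x y. x 0 = x0 & y 0 = y0 & hsol (quart a b c d) {0..} x y"
  using loop_global_near_origin[OF lead l] by blast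
 have "- d > 0" using d by simp
 then obtain r1 where r1: "r1 > 0" "!!x. \<bar>x\<bar> < r1 ==> \<exists>g. quart a b c d x = x * g & \<bar>g - d\<bar> <= - d"
  using quart_slope_near_0[of "- d" a b c d] by blast
 define r where "r = min r0 (min r1 e)"
 have r: "r > 0" "r <= r0" "r <= r1" "r <= e" using r0 r1 e by (auto simp: r_def)
 show "\<exists>r>0. \<forall>x0 y0. x0^2 + y0^2 < r^2 --> (\<exists>x y. x 0 = x0 & y 0 = y0 &
  hsol (quart a b c d) {0..} x y & (\<forall>t\<ge>0. (x t)^2 + (y t)^2 < e^2))"
 proof (rule exI[of _ r], intro conjI allI impI r(1))
  fix x0 y0 :: real assume 0: "x0^2 + y0^2 < r^2"
  have sq: "r^2 <= r0^2" "r^2 <= e^2" using r by (auto intro: power_mono)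
  obtain x y where xy: "x 0 = x0" "y 0 = y0" "hsol (quart a b c d) {0..} x y" using r0(2)[of x0 y0] 0 sq by auto
  note xd = hsol_halfline(4)[OF xy(3)] and yd = hsol_halfline(5)[OF xy(3)]
  define E where "E = (%t. (x t)^2 + (y t)^2)"
  have Ec: "continuous_on {0..T} E" for T unfolding E_def
   by (intro continuous_intros hsol_halfline(2,3)[OF xy(3)])
  have Ed: "(E has_real_derivative 2 * (x t * quart a b c d (x t))) (at t)" if "t > 0" for t
   unfolding E_def using xd[OF that] yd[OF that] by (auto intro!: derivative_eq_intros simp: algebra_simps)
  have "E t < r^2" if t: "t >= 0" for t
  proof (rule ccontr)
   assume n: "\<not> E t < r^2"
   have "continuous_on {0..t} (%s. r^2 - E s)" by (intro continuous_intros Ec)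
   moreover have "r^2 - E 0 > 0" "r^2 - E t <= 0" using n 0 xy by (simp_all add: E_def)
   ultimately obtain z where z: "0 < z" "z <= t" "r^2 - E z = 0" "!!s. 0 <= s ==> s < z ==> r^2 - E s > 0"
    using first_zero[OF t] by blast
   have "E z <= E 0 + 0 * (z - 0)"
   proof (rule increment_le[OF _ Ec Ed])
    fix s assume s: "0 < s" "s < z"
    have "(x s)^2 < r^2" using z(4)[OF less_imp_le[OF s(1)] s(2)] zero_le_power2[of "y s"] unfolding E_def by linarith
    then have "\<bar>x s\<bar> < r" using r(1) by (metis abs_of_pos power2_less_imp_less abs_ge_zero power2_abs less_imp_le)
    then obtain g where g: "quart a b c d (x s) = x s * g" "\<bar>g - d\<bar> <= - d" using r1(2)[of "x s"] r by auto
    have "x s * quart a b c d (x s) = (x s)^2 * g" by (simp add: g power2_eq_square)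
    moreover have "(x s)^2 * g <= 0" using g(2) by (intro mult_nonneg_nonpos) auto
    ultimately show "2 * (x s * quart a b c d (x s)) <= 0" by linarith
   qed (use z in auto)
   then show False using z(3) 0 xy by (simp add: E_def)
  qed
  then have "(x t)^2 + (y t)^2 < e^2" if "t >= 0" for t using that sq unfolding E_def by (meson less_le_trans)
  then show "\<exists>x y. x 0 = x0 & y 0 = y0 & hsol (quart a b c d) {0..} x y & (\<forall>t\<ge>0. (x t)^2 + (y t)^2 < e^2)"
   using xy by blast
 qed
qed

text \<open>The derivative of \<open>x\<^sup>2 + y\<^sup>2\<close> vanishes on the \<open>y\<close>-axis; the term \<open>- \<kappa> x y\<close> makes it definite.\<close>

lemma origin_unstable:
 assumes d: "d > 0"
 shows "\<not> lyapunov_stable (hfield a b c d) 0"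
proof
 assume S: "lyapunov_stable (hfield a b c d) 0"
 have "d / 2 > 0" using d by simp
 then obtain r where r: "r > 0" "r <= 1" "!!x. \<bar>x\<bar> < r ==> \<exists>g. quart a b c d x = x * g & \<bar>g - d\<bar> <= d / 2"
  using quart_slope_near_0[of "d / 2" a b c d] by blast
 obtain \<delta> where \<delta>: "\<delta> > 0" "!!q. dist q 0 < \<delta> ==> \<exists>\<phi>. forward_solution (hfield a b c d) q \<phi> & (\<forall>t\<ge>0. dist (\<phi> t) 0 < r)"
  using S r(1) unfolding lyapunov_stable_def by blast
 have "dist (\<delta> / 2, 0) (0 :: real \<times> real) < \<delta>" using \<delta> by (simp add: norm_Pair)
 then obtain \<phi> where \<phi>: "forward_solution (hfield a b c d) (\<delta> / 2, 0) \<phi>" "!!t. t >= 0 ==> dist (\<phi> t) 0 < r" using \<delta>(2) by blast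
 define x y where "x = (%t. fst (\<phi> t))" and "y = (%t. snd (\<phi> t))"
 have h: "hsol (quart a b c d) {0..} x y" and 0: "x 0 = \<delta> / 2" "y 0 = 0"
  using \<phi>(1) unfolding forward_solution_hsol by (auto simp: x_def y_def)
 have small: "(x t)^2 + (y t)^2 < r^2" if "t >= 0" for t
  using \<phi>(2)[OF that] unfolding dist_zero_less_iff[OF r(1)] by (simp add: x_def y_def)
 note xd = hsol_halfline(4)[OF h] and yd = hsol_halfline(5)[OF h]
 \<comment> \<open>Chosen so that d = 2 \<kappa> + 4 \<kappa> d^2. For g between d / 2 and 3 d / 2
   the coefficient 2 g - \<kappa> - \<kappa> g^2 / 2 of x^2 is then at least \<kappa> / 2.\<close>
 define \<kappa> where "\<kappa> = d / (2 + 4 * d^2)"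
 have \<kappa>: "\<kappa> > 0" using d by (simp add: \<kappa>_def add_pos_nonneg)
 have "2 + 4 * d^2 > 0" by (simp add: add_pos_nonneg)
 then have \<kappa>d: "\<kappa> * (2 + 4 * d^2) = d" by (simp add: \<kappa>_def)
 have \<kappa>1: "\<kappa> <= 1"
 proof -
  have "0 <= (2 * d - 1 / 4)^2" by simp
  then have "d <= 2 + 4 * d^2" by (simp add: power2_eq_square algebra_simps)
  then show ?thesis unfolding \<kappa>_def by (simp add: divide_le_eq add_pos_nonneg)
 qed
 define V where "V = (%t. (x t)^2 + (y t)^2 - \<kappa> * (x t * y t))"
 define V' where "V' = (%t. 2 * (x t * quart a b c d (x t)) - \<kappa> * ((quart a b c d (x t) - y t) * y t + (x t)^2))"
 have Vc: "continuous_on {0..T} V" for T unfolding V_def by (intro continuous_intros hsol_halfline(2,3)[OF h])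
 have Vd: "(V has_real_derivative V' t) (at t)" if "t > 0" for t
  unfolding V_def V'_def using xd[OF that] yd[OF that]
  by (auto intro!: derivative_eq_intros simp: power2_eq_square algebra_simps)
 have V'ge: "V' t >= \<kappa> / 2 * ((x t)^2 + (y t)^2)" if t: "t >= 0" for t
 proof -
  have "(x t)^2 < r^2" using small[OF t] zero_le_power2[of "y t"] by linarith
  then have "\<bar>x t\<bar> < r" using r(1) by (metis abs_of_pos power2_less_imp_less abs_ge_zero power2_abs less_imp_le)
  then obtain g where g: "quart a b c d (x t) = x t * g" "\<bar>g - d\<bar> <= d / 2" using r(3) by blast
  have gd: "g >= d / 2" "g <= 3 / 2 * d" using g(2) unfolding abs_le_iff by linarith+
  have "g^2 <= (3 / 2 * d)^2" using gd d by (intro power_mono) auto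
  then have g2: "\<kappa> * (g^2 / 2) <= \<kappa> * (9 / 8 * d^2)" using \<kappa> by (intro mult_left_mono) (auto simp: power_mult_distrib power_divide)
  have "V' t = (2 * g - \<kappa>) * (x t)^2 - \<kappa> * (g * x t * y t) + \<kappa> * (y t)^2"
   unfolding V'_def g(1) by (simp add: power2_eq_square algebra_simps)
  moreover have "\<kappa> * (g * x t * y t) <= \<kappa> * ((y t)^2 / 2 + g^2 / 2 * (x t)^2)"
  proof (rule mult_left_mono)
   have "0 <= (y t - g * x t)^2" by simp
   then show "g * x t * y t <= (y t)^2 / 2 + g^2 / 2 * (x t)^2" by (simp add: power2_eq_square algebra_simps)
  qed (use \<kappa> in simp)
  ultimately have "V' t >= (2 * g - \<kappa> - \<kappa> * (g^2 / 2)) * (x t)^2 + \<kappa> / 2 * (y t)^2" by (simp add: algebra_simps)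
  moreover have "2 * g - \<kappa> - \<kappa> * (g^2 / 2) >= \<kappa> / 2"
  proof -
   have "\<kappa> * 2 + \<kappa> * (4 * d^2) = d" using \<kappa>d by (simp add: algebra_simps)
   moreover have "\<kappa> * (9 / 8 * d^2) <= \<kappa> * (4 * d^2)" using \<kappa> by (intro mult_left_mono) auto
   ultimately show ?thesis using g2 gd(1) \<kappa> by linarith
  qed
  then have "(2 * g - \<kappa> - \<kappa> * (g^2 / 2)) * (x t)^2 >= \<kappa> / 2 * (x t)^2" by (intro mult_right_mono) auto
  ultimately show ?thesis by (simp add: algebra_simps)
 qed
 have V2: "V t <= 2 * ((x t)^2 + (y t)^2)" for t
 proof -
  have "0 <= (x t + y t)^2" by simp
  then have xy: "- (x t * y t) <= ((x t)^2 + (y t)^2) / 2" by (simp add: power2_eq_square algebra_simps)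
  have "\<kappa> * (- (x t * y t)) <= \<kappa> * (((x t)^2 + (y t)^2) / 2)" using xy \<kappa> by (intro mult_left_mono) auto
  also have "\<dots> <= 1 * (((x t)^2 + (y t)^2) / 2)" using \<kappa>1 by (intro mult_right_mono) auto
  finally have 1: "- (\<kappa> * (x t * y t)) <= ((x t)^2 + (y t)^2) / 2" by simp
  define P S where "P = \<kappa> * (x t * y t)" and "S = (x t)^2 + (y t)^2"
  have "S >= 0" "- P <= S / 2" using 1 by (simp_all add: S_def P_def)
  then have "S - P <= 2 * S" by linarith
  then show ?thesis by (simp add: V_def P_def S_def)
 qed
 have V0: "V 0 > 0" using 0 \<delta> by (simp add: V_def)
 have Vge: "V t >= V 0" if "t >= 0" for t
 proof -
  have "V t >= V 0 + 0 * (t - 0)"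
  proof (rule increment_ge[OF that Vc Vd])
   fix s assume "0 < s" "s < t"
   then have "\<kappa> / 2 * ((x s)^2 + (y s)^2) <= V' s" "0 <= \<kappa> / 2 * ((x s)^2 + (y s)^2)" using V'ge[of s] \<kappa> by auto
   then show "0 <= V' s" by linarith
  qed
  then show ?thesis by simp
 qed
 define m where "m = \<kappa> / 4 * V 0"
 have m: "m > 0" using \<kappa> V0 by (simp add: m_def)
 \<comment> \<open>By this time V has gained 2 r^2 + 1, more than V <= 2 (x^2 + y^2) < 2 r^2
   permits.\<close>
 define T where "T = (2 * r^2 + 1) / m"
 have T: "T >= 0" using m by (simp add: T_def)
 have "V T >= V 0 + m * (T - 0)"
 proof (rule increment_ge[OF T Vc Vd])
  fix s assume s: "0 < s" "s < T"
  have "V 0 <= 2 * ((x s)^2 + (y s)^2)" using V2[of s] Vge[of s] s by linarith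
  then have "\<kappa> / 4 * V 0 <= \<kappa> / 4 * (2 * ((x s)^2 + (y s)^2))" using \<kappa> by (intro mult_left_mono) auto
  also have "\<dots> = \<kappa> / 2 * ((x s)^2 + (y s)^2)" by simp
  also have "\<dots> <= V' s" using V'ge[of s] s by simp
  finally show "m <= V' s" by (simp add: m_def)
 qed
 moreover have "m * T = 2 * r^2 + 1" using m by (simp add: T_def)
 ultimately show False using V2[of T] small[OF T] V0 by simp
qed

section \<open>The centre in the reversible case\<close>

lemma quart_even_abs_le:
 assumes "\<bar>x\<bar> <= 1"
 shows "\<bar>quart a 0 c 0 x\<bar> <= (\<bar>a\<bar> + \<bar>c\<bar>) * x^2"
proof -
 have "x^2 <= 1" using assms by (simp add: abs_square_le_1)
 then have "\<bar>a\<bar> * (x^2 * x^2) <= \<bar>a\<bar> * (1 * x^2)" by (intro mult_left_mono mult_right_mono) auto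
 moreover have "\<bar>quart a 0 c 0 x\<bar> <= \<bar>a\<bar> * (x^2 * x^2) + \<bar>c\<bar> * x^2"
  using abs_triangle_ineq[of "a * x^4" "c * x^2"] by (simp add: quart_def abs_mult power4_eq_xxxx power2_eq_square)
 ultimately show ?thesis by (simp add: algebra_simps)
qed

text \<open>In coordinates rotating with the linear part the solution moves only by the nonlinear terms.\<close>

lemma near_rotation:
 assumes h: "hsol (quart a 0 c 0) {0..} x y" and \<rho>: "\<rho> > 0" "2 * \<rho> <= 1" "208 * (\<bar>a\<bar> + \<bar>c\<bar>) * \<rho> <= 1"
  and 0: "(x 0)^2 + (y 0)^2 = \<rho>^2" and t: "0 <= t" "t <= 13"
 shows "(x t)^2 + (y t)^2 < 4 * \<rho>^2" "\<bar>x t - (x 0 * cos t - y 0 * sin t)\<bar> <= \<rho> / 2"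
proof -
 define F where "F = quart a 0 c 0"
 note xd = hsol_halfline(4)[OF h, folded F_def] and yd = hsol_halfline(5)[OF h]
 define A B where "A = (%t. x t * cos t + y t * sin t)" and "B = (%t. y t * cos t - x t * sin t)"
 \<comment> \<open>Bounds |F x| while |x| <= 2 \<rho>. Over a time of 13, enough for two full turns,
   A and B each move by at most 13 M <= \<rho> / 4; hence 208 = 4 * 4 * 13.\<close>
 define M where "M = 4 * (\<bar>a\<bar> + \<bar>c\<bar>) * \<rho>^2"
 have "13 * M = 208 * (\<bar>a\<bar> + \<bar>c\<bar>) * \<rho> * (\<rho> / 4)" by (simp add: M_def power2_eq_square)
 also have "\<dots> <= 1 * (\<rho> / 4)" using \<rho> by (intro mult_right_mono) auto
 finally have M: "13 * M <= \<rho> / 4" "M >= 0" by (simp_all add: M_def)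
 have Ac: "continuous_on {0..T} A" and Bc: "continuous_on {0..T} B" for T
  unfolding A_def B_def by (intro continuous_intros hsol_halfline(2,3)[OF h])+
 have Ad: "(A has_real_derivative F (x s) * cos s) (at s)" and Bd: "(B has_real_derivative - (F (x s) * sin s)) (at s)"
  if "s > 0" for s unfolding A_def B_def using xd[OF that] yd[OF that]
  by (auto intro!: derivative_eq_intros simp: algebra_simps)
 have AB: "(A s)^2 + (B s)^2 = (x s)^2 + (y s)^2" for s
 proof -
  have "(A s)^2 + (B s)^2 = ((x s)^2 + (y s)^2) * ((sin s)^2 + (cos s)^2)"
   unfolding A_def B_def by algebra
  then show ?thesis by simp
 qed
 have near: "\<bar>A z - x 0\<bar> <= \<rho> / 4 & \<bar>B z - y 0\<bar> <= \<rho> / 4"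
  if z: "0 <= z" "z <= 13" and E: "!!s. 0 <= s ==> s < z ==> (x s)^2 + (y s)^2 <= 4 * \<rho>^2" for z
 proof -
  have FM: "\<bar>F (x s)\<bar> <= M" if "0 < s" "s < z" for s
  proof -
   have "(2 * \<rho>)^2 = 4 * \<rho>^2" by (simp add: power_mult_distrib)
   then have x2: "(x s)^2 <= (2 * \<rho>)^2" using E[OF less_imp_le[OF that(1)] that(2)] zero_le_power2[of "y s"] by linarith
   then have "\<bar>x s\<bar> <= \<bar>2 * \<rho>\<bar>" unfolding abs_le_square_iff .
   then have "\<bar>x s\<bar> <= 2 * \<rho>" using \<rho> by simp
   then have "\<bar>F (x s)\<bar> <= (\<bar>a\<bar> + \<bar>c\<bar>) * (x s)^2" unfolding F_def using \<rho> by (intro quart_even_abs_le) auto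
   also have "\<dots> <= (\<bar>a\<bar> + \<bar>c\<bar>) * (2 * \<rho>)^2" using x2 by (intro mult_left_mono) auto
   finally show ?thesis by (simp add: M_def power_mult_distrib algebra_simps)
  qed
  have b: "\<bar>F (x s) * cos s\<bar> <= M" "\<bar>F (x s) * sin s\<bar> <= M" if "0 < s" "s < z" for s
  proof -
   have "\<bar>F (x s)\<bar> * \<bar>cos s\<bar> <= M * 1" "\<bar>F (x s)\<bar> * \<bar>sin s\<bar> <= M * 1"
    using FM[OF that] M by (intro mult_mono; simp)+
   then show "\<bar>F (x s) * cos s\<bar> <= M" "\<bar>F (x s) * sin s\<bar> <= M" by (simp_all add: abs_mult)
  qed
  have "A z <= A 0 + M * (z - 0)" "A z >= A 0 + - M * (z - 0)" "B z <= B 0 + M * (z - 0)" "B z >= B 0 + - M * (z - 0)"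
   by (rule increment_le[OF z(1) Ac Ad] increment_ge[OF z(1) Ac Ad] increment_le[OF z(1) Bc Bd] increment_ge[OF z(1) Bc Bd];
     use b in \<open>fastforce simp: abs_le_iff\<close>)+
  moreover have "M * z <= M * 13" using z M by (intro mult_left_mono) auto
  moreover have "A 0 = x 0" "B 0 = y 0" by (simp_all add: A_def B_def)
  ultimately show ?thesis using M unfolding abs_le_iff by simp
 qed
 have E: "(x s)^2 + (y s)^2 < 4 * \<rho>^2" if s: "0 <= s" "s <= 13" for s
 proof (rule ccontr)
  assume n: "\<not> (x s)^2 + (y s)^2 < 4 * \<rho>^2"
  define E where "E = (%s. 4 * \<rho>^2 - ((x s)^2 + (y s)^2))"
  have "continuous_on {0..s} E" unfolding E_def by (intro continuous_intros hsol_halfline(2,3)[OF h])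
  moreover have "E 0 > 0" "E s <= 0" using n 0 \<rho>(1) by (simp_all add: E_def)
  ultimately obtain z where z: "0 < z" "z <= s" "E z = 0" "!!w. 0 <= w ==> w < z ==> E w > 0"
   using first_zero[OF s(1)] by blast
  note z = z[unfolded E_def]
  have "(x w)^2 + (y w)^2 <= 4 * \<rho>^2" if "0 <= w" "w < z" for w using z(4)[OF that] by simp
  then have nz: "\<bar>A z - x 0\<bar> <= \<rho> / 4" "\<bar>B z - y 0\<bar> <= \<rho> / 4" using near[of z] z s by auto
  have sq: "u^2 <= 2 * v^2 + 2 * (\<rho> / 4)^2" if "\<bar>u - v\<bar> <= \<rho> / 4" for u v :: real
  proof -
   have "\<bar>u - v\<bar> <= \<bar>\<rho> / 4\<bar>" using that \<rho> by simp
   then have "(u - v)^2 <= (\<rho> / 4)^2" unfolding abs_le_square_iff .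
   moreover have "0 <= (u - 2 * v)^2" by simp
   moreover have "u^2 + (u - 2 * v)^2 = 2 * v^2 + 2 * (u - v)^2" by (simp add: power2_eq_square algebra_simps)
   ultimately show ?thesis by linarith
  qed
  have "(A z)^2 + (B z)^2 <= 2 * \<rho>^2 + 4 * (\<rho> / 4)^2"
   using sq[OF nz(1)] sq[OF nz(2)] 0 by linarith
  moreover have "2 * \<rho>^2 + 4 * (\<rho> / 4)^2 < 4 * \<rho>^2" using \<rho> by (simp add: power_divide)
  ultimately show False using AB[of z] z(3) by simp
 qed
 show "(x t)^2 + (y t)^2 < 4 * \<rho>^2" by (rule E[OF t])
 have "(x s)^2 + (y s)^2 <= 4 * \<rho>^2" if "0 <= s" "s < t" for s using E[of s] that t by simp
 then have nt: "\<bar>A t - x 0\<bar> <= \<rho> / 4" "\<bar>B t - y 0\<bar> <= \<rho> / 4" using near[OF t] by auto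
 have "x t = x t * ((sin t)^2 + (cos t)^2)" by simp
 also have "\<dots> = A t * cos t - B t * sin t" unfolding A_def B_def by algebra
 finally have "x t - (x 0 * cos t - y 0 * sin t) = (A t - x 0) * cos t - (B t - y 0) * sin t" by (simp add: algebra_simps)
 moreover have "\<bar>(A t - x 0) * cos t\<bar> <= \<rho> / 4 * 1" "\<bar>(B t - y 0) * sin t\<bar> <= \<rho> / 4 * 1"
  unfolding abs_mult using nt \<rho> by (intro mult_mono; simp)+
 ultimately show "\<bar>x t - (x 0 * cos t - y 0 * sin t)\<bar> <= \<rho> / 2" by linarith
qed

text \<open>Up to an error \<rho> / 2, x is \<rho> cos (t + \<alpha>), which within two full turns
  goes from \<rho> to - \<rho> and back; each change of sign gives a crossing.\<close>

lemma axis_crossings: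
 assumes h: "hsol (quart a 0 c 0) {0..} x y" and \<rho>: "\<rho> > 0" "2 * \<rho> <= 1" "208 * (\<bar>a\<bar> + \<bar>c\<bar>) * \<rho> <= 1"
  and 0: "(x 0)^2 + (y 0)^2 = \<rho>^2"
 obtains T1 T2 where "0 <= T1" "T1 < T2" "T2 <= 13" "x T1 = 0" "x T2 = 0"
proof -
 have "(x 0 / \<rho>)^2 + (y 0 / \<rho>)^2 = ((x 0)^2 + (y 0)^2) / \<rho>^2" by (simp add: power_divide add_divide_distrib)
 then have "(x 0 / \<rho>)^2 + (y 0 / \<rho>)^2 = 1" using \<rho> 0 by simp
 then obtain \<alpha> where \<alpha>: "0 <= \<alpha>" "\<alpha> < 2 * pi" "x 0 / \<rho> = cos \<alpha>" "y 0 / \<rho> = sin \<alpha>" using sincos_total_2pi by metis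
 have p0: "x 0 = \<rho> * cos \<alpha>" "y 0 = \<rho> * sin \<alpha>" unfolding \<alpha>(3,4)[symmetric] using \<rho> by simp_all
 have rot: "x 0 * cos u - y 0 * sin u = \<rho> * cos (u + \<alpha>)" for u
  unfolding p0 by (simp add: cos_add algebra_simps)
 have pi13: "4 * pi <= 13" using pi_approx by simp
 \<comment> \<open>The time at which the angle t + \<alpha> completes a full turn and x is close to
   \<rho>; it is at most 2 pi, so one more turn fits into 4 pi <= 13.\<close>
 define b where "b = 2 * pi - \<alpha>"
 have bb: "0 <= b" "b + 2 * pi <= 13" using \<alpha> pi13 by (auto simp: b_def)
 have eqs: "b + \<alpha> = 2 * pi" "b + pi + \<alpha> = pi + 2 * pi" "b + 2 * pi + \<alpha> = 2 * pi + 2 * pi" by (simp_all add: b_def)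
 have cs: "cos (b + \<alpha>) = 1" "cos (b + pi + \<alpha>) = - 1" "cos (b + 2 * pi + \<alpha>) = 1"
  unfolding eqs by (simp_all only: cos_periodic cos_two_pi cos_pi)
 have r: "\<bar>x u - \<rho> * cos (u + \<alpha>)\<bar> <= \<rho> / 2" if "0 <= u" "u <= 13" for u
  using near_rotation(2)[OF h \<rho> 0 that] unfolding rot .
 have pp: "pi > 0" by simp
 have "\<bar>x b - \<rho> * 1\<bar> <= \<rho> / 2" "\<bar>x (b + pi) - \<rho> * - 1\<bar> <= \<rho> / 2" "\<bar>x (b + 2 * pi) - \<rho> * 1\<bar> <= \<rho> / 2"
  using r[of b] r[of "b + pi"] r[of "b + 2 * pi"] bb pp unfolding cs by linarith+
 then have sg: "x b > 0" "x (b + pi) < 0" "x (b + 2 * pi) > 0" using \<rho>(1) unfolding abs_le_iff by linarith+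
 have xc: "continuous_on {b..b + pi} x" "continuous_on {b + pi..b + 2 * pi} x"
  using bb pp by (auto intro: continuous_on_subset[OF hsol_halfline(2)[OF h, of "b + 2 * pi"]])
 obtain T1 where T1: "b <= T1" "T1 <= b + pi" "x T1 = 0"
  using IVT2'[of x "b + pi" 0 b] sg xc(1) pp by auto
 obtain T2 where T2: "b + pi <= T2" "T2 <= b + 2 * pi" "x T2 = 0"
  using IVT'[of x "b + pi" 0 "b + 2 * pi"] sg xc(2) pp by auto
 have "T1 \<noteq> b + pi" using T1 sg by auto
 then show ?thesis using that[of T1 T2] T1 T2 bb by auto
qed

text \<open>The system is reversible, so an orbit that meets the axis of symmetry twice is periodic.\<close>

lemma even_orbit_bounded:
 assumes h: "hsol (quart a 0 c 0) {0..} x y" and T: "0 <= T1" "T1 < T2" "x T1 = 0" "x T2 = 0"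
  and bnd: "!!u. 0 <= u ==> u <= T2 ==> (x u)^2 + (y u)^2 < R" and u: "u >= 0"
 shows "(x u)^2 + (y u)^2 < R"
proof -
 define F where "F = quart a 0 c 0"
 note h = h[folded F_def]
 have ev: "(%x. F (- x)) = F" using quart_uminus_fun[of a 0 c 0] by (simp add: F_def)
 define L where "L = T2 - T1"
 have L: "L > 0" "T1 + L = T2" using T by (simp_all add: L_def)
 have nn: "0 <= T2" "0 <= T1 + 2 * L" using T L by auto
 have h1: "hsol F {0..} (%t. x (T1 + t)) (%t. y (T1 + t))" by (rule hsol_halfline_shift[OF h T(1)])
 have h2: "hsol F {0..} (%t. x (T2 + t)) (%t. y (T2 + t))" by (rule hsol_halfline_shift[OF h nn(1)])
 have h3: "hsol F {0..} (%t. x (T1 + 2 * L + t)) (%t. y (T1 + 2 * L + t))" by (rule hsol_halfline_shift[OF h nn(2)])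
 have h4: "hsol F {0..L} (%t. - x (T1 + (L - t))) (%t. y (T1 + (L - t)))"
  using hsol_reverse[OF hsol_halfline(1)[OF h1, of L]] unfolding ev by simp
 \<comment> \<open>As x T2 = 0, the orbit after T2 is the mirror image of the orbit before it. Since
   also x T1 = 0, the mirror image of the point at T1 is that point itself, so the orbit closes up
   after 2 * L.\<close>
 have mir: "x (T2 + w) = - x (T1 + (L - w)) & y (T2 + w) = y (T1 + (L - w))" if "0 <= w" "w <= L" for w
  by (rule hsol_unique[OF hsol_halfline(1)[OF h2, of L, unfolded F_def] h4[unfolded F_def]]) (use that T L in auto)
 have eq: "T1 + 2 * L = T2 + L" using L by simp
 have p0: "x (T1 + 2 * L) = x T1" "y (T1 + 2 * L) = y T1" unfolding eq using mir[of L] L T by simp_all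
 have per: "x (T1 + 2 * L + w) = x (T1 + w)" "y (T1 + 2 * L + w) = y (T1 + w)" if "w >= 0" for w
  by (rule hsol_halfline_unique[OF h3[unfolded F_def] h1[unfolded F_def]]; use p0 that in simp)+
 have one: "(x w)^2 + (y w)^2 < R" if w: "0 <= w" "w <= T1 + 2 * L" for w
 proof (cases "w <= T2")
  case True
  then show ?thesis using bnd w by blast
 next
  case False
  have "x w = - x (T1 + (L - (w - T2)))" "y w = y (T1 + (L - (w - T2)))" using mir[of "w - T2"] False w L by auto
  moreover have "(x (T1 + (L - (w - T2))))^2 + (y (T1 + (L - (w - T2))))^2 < R"
   by (rule bnd) (use False w L T in auto)
  ultimately show ?thesis by simp
 qed
 have many: "\<forall>w. 0 <= w & w <= T1 + 2 * L * real (Suc n) --> (x w)^2 + (y w)^2 < R" for n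
 proof (induction n)
  case (Suc n)
  show ?case
  proof (intro allI impI)
   fix w assume w: "0 <= w & w <= T1 + 2 * L * real (Suc (Suc n))"
   show "(x w)^2 + (y w)^2 < R"
   proof (cases "w <= T1 + 2 * L")
    case True
    then show ?thesis using one w by blast
   next
    case False
    have "x w = x (w - 2 * L)" "y w = y (w - 2 * L)" using per[of "w - T1 - 2 * L"] False by auto
    moreover have "0 <= w - 2 * L" "w - 2 * L <= T1 + 2 * L * real (Suc n)"
     using False w T by (auto simp: algebra_simps)
    then have "(x (w - 2 * L))^2 + (y (w - 2 * L))^2 < R" using Suc.IH by blast
    ultimately show ?thesis by simp
   qed
  qed
 qed (use one in simp)
 obtain n where "u / (2 * L) < real n" using reals_Archimedean2 by blast
 then have "u < 2 * L * real n" using L by (simp add: pos_divide_less_eq mult.commute)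
 moreover have "2 * L * real n <= 2 * L * real (Suc n)" using L by (intro mult_left_mono) auto
 ultimately have "u <= T1 + 2 * L * real (Suc n)" using T by linarith
 then show ?thesis using many[of n] u by blast
qed

lemma origin_center:
 assumes lead: "lead a 0 c" and l: "loopg (quart a 0 c 0) yy"
 shows "lyapunov_stable (hfield a 0 c 0) 0"
proof (rule lyapunov_stable_hfieldI)
 fix e :: real assume e: "e > 0"
 obtain r0 where r0: "r0 > 0" "!!x0 y0. x0^2 + y0^2 < r0^2 ==> \<exists>x y. x 0 = x0 & y 0 = y0 & hsol (quart a 0 c 0) {0..} x y"
  using loop_global_near_origin[OF lead l] by blast
 define K where "K = 208 * (\<bar>a\<bar> + \<bar>c\<bar>) + 1"
 have K: "K > 0" by (simp add: K_def add_nonneg_pos)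
 define r where "r = min r0 (min (e / 2) (min (1 / 2) (1 / K)))"
 have r: "r > 0" "r <= r0" "r <= e / 2" "r <= 1 / 2" "r <= 1 / K" using r0 e K by (auto simp: r_def)
 show "\<exists>r>0. \<forall>x0 y0. x0^2 + y0^2 < r^2 --> (\<exists>x y. x 0 = x0 & y 0 = y0 &
  hsol (quart a 0 c 0) {0..} x y & (\<forall>t\<ge>0. (x t)^2 + (y t)^2 < e^2))"
 proof (rule exI[of _ r], intro conjI allI impI r(1))
  fix x0 y0 :: real assume 0: "x0^2 + y0^2 < r^2"
  have sq: "r^2 <= r0^2" using r by (intro power_mono) auto
  obtain x y where xy: "x 0 = x0" "y 0 = y0" "hsol (quart a 0 c 0) {0..} x y" using r0(2)[of x0 y0] 0 sq by auto
  have bnd: "(x t)^2 + (y t)^2 < e^2" if t: "t >= 0" for t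
  proof (cases "x0^2 + y0^2 = 0")
   case True
   have "hsol (quart a 0 c 0) {0..} (%t. 0) (%t. 0)" by (auto simp: hsol_def)
   moreover have "x 0 = 0" "y 0 = 0" using True xy by (auto simp: sum_power2_eq_zero_iff)
   ultimately have "x t = 0" "y t = 0" using hsol_halfline_unique[OF xy(3), of "%t. 0" "%t. 0" t] t by auto
   then show ?thesis using e by simp
  next
   case False
   define R where "R = sqrt (x0^2 + y0^2)"
   have R: "R > 0" "R^2 = x0^2 + y0^2" using False by (simp_all add: R_def less_le)
   have Rr: "R < r" by (rule power2_less_imp_less) (use R 0 r in auto)
   have "K * R <= K * (1 / K)" using Rr r K by (intro mult_left_mono) auto
   then have "K * R <= 1" using K by simp
   then have small: "208 * (\<bar>a\<bar> + \<bar>c\<bar>) * R <= 1" using R(1) unfolding K_def distrib_right by linarith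
   have R2: "2 * R <= 1" using Rr r by simp
   have R0: "(x 0)^2 + (y 0)^2 = R^2" using xy R by simp
   obtain T1 T2 where T: "0 <= T1" "T1 < T2" "T2 <= 13" "x T1 = 0" "x T2 = 0"
    using axis_crossings[OF xy(3) R(1) R2 small R0] by metis
   have "(x t)^2 + (y t)^2 < 4 * R^2"
   proof (rule even_orbit_bounded[OF xy(3) T(1,2,4,5) _ t])
    fix u assume "0 <= u" "u <= T2"
    then show "(x u)^2 + (y u)^2 < 4 * R^2" using near_rotation(1)[OF xy(3) R(1) R2 small R0, of u] T by simp
   qed
   moreover have "(2 * R)^2 <= e^2" using Rr r R by (intro power_mono) auto
   ultimately show ?thesis by (simp add: power_mult_distrib)
  qed
  show "\<exists>x y. x 0 = x0 & y 0 = y0 & hsol (quart a 0 c 0) {0..} x y & (\<forall>t\<ge>0. (x t)^2 + (y t)^2 < e^2)"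
   using xy bnd by blast
 qed
qed

lemma loop_stable_iff_origin_unstable:
 assumes lead: "lead a b c" and l: "loopg (quart a b c d) yy"
  and sgn: "b > 0 ==> d < 0" "b < 0 ==> d > 0" "b = 0 ==> d = 0"
 shows "loop_stable (hfield a b c d) (0, 1, 0) (range (%x. (x, yy x))) \<longleftrightarrow> \<not> lyapunov_stable (hfield a b c d) 0"
proof -
 have "lyapunov_stable (hfield a b c d) 0 \<longleftrightarrow> \<not> b < 0"
 proof (cases "b = 0")
  case True
  then have "d = 0" using sgn by simp
  show ?thesis using origin_center[of a c yy] lead l unfolding True \<open>d = 0\<close> by blast
 next
  case False
  then show ?thesis using origin_stable[OF lead l] origin_unstable[of d a b c] sgn by (cases "b < 0") auto
 qed
 then show ?thesis using loop_stable_iff[OF lead l sgn(3)] by blast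
qed

section \<open>Transfer to the original system\<close>

text \<open>Used with s and t equal to 1 or - 1: reflections of the plane, matched by reflections of
  the sphere. They are isometric involutions fixing 0, so all notions of the statement carry
  over.\<close>

definition flip :: "real \<Rightarrow> real \<Rightarrow> real \<times> real \<Rightarrow> real \<times> real" where
 "flip s t = (%(x, y). (s * x, t * y))"

definition flip3 :: "real \<Rightarrow> real \<Rightarrow> real \<times> real \<times> real \<Rightarrow> real \<times> real \<times> real" where
 "flip3 s t = (%(u, v, w). (s * u, t * v, w))"

context
 fixes s t :: real
 assumes st: "s * s = 1" "t * t = 1"
begin

lemma st_square: "s^2 = 1" "t^2 = 1"
 using st by (simp_all add: power2_eq_square)

lemma flip_flip: "flip s t (flip s t q) = q"
 using st by (auto simp: flip_def mult.assoc[symmetric] split: prod.split)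

lemma flip3_flip3: "flip3 s t (flip3 s t q) = q"
 using st by (auto simp: flip3_def mult.assoc[symmetric] split: prod.split)

lemma poincare_flip: "poincare (flip s t q) = flip3 s t (poincare q)"
 by (cases q) (simp add: flip_def flip3_def poincare_Pair power_mult_distrib st_square)

lemma dist_flip: "dist (flip s t p) (flip s t q) = dist p q"
 by (cases p; cases q) (simp add: flip_def dist_Pair_Pair dist_real_def right_diff_distrib[symmetric]
   abs_mult power_mult_distrib st_square)

lemma dist_flip3: "dist (flip3 s t p) (flip3 s t q) = dist p q"
 by (cases p; cases q) (simp add: flip3_def dist_Pair_Pair dist_real_def right_diff_distrib[symmetric]
   abs_mult power_mult_distrib st_square)

lemma flip_0: "flip s t 0 = 0"
 by (simp add: flip_def zero_prod_def)

lemma bounded_linear_flip: "bounded_linear (flip s t)"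
 unfolding flip_def split_def
 by (intro bounded_linear_Pair bounded_linear_const_mult bounded_linear_fst bounded_linear_snd)

lemma continuous_on_flip: "continuous_on S (flip s t)"
 unfolding flip_def split_def by (intro continuous_intros)

lemma continuous_on_flip3: "continuous_on S (flip3 s t)"
 unfolding flip3_def split_def by (intro continuous_intros)

lemma flip_image_image: "flip s t ` flip s t ` \<Gamma> = \<Gamma>"
 by (simp add: image_image flip_flip)

lemma loop_interior_flip:
 assumes "q \<in> loop_interior (flip s t ` \<Gamma>)"
 shows "flip s t q \<in> loop_interior \<Gamma>"
proof -
 obtain T where T: "connected T" "T \<subseteq> - flip s t ` \<Gamma>" "0 \<in> T" "q \<in> T"
  using assms unfolding loop_interior_def connected_component_def by auto
 show ?thesis unfolding loop_interior_def connected_component_def mem_Collect_eq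
 proof (intro exI conjI)
  show "connected (flip s t ` T)" by (rule connected_continuous_image[OF continuous_on_flip T(1)])
  show "flip s t ` T \<subseteq> - \<Gamma>"
  proof
   fix z assume "z \<in> flip s t ` T"
   then obtain w where w: "w \<in> T" "z = flip s t w" by blast
   then have "flip s t z = w" by (simp add: flip_flip)
   then show "z \<in> - \<Gamma>" using T(2) w(1) by blast
  qed
  show "0 \<in> flip s t ` T" using T(3) flip_0 by (metis imageI)
  show "flip s t q \<in> flip s t ` T" using T(4) by blast
 qed
qed

lemma loop_dist_flip: "loop_dist (flip3 s t p) (flip s t ` \<Gamma>) (flip s t q) = loop_dist p \<Gamma> q"
proof -
 have "insert (flip3 s t p) (poincare ` flip s t ` \<Gamma>) = flip3 s t ` insert p (poincare ` \<Gamma>)"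
  by (simp add: image_image poincare_flip)
 then show ?thesis unfolding loop_dist_def
  by (simp only: infdist_notempty insert_not_empty image_is_empty not_False_eq_True image_image poincare_flip dist_flip3)
qed

context
 fixes X Y :: "real \<times> real \<Rightarrow> real \<times> real"
 assumes XY: "!!q. X (flip s t q) = flip s t (Y q)"
begin

lemma has_vector_derivative_flip:
 assumes "(\<gamma> has_vector_derivative Y (\<gamma> r)) F"
 shows "((%r. flip s t (\<gamma> r)) has_vector_derivative X (flip s t (\<gamma> r))) F"
 using bounded_linear.has_vector_derivative[OF bounded_linear_flip assms] by (simp add: XY)

lemma loop_orbit_at_flip:
 assumes "loop_orbit_at Y p \<Gamma>"
 shows "loop_orbit_at X (flip3 s t p) (flip s t ` \<Gamma>)"
proof -
 obtain \<alpha> \<omega> :: ereal and \<gamma> where p: "p \<in> equator" and ao: "\<alpha> < \<omega>"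
  and d: "\<forall>r\<in>einterval \<alpha> \<omega>. (\<gamma> has_vector_derivative Y (\<gamma> r)) (at r)" and G: "\<Gamma> = \<gamma> ` einterval \<alpha> \<omega>"
  and l: "((%r. poincare (\<gamma> (real_of_ereal r))) \<longlongrightarrow> p) (at_right \<alpha>)"
   "((%r. poincare (\<gamma> (real_of_ereal r))) \<longlongrightarrow> p) (at_left \<omega>)"
  using assms unfolding loop_orbit_at_def by blast
 have lim: "((%r. poincare (flip s t (\<gamma> (real_of_ereal r)))) \<longlongrightarrow> flip3 s t p) H"
  if "((%r. poincare (\<gamma> (real_of_ereal r))) \<longlongrightarrow> p) H" for H
  unfolding poincare_flip using continuous_on_tendsto_compose[OF continuous_on_flip3[of UNIV] that] by simp
 have "flip3 s t p \<in> equator"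
  using p st_square by (cases p) (auto simp: equator_def flip3_def power_mult_distrib)
 moreover have "\<forall>r\<in>einterval \<alpha> \<omega>. ((%r. flip s t (\<gamma> r)) has_vector_derivative X (flip s t (\<gamma> r))) (at r)"
  using d has_vector_derivative_flip by blast
 moreover have "flip s t ` \<Gamma> = (%r. flip s t (\<gamma> r)) ` einterval \<alpha> \<omega>" by (simp add: G image_image)
 ultimately show ?thesis using ao lim[OF l(1)] lim[OF l(2)] unfolding loop_orbit_at_def by blast
qed

lemma forward_solution_flip:
 assumes "forward_solution Y q \<phi>"
 shows "forward_solution X (flip s t q) (%r. flip s t (\<phi> r))"
 using assms has_vector_derivative_flip unfolding forward_solution_def by blast

lemma loop_stable_flip:
 assumes "loop_stable Y p \<Gamma>"
 shows "loop_stable X (flip3 s t p) (flip s t ` \<Gamma>)"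
proof -
 obtain e where e: "e > 0" "!!q. q \<in> loop_interior \<Gamma> ==> loop_dist p \<Gamma> q < e ==>
  \<exists>\<phi>. forward_solution Y q \<phi> & ((%r. loop_dist p \<Gamma> (\<phi> r)) \<longlongrightarrow> 0) at_top"
  using assms unfolding loop_stable_def by blast
 show ?thesis unfolding loop_stable_def
 proof (intro exI[of _ e] conjI ballI impI e(1))
  fix q assume q: "q \<in> loop_interior (flip s t ` \<Gamma>)" "loop_dist (flip3 s t p) (flip s t ` \<Gamma>) q < e"
  have "loop_dist p \<Gamma> (flip s t q) < e" using q(2) loop_dist_flip[of p \<Gamma> "flip s t q"] by (simp add: flip_flip)
  then obtain \<phi> where \<phi>: "forward_solution Y (flip s t q) \<phi>" "((%r. loop_dist p \<Gamma> (\<phi> r)) \<longlongrightarrow> 0) at_top"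
   using e(2)[OF loop_interior_flip[OF q(1)]] by blast
  have "forward_solution X q (%r. flip s t (\<phi> r))" using forward_solution_flip[OF \<phi>(1)] by (simp add: flip_flip)
  moreover have "((%r. loop_dist (flip3 s t p) (flip s t ` \<Gamma>) (flip s t (\<phi> r))) \<longlongrightarrow> 0) at_top"
   unfolding loop_dist_flip by (rule \<phi>(2))
  ultimately show "\<exists>\<phi>. forward_solution X q \<phi> & ((%r. loop_dist (flip3 s t p) (flip s t ` \<Gamma>) (\<phi> r)) \<longlongrightarrow> 0) at_top"
   by blast
 qed
qed

lemma lyapunov_stable_flip:
 assumes "lyapunov_stable Y 0"
 shows "lyapunov_stable X 0"
 unfolding lyapunov_stable_def
proof (intro allI impI)
 fix e :: real assume "e > 0"
 then obtain \<delta> where \<delta>: "\<delta> > 0" "!!q. dist q 0 < \<delta> ==> \<exists>\<phi>. forward_solution Y q \<phi> & (\<forall>r\<ge>0. dist (\<phi> r) 0 < e)"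
  using assms unfolding lyapunov_stable_def by blast
 have d0: "dist (flip s t q) 0 = dist q 0" for q using dist_flip[of q 0] by (simp add: flip_0)
 show "\<exists>\<delta>>0. \<forall>q. dist q 0 < \<delta> --> (\<exists>\<phi>. forward_solution X q \<phi> & (\<forall>r\<ge>0. dist (\<phi> r) 0 < e))"
 proof (rule exI[of _ \<delta>], intro conjI allI impI \<delta>(1))
  fix q :: "real \<times> real" assume "dist q 0 < \<delta>"
  then obtain \<phi> where \<phi>: "forward_solution Y (flip s t q) \<phi>" "!!r. r >= 0 ==> dist (\<phi> r) 0 < e"
   using \<delta>(2)[of "flip s t q"] unfolding d0 by blast
  have "forward_solution X q (%r. flip s t (\<phi> r))" using forward_solution_flip[OF \<phi>(1)] by (simp add: flip_flip)
  then show "\<exists>\<phi>. forward_solution X q \<phi> & (\<forall>r\<ge>0. dist (\<phi> r) 0 < e)"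
   using \<phi>(2) d0 by (intro exI[of _ "%r. flip s t (\<phi> r)"]) simp
 qed
qed

end

lemma loop_stable_flip_iff:
 assumes "!!q. X (flip s t q) = flip s t (Y q)"
 shows "loop_stable X p \<Gamma> \<longleftrightarrow> loop_stable Y (flip3 s t p) (flip s t ` \<Gamma>)"
proof -
 have Y: "Y (flip s t q) = flip s t (X q)" for q using assms[of "flip s t q"] by (simp add: flip_flip)
 show ?thesis
  using loop_stable_flip[of Y X p \<Gamma>, OF Y] loop_stable_flip[of X Y "flip3 s t p" "flip s t ` \<Gamma>", OF assms]
  by (auto simp: flip3_flip3 flip_image_image)
qed

lemma lyapunov_stable_flip_iff:
 assumes "!!q. X (flip s t q) = flip s t (Y q)"
 shows "lyapunov_stable X 0 \<longleftrightarrow> lyapunov_stable Y 0"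
proof -
 have Y: "Y (flip s t q) = flip s t (X q)" for q using assms[of "flip s t q"] by (simp add: flip_flip)
 show ?thesis using lyapunov_stable_flip[of Y X, OF Y] lyapunov_stable_flip[of X Y, OF assms] by blast
qed

end

section \<open>The base point is singular, and the two sign cases\<close>

text \<open>Normalising a vector of length \<Delta> divides increments by \<Delta>, up to a
  constant; this supplies one more factor of the height.\<close>

lemma norm_frechet_derivative_poincare:
 "norm (frechet_derivative poincare (at (x, y)) (h, k)) <= 2 * (\<bar>h\<bar> + \<bar>k\<bar>) / sqrt (1 + x^2 + y^2)"
proof -
 define \<Delta> where "\<Delta> = sqrt (1 + x^2 + y^2)"
 have p: "1 + x^2 + y^2 > 0" by (simp add: add_pos_nonneg)
 then have \<Delta>: "\<Delta> > 0" by (simp add: \<Delta>_def)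
 define m where "m = - (inverse \<Delta> * (inverse \<Delta> / 2) * inverse \<Delta>)"
 define g :: "real \<times> real \<Rightarrow> real" where "g = (%q. 1 + (fst q)^2 + (snd q)^2)"
 define r where "r = (%q. inverse (sqrt (g q)))"
 have P: "poincare = (%q. r q *\<^sub>R (fst q, snd q, 1))"
  by (simp add: poincare_def r_def g_def fun_eq_iff inverse_eq_divide split: prod.split)
 have "(sqrt has_real_derivative inverse \<Delta> / 2) (at (1 + x^2 + y^2))"
  unfolding \<Delta>_def by (rule DERIV_real_sqrt[OF p])
 then have "((%u. inverse (sqrt u)) has_real_derivative m) (at (1 + x^2 + y^2))"
  unfolding m_def using DERIV_inverse'[of sqrt "inverse \<Delta> / 2" "1 + x^2 + y^2" UNIV] \<Delta> by (simp add: \<Delta>_def)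
 then have A: "((%u. inverse (sqrt u)) has_real_derivative m) (at (g (x, y)))" by (simp add: g_def)
 have B: "(g has_derivative (%q. 2 * x * fst q + 2 * y * snd q)) (at (x, y))"
  unfolding g_def by (auto intro!: derivative_eq_intros simp: fun_eq_iff algebra_simps)
 have R: "(r has_derivative (%q. (2 * x * fst q + 2 * y * snd q) * m)) (at (x, y))"
  unfolding r_def by (rule DERIV_compose_FDERIV[where f = "%u. inverse (sqrt u)" and g = g, OF A B])
 have N: "((%q. (fst q, snd q, 1::real)) has_derivative (%q. (fst q, snd q, 0))) (at (x, y))"
  by (auto intro!: derivative_eq_intros)
 have "((%q. r q *\<^sub>R (fst q, snd q, 1::real)) has_derivative (%q. r (x, y) *\<^sub>R (fst q, snd q, 0) +
   ((2 * x * fst q + 2 * y * snd q) * m) *\<^sub>R (fst (x, y), snd (x, y), 1))) (at (x, y))"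
  by (rule has_derivative_scaleR[OF R N])
 moreover have "r (x, y) = inverse \<Delta>" by (simp add: r_def g_def \<Delta>_def)
 ultimately have "(poincare has_derivative (%q. inverse \<Delta> *\<^sub>R (fst q, snd q, 0) + ((2 * x * fst q + 2 * y * snd q) * m) *\<^sub>R (x, y, 1))) (at (x, y))"
  unfolding P by simp
 from fun_cong[OF frechet_derivative_at[OF this, symmetric], of "(h, k)"]
 have D: "frechet_derivative poincare (at (x, y)) (h, k) = inverse \<Delta> *\<^sub>R (h, k, 0) + ((2 * x * h + 2 * y * k) * m) *\<^sub>R (x, y, 1)"
  by (simp only: fst_conv snd_conv)
 have n0: "norm (h, k, 0::real) <= \<bar>h\<bar> + \<bar>k\<bar>" by (simp add: norm_Pair sqrt_sum_squares_le_sum_abs)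
 have n1: "norm (x, y, 1::real) = \<Delta>" by (simp add: norm_Pair \<Delta>_def add_ac)
 have a: "\<bar>x\<bar> <= \<Delta>" "\<bar>y\<bar> <= \<Delta>" unfolding \<Delta>_def by (simp_all add: real_le_rsqrt)
 have "\<bar>x * h + y * k\<bar> <= \<bar>x\<bar> * \<bar>h\<bar> + \<bar>y\<bar> * \<bar>k\<bar>" by (metis abs_mult abs_triangle_ineq)
 also have "\<dots> <= \<Delta> * \<bar>h\<bar> + \<Delta> * \<bar>k\<bar>" using a by (intro add_mono mult_right_mono) auto
 finally have xh: "\<bar>x * h + y * k\<bar> <= \<Delta> * (\<bar>h\<bar> + \<bar>k\<bar>)" by (simp add: algebra_simps)
 have m2: "2 * m = - (1 / (\<Delta> * \<Delta> * \<Delta>))" using \<Delta> by (simp add: m_def field_simps)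
 have "(2 * x * h + 2 * y * k) * m = (x * h + y * k) * (2 * m)" by (simp add: algebra_simps)
 also have "\<dots> = - ((x * h + y * k) / (\<Delta> * \<Delta> * \<Delta>))" unfolding m2 by simp
 finally have "(2 * x * h + 2 * y * k) * m = - ((x * h + y * k) / (\<Delta> * \<Delta> * \<Delta>))" .
 then have "\<bar>(2 * x * h + 2 * y * k) * m\<bar> = \<bar>x * h + y * k\<bar> / (\<Delta> * \<Delta> * \<Delta>)" using \<Delta> by (simp add: abs_mult)
 also have "\<dots> <= \<Delta> * (\<bar>h\<bar> + \<bar>k\<bar>) / (\<Delta> * \<Delta> * \<Delta>)" using xh \<Delta> by (intro divide_right_mono) auto
 finally have "\<bar>(2 * x * h + 2 * y * k) * m\<bar> * \<Delta> <= \<Delta> * (\<bar>h\<bar> + \<bar>k\<bar>) / (\<Delta> * \<Delta> * \<Delta>) * \<Delta>" using \<Delta> by (intro mult_right_mono) auto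
 also have "\<dots> = (\<bar>h\<bar> + \<bar>k\<bar>) / \<Delta>" using \<Delta> by (simp add: field_simps)
 finally have b: "\<bar>(2 * x * h + 2 * y * k) * m\<bar> * \<Delta> <= (\<bar>h\<bar> + \<bar>k\<bar>) / \<Delta>" .
 have "norm (frechet_derivative poincare (at (x, y)) (h, k)) <= norm (inverse \<Delta> *\<^sub>R (h, k, 0::real)) + norm (((2 * x * h + 2 * y * k) * m) *\<^sub>R (x, y, 1::real))"
  unfolding D by (rule norm_triangle_ineq)
 also have "norm (((2 * x * h + 2 * y * k) * m) *\<^sub>R (x, y, 1::real)) = \<bar>(2 * x * h + 2 * y * k) * m\<bar> * \<Delta>" by (simp only: norm_scaleR n1)
 also have "norm (inverse \<Delta> *\<^sub>R (h, k, 0::real)) = norm (h, k, 0::real) / \<Delta>" unfolding norm_scaleR using \<Delta> by (simp add: divide_inverse mult.commute)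
 also have "norm (h, k, 0::real) / \<Delta> <= (\<bar>h\<bar> + \<bar>k\<bar>) / \<Delta>" using n0 \<Delta> by (intro divide_right_mono) auto
 finally show ?thesis using b unfolding \<Delta>_def[symmetric] by (simp add: add_divide_distrib)
qed

lemma lienard_quart: "lienard_field a b c d (x, y) = (y - quart a b c d x, - x)"
 by (simp add: lienard_field_def quart_def)

text \<open>With the n - 1 factors of the height from the definition and one from the derivative of
  \<open>poincare\<close>, the quartic becomes a form of degree n in U and W, and both tend to 0 at
  the ends of the y-axis. The linear terms keep the factor W ^ (n - 1), which vanishes because n >=
  2.\<close>

lemma singular_at_vertical_infinity:
 assumes ab: "a \<noteq> 0 \<or> (b = 0 & c \<noteq> 0)" and v: "v * v = 1"
 shows "singular_at_infinity (lienard_degree a b c d) (lienard_field a b c d) (0, v, 0)"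
proof -
 define n where "n = lienard_degree a b c d"
 define G where "G = filtercomap poincare (nhds (0::real, v, 0::real))"
 define U V W where "U = (%q. fst (poincare q))" and "V = (%q. fst (snd (poincare q)))" and "W = (%q. snd (snd (poincare q)))"
 have P: "(poincare \<longlongrightarrow> (0, v, 0)) G" unfolding G_def by (rule filterlim_filtercomap)
 have lim: "(U \<longlongrightarrow> 0) G" "(V \<longlongrightarrow> v) G" "(W \<longlongrightarrow> 0) G"
  using tendsto_fst[OF P] tendsto_fst[OF tendsto_snd[OF P]] tendsto_snd[OF tendsto_snd[OF P]] by (simp_all add: U_def V_def W_def)
 have \<Delta>: "sqrt (1 + x^2 + y^2) > 0" for x y :: real by (simp add: add_pos_nonneg)
 define R where "R = (%q. W q ^ n * quart a b c d (fst q))"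
 have Wp: "W q > 0" "U q = W q * fst q" "V q = W q * snd q" for q
  using \<Delta> by (cases q; simp add: U_def V_def W_def poincare_Pair)+
 have n: "n >= 2" and Rlim: "(R \<longlongrightarrow> 0) G"
 proof -
  consider "a \<noteq> 0" | "a = 0" "b = 0" "c \<noteq> 0" using ab by blast
  then have "n >= 2 & (R \<longlongrightarrow> 0) G"
  proof cases
   case 1
   then have n4: "n = 4" by (simp add: n_def lienard_degree_def)
   have "R = (%q. a * (U q)^4 + b * ((U q)^3 * W q) + c * ((U q)^2 * (W q)^2) + d * (U q * (W q)^3))"
    unfolding R_def n4 Wp(2) quart_def
    by (simp add: fun_eq_iff power4_eq_xxxx power3_eq_cube power2_eq_square algebra_simps)
   moreover have "((%q. a * (U q)^4 + b * ((U q)^3 * W q) + c * ((U q)^2 * (W q)^2) + d * (U q * (W q)^3))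
     \<longlongrightarrow> a * 0^4 + b * (0^3 * 0) + c * (0^2 * 0^2) + d * (0 * 0^3)) G"
    by (intro tendsto_intros lim)
   ultimately show ?thesis using n4 by simp
  next
   case 2
   then have n2: "n = 2" by (simp add: n_def lienard_degree_def)
   have "R = (%q. c * (U q)^2 + d * (U q * W q))"
    unfolding R_def n2 Wp(2) quart_def using 2
    by (simp add: fun_eq_iff power2_eq_square algebra_simps)
   moreover have "((%q. c * (U q)^2 + d * (U q * W q)) \<longlongrightarrow> c * 0^2 + d * (0 * 0)) G"
    by (intro tendsto_intros lim)
   ultimately show ?thesis using n2 by simp
  qed
  then show "n >= 2" "(R \<longlongrightarrow> 0) G" by auto
 qed
 have bound: "norm (poincare_field n (lienard_field a b c d) q) <= 2 * (W q ^ (n - 1) * (\<bar>V q\<bar> + \<bar>U q\<bar>) + \<bar>R q\<bar>)" for q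
 proof -
  obtain x y where q: "q = (x, y)" by (cases q)
  have w: "1 / sqrt (1 + x^2 + y^2) = W q" by (simp add: q W_def poincare_Pair)
  have Wq: "snd (snd (poincare (x, y))) = W (x, y)" by (simp add: W_def)
  have "norm (poincare_field n (lienard_field a b c d) q) = W q ^ (n - 1) * norm (frechet_derivative poincare (at (x, y)) (y - quart a b c d x, - x))"
   using Wp(1)[of q] by (simp add: poincare_field_def Wq q lienard_quart)
  also have "\<dots> <= W q ^ (n - 1) * (2 * (\<bar>y - quart a b c d x\<bar> + \<bar>- x\<bar>) / sqrt (1 + x^2 + y^2))"
   using Wp(1)[of q] by (intro mult_left_mono norm_frechet_derivative_poincare) simp
  also have "\<dots> = 2 * (W q ^ (n - 1) * (W q * (\<bar>y - quart a b c d x\<bar> + \<bar>x\<bar>)))" unfolding w[symmetric] by simp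
  also have "\<dots> <= 2 * (W q ^ (n - 1) * (W q * (\<bar>y\<bar> + \<bar>x\<bar> + \<bar>quart a b c d x\<bar>)))"
   using Wp(1)[of q] by (intro mult_left_mono) auto
  also have "\<dots> = 2 * (W q ^ (n - 1) * (\<bar>V q\<bar> + \<bar>U q\<bar>) + \<bar>R q\<bar>)"
  proof -
   have "W q ^ n = W q ^ (n - 1) * W q" using n by (cases n) auto
   then show ?thesis using Wp[of q] by (simp add: R_def q abs_mult algebra_simps)
  qed
  finally show ?thesis .
 qed
 have "((%q. 2 * (W q ^ (n - 1) * (\<bar>V q\<bar> + \<bar>U q\<bar>) + \<bar>R q\<bar>)) \<longlongrightarrow> 2 * (0 ^ (n - 1) * (\<bar>v\<bar> + \<bar>0\<bar>) + \<bar>0\<bar>)) G"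
  by (intro tendsto_intros lim Rlim)
 note T = this
 have z: "(0::real) ^ (n - 1) = 0" by (rule zero_power) (use n in simp)
 have g: "((%q. 2 * (W q ^ (n - 1) * (\<bar>V q\<bar> + \<bar>U q\<bar>) + \<bar>R q\<bar>)) \<longlongrightarrow> 0) G"
  using T unfolding z by simp
 have "(poincare_field n (lienard_field a b c d) \<longlongrightarrow> 0) G"
  by (rule Lim_null_comparison[OF _ g]) (rule always_eventually, rule allI, rule bound)
 then show ?thesis using v by (simp add: singular_at_infinity_def equator_def power2_eq_square n_def G_def)
qed

text \<open>Treats both sign cases at once; k is the sign that the reflection puts on d, so d
  \<mapsto> k * d is a bijection of the parameters.\<close>

lemma lienard_loop_theorem:
 assumes ab: "a \<noteq> 0 \<or> (b = 0 & c \<noteq> 0)" and st: "s * s = 1" "t * t = 1" and lead: "lead A B C" and k: "k * k = 1"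
  and XY: "!!d q. lienard_field a b c d (flip s t q) = flip s t (hfield A B C (k * d) q)"
 shows "(\<exists>!d. \<exists>p \<Gamma>. homoclinic_loop (lienard_degree a b c d) (lienard_field a b c d) p \<Gamma>) &
     (\<forall>d p \<Gamma>. homoclinic_loop (lienard_degree a b c d) (lienard_field a b c d) p \<Gamma> -->
      (loop_stable (lienard_field a b c d) p \<Gamma> \<longleftrightarrow>
       \<not> lyapunov_stable (lienard_field a b c d) 0))"
proof -
 have YX: "hfield A B C (k * d) (flip s t q) = flip s t (lienard_field a b c d q)" for d q
  using XY[of d "flip s t q"] by (simp add: flip_flip[OF st])
 have graph: "\<exists>yy. flip3 s t p = (0, 1, 0) & loopg (quart A B C (k * d)) yy & loop_param A B C (k * d) (yy 0) &
   flip s t ` \<Gamma> = range (%x. (x, yy x))"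
  if "homoclinic_loop (lienard_degree a b c d) (lienard_field a b c d) p \<Gamma>" for d p \<Gamma>
 proof -
  have "loop_orbit_at (lienard_field a b c d) p \<Gamma>" using that by (simp add: homoclinic_loop_iff)
  then have "loop_orbit_at (hfield A B C (k * d)) (flip3 s t p) (flip s t ` \<Gamma>)" 
   by (rule loop_orbit_at_flip[where X = "hfield A B C (k * d)" and Y = "lienard_field a b c d", OF st YX])
  then show ?thesis by (rule loop_orbit_at_graph[OF lead]) blast
 qed
 obtain D \<sigma> where D: "loop_param A B C D \<sigma>" using loop_param_exists[OF lead] by blast
 have kk: "k * (k * D) = D" using k by (simp add: mult.assoc[symmetric])
 obtain yy where yy: "loopg (quart A B C (k * (k * D))) yy" unfolding kk by (rule loop_param_loopg[OF D])
 have "loop_orbit_at (lienard_field a b c (k * D)) (flip3 s t (0, 1, 0)) (flip s t ` range (%x. (x, yy x)))"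
  by (rule loop_orbit_at_flip[where X = "lienard_field a b c (k * D)" and Y = "hfield A B C (k * (k * D))",
     OF st XY loopg_loop_orbit_at[OF lead yy]])
 moreover have "flip3 s t (0, 1, 0) = (0, t, 0)" by (simp add: flip3_def)
 ultimately have "homoclinic_loop (lienard_degree a b c (k * D)) (lienard_field a b c (k * D)) (0, t, 0) (flip s t ` range (%x. (x, yy x)))"
  using singular_at_vertical_infinity[OF ab st(2)] by (simp add: homoclinic_loop_iff)
 moreover have "d = k * D" if "homoclinic_loop (lienard_degree a b c d) (lienard_field a b c d) p \<Gamma>" for d p \<Gamma>
 proof -
  have "k * d = D" using graph[OF that] loop_param_unique(1)[OF _ D] by blast
  moreover have "k * (k * d) = d" using k by (simp add: mult.assoc[symmetric])
  ultimately show ?thesis by simp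
 qed
 ultimately have 1: "\<exists>!d. \<exists>p \<Gamma>. homoclinic_loop (lienard_degree a b c d) (lienard_field a b c d) p \<Gamma>" by blast
 have "loop_stable (lienard_field a b c d) p \<Gamma> \<longleftrightarrow> \<not> lyapunov_stable (lienard_field a b c d) 0"
  if h: "homoclinic_loop (lienard_degree a b c d) (lienard_field a b c d) p \<Gamma>" for d p \<Gamma>
 proof -
  obtain yy where g: "flip3 s t p = (0, 1, 0)" "loopg (quart A B C (k * d)) yy" "loop_param A B C (k * d) (yy 0)"
   "flip s t ` \<Gamma> = range (%x. (x, yy x))" using graph[OF h] by blast
  show ?thesis
   unfolding loop_stable_flip_iff[where X = "lienard_field a b c d" and Y = "hfield A B C (k * d)", OF st XY]
    lyapunov_stable_flip_iff[where X = "lienard_field a b c d" and Y = "hfield A B C (k * d)", OF st XY] g(1,4)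
   by (rule loop_stable_iff_origin_unstable[OF lead g(2) loop_param_sign[OF g(3)]])
 qed
 with 1 show ?thesis by blast
qed

theorem theorem1:
  fixes a b c :: real
  assumes "a \<noteq> 0 \<or> (b = 0 \<and> c \<noteq> 0)"
  shows "(\<exists>!d. \<exists>p \<Gamma>. homoclinic_loop (lienard_degree a b c d) (lienard_field a b c d) p \<Gamma>) \<and>
         (\<forall>d p \<Gamma>. homoclinic_loop (lienard_degree a b c d) (lienard_field a b c d) p \<Gamma> \<longrightarrow>
            (loop_stable (lienard_field a b c d) p \<Gamma> \<longleftrightarrow>
             \<not> lyapunov_stable (lienard_field a b c d) 0))"
proof (cases "lead a b c")
  case True
  show ?thesis
  \<comment> \<open>The reflection x \<mapsto> - x turns the system into the half-system form with F
    (- x).\<close>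
  proof (rule lienard_loop_theorem[OF assms, of "- 1" 1 a "- b" c "- 1"])
    show "lead a (- b) c" using True by (rule lead_minus)
    show "lienard_field a b c d (flip (- 1) 1 q) = flip (- 1) 1 (hfield a (- b) c (- 1 * d) q)" for d q
      by (cases q) (simp add: flip_def hfield_def lienard_quart quart_minus)
  qed simp_all
next
  case False
  show ?thesis
  \<comment> \<open>Here the negated coefficients satisfy \<open>lead\<close>, and y \<mapsto> - y
    gives the form with - F.\<close>
  proof (rule lienard_loop_theorem[OF assms, of 1 "- 1" "- a" "- b" "- c" "- 1"])
    show "lead (- a) (- b) (- c)" using False assms by (auto simp: lead_def)
    show "lienard_field a b c d (flip 1 (- 1) q) = flip 1 (- 1) (hfield (- a) (- b) (- c) (- 1 * d) q)" for d q
      by (cases q) (simp add: flip_def hfield_def lienard_quart quart_def)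
  qed simp_all
qed

end
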